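(* Let $\sigma\ge 1$ be a real number, $n\ge1$, $p>1$ and $m\in[1,2)$. Assume that $$\frac2m\le p<\infty\ \text{ if } n\le 2\sigma,\qquad \frac2m\le p\le\frac{n}{n-2\sigma}\ \text{ if } n\in\Big(2\sigma,\frac{4\sigma}{2-m}\Big],$$ and moreover that $$p>1+\frac{2m\sigma}{n}.$$ Then there exists a constant $\varepsilon>0$ such that for any small data $$(u_0,u_1)\in\mathcal{A}^\sigma_m:=(L^m\cap H^\sigma)\times(L^m\cap L^2)\quad\text{with}\quad\|(u_0,u_1)\|_{\mathcal{A}^\sigma_m}\le\varepsilon,$$ there is a uniquely determined global (in time) small data energy solution $$u\in C([0,\infty),H^\sigma)\cap C^1([0,\infty),L^2)$$ to $$u_{tt}+(-\Delta)^\sigma u+u_t+(-\Delta)^\sigma u_t=|u|^p,\quad u(0,x)=u_0(x),\quad u_t(0,x)=u_1(x),\qquad x\in\mathbb{R}^n.$$ The following estimates hold: $$\|u(t,\cdot)\|_{L^2}\lesssim(1+t)^{-\frac{n}{2\sigma}\left(\frac1m-\frac12\right)}\|(u_0,u_1)\|_{\mathcal{A}^\sigma_m},$$ $$\big\||D|^\sigma u(t,\cdot)\big\|_{L^2}\lesssim(1+t)^{-\frac{n}{2\sigma}\left(\frac1m-\frac12\right)-\frac12}\|(u_0,u_1)\|_{\mathcal{A}^\sigma_m},$$ $$\|u_t(t,\cdot)\|_{L^2}\lesssim(1+t)^{-\frac{n}{2\sigma}\left(\frac1m-\frac12\right)-1}\|(u_0,u_1)\|_{\mathcal{A}^\sig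ma_m}.$$
   Context: All spaces are over $\mathbb{R}^n$; the assumptions imply that the dimension satisfies $n\le 2\sigma$ or $2\sigma<n\le 4\sigma/(2-m)$. $H^\sigma$ is the $L^2$-based Bessel potential (Sobolev) space; $|D|^\sigma$ is the Fourier multiplier with symbol $|\xi|^\sigma$. Norms of intersections and products are sums of norms: $\|(u_0,u_1)\|_{\mathcal{A}^\sigma_m}=\|u_0\|_{L^m}+\|u_0\|_{H^\sigma}+\|u_1\|_{L^m}+\|u_1\|_{L^2}$. $f\lesssim g$ means $f\le Cg$ with a constant $C>0$ (here independent of $t\ge0$ and of the data). Solutions are understood in the Duhamel (mild) sense: $$u(t,x)=K_0(t,x)\ast_x u_0(x)+K_1(t,x)\ast_x u_1(x)+\int_0^t K_1(t-\tau,x)\ast_x|u(\tau,x)|^p\,d\tau,$$ where $$K_0(t,x)=\mathcal{F}^{-1}\Big(\frac{e^{-t|\xi|^{2\sigma}}-|\xi|^{2\sigma}e^{-t}}{1-|\xi|^{2\sigma}}\Big),\qquad K_1(t,x)=\mathcal{F}^{-1}\Big(\frac{e^{-t|\xi|^{2\sigma}}-e^{-t}}{1-|\xi|^{2\sigma}}\Big),$$ the multipliers being extended continuously across $|\xi|=1$. *)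

theory Defs
  imports "HOL-Analysis.Analysis"
begin

section \<open>Lebesgue spaces\<close>

(* Functions are complex valued and are used as representatives of their
   almost-everywhere classes. *)

definition Lp :: "real \<Rightarrow> ('a::euclidean_space \<Rightarrow> complex) set" where
  "Lp q = {f \<in> borel_measurable lebesgue. integrable lebesgue (\<lambda>x. norm (f x) powr q)}"

definition Lp_norm :: "real \<Rightarrow> ('a::euclidean_space \<Rightarrow> complex) \<Rightarrow> real" where
  "Lp_norm q f = (LINT x|lebesgue. norm (f x) powr q) powr (1 / q)"

(* The membership clause is needed because Lp_norm is meaningless (it is 0)
   for functions whose q-th power is not integrable. *)
definition L2_tendsto ::
    "('i \<Rightarrow> 'a::euclidean_space \<Rightarrow> complex) \<Rightarrow> ('a \<Rightarrow> complex) \<Rightarrow> 'i filter \<Rightarrow> bool" where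
  "L2_tendsto f l F \<longleftrightarrow>
     (\<forall>\<^sub>F s in F. (\<lambda>x. f s x - l x) \<in> Lp 2) \<and>
     ((\<lambda>s. Lp_norm 2 (\<lambda>x. f s x - l x)) \<longlongrightarrow> 0) F"

(* The integral over [a,b] of an L2-valued function: the library's has_integral,
   read in the norm of L2 (compare has_integral_cbox).  For a continuous
   integrand this is the Riemann integral, hence also the Bochner integral. *)
definition has_L2_integral ::
    "(real \<Rightarrow> 'a::euclidean_space \<Rightarrow> complex) \<Rightarrow> ('a \<Rightarrow> complex) \<Rightarrow> real \<Rightarrow> real \<Rightarrow> bool" where
  "has_L2_integral g w a b \<longleftrightarrow>
     w \<in> Lp 2 \<and> (\<forall>\<tau>\<in>{a..b}. g \<tau> \<in> Lp 2) \<and>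
     L2_tendsto (\<lambda>P x. \<Sum>(\<tau>, k)\<in>P. measure lborel k *\<^sub>R g \<tau> x) w (division_filter (cbox a b))"

section \<open>Fourier transform and Fourier multipliers on \<open>L\<^sup>2\<close>\<close>

(* Unitary normalisation; the transform of an L2 function is the L2 limit
   of the transforms of its truncations to balls. *)

definition fourier_trunc ::
    "real \<Rightarrow> ('a::euclidean_space \<Rightarrow> complex) \<Rightarrow> 'a \<Rightarrow> complex" where
  "fourier_trunc R f \<xi> =
     (2 * pi) powr (- real DIM('a) / 2) *\<^sub>R
       (LINT x:cball 0 R|lebesgue. cis (- (x \<bullet> \<xi>)) * f x)"

definition has_fourier ::
    "('a::euclidean_space \<Rightarrow> complex) \<Rightarrow> ('a \<Rightarrow> complex) \<Rightarrow> bool" where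
  "has_fourier f g \<longleftrightarrow>
     f \<in> Lp 2 \<and> g \<in> Lp 2 \<and> L2_tendsto (\<lambda>R. fourier_trunc R f) g at_top"

(* By Plancherel's theorem both transforms below exist for every L2 function
   and are determined up to null sets; SOME picks a representative. *)

definition fourier :: "('a::euclidean_space \<Rightarrow> complex) \<Rightarrow> 'a \<Rightarrow> complex" where
  "fourier f = (SOME g. has_fourier f g)"

definition inv_fourier :: "('a::euclidean_space \<Rightarrow> complex) \<Rightarrow> 'a \<Rightarrow> complex" where
  "inv_fourier g = (SOME f. has_fourier f g)"

(* The operator with symbol M, that is, convolution with the tempered
   distribution whose Fourier transform is M. *)
definition fourier_mult ::
    "('a::euclidean_space \<Rightarrow> real) \<Rightarrow> ('a \<Rightarrow> complex) \<Rightarrow> 'a \<Rightarrow> complex" where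
  "fourier_mult M f = inv_fourier (\<lambda>\<xi>. complex_of_real (M \<xi>) * fourier f \<xi>)"

definition abs_D :: "real \<Rightarrow> ('a::euclidean_space \<Rightarrow> complex) \<Rightarrow> 'a \<Rightarrow> complex" where
  "abs_D \<sigma> = fourier_mult (\<lambda>\<xi>. norm \<xi> powr \<sigma>)"

section \<open>Bessel potential spaces\<close>

definition bessel_hat ::
    "real \<Rightarrow> ('a::euclidean_space \<Rightarrow> complex) \<Rightarrow> 'a \<Rightarrow> complex" where
  "bessel_hat \<sigma> f \<xi> = complex_of_real ((1 + (norm \<xi>)\<^sup>2) powr (\<sigma> / 2)) * fourier f \<xi>"

(* Only meant for nonnegative order, where the space is contained in L2. *)
definition Hs :: "real \<Rightarrow> ('a::euclidean_space \<Rightarrow> complex) set" where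
  "Hs \<sigma> = {f \<in> Lp 2. bessel_hat \<sigma> f \<in> Lp 2}"

definition Hs_norm :: "real \<Rightarrow> ('a::euclidean_space \<Rightarrow> complex) \<Rightarrow> real" where
  "Hs_norm \<sigma> f = Lp_norm 2 (bessel_hat \<sigma> f)"

definition data_space ::
    "real \<Rightarrow> real \<Rightarrow> (('a::euclidean_space \<Rightarrow> complex) \<times> ('a \<Rightarrow> complex)) set" where
  "data_space \<sigma> m = (Lp m \<inter> Hs \<sigma>) \<times> (Lp m \<inter> Lp 2)"

definition data_norm ::
    "real \<Rightarrow> real \<Rightarrow> ('a::euclidean_space \<Rightarrow> complex) \<Rightarrow> ('a \<Rightarrow> complex) \<Rightarrow> real" where
  "data_norm \<sigma> m u\<^sub>0 u\<^sub>1 = Lp_norm m u\<^sub>0 + Hs_norm \<sigma> u\<^sub>0 + Lp_norm m u\<^sub>1 + Lp_norm 2 u\<^sub>1"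

section \<open>The fundamental solutions\<close>

(* Symbols of K0 and K1 as functions of r = |xi|^(2 sigma); the values at r = 1
   are the continuous extensions, see the two lemmas. *)

definition K0_symb :: "real \<Rightarrow> real \<Rightarrow> real" where
  "K0_symb t r =
     (if r = 1 then (1 + t) * exp (- t) else (exp (- t * r) - r * exp (- t)) / (1 - r))"

definition K1_symb :: "real \<Rightarrow> real \<Rightarrow> real" where
  "K1_symb t r =
     (if r = 1 then t * exp (- t) else (exp (- t * r) - exp (- t)) / (1 - r))"

lemma isCont_K1_symb: "isCont (K1_symb t) r"
proof (cases "r = 1")
  case True
  have "((\<lambda>r. exp (- t * r)) has_real_derivative - t * exp (- t)) (at 1)"
    by (auto intro!: derivative_eq_intros)
  then have "((\<lambda>r. (exp (- t * r) - exp (- t)) / (r - 1)) \<longlongrightarrow> - t * exp (- t)) (at 1)"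
    by (simp add: has_field_derivative_iff)
  from tendsto_minus[OF this]
  have "((\<lambda>r. - ((exp (- t * r) - exp (- t)) / (r - 1))) \<longlongrightarrow> t * exp (- t)) (at 1)"
    by simp
  moreover have "\<forall>\<^sub>F r in at 1. - ((exp (- t * r) - exp (- t)) / (r - 1)) = K1_symb t r"
    by (auto simp: eventually_at_filter K1_symb_def divide_simps algebra_simps
          intro!: always_eventually)
  ultimately have "(K1_symb t \<longlongrightarrow> t * exp (- t)) (at 1)"
    by (rule Lim_transform_eventually)
  then show ?thesis
    using True by (simp add: isCont_def K1_symb_def)
next
  case False
  have "isCont (\<lambda>r. (exp (- t * r) - exp (- t)) / (1 - r)) r"
    using False by (intro continuous_intros) auto
  moreover have "\<forall>\<^sub>F s in nhds r. K1_symb t s = (exp (- t * s) - exp (- t)) / (1 - s)"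
    using t1_space_nhds[OF False] by eventually_elim (auto simp: K1_symb_def)
  ultimately show ?thesis
    by (simp add: isCont_cong)
qed

lemma isCont_K0_symb: "isCont (K0_symb t) r"
proof -
  have "K0_symb t = (\<lambda>r. K1_symb t r + exp (- t))"
    by (auto simp: fun_eq_iff K0_symb_def K1_symb_def field_simps)
  then show ?thesis
    using isCont_K1_symb by (auto intro: continuous_intros)
qed

definition K0_conv ::
    "real \<Rightarrow> real \<Rightarrow> ('a::euclidean_space \<Rightarrow> complex) \<Rightarrow> 'a \<Rightarrow> complex" where
  "K0_conv \<sigma> t = fourier_mult (\<lambda>\<xi>. K0_symb t (norm \<xi> powr (2 * \<sigma>)))"

definition K1_conv ::
    "real \<Rightarrow> real \<Rightarrow> ('a::euclidean_space \<Rightarrow> complex) \<Rightarrow> 'a \<Rightarrow> complex" where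
  "K1_conv \<sigma> t = fourier_mult (\<lambda>\<xi>. K1_symb t (norm \<xi> powr (2 * \<sigma>)))"

section \<open>Energy solutions\<close>

(* u lies in C([0,\<infinity>), H^sigma) and in C^1([0,\<infinity>), L2), and v is its time derivative. *)
definition energy_class ::
    "real \<Rightarrow> (real \<Rightarrow> 'a::euclidean_space \<Rightarrow> complex) \<Rightarrow> (real \<Rightarrow> 'a \<Rightarrow> complex) \<Rightarrow> bool" where
  "energy_class \<sigma> u v \<longleftrightarrow>
     (\<forall>t\<ge>0. u t \<in> Hs \<sigma> \<and> v t \<in> Lp 2 \<and>
        ((\<lambda>s. Hs_norm \<sigma> (\<lambda>x. u s x - u t x)) \<longlongrightarrow> 0) (at t within {0..}) \<and>
        L2_tendsto (\<lambda>s x. (u s x - u t x) /\<^sub>R (s - t)) (v t) (at t within {0..}) \<and>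
        L2_tendsto v (v t) (at t within {0..}))"

definition abs_powr :: "real \<Rightarrow> ('a \<Rightarrow> complex) \<Rightarrow> 'a \<Rightarrow> complex" where
  "abs_powr p f x = complex_of_real (norm (f x) powr p)"

(* Duhamel's formula.  The requirement that |u|^p take values in L2 makes the
   Fourier multiplier K1 applicable. *)
definition mild_solution ::
    "real \<Rightarrow> real \<Rightarrow> ('a::euclidean_space \<Rightarrow> complex) \<Rightarrow> ('a \<Rightarrow> complex)
       \<Rightarrow> (real \<Rightarrow> 'a \<Rightarrow> complex) \<Rightarrow> bool" where
  "mild_solution \<sigma> p u\<^sub>0 u\<^sub>1 u \<longleftrightarrow>
     (\<forall>t\<ge>0. abs_powr p (u t) \<in> Lp 2 \<and>
        (\<exists>w. has_L2_integral (\<lambda>\<tau>. K1_conv \<sigma> (t - \<tau>) (abs_powr p (u \<tau>))) w 0 t \<and>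
             (AE x in lebesgue. u t x = K0_conv \<sigma> t u\<^sub>0 x + K1_conv \<sigma> t u\<^sub>1 x + w x)))"

definition energy_solution ::
    "real \<Rightarrow> real \<Rightarrow> ('a::euclidean_space \<Rightarrow> complex) \<Rightarrow> ('a \<Rightarrow> complex)
       \<Rightarrow> (real \<Rightarrow> 'a \<Rightarrow> complex) \<Rightarrow> (real \<Rightarrow> 'a \<Rightarrow> complex) \<Rightarrow> bool" where
  "energy_solution \<sigma> p u\<^sub>0 u\<^sub>1 u v \<longleftrightarrow> energy_class \<sigma> u v \<and> mild_solution \<sigma> p u\<^sub>0 u\<^sub>1 u"

end

theory Submission
  imports Defs "HOL-Probability.Characteristic_Functions"
begin

text \<open>Let \<open>X\<close> be the Fourier transform of the solution times the weight
  \<open>(1 + t)^\<alpha> (1 + (1 + t)^(1/2) |\<xi>|^\<sigma>)\<close> with \<open>\<alpha> = n / (2 \<sigma>) (1 / m - 1 / 2)\<close>. Duhamel's formula becomes a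
  fixed point equation for bounded continuous functions \<open>X\<close> of time with values in \<open>L\<^sup>2\<close>. At low
  frequencies the symbols of the fundamental solutions are dominated by the heat symbol
  \<open>exp (- t |\<xi>|^(2 \<sigma>) / 2)\<close>, at high frequencies they decay exponentially in time, so
  ultracontractivity of the fractional heat semigroup yields the rates for data in \<open>L\<^sup>m \<inter> L\<^sup>2\<close>.
  By Sobolev's embedding \<open>|u|\<^sup>p\<close> is bounded in \<open>L\<^sup>m\<close> with the factor \<open>(1 + \<tau>)^(- \<beta>)\<close>, and in \<open>L\<^sup>2\<close> with
  \<open>(1 + \<tau>)^(- \<alpha> - \<beta>)\<close>, where \<open>\<beta> = n (p - 1) / (2 m \<sigma>)\<close>; the condition \<open>p > 1 + 2 m \<sigma> / n\<close> says that
  \<open>\<beta> > 1\<close>, so that these factors are integrable in time and the map contracts a small ball. Uniqueness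
  needs no smallness: \<open>u \<mapsto> |u|\<^sup>p\<close> is locally Lipschitz from \<open>H\<^sup>\<sigma>\<close> to \<open>L\<^sup>2\<close>, and Gronwall's argument applies.
  Plancherel's theorem is obtained by integrating \<open>|FT1 f|\<^sup>2\<close> against wide Gaussians, which by Fubini
  tests the autocorrelation of \<open>f\<close> near \<open>0\<close>; translations are continuous in \<open>L\<^sup>2\<close>.\<close>

section \<open>The Hilbert space of square integrable functions\<close>

text \<open>The unknown is a curve in a concrete real Hilbert space of classes modulo null sets, so
  that integration over time, differentiation under the integral and Banach's fixed point theorem
  apply to it directly. The obstacle is that no single weight serves every purpose: decay asks for a
  weight that moves with time, whereas continuity, differentiability and the comparison with an
  arbitrary second solution ask for one that stands still. The solution is therefore kept in the
  weight of time 0, equivalent to the norm of H^\<sigma>, and carried to the weight of time t for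
  the estimates only. The three decay rates differ because the factors 1, |\<xi>|^\<sigma> and
  |\<xi>|^(2\<sigma>) in front of the symbol of K1 gain (1+t)^0, (1+t)^(-1/2) and (1+t)^(-1). The
  symbol of K0 is that of K1 plus exp(-t), so one analysis covers both. The condition p >= 2/m and,
  for n > 2\<sigma>, the condition p <= n/(n-2\<sigma>) place the exponents pm and 2p between 2 and
  the Sobolev exponent of H^\<sigma>.\<close>

definition sqint :: "('a::euclidean_space \<Rightarrow> complex) set" where
  "sqint = {f \<in> borel_measurable borel. integrable lborel (\<lambda>x. (norm (f x))\<^sup>2)}"

lemma sqint_measurable [measurable_dest]: "f \<in> sqint \<Longrightarrow> f \<in> borel_measurable borel"
  and sqint_integrable: "f \<in> sqint \<Longrightarrow> integrable lborel (\<lambda>x. (norm (f x))\<^sup>2)"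
  by (auto simp: sqint_def)

lemma sqint_dominated:
  assumes g: "g \<in> sqint" and f: "f \<in> borel_measurable borel"
    and le: "\<And>x. norm (f x) \<le> B * norm (g x)"
  shows "f \<in> sqint"
proof -
  have "integrable lborel (\<lambda>x. (norm (f x))\<^sup>2)"
  proof (rule Bochner_Integration.integrable_bound)
    show "integrable lborel (\<lambda>x. B\<^sup>2 * (norm (g x))\<^sup>2)"
      using sqint_integrable[OF g] by simp
    show "(\<lambda>x. (norm (f x))\<^sup>2) \<in> borel_measurable lborel"
      using f by measurable
    show "AE x in lborel. norm ((norm (f x))\<^sup>2) \<le> norm (B\<^sup>2 * (norm (g x))\<^sup>2)"
      using power_mono[OF le norm_ge_zero, of _ 2] by (auto simp: power_mult_distrib)
  qed
  then show ?thesis using f by (simp add: sqint_def)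
qed

lemma sqint_zero [simp]: "(\<lambda>_. 0) \<in> sqint"
  by (simp add: sqint_def)

lemma sqint_add:
  assumes f: "f \<in> sqint" and g: "g \<in> sqint"
  shows "(\<lambda>x. f x + g x) \<in> sqint"
proof -
  have "integrable lborel (\<lambda>x. (norm (f x + g x))\<^sup>2)"
  proof (rule Bochner_Integration.integrable_bound)
    show "integrable lborel (\<lambda>x. 2 * (norm (f x))\<^sup>2 + 2 * (norm (g x))\<^sup>2)"
      using sqint_integrable[OF g] sqint_integrable[OF f] by simp
    show "(\<lambda>x. (norm (f x + g x))\<^sup>2) \<in> borel_measurable lborel"
      using f g by measurable
    have "(norm (f x + g x))\<^sup>2 \<le> 2 * (norm (f x))\<^sup>2 + 2 * (norm (g x))\<^sup>2" for x
    proof -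
      have "(norm (f x + g x))\<^sup>2 \<le> (norm (f x) + norm (g x))\<^sup>2"
        by (intro power_mono norm_triangle_ineq norm_ge_zero)
      also have "\<dots> \<le> 2 * (norm (f x))\<^sup>2 + 2 * (norm (g x))\<^sup>2"
        using sum_squares_bound[of "norm (f x)" "norm (g x)"] by (simp add: power2_sum)
      finally show ?thesis .
    qed
    then show "AE x in lborel. norm ((norm (f x + g x))\<^sup>2) \<le> norm (2 * (norm (f x))\<^sup>2 + 2 * (norm (g x))\<^sup>2)"
      by simp
  qed
  moreover have "(\<lambda>x. f x + g x) \<in> borel_measurable borel"
    using f g by measurable
  ultimately show ?thesis by (simp add: sqint_def)
qed

lemma sqint_scaleR: "f \<in> sqint \<Longrightarrow> (\<lambda>x. c *\<^sub>R f x) \<in> sqint"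
  by (rule sqint_dominated[where B = "\<bar>c\<bar>"]) auto

lemma sqint_uminus: "f \<in> sqint \<Longrightarrow> (\<lambda>x. - f x) \<in> sqint"
  by (rule sqint_dominated[where B = 1]) auto

lemma sqint_diff: "f \<in> sqint \<Longrightarrow> g \<in> sqint \<Longrightarrow> (\<lambda>x. f x - g x) \<in> sqint"
  using sqint_add[OF _ sqint_uminus, of f g] by simp

lemma sqint_inner_integrable:
  assumes f: "f \<in> sqint" and g: "g \<in> sqint"
  shows "integrable lborel (\<lambda>x. f x \<bullet> g x)"
proof (rule Bochner_Integration.integrable_bound)
  show "integrable lborel (\<lambda>x. (norm (f x))\<^sup>2 + (norm (g x))\<^sup>2)"
    using sqint_integrable[OF g] sqint_integrable[OF f] by simp
  show "(\<lambda>x. f x \<bullet> g x) \<in> borel_measurable lborel"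
    using f g by measurable
  have "\<bar>f x \<bullet> g x\<bar> \<le> (norm (f x))\<^sup>2 + (norm (g x))\<^sup>2" for x
  proof -
    have "\<bar>f x \<bullet> g x\<bar> \<le> norm (f x) * norm (g x)"
      by (rule Cauchy_Schwarz_ineq2)
    also have "\<dots> \<le> (norm (f x))\<^sup>2 + (norm (g x))\<^sup>2"
      using sum_squares_bound[of "norm (f x)" "norm (g x)"]
        mult_nonneg_nonneg[OF norm_ge_zero[of "f x"] norm_ge_zero[of "g x"]] by linarith
    finally show ?thesis .
  qed
  then show "AE x in lborel. norm (f x \<bullet> g x) \<le> norm ((norm (f x))\<^sup>2 + (norm (g x))\<^sup>2)"
    by (auto intro!: AE_I2)
qed

\<comment> \<open>Identifying functions that agree almost everywhere makes the norm definite, so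
  that the type can become a Banach space. Representatives are Borel rather than Lebesgue measurable
  because Fubini's theorem is applied to them on product spaces.\<close>
quotient_type (overloaded) 'a L2 = "'a::euclidean_space \<Rightarrow> complex" /
  partial: "\<lambda>f g. f \<in> sqint \<and> g \<in> sqint \<and> (AE x in lborel. f x = g x)"
proof (rule part_equivpI)
  show "\<exists>f::'a \<Rightarrow> complex. f \<in> sqint \<and> f \<in> sqint \<and> (AE x in lborel. f x = f x)"
    by (intro exI[of _ "\<lambda>_. 0"]) auto
  show "symp (\<lambda>f g::'a \<Rightarrow> complex. f \<in> sqint \<and> g \<in> sqint \<and> (AE x in lborel. f x = g x))"
    by (rule sympI) auto
  show "transp (\<lambda>f g::'a \<Rightarrow> complex. f \<in> sqint \<and> g \<in> sqint \<and> (AE x in lborel. f x = g x))"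
    by (rule transpI) auto
qed

instantiation L2 :: (euclidean_space) real_inner
begin

lift_definition zero_L2 :: "'a L2" is "\<lambda>_. 0" by simp
lift_definition plus_L2 :: "'a L2 \<Rightarrow> 'a L2 \<Rightarrow> 'a L2" is "\<lambda>f g x. f x + g x"
  by (auto simp: sqint_add)
lift_definition minus_L2 :: "'a L2 \<Rightarrow> 'a L2 \<Rightarrow> 'a L2" is "\<lambda>f g x. f x - g x"
  by (auto simp: sqint_diff)
lift_definition uminus_L2 :: "'a L2 \<Rightarrow> 'a L2" is "\<lambda>f x. - f x"
  by (auto simp: sqint_uminus)
lift_definition scaleR_L2 :: "real \<Rightarrow> 'a L2 \<Rightarrow> 'a L2" is "\<lambda>c f x. c *\<^sub>R f x"
  by (auto simp: sqint_scaleR)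
text \<open>On complex values \<open>\<bullet>\<close> is the real part of the Hermitian product.
  This real structure already determines the norm and provides adjoints.\<close>

lift_definition inner_L2 :: "'a L2 \<Rightarrow> 'a L2 \<Rightarrow> real" is "\<lambda>f g. LINT x|lborel. f x \<bullet> g x"
  by (rule integral_cong_AE) auto

definition norm_L2 :: "'a L2 \<Rightarrow> real" where "norm_L2 U = sqrt (inner U U)"
definition sgn_L2 :: "'a L2 \<Rightarrow> 'a L2" where "sgn_L2 U = scaleR (inverse (norm U)) U"
definition dist_L2 :: "'a L2 \<Rightarrow> 'a L2 \<Rightarrow> real" where "dist_L2 U V = norm (U - V)"
definition uniformity_L2 :: "('a L2 \<times> 'a L2) filter" where
  "uniformity_L2 = (INF e\<in>{0<..}. principal {(x, y). dist x y < e})"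
definition open_L2 :: "'a L2 set \<Rightarrow> bool" where
  "open_L2 S = (\<forall>x\<in>S. \<forall>\<^sub>F (x', y) in uniformity. x' = x \<longrightarrow> y \<in> S)"

instance
proof
  fix U V W :: "'a L2" and c d :: real
  show "U + V + W = U + (V + W)" by transfer (auto intro!: sqint_add simp: add.assoc)
  show "U + V = V + U" by transfer (auto intro!: sqint_add simp: add.commute)
  show "0 + U = U" by transfer auto
  show "- U + U = 0" by transfer auto
  show "U - V = U + - V" by transfer (auto intro!: sqint_add sqint_diff sqint_uminus)
  show "c *\<^sub>R (U + V) = c *\<^sub>R U + c *\<^sub>R V"
    by transfer (auto intro!: sqint_add sqint_scaleR simp: scaleR_add_right)
  show "(c + d) *\<^sub>R U = c *\<^sub>R U + d *\<^sub>R U"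
    by transfer (auto intro!: sqint_add sqint_scaleR simp: scaleR_add_left)
  show "c *\<^sub>R d *\<^sub>R U = (c * d) *\<^sub>R U" by transfer (auto intro!: sqint_scaleR)
  show "1 *\<^sub>R U = U" by transfer auto
  show "dist U V = norm (U - V)" by (rule dist_L2_def)
  show "sgn U = scaleR (inverse (norm U)) U" by (rule sgn_L2_def)
  show "uniformity = (INF e\<in>{0<..}. principal {(x::'a L2, y). dist x y < e})"
    by (rule uniformity_L2_def)
  show "open S = (\<forall>x\<in>S. \<forall>\<^sub>F (x', y) in uniformity. x' = x \<longrightarrow> y \<in> S)" for S :: "'a L2 set"
    by (rule open_L2_def)
  show "inner U V = inner V U" by transfer (simp add: inner_commute)
  show "inner (U + V) W = inner U W + inner V W"
    by transfer (auto simp: inner_add_left sqint_inner_integrable)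
  show "inner (c *\<^sub>R U) V = c * inner U V" by transfer simp
  show "0 \<le> inner U U" by transfer simp
  show "inner U U = 0 \<longleftrightarrow> U = 0"
  proof (transfer, goal_cases)
    case (1 U)
    have "(LINT x|lborel. U x \<bullet> U x) = 0 \<longleftrightarrow> (AE x in lborel. U x \<bullet> U x = 0)"
      by (rule integral_nonneg_eq_0_iff_AE) (use 1 in \<open>auto simp: sqint_inner_integrable\<close>)
    then show ?case using 1 by simp
  qed
  show "norm U = sqrt (inner U U)" by (rule norm_L2_def)
qed

end

lemma rep_L2_sqint [simp]: "rep_L2 U \<in> sqint"
  using Quotient3_rep_reflp[OF Quotient3_L2] by blast

lemma rep_L2_measurable [measurable]: "rep_L2 U \<in> borel_measurable borel"
  by (rule sqint_measurable) simp

lemma abs_rep_L2 [simp]: "abs_L2 (rep_L2 U) = U"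
  by (rule Quotient3_abs_rep[OF Quotient3_L2])

lemma abs_L2_eq_iff:
  "f \<in> sqint \<Longrightarrow> g \<in> sqint \<Longrightarrow> abs_L2 f = abs_L2 g \<longleftrightarrow> (AE x in lborel. f x = g x)"
  using Quotient3_rel[OF Quotient3_L2, of f g] by auto

lemma rep_abs_L2: "f \<in> sqint \<Longrightarrow> AE x in lborel. rep_L2 (abs_L2 f) x = f x"
  by (subst abs_L2_eq_iff[symmetric]) auto

lemma abs_L2_add: "f \<in> sqint \<Longrightarrow> g \<in> sqint \<Longrightarrow> abs_L2 f + abs_L2 g = abs_L2 (\<lambda>x. f x + g x)"
  by (rule plus_L2.abs_eq) auto
lemma abs_L2_diff: "f \<in> sqint \<Longrightarrow> g \<in> sqint \<Longrightarrow> abs_L2 f - abs_L2 g = abs_L2 (\<lambda>x. f x - g x)"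
  by (rule minus_L2.abs_eq) auto
lemma abs_L2_scaleR: "f \<in> sqint \<Longrightarrow> c *\<^sub>R abs_L2 f = abs_L2 (\<lambda>x. c *\<^sub>R f x)"
  by (rule scaleR_L2.abs_eq) auto
lemma abs_L2_zero: "abs_L2 (\<lambda>_. 0) = 0"
  by (simp add: zero_L2.abs_eq)
lemma inner_abs_L2: "f \<in> sqint \<Longrightarrow> g \<in> sqint \<Longrightarrow> inner (abs_L2 f) (abs_L2 g) = (LINT x|lborel. f x \<bullet> g x)"
  by (rule inner_L2.abs_eq) auto

lemma sqint_sum: "(\<And>i. i \<in> I \<Longrightarrow> f i \<in> sqint) \<Longrightarrow> (\<lambda>x. \<Sum>i\<in>I. f i x) \<in> sqint"
  by (induction I rule: infinite_finite_induct) (auto intro: sqint_add)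

lemma abs_L2_sum: "(\<And>i. i \<in> I \<Longrightarrow> f i \<in> sqint) \<Longrightarrow> (\<Sum>i\<in>I. abs_L2 (f i)) = abs_L2 (\<lambda>x. \<Sum>i\<in>I. f i x)"
  by (induction I rule: infinite_finite_induct) (auto simp: abs_L2_add sqint_sum abs_L2_zero)

lemma norm_abs_L2_sq: "f \<in> sqint \<Longrightarrow> (norm (abs_L2 f))\<^sup>2 = (LINT x|lborel. (norm (f x))\<^sup>2)"
  by (simp add: power2_norm_eq_inner inner_abs_L2)

lemma norm_abs_L2_sq_nn:
  "f \<in> sqint \<Longrightarrow> ennreal ((norm (abs_L2 f))\<^sup>2) = (\<integral>\<^sup>+x. ennreal ((norm (f x))\<^sup>2) \<partial>lborel)"
  by (subst nn_integral_eq_integral) (auto simp: norm_abs_L2_sq sqint_integrable)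

lemma norm_L2_sq_nn: "ennreal ((norm U)\<^sup>2) = (\<integral>\<^sup>+x. ennreal ((norm (rep_L2 U x))\<^sup>2) \<partial>lborel)"
  using norm_abs_L2_sq_nn[OF rep_L2_sqint, of U] by simp

lemma sqintI_nn:
  assumes "f \<in> borel_measurable borel" "(\<integral>\<^sup>+x. ennreal ((norm (f x))\<^sup>2) \<partial>lborel) < \<infinity>"
  shows "f \<in> sqint"
  using assms by (auto simp: sqint_def intro!: integrableI_bounded)

lemma norm_abs_L2_le:
  assumes f: "f \<in> sqint" and g: "g \<in> sqint" and B: "0 \<le> B"
    and le: "\<And>x. norm (f x) \<le> B * norm (g x)"
  shows "norm (abs_L2 f) \<le> B * norm (abs_L2 g)"
proof (rule power2_le_imp_le)
  have "(norm (abs_L2 f))\<^sup>2 \<le> (LINT x|lborel. B\<^sup>2 * (norm (g x))\<^sup>2)"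
    unfolding norm_abs_L2_sq[OF f]
    using power_mono[OF le norm_ge_zero, of _ 2] f g
    by (intro integral_mono) (auto simp: power_mult_distrib sqint_integrable)
  then show "(norm (abs_L2 f))\<^sup>2 \<le> (B * norm (abs_L2 g))\<^sup>2"
    by (simp add: norm_abs_L2_sq[OF g] power_mult_distrib)
qed (use B in simp)

text \<open>The weight 2^k leaves a convergent series of integrals, with terms 2^k 4^(-k). At almost
  every point the weighted sum is then finite, so the increments are at most a constant times
  2^(-k/2), and these are summable.\<close>

lemma AE_convergent_fast_Cauchy:
  fixes f :: "nat \<Rightarrow> 'a::euclidean_space \<Rightarrow> complex"
  assumes f: "\<And>k. f k \<in> sqint"
    and fast: "\<And>k. (\<integral>\<^sup>+x. ennreal ((norm (f (Suc k) x - f k x))\<^sup>2) \<partial>lborel) \<le> ennreal ((1/4)^k)"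
  shows "AE x in lborel. convergent (\<lambda>k. f k x)"
proof -
  have [measurable]: "\<And>k. f k \<in> borel_measurable borel" using f by (auto dest: sqint_measurable)
  have "(\<integral>\<^sup>+x. (\<Sum>k. ennreal (2^k * (norm (f (Suc k) x - f k x))\<^sup>2)) \<partial>lborel)
      = (\<Sum>k. (\<integral>\<^sup>+x. ennreal (2^k * (norm (f (Suc k) x - f k x))\<^sup>2) \<partial>lborel))"
    by (rule nn_integral_suminf) measurable
  also have "\<dots> = (\<Sum>k. ennreal (2^k) * (\<integral>\<^sup>+x. ennreal ((norm (f (Suc k) x - f k x))\<^sup>2) \<partial>lborel))"
    by (subst nn_integral_cmult[symmetric]) (auto simp: ennreal_mult'')
  also have "\<dots> \<le> (\<Sum>k. ennreal ((1/2)^k))"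
  proof (rule suminf_le)
    fix k
    have "ennreal (2^k) * (\<integral>\<^sup>+x. ennreal ((norm (f (Suc k) x - f k x))\<^sup>2) \<partial>lborel) \<le> ennreal (2^k) * ennreal ((1/4)^k)"
      using mult_left_mono[OF fast, of "ennreal (2^k)" k] by simp
    also have "\<dots> = ennreal ((1/2)^k)"
      by (subst ennreal_mult''[symmetric]) (auto simp flip: power_mult_distrib)
    finally show "ennreal (2^k) * (\<integral>\<^sup>+x. ennreal ((norm (f (Suc k) x - f k x))\<^sup>2) \<partial>lborel) \<le> ennreal ((1/2)^k)" .
  qed auto
  also have "\<dots> = ennreal 2"
    using suminf_geometric[of "1/2::real"] by (subst suminf_ennreal2) (auto simp: summable_geometric)
  finally have "(\<integral>\<^sup>+x. (\<Sum>k. ennreal (2^k * (norm (f (Suc k) x - f k x))\<^sup>2)) \<partial>lborel) \<noteq> \<infinity>"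
    by (auto simp: top_unique)
  then have "AE x in lborel. (\<Sum>k. ennreal (2^k * (norm (f (Suc k) x - f k x))\<^sup>2)) \<noteq> \<infinity>"
    by (rule nn_integral_PInf_AE[rotated]) measurable
  then show ?thesis
  proof eventually_elim
    fix x assume "(\<Sum>k. ennreal (2^k * (norm (f (Suc k) x - f k x))\<^sup>2)) \<noteq> \<infinity>"
    then have "summable (\<lambda>k. 2^k * (norm (f (Suc k) x - f k x))\<^sup>2)"
      by (intro summable_suminf_not_top) auto
    then have "Bseq (\<lambda>k. 2^k * (norm (f (Suc k) x - f k x))\<^sup>2)"
      by (intro convergent_imp_Bseq) (auto simp: convergent_def dest: summable_LIMSEQ_zero)
    then obtain K where K: "K > 0" "\<And>k. norm (2^k * (norm (f (Suc k) x - f k x))\<^sup>2) \<le> K"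
      by (auto simp: Bseq_def)
    have bd: "norm (f (Suc k) x - f k x) \<le> sqrt K * (sqrt (1/2))^k" for k
    proof -
      have "(norm (f (Suc k) x - f k x))\<^sup>2 \<le> K * (1/2)^k"
        using K(2)[of k] by (auto simp: field_simps abs_mult power_divide)
      then have "norm (f (Suc k) x - f k x) \<le> sqrt (K * (1/2)^k)"
        by (rule real_le_rsqrt)
      then show ?thesis by (simp add: real_sqrt_mult real_sqrt_power)
    qed
    have "summable (\<lambda>k. f (Suc k) x - f k x)"
    proof (rule summable_comparison_test')
      show "summable (\<lambda>k. sqrt K * (sqrt (1/2))^k)"
        by (intro summable_mult summable_geometric) (simp add: real_sqrt_divide)
    qed (rule bd)
    then have "convergent (\<lambda>n. f n x - f 0 x)"
      using sum_lessThan_telescope[of "\<lambda>k. f k x"] by (simp add: summable_iff_convergent)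
    from convergent_add[OF this convergent_const[of "f 0 x"]]
    show "convergent (\<lambda>k. f k x)" by simp
  qed
qed

lemma diff_rep_L2: "U - V = abs_L2 (\<lambda>x. rep_L2 U x - rep_L2 V x)"
  using abs_L2_diff[of "rep_L2 U" "rep_L2 V"] by simp

lemma norm_diff_L2_sq_nn:
  "ennreal ((norm (U - V))\<^sup>2) = (\<integral>\<^sup>+x. ennreal ((norm (rep_L2 U x - rep_L2 V x))\<^sup>2) \<partial>lborel)"
  by (subst diff_rep_L2, subst norm_abs_L2_sq_nn) (auto intro: sqint_diff)

instance L2 :: (euclidean_space) banach
proof
  fix X :: "nat \<Rightarrow> 'a L2" assume X: "Cauchy X"
  have "\<exists>N. \<forall>i\<ge>N. \<forall>j\<ge>N. norm (X i - X j) < (1/2)^k" for k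
    using metric_CauchyD[OF X, of "(1/2)^k"] by (auto simp: dist_norm)
  then obtain N where N: "\<And>k i j. i \<ge> N k \<Longrightarrow> j \<ge> N k \<Longrightarrow> norm (X i - X j) < (1/2)^k"
    by metis
  \<comment> \<open>Summing makes the indices monotone: \<open>r l\<close> lies beyond
    \<open>N k\<close> for every l >= k, so all later terms are within (1/2)^k of the k-th
    one.\<close>
  define r where "r k = sum N {..k}" for k
  have r: "N k \<le> r l" if "k \<le> l" for k l
  proof -
    have "N k \<le> sum N {..k}" by (rule member_le_sum) auto
    also have "\<dots> \<le> sum N {..l}" using that by (intro sum_mono2) auto
    finally show ?thesis by (simp add: r_def)
  qed
  define f where "f k = rep_L2 (X (r k))" for k
  have f[measurable, simp]: "f k \<in> sqint" "f k \<in> borel_measurable borel" for k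
    by (auto simp: f_def)
  have ff: "(\<integral>\<^sup>+x. ennreal ((norm (f i x - f k x))\<^sup>2) \<partial>lborel) \<le> ennreal ((1/4)^k)" if "k \<le> i" for i k
  proof -
    have "(\<integral>\<^sup>+x. ennreal ((norm (f i x - f k x))\<^sup>2) \<partial>lborel) = ennreal ((norm (X (r i) - X (r k)))\<^sup>2)"
      by (simp add: norm_diff_L2_sq_nn f_def)
    also have "\<dots> \<le> ennreal (((1/2)^k)\<^sup>2)"
      using N[OF r[OF that] r[OF order_refl]] by (intro ennreal_leI power_mono) auto
    finally show ?thesis by (simp add: power2_eq_square flip: power_mult_distrib)
  qed
  \<comment> \<open>\<open>lim\<close> is defined everywhere, so g is Borel measurable although the
    sequence converges only almost everywhere.\<close>
  define g where "g x = lim (\<lambda>k. f k x)" for x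
  have g[measurable]: "g \<in> borel_measurable borel" unfolding g_def by measurable
  have conv: "AE x in lborel. (\<lambda>k. f k x) \<longlonglongrightarrow> g x"
    using AE_convergent_fast_Cauchy[OF f(1) ff[OF le_SucI[OF order_refl]]]
    by eventually_elim (simp add: g_def convergent_LIMSEQ_iff)
  \<comment> \<open>Fatou's lemma in i with k fixed: the bound for the differences passes to the
    limit, which yields both the membership of g and the rate of convergence.\<close>
  have gf: "(\<integral>\<^sup>+x. ennreal ((norm (g x - f k x))\<^sup>2) \<partial>lborel) \<le> ennreal ((1/4)^k)" for k
  proof -
    have "(\<integral>\<^sup>+x. ennreal ((norm (g x - f k x))\<^sup>2) \<partial>lborel)
        = (\<integral>\<^sup>+x. liminf (\<lambda>i. ennreal ((norm (f i x - f k x))\<^sup>2)) \<partial>lborel)"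
    proof (rule nn_integral_cong_AE, use conv in eventually_elim)
      fix x assume "(\<lambda>k. f k x) \<longlonglongrightarrow> g x"
      then have "(\<lambda>i. ennreal ((norm (f i x - f k x))\<^sup>2)) \<longlonglongrightarrow> ennreal ((norm (g x - f k x))\<^sup>2)"
        by (intro tendsto_intros)
      then show "ennreal ((norm (g x - f k x))\<^sup>2) = liminf (\<lambda>i. ennreal ((norm (f i x - f k x))\<^sup>2))"
        by (intro lim_imp_Liminf[symmetric]) auto
    qed
    also have "\<dots> \<le> liminf (\<lambda>i. \<integral>\<^sup>+x. ennreal ((norm (f i x - f k x))\<^sup>2) \<partial>lborel)"
      by (rule nn_integral_liminf) measurable
    also have "\<dots> \<le> limsup (\<lambda>i. \<integral>\<^sup>+x. ennreal ((norm (f i x - f k x))\<^sup>2) \<partial>lborel)"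
      by (rule Liminf_le_Limsup) simp
    also have "\<dots> \<le> ennreal ((1/4)^k)"
      by (rule Limsup_bounded) (auto simp: eventually_sequentially intro!: exI[of _ k] ff)
    finally show ?thesis .
  qed
  have "(\<lambda>x. g x - f 0 x) \<in> sqint"
    by (rule sqintI_nn) (use gf[of 0] in \<open>auto simp: le_less_trans\<close>)
  from sqint_add[OF this f(1)[of 0]] have gs: "g \<in> sqint" by simp
  have lim: "norm (abs_L2 g - X (r k)) \<le> (1/2)^k" for k
  proof (rule power2_le_imp_le)
    have "abs_L2 g - X (r k) = abs_L2 (\<lambda>x. g x - f k x)"
      using abs_L2_diff[OF gs f(1)] by (simp add: f_def)
    then have "ennreal ((norm (abs_L2 g - X (r k)))\<^sup>2) \<le> ennreal ((1/4)^k)"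
      using gf[of k] gs by (simp add: norm_abs_L2_sq_nn sqint_diff)
    then show "(norm (abs_L2 g - X (r k)))\<^sup>2 \<le> ((1/2)^k)\<^sup>2"
      by (simp add: power2_eq_square flip: power_mult_distrib)
  qed simp
  have "X \<longlonglongrightarrow> abs_L2 g"
  proof (rule LIMSEQ_I)
    fix e :: real assume "e > 0"
    then obtain k where k: "(1/2)^k < e/2" using real_arch_pow_inv[of "e/2" "1/2"] by auto
    have "norm (X n - abs_L2 g) < e" if "n \<ge> r k" for n
    proof -
      have "norm (X n - abs_L2 g) \<le> norm (X n - X (r k)) + norm (abs_L2 g - X (r k))"
        using norm_triangle_ineq4[of "X n - X (r k)" "abs_L2 g - X (r k)"] by simp
      also have "norm (X n - X (r k)) < (1/2)^k"
        using that r[OF order_refl, of k] by (intro N) auto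
      finally show ?thesis using lim[of k] k by simp
    qed
    then show "\<exists>n0. \<forall>n\<ge>n0. norm (X n - abs_L2 g) < e" by blast
  qed
  then show "convergent X" by (auto simp: convergent_def)
qed

lemma tendsto_abs_L2_dominated:
  fixes f :: "nat \<Rightarrow> 'a::euclidean_space \<Rightarrow> complex"
  assumes g: "g \<in> sqint" and f: "\<And>i. f i \<in> borel_measurable borel" and h: "h \<in> borel_measurable borel"
    and le: "\<And>i x. norm (f i x) \<le> norm (g x)"
    and lim: "AE x in lborel. (\<lambda>i. f i x) \<longlonglongrightarrow> h x"
  shows "h \<in> sqint" "(\<lambda>i. abs_L2 (f i)) \<longlonglongrightarrow> abs_L2 h"
proof -
  note [measurable] = f h
  have fs: "f i \<in> sqint" for i using sqint_dominated[OF g f, of i 1] le by simp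
  have hle: "AE x in lborel. norm (h x) \<le> norm (g x)"
    using lim
  proof eventually_elim
    fix x assume "(\<lambda>i. f i x) \<longlonglongrightarrow> h x"
    from tendsto_norm[OF this] show "norm (h x) \<le> norm (g x)"
      by (rule LIMSEQ_le_const2) (use le in auto)
  qed
  have [measurable]: "g \<in> borel_measurable borel" using g by (rule sqint_measurable)
  show hs: "h \<in> sqint"
    unfolding sqint_def
  proof (safe intro!: h)
    show "integrable lborel (\<lambda>x. (norm (h x))\<^sup>2)"
      by (rule Bochner_Integration.integrable_bound[OF sqint_integrable[OF g]])
         (use hle in \<open>auto elim!: eventually_mono\<close>)
  qed
  have "(\<lambda>i. LINT x|lborel. (norm (f i x - h x))\<^sup>2) \<longlonglongrightarrow> (LINT x::'a|lborel. 0)"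
  proof (rule integral_dominated_convergence[where w = "\<lambda>x. 4 * (norm (g x))\<^sup>2"])
    show "integrable lborel (\<lambda>x. 4 * (norm (g x))\<^sup>2)" using sqint_integrable[OF g] by simp
    show "AE x in lborel. (\<lambda>i. (norm (f i x - h x))\<^sup>2) \<longlonglongrightarrow> 0"
      using lim by eventually_elim (auto intro!: tendsto_eq_intros)
    fix i
    show "AE x in lborel. norm ((norm (f i x - h x))\<^sup>2) \<le> 4 * (norm (g x))\<^sup>2"
      using hle
    proof eventually_elim
      fix x assume "norm (h x) \<le> norm (g x)"
      then have "norm (f i x - h x) \<le> 2 * norm (g x)"
        using norm_triangle_ineq4[of "f i x" "h x"] le[of i x] by linarith
      from power_mono[OF this norm_ge_zero, of 2]
      show "norm ((norm (f i x - h x))\<^sup>2) \<le> 4 * (norm (g x))\<^sup>2" by (simp add: power_mult_distrib)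
    qed
  qed measurable
  then have "(\<lambda>i. (norm (abs_L2 (f i) - abs_L2 h))\<^sup>2) \<longlonglongrightarrow> 0"
    by (simp add: abs_L2_diff fs hs norm_abs_L2_sq sqint_diff)
  from tendsto_real_sqrt[OF this] show "(\<lambda>i. abs_L2 (f i)) \<longlonglongrightarrow> abs_L2 h"
    by (subst LIM_zero_iff[symmetric]) (simp add: tendsto_norm_zero_iff)
qed

section \<open>Affine substitutions and continuity of translations in L^2\<close>

lemma nn_integral_lborel_affine:
  fixes t :: "'a::euclidean_space"
  assumes [measurable]: "f \<in> borel_measurable borel" and c: "c \<noteq> 0"
  shows "(\<integral>\<^sup>+x. f x \<partial>lborel) = ennreal (\<bar>c\<bar> ^ DIM('a)) * (\<integral>\<^sup>+x. f (t + c *\<^sub>R x) \<partial>lborel)"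
  by (subst lborel_affine[OF c, of t])
     (simp add: nn_integral_density nn_integral_distr nn_integral_cmult)

lemma AE_lborel_affine:
  fixes t :: "'a::euclidean_space"
  assumes [measurable]: "Measurable.pred borel P" and c: "c \<noteq> 0" and P: "AE x in lborel. P x"
  shows "AE x in lborel. P (t + c *\<^sub>R x)"
proof -
  from P have "(\<integral>\<^sup>+x. indicator {x. \<not> P x} x \<partial>lborel) = 0"
    by (subst nn_integral_0_iff_AE) auto
  then have "(\<integral>\<^sup>+x. indicator {x. \<not> P x} (t + c *\<^sub>R x) \<partial>lborel) = 0"
    using c by (subst (asm) nn_integral_lborel_affine[OF _ c, of _ t]) auto
  then show ?thesis
    by (subst (asm) nn_integral_0_iff_AE) (auto elim!: eventually_mono split: split_indicator_asm)
qed

lemma integrable_lborel_affine: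
  fixes t :: "'a::euclidean_space" and f :: "'a \<Rightarrow> 'b::{banach, second_countable_topology}"
  assumes c: "c \<noteq> 0" and f: "integrable lborel f"
  shows "integrable lborel (\<lambda>x. f (t + c *\<^sub>R x))"
proof -
  from f have [measurable]: "f \<in> borel_measurable borel" by auto
  from f have "(\<integral>\<^sup>+x. norm (f x) \<partial>lborel) < \<infinity>" by (simp add: integrable_iff_bounded)
  then have "(\<integral>\<^sup>+x. norm (f (t + c *\<^sub>R x)) \<partial>lborel) < \<infinity>"
    using c by (subst (asm) nn_integral_lborel_affine[OF _ c, of _ t]) (auto simp: ennreal_mult_less_top)
  then show ?thesis by (intro integrableI_bounded) auto
qed

lemma integral_lborel_affine:
  fixes t :: "'a::euclidean_space" and f :: "'a \<Rightarrow> 'b::{banach, second_countable_topology}"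
  assumes c: "c \<noteq> 0" and f: "integrable lborel f"
  shows "(LINT x|lborel. f x) = (\<bar>c\<bar> ^ DIM('a)) *\<^sub>R (LINT x|lborel. f (t + c *\<^sub>R x))"
proof -
  from f have [measurable]: "f \<in> borel_measurable borel" by auto
  show ?thesis
    by (subst lborel_affine[OF c, of t]) (simp add: integral_density integral_distr)
qed

lemma sqint_affine:
  fixes t :: "'a::euclidean_space"
  assumes c: "c \<noteq> 0" and f: "f \<in> sqint"
  shows "(\<lambda>x. f (t + c *\<^sub>R x)) \<in> sqint"
  using integrable_lborel_affine[OF c sqint_integrable[OF f], of t] sqint_measurable[OF f]
  by (simp add: sqint_def)

text \<open>Two cases matter: \<open>affL 1 a\<close> is a translation, whose continuity in a
  underlies Plancherel's theorem, and \<open>affL (-1) 0\<close> is the reflection that turns the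
  transform into its inverse.\<close>

definition affL :: "real \<Rightarrow> 'a::euclidean_space \<Rightarrow> 'a L2 \<Rightarrow> 'a L2" where
  "affL c t U = abs_L2 (\<lambda>x. rep_L2 U (t + c *\<^sub>R x))"

lemma affL_abs_L2:
  assumes c: "c \<noteq> 0" and f: "f \<in> sqint"
  shows "affL c t (abs_L2 f) = abs_L2 (\<lambda>x. f (t + c *\<^sub>R x))"
proof -
  have [measurable]: "f \<in> borel_measurable borel" using f by (rule sqint_measurable)
  have "AE x in lborel. rep_L2 (abs_L2 f) (t + c *\<^sub>R x) = f (t + c *\<^sub>R x)"
    by (rule AE_lborel_affine[OF _ c rep_abs_L2[OF f]]) measurable
  then show ?thesis
    unfolding affL_def using c f by (subst abs_L2_eq_iff) (auto intro: sqint_affine)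
qed

lemma affL_simps:
  assumes c: "c \<noteq> 0"
  shows affL_add: "affL c t (U + V) = affL c t U + affL c t V"
    and affL_diff: "affL c t (U - V) = affL c t U - affL c t V"
    and affL_scaleR: "affL c t (a *\<^sub>R U) = a *\<^sub>R affL c t U"
proof -
  note [simp] = affL_abs_L2[OF c] abs_L2_add abs_L2_diff abs_L2_scaleR sqint_add sqint_diff sqint_scaleR
    sqint_affine[OF c]
  show "affL c t (U + V) = affL c t U + affL c t V"
    using affL_abs_L2[OF c, of "\<lambda>x. rep_L2 U x + rep_L2 V x" t] abs_L2_add[of "rep_L2 U" "rep_L2 V"]
    by (simp add: affL_def)
  show "affL c t (U - V) = affL c t U - affL c t V"
    using affL_abs_L2[OF c, of "\<lambda>x. rep_L2 U x - rep_L2 V x" t] abs_L2_diff[of "rep_L2 U" "rep_L2 V"]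
    by (simp add: affL_def)
  show "affL c t (a *\<^sub>R U) = a *\<^sub>R affL c t U"
    using affL_abs_L2[OF c, of "\<lambda>x. a *\<^sub>R rep_L2 U x" t] abs_L2_scaleR[of "rep_L2 U" a]
    by (simp add: affL_def)
qed

lemma norm_affL:
  fixes t :: "'a::euclidean_space"
  assumes c: "\<bar>c\<bar> = 1"
  shows "norm (affL c t U) = norm U"
proof -
  have c0: "c \<noteq> 0" using c by auto
  have "(norm U)\<^sup>2 = (norm (affL c t U))\<^sup>2"
    using integral_lborel_affine[OF c0 sqint_integrable[of "rep_L2 U"], of t] c
      norm_abs_L2_sq[of "rep_L2 U"] norm_abs_L2_sq[OF sqint_affine[OF c0, of "rep_L2 U" t]]
    by (simp add: affL_def)
  then show ?thesis by simp
qed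

lemma emeasure_bounded_less_top: "bounded E \<Longrightarrow> emeasure lborel E < top"
  using emeasure_bounded_finite by auto

lemma sqint_bounded_support:
  assumes [measurable]: "f \<in> borel_measurable borel" and B: "\<And>x. norm (f x) \<le> B"
    and E: "\<And>x. x \<notin> E \<Longrightarrow> f x = 0" "E \<in> sets borel" "emeasure lborel E < \<infinity>"
  shows "f \<in> sqint"
proof (rule sqintI_nn)
  have "(\<integral>\<^sup>+x. ennreal ((norm (f x))\<^sup>2) \<partial>lborel) \<le> (\<integral>\<^sup>+x. ennreal (B\<^sup>2) * indicator E x \<partial>lborel)"
    using power_mono[OF B norm_ge_zero, of _ 2] E(1)
    by (intro nn_integral_mono) (auto split: split_indicator)
  also have "\<dots> < \<infinity>" using E by (simp add: nn_integral_cmult_indicator ennreal_mult_less_top)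
  finally show "(\<integral>\<^sup>+x. ennreal ((norm (f x))\<^sup>2) \<partial>lborel) < \<infinity>" .
qed simp

lemma sqint_indicator:
  "E \<in> sets borel \<Longrightarrow> emeasure lborel E < \<infinity> \<Longrightarrow> (\<lambda>x. indicator E x *\<^sub>R (y::complex)) \<in> sqint"
  by (rule sqint_bounded_support[where B = "norm y" and E = E]) (auto split: split_indicator)

text \<open>If \<open>K\<close> is a compact subset and \<open>G\<close> an open neighbourhood, both almost as large as \<open>E\<close>, then
  \<open>K + a\<close> stays in \<open>G\<close> for small \<open>a\<close>, so \<open>E\<close> and \<open>E + a\<close> overlap almost entirely.\<close>

lemma measure_Int_translate_tendsto:
  fixes E :: "'a::euclidean_space set"
  assumes E: "E \<in> sets borel" "bounded E"
  shows "((\<lambda>a. measure lborel {x\<in>E. x - a \<in> E}) \<longlongrightarrow> measure lborel E) (at 0)"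
proof (rule tendstoI)
  fix e :: real assume e: "e > 0"
  have Efin: "emeasure lborel E < \<infinity>" using E by (simp add: emeasure_bounded_less_top)
  have EL: "E \<in> sets lebesgue" using E by simp
  obtain K where K: "closed K" "K \<subseteq> E" "emeasure lebesgue (E - K) < ennreal (e/4)"
    using sets_lebesgue_inner_closed[OF EL divide_pos_pos[OF e zero_less_numeral]] by metis
  obtain G where G: "open G" "E \<subseteq> G" "emeasure lebesgue (G - E) < ennreal (e/4)"
    using sets_lebesgue_outer_open[OF EL divide_pos_pos[OF e zero_less_numeral]] by metis
  have "compact K" using K E by (auto simp: compact_eq_bounded_closed intro: bounded_subset)
  then obtain d where d: "d > 0" "(\<Union>x\<in>K. ball x d) \<subseteq> G"
    using compact_subset_open_imp_ball_epsilon_subset[of K G] K G by blast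
  note [measurable] = E(1) borel_closed[OF K(1)] borel_open[OF G(1)]
  have measure_less: "measure lborel A < r" if "A \<in> sets borel" "emeasure lebesgue A < ennreal r" for A :: "'a set" and r
  proof -
    have "0 < ennreal r" using that(2) by (rule le_less_trans[rotated]) simp
    moreover have "emeasure lborel A = ennreal (measure lborel A)"
      using that by (intro emeasure_eq_ennreal_measure) auto
    ultimately show ?thesis using that by (simp add: ennreal_less_iff)
  qed
  have EK: "measure lborel (E - K) < e/4" and GE: "measure lborel (G - E) < e/4"
    using measure_less[OF _ K(3)] measure_less[OF _ G(3)] e by auto
  have bound: "dist (measure lborel {x\<in>E. x - a \<in> E}) (measure lborel E) < e" if "norm a < d" for a
  proof -
    define S where "S = {x\<in>E. x - a \<in> E}"
    have S[measurable]: "S \<in> sets borel" unfolding S_def by measurable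
    have fin: "A \<in> fmeasurable lborel" if "A \<in> sets borel" "A \<subseteq> E" for A
      using Efin emeasure_mono[of A E lborel] that E by (auto simp: fmeasurable_def)
    define T where "T = {x. x - a \<in> E - K} \<union> (G - E)"
    have T1: "measure lborel {x. x - a \<in> E - K} = measure lborel (E - K)"
    proof -
      have "emeasure lborel (E - K) = (\<integral>\<^sup>+x. indicator (E - K) (-a + 1 *\<^sub>R x) \<partial>lborel)"
        by (subst nn_integral_indicator[symmetric], simp, subst nn_integral_lborel_affine[of _ 1 "-a"]) auto
      also have "\<dots> = (\<integral>\<^sup>+x. indicator {x. x - a \<in> E - K} x \<partial>lborel)"
        by (intro nn_integral_cong) (auto split: split_indicator)
      also have "\<dots> = emeasure lborel {x. x - a \<in> E - K}"
        by (subst nn_integral_indicator) auto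
      finally show ?thesis by (simp add: measure_def)
    qed
    have E1: "measure lborel {x. x - a \<in> E} = measure lborel E" and E1f: "{x. x - a \<in> E} \<in> fmeasurable lborel"
    proof -
      have "emeasure lborel E = (\<integral>\<^sup>+x. indicator E (-a + 1 *\<^sub>R x) \<partial>lborel)"
        by (subst nn_integral_indicator[symmetric], simp, subst nn_integral_lborel_affine[of _ 1 "-a"]) auto
      also have "\<dots> = (\<integral>\<^sup>+x. indicator {x. x - a \<in> E} x \<partial>lborel)"
        by (intro nn_integral_cong) (auto split: split_indicator)
      also have "\<dots> = emeasure lborel {x. x - a \<in> E}"
        by (subst nn_integral_indicator) auto
      finally show "measure lborel {x. x - a \<in> E} = measure lborel E" "{x. x - a \<in> E} \<in> fmeasurable lborel"
        using Efin by (auto simp: measure_def fmeasurable_def)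
    qed
    have "{x. x - a \<in> E} \<subseteq> S \<union> ({x. x - a \<in> E - K} \<union> (G - E))"
    proof
      fix x assume x: "x \<in> {x. x - a \<in> E}"
      show "x \<in> S \<union> ({x. x - a \<in> E - K} \<union> (G - E))"
      proof (cases "x - a \<in> K")
        case True
        then have "x \<in> G" using d(2) that by (force simp: dist_norm)
        then show ?thesis using x by (auto simp: S_def)
      qed (use x in auto)
    qed
    moreover have f2: "{x. x - a \<in> E - K} \<in> fmeasurable lborel"
      by (rule fmeasurableI2[OF E1f]) auto
    moreover have f3: "G - E \<in> fmeasurable lborel"
      using G(3) by (auto simp: fmeasurable_def emeasure_completion intro: less_trans)
    moreover have f1: "S \<in> fmeasurable lborel" by (rule fin) (auto simp: S_def)
    ultimately have "measure lborel {x. x - a \<in> E} \<le> measure lborel (S \<union> ({x. x - a \<in> E - K} \<union> (G - E)))"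
      by (intro measure_mono_fmeasurable) auto
    also have "\<dots> \<le> measure lborel S + (measure lborel {x. x - a \<in> E - K} + measure lborel (G - E))"
      using f1 f2 f3 by (intro order_trans[OF measure_Un_le] add_left_mono measure_Un_le) auto
    finally have "measure lborel E < measure lborel S + e" using EK GE T1 E1 e by linarith
    moreover have "measure lborel S \<le> measure lborel E"
      by (rule measure_mono_fmeasurable) (auto simp: S_def intro: fin)
    ultimately show ?thesis by (simp add: S_def[symmetric] dist_real_def)
  qed
  show "\<forall>\<^sub>F a in at 0. dist (measure lborel {x \<in> E. x - a \<in> E}) (measure lborel E) < e"
    using bound d(1) by (auto simp: eventually_at intro!: exI[of _ d])
qed

text \<open>The classes at which translation is continuous form a set S closed under sums and, since
  all translations are isometries, under limits. Indicators of bounded sets belong to S by the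
  overlap of a set with its translates; simple functions, functions of bounded support and
  truncations then exhaust L^2.\<close>

lemma affL_tendsto:
  fixes U :: "'a::euclidean_space L2"
  shows "((\<lambda>a. affL 1 a U) \<longlongrightarrow> U) (at 0)"
proof -
  define S where "S = {U::'a L2. ((\<lambda>a. affL 1 a U) \<longlongrightarrow> U) (at 0)}"
  have closedS: "U \<in> S" if X: "\<And>i. X i \<in> S" "X \<longlonglongrightarrow> U" for X :: "nat \<Rightarrow> 'a L2" and U
    unfolding S_def
  proof (safe, rule tendstoI)
    fix e :: real assume e: "e > 0"
    then obtain i where i: "dist (X i) U < e/3"
      using LIMSEQ_D[OF X(2), of "e/3"] by (auto simp: dist_norm)
    have "\<forall>\<^sub>F a in at 0. dist (affL 1 a (X i)) (X i) < e/3"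
      using X(1)[of i] e by (auto simp: S_def dest!: tendstoD[of _ _ _ "e/3"])
    then show "\<forall>\<^sub>F a in at 0. dist (affL 1 a U) U < e"
    proof eventually_elim
      case (elim a)
      have "dist (affL 1 a U) (affL 1 a (X i)) = dist U (X i)"
        by (simp add: dist_norm norm_affL flip: affL_diff)
      then show ?case
        using i elim dist_triangle[of "affL 1 a U" U "affL 1 a (X i)"]
          dist_triangle[of "affL 1 a (X i)" U "X i"] by (simp add: dist_commute)
    qed
  qed
  have addS: "U + V \<in> S" if "U \<in> S" "V \<in> S" for U V
    using that by (auto simp: S_def affL_add intro: tendsto_add)
  have indS: "abs_L2 (\<lambda>x. indicator E x *\<^sub>R y) \<in> S" if E: "E \<in> sets borel" "bounded E" for E and y :: complex
  proof -
    note [measurable] = E(1)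
    have Efin: "emeasure lborel E < \<infinity>" using E by (simp add: emeasure_bounded_less_top)
    define f where "f x = indicator E x *\<^sub>R y" for x
    have f: "f \<in> sqint" unfolding f_def by (rule sqint_indicator[OF E(1) Efin])
    define V where "V = abs_L2 f"
    have fa: "(\<lambda>x. f (a + x)) \<in> sqint" for a using sqint_affine[OF _ f, of 1 a] by simp
    \<comment> \<open>When the square is expanded, invariance of the norm leaves the overlap of E
      with a translate as the only term that depends on a.\<close>
    have eq: "(norm (affL 1 a V - V))\<^sup>2 = 2 * (norm y)\<^sup>2 * (measure lborel E - measure lborel {x\<in>E. x - (-a) \<in> E})" for a
    proof -
      have "inner (affL 1 a V) V = (LINT x|lborel. f (a + x) \<bullet> f x)"
        using f fa by (simp add: V_def affL_abs_L2 inner_abs_L2)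
      also have "\<dots> = (LINT x|lborel. (norm y)\<^sup>2 * indicator {x\<in>E. x - (-a) \<in> E} x)"
        by (intro Bochner_Integration.integral_cong)
           (auto simp: f_def power2_norm_eq_inner add.commute split: split_indicator)
      also have "\<dots> = (norm y)\<^sup>2 * measure lborel {x\<in>E. x - (-a) \<in> E}"
        by simp
      finally have 1: "inner (affL 1 a V) V = (norm y)\<^sup>2 * measure lborel {x\<in>E. x - (-a) \<in> E}" .
      have "(norm V)\<^sup>2 = (LINT x|lborel. (norm y)\<^sup>2 * indicator E x)"
        unfolding V_def norm_abs_L2_sq[OF f]
        by (intro Bochner_Integration.integral_cong) (auto simp: f_def split: split_indicator)
      then have 2: "(norm V)\<^sup>2 = (norm y)\<^sup>2 * measure lborel E" by simp
      have "(norm (affL 1 a V - V))\<^sup>2 = (norm (affL 1 a V))\<^sup>2 + (norm V)\<^sup>2 - 2 * inner (affL 1 a V) V"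
        by (simp add: power2_norm_eq_inner inner_diff_left inner_diff_right inner_commute)
      also have "(norm (affL 1 a V))\<^sup>2 = (norm V)\<^sup>2" by (simp add: norm_affL)
      finally show ?thesis using 1 2 by (simp add: algebra_simps)
    qed
    have "((\<lambda>a. measure lborel {x\<in>E. x - (-a) \<in> E}) \<longlongrightarrow> measure lborel E) (at 0)"
      using measure_Int_translate_tendsto[OF E]
      by (intro filterlim_compose[OF measure_Int_translate_tendsto[OF E]])
         (auto simp: filterlim_at eventually_at_filter intro!: tendsto_eq_intros)
    then have "((\<lambda>a. (norm (affL 1 a V - V))\<^sup>2) \<longlongrightarrow> 2 * (norm y)\<^sup>2 * (measure lborel E - measure lborel E)) (at 0)"
      unfolding eq by (intro tendsto_intros)
    from tendsto_real_sqrt[OF this] have "((\<lambda>a. affL 1 a V) \<longlongrightarrow> V) (at 0)"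
      by (subst LIM_zero_iff[symmetric]) (simp add: tendsto_norm_zero_iff)
    then show ?thesis by (simp add: S_def V_def f_def[abs_def])
  qed
  have sumS: "abs_L2 (\<lambda>x. \<Sum>y\<in>Y. indicator (E y) x *\<^sub>R y) \<in> S"
    if "finite Y" "\<And>y. y \<in> Y \<Longrightarrow> E y \<in> sets borel \<and> bounded (E y)" for E and Y :: "complex set"
  proof -
    have sq: "(\<lambda>x. indicator (E y) x *\<^sub>R y) \<in> sqint" if "y \<in> Y" for y
      using that \<open>\<And>y. y \<in> Y \<Longrightarrow> _\<close>[OF that]
      by (intro sqint_indicator) (auto simp: emeasure_bounded_less_top)
    have "(\<Sum>y\<in>Y. abs_L2 (\<lambda>x. indicator (E y) x *\<^sub>R y)) \<in> S"
      using that
    proof (induction Y rule: finite_induct)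
      case empty
      then show ?case by (simp add: S_def affL_abs_L2 flip: abs_L2_zero)
    next
      case (insert y Y)
      then show ?case by (auto intro!: addS indS)
    qed
    then show ?thesis by (simp add: abs_L2_sum sq)
  qed
  have bndS: "abs_L2 f \<in> S" if f: "f \<in> sqint" and R: "\<And>x. norm x > R \<Longrightarrow> f x = 0" for f R
  proof -
    have [measurable]: "f \<in> borel_measurable borel" using f by (rule sqint_measurable)
    obtain s where s: "\<And>i. simple_function borel (s i)" "\<And>x. (\<lambda>i. s i x) \<longlonglongrightarrow> f x"
      "\<And>i x. norm (s i x) \<le> 2 * norm (f x)"
      using borel_measurable_implies_sequence_metric[of f borel 0] by auto
    have "abs_L2 (s i) \<in> S" for i
    proof -
      \<comment> \<open>The value 0 is dropped because its level set need not be bounded. The other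
        level sets lie where f does not vanish, hence in the ball of radius R.\<close>
      have eq: "s i x = (\<Sum>y\<in>range (s i) - {0}. indicator (s i -` {y}) x *\<^sub>R y)" for x
      proof -
        have "s i x = (\<Sum>y\<in>range (s i). indicator (s i -` {y}) x *\<^sub>R y)"
          by (subst simple_function_indicator_representation_banach[OF s(1)[of i]]) (simp_all only: space_borel UNIV_I Int_UNIV_right)
        also have "\<dots> = (\<Sum>y\<in>range (s i) - {0}. indicator (s i -` {y}) x *\<^sub>R y)"
          using simple_functionD(1)[OF s(1), of i] by (intro sum.mono_neutral_right) auto
        finally show ?thesis .
      qed
      have "abs_L2 (\<lambda>x. \<Sum>y\<in>range (s i) - {0}. indicator (s i -` {y}) x *\<^sub>R y) \<in> S"
      proof (rule sumS)
        show "finite (range (s i) - {0})" using simple_functionD(1)[OF s(1), of i] by simp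
        fix y assume y: "y \<in> range (s i) - {0}"
        have "s i -` {y} \<subseteq> cball 0 R"
        proof
          fix x assume "x \<in> s i -` {y}"
          then have "s i x \<noteq> 0" using y by auto
          then have "f x \<noteq> 0" using s(3)[of i x] by auto
          then show "x \<in> cball 0 R" using R[of x] by force
        qed
        then have "bounded (s i -` {y})" using bounded_cball bounded_subset by blast
        then show "s i -` {y} \<in> sets borel \<and> bounded (s i -` {y})"
          using simple_functionD(2)[OF s(1), of i "{y}"] by simp
      qed
      moreover have "(\<lambda>x. \<Sum>y\<in>range (s i) - {0}. indicator (s i -` {y}) x *\<^sub>R y) = s i"
        using eq by (intro ext) (rule sym)
      ultimately show ?thesis by metis
    qed
    moreover have "(\<lambda>i. abs_L2 (s i)) \<longlonglongrightarrow> abs_L2 f"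
      by (rule tendsto_abs_L2_dominated(2)[OF sqint_scaleR[OF f, of 2]])
         (use s in \<open>auto intro: borel_measurable_simple_function\<close>)
    ultimately show ?thesis by (rule closedS)
  qed
  have "abs_L2 (rep_L2 U) \<in> S"
  proof (rule closedS)
    show "abs_L2 (\<lambda>x. indicator (cball 0 (real k)) x *\<^sub>R rep_L2 U x) \<in> S" for k
      by (rule bndS[where R = "real k"])
         (auto intro!: sqint_dominated[OF rep_L2_sqint, where B = 1] borel_measurable_scaleR borel_measurable_indicator split: split_indicator)
    show "(\<lambda>k. abs_L2 (\<lambda>x. indicator (cball 0 (real k)) x *\<^sub>R rep_L2 U x)) \<longlonglongrightarrow> abs_L2 (rep_L2 U)"
    proof (rule tendsto_abs_L2_dominated(2)[OF rep_L2_sqint])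
      show "AE x in lborel. (\<lambda>k. indicator (cball 0 (real k)) x *\<^sub>R rep_L2 U x) \<longlonglongrightarrow> rep_L2 U x"
      proof (intro AE_I2 tendsto_eventually)
        fix x :: 'a
        obtain k0 :: nat where "norm x \<le> real k0" using real_arch_simple by blast
        then show "\<forall>\<^sub>F k in sequentially. indicator (cball 0 (real k)) x *\<^sub>R rep_L2 U x = rep_L2 U x"
          by (intro eventually_sequentiallyI[of k0]) auto
      qed
    qed (auto intro!: borel_measurable_scaleR borel_measurable_indicator split: split_indicator)
  qed
  then show ?thesis by (simp add: S_def)
qed

section \<open>The Fourier transform\<close>

lemma borel_measurable_cis [measurable]: "cis \<in> borel_measurable borel"
  by (intro borel_measurable_continuous_onI continuous_intros)

section \<open>Fourier transforms of Gaussians, one coordinate at a time\<close>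

lemma integral_lborel_prod_Basis:
  fixes f :: "'a::euclidean_space \<Rightarrow> real \<Rightarrow> complex"
  assumes f: "\<And>b. b \<in> Basis \<Longrightarrow> integrable lborel (f b)"
  shows "(LINT x|lborel. (\<Prod>b\<in>Basis. f b (x \<bullet> b))) = (\<Prod>b\<in>Basis. (LINT x|lborel. f b x))"
    and "integrable lborel (\<lambda>x. \<Prod>b\<in>Basis. f b (x \<bullet> b))"
proof -
  interpret P: product_sigma_finite "\<lambda>_::'a. lborel :: real measure" ..
  have [measurable]: "f b \<in> borel_measurable borel" if "b \<in> Basis" for b
    using f[OF that] by auto
  let ?T = "\<lambda>x. \<Sum>b\<in>Basis. x b *\<^sub>R (b::'a)"
  have T[measurable]: "?T \<in> measurable (Pi\<^sub>M Basis (\<lambda>_. lborel)) borel" by measurable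
  have eq: "(\<Prod>b\<in>Basis. f b (?T x \<bullet> b)) = (\<Prod>b\<in>Basis. f b (x b))" for x
    by (intro prod.cong) auto
  have m: "(\<lambda>x::'a. \<Prod>b\<in>Basis. f b (x \<bullet> b)) \<in> borel_measurable borel" by measurable
  show "(LINT x|lborel. (\<Prod>b\<in>Basis. f b (x \<bullet> b))) = (\<Prod>b\<in>Basis. (LINT x|lborel. f b x))"
    by (subst lborel_eq, subst integral_distr[OF T m]) (simp only: eq P.product_integral_prod[OF finite_Basis f])
  show "integrable lborel (\<lambda>x. \<Prod>b\<in>Basis. f b (x \<bullet> b))"
    by (subst lborel_eq, subst integrable_distr_eq[OF T m]) (simp only: eq P.product_integrable_prod[OF finite_Basis f])
qed

text \<open>This is the characteristic function of the standard normal distribution, freed of its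
  normalising factor.\<close>

lemma gaussian_Fourier_real:
  "integrable lborel (\<lambda>x. cis (t * x) * exp (- x\<^sup>2 / 2))"
  "(LINT x|lborel. cis (t * x) * exp (- x\<^sup>2 / 2)) = complex_of_real (sqrt (2 * pi) * exp (- t\<^sup>2 / 2))"
proof -
  have d: "std_normal_density x = exp (- x\<^sup>2 / 2) / sqrt (2 * pi)" for x
    by (simp add: std_normal_density_def)
  have i: "integrable lborel (\<lambda>x::real. exp (- x\<^sup>2 / 2))"
    using integrable_mult_right[OF integrable_std_normal_moment[of 0], of "sqrt (2 * pi)"]
    by (simp add: d)
  show int: "integrable lborel (\<lambda>x. cis (t * x) * exp (- x\<^sup>2 / 2))"
    by (rule Bochner_Integration.integrable_bound[OF i]) (auto simp: norm_mult)
  have "complex_of_real (exp (- t\<^sup>2 / 2)) = char std_normal_distribution t"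
    by (simp add: char_std_normal_distribution)
  also have "\<dots> = (LINT x|lborel. std_normal_density x *\<^sub>R iexp (t * x))"
    unfolding char_def by (subst integral_density) (auto simp: normal_density_nonneg)
  also have "\<dots> = (LINT x|lborel. (1 / sqrt (2 * pi)) *\<^sub>R (cis (t * x) * exp (- x\<^sup>2 / 2)))"
    by (intro Bochner_Integration.integral_cong) (auto simp: d cis_conv_exp scaleR_conv_of_real field_simps)
  also have "\<dots> = (1 / sqrt (2 * pi)) *\<^sub>R (LINT x|lborel. cis (t * x) * exp (- x\<^sup>2 / 2))"
    by simp
  finally show "(LINT x|lborel. cis (t * x) * exp (- x\<^sup>2 / 2)) = complex_of_real (sqrt (2 * pi) * exp (- t\<^sup>2 / 2))"
    by (simp add: scaleR_conv_of_real field_simps)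
qed

definition gauss :: "'a::euclidean_space \<Rightarrow> real" where "gauss x = exp (- (norm x)\<^sup>2 / 2)"

lemma gauss_pos: "gauss x > 0" by (simp add: gauss_def)
lemma gauss_le_1: "gauss x \<le> 1" by (simp add: gauss_def)
lemma gauss_measurable [measurable]: "gauss \<in> borel_measurable borel"
  unfolding gauss_def by measurable

lemma gaussian_Fourier:
  fixes z :: "'a::euclidean_space"
  shows "integrable lborel (\<lambda>x. cis (z \<bullet> x) * gauss x)"
    "(LINT x|lborel. cis (z \<bullet> x) * gauss x) = complex_of_real ((2 * pi) powr (real DIM('a) / 2) * gauss z)"
proof -
  have eq: "cis (z \<bullet> x) * complex_of_real (gauss x) = (\<Prod>b\<in>Basis. cis ((z \<bullet> b) * (x \<bullet> b)) * complex_of_real (exp (- (x \<bullet> b)\<^sup>2 / 2)))" for x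
  proof -
    have "z \<bullet> x = (\<Sum>b\<in>Basis. (z \<bullet> b) * (x \<bullet> b))" by (rule euclidean_inner)
    then have 1: "cis (z \<bullet> x) = (\<Prod>b\<in>Basis. cis ((z \<bullet> b) * (x \<bullet> b)))"
      by (simp add: cis_conv_exp sum_distrib_left exp_sum)
    have "(norm x)\<^sup>2 = (\<Sum>b\<in>Basis. (x \<bullet> b)\<^sup>2)"
      unfolding power2_norm_eq_inner euclidean_inner[of x x] by (simp add: power2_eq_square)
    then have 2: "gauss x = (\<Prod>b\<in>Basis. exp (- (x \<bullet> b)\<^sup>2 / 2))"
      by (simp add: gauss_def sum_negf sum_divide_distrib flip: exp_sum)
    show ?thesis by (simp add: 1 2 prod.distrib)
  qed
  have g: "gauss z = (\<Prod>b\<in>Basis. exp (- (z \<bullet> b)\<^sup>2 / 2))"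
  proof -
    have "(norm z)\<^sup>2 = (\<Sum>b\<in>Basis. (z \<bullet> b)\<^sup>2)"
      unfolding power2_norm_eq_inner euclidean_inner[of z z] by (simp add: power2_eq_square)
    then show ?thesis by (simp add: gauss_def sum_negf sum_divide_distrib flip: exp_sum)
  qed
  show "integrable lborel (\<lambda>x. cis (z \<bullet> x) * gauss x)"
    unfolding eq by (rule integral_lborel_prod_Basis(2)) (rule gaussian_Fourier_real)
  have "(LINT x|lborel. cis (z \<bullet> x) * gauss x) = (\<Prod>b\<in>Basis. complex_of_real (sqrt (2 * pi) * exp (- (z \<bullet> b)\<^sup>2 / 2)))"
    unfolding eq by (subst integral_lborel_prod_Basis(1)) (simp_all only: gaussian_Fourier_real)
  also have "\<dots> = complex_of_real (sqrt (2 * pi) ^ DIM('a) * gauss z)"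
    by (simp add: prod.distrib g)
  also have "sqrt (2 * pi) ^ DIM('a) = (2 * pi) powr (real DIM('a) / 2)"
    by (simp add: powr_half_sqrt[symmetric] powr_powr flip: powr_realpow)
  finally show "(LINT x|lborel. cis (z \<bullet> x) * gauss x) = complex_of_real ((2 * pi) powr (real DIM('a) / 2) * gauss z)" .
qed

lemma gauss_integrable: "integrable lborel (gauss :: 'a::euclidean_space \<Rightarrow> real)"
  using gaussian_Fourier(1)[of "0::'a"] integrable_Re[of lborel "\<lambda>x::'a. cis (0 \<bullet> x) * gauss x"] by simp

lemma gauss_integral: "(LINT x|lborel. gauss (x::'a::euclidean_space)) = (2 * pi) powr (real DIM('a) / 2)"
proof -
  have "complex_of_real (LINT x|lborel. gauss (x::'a)) = complex_of_real ((2 * pi) powr (real DIM('a) / 2))"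
    using gaussian_Fourier(2)[of "0::'a"] by (simp add: gauss_def flip: integral_complex_of_real)
  then show ?thesis by (simp only: of_real_eq_iff)
qed

lemma gauss_scaled_integrable: "e \<noteq> 0 \<Longrightarrow> integrable lborel (\<lambda>x::'a::euclidean_space. gauss (e *\<^sub>R x))"
  using integrable_lborel_affine[OF _ gauss_integrable, of e 0] by simp

lemma gaussian_Fourier_scaled:
  fixes z :: "'a::euclidean_space"
  assumes e: "e > 0"
  shows "(LINT x|lborel. cis (z \<bullet> x) * gauss (e *\<^sub>R x))
    = complex_of_real ((1 / e) ^ DIM('a) * (2 * pi) powr (real DIM('a) / 2) * gauss ((1 / e) *\<^sub>R z))"
proof -
  have "integrable lborel (\<lambda>x. cis (z \<bullet> x) * gauss (e *\<^sub>R x))"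
    using integrable_lborel_affine[OF _ gaussian_Fourier(1)[of "(1/e) *\<^sub>R z"], of e 0] e by simp
  from integral_lborel_affine[OF _ this, of "1/e" 0]
  have "(LINT x|lborel. cis (z \<bullet> x) * gauss (e *\<^sub>R x))
      = ((1 / e) ^ DIM('a)) *\<^sub>R (LINT x|lborel. cis (((1/e) *\<^sub>R z) \<bullet> x) * gauss x)"
    using e by simp
  then show ?thesis
    by (simp only: gaussian_Fourier(2)) (simp add: scaleR_conv_of_real)
qed

section \<open>The transform of integrable functions and Plancherel's theorem\<close>

definition fconst :: "'a::euclidean_space itself \<Rightarrow> real" where
  "fconst _ = (2 * pi) powr (- real DIM('a) / 2)"

lemma fconst_pos: "fconst TYPE('a::euclidean_space) > 0" by (simp add: fconst_def)

lemma gauss_integral_fconst: "(LINT x|lborel. gauss (x::'a::euclidean_space)) = inverse (fconst TYPE('a))"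
  unfolding gauss_integral fconst_def by (subst powr_minus[symmetric]) simp

definition FT1 :: "('a::euclidean_space \<Rightarrow> complex) \<Rightarrow> 'a \<Rightarrow> complex" where
  "FT1 f \<xi> = fconst TYPE('a) *\<^sub>R (LINT x|lborel. cis (- (x \<bullet> \<xi>)) * f x)"

lemma FT1_measurable [measurable]:
  assumes [measurable]: "f \<in> borel_measurable borel"
  shows "FT1 f \<in> borel_measurable borel"
  unfolding FT1_def by measurable

lemma integrable_cis_mult:
  fixes f :: "'a::euclidean_space \<Rightarrow> complex"
  assumes f: "integrable lborel f"
  shows "integrable lborel (\<lambda>x. cis (- (x \<bullet> \<xi>)) * f x)"
proof (rule Bochner_Integration.integrable_bound[OF f])
  have [measurable]: "f \<in> borel_measurable borel" using f by auto
  show "(\<lambda>x. cis (- (x \<bullet> \<xi>)) * f x) \<in> borel_measurable lborel" by measurable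
qed (auto simp: norm_mult)

lemma norm_FT1_le: "norm (FT1 f \<xi>) \<le> fconst TYPE('a) * (LINT x|lborel. norm (f (x::'a::euclidean_space)))"
proof -
  have "norm (LINT x|lborel. cis (- (x \<bullet> \<xi>)) * f x) \<le> (LINT x|lborel. norm (cis (- (x \<bullet> \<xi>)) * f x))"
    by (rule integral_norm_bound)
  then show ?thesis
    using fconst_pos[where 'a = 'a] by (simp add: FT1_def norm_mult)
qed

lemma FT1_diff:
  "integrable lborel f \<Longrightarrow> integrable lborel g \<Longrightarrow> FT1 (\<lambda>x. f x - g x) \<xi> = FT1 f \<xi> - FT1 g \<xi>"
  by (simp add: FT1_def right_diff_distrib integrable_cis_mult scaleR_diff_right)

text \<open>Fubini moves the transform to the other factor. Carrying a unimodular number across the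
  real inner product conjugates it, whence the reflected argument on the right.\<close>

lemma FT1_adjoint:
  fixes f g :: "'a::euclidean_space \<Rightarrow> complex"
  assumes f: "integrable lborel f" and g: "integrable lborel g"
  shows "(LINT \<xi>|lborel. FT1 f \<xi> \<bullet> g \<xi>) = (LINT x|lborel. f x \<bullet> FT1 g (- x))"
proof -
  have [measurable]: "f \<in> borel_measurable borel" "g \<in> borel_measurable borel" using f g by auto
  have int: "integrable (lborel \<Otimes>\<^sub>M lborel) (\<lambda>(\<xi>, x). (cis (- (x \<bullet> \<xi>)) * f x) \<bullet> g \<xi>)"
  proof (rule Bochner_Integration.integrable_bound)
    show "integrable (lborel \<Otimes>\<^sub>M lborel) (\<lambda>(\<xi>, x). norm (g \<xi>) * norm (f x))"
      using f g by (intro lborel_pair.Fubini_integrable) (auto simp: norm_mult)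
    show "(\<lambda>(\<xi>, x). (cis (- (x \<bullet> \<xi>)) * f x) \<bullet> g \<xi>) \<in> borel_measurable (lborel \<Otimes>\<^sub>M lborel)"
      by measurable
    have "\<bar>(cis (- (x \<bullet> \<xi>)) * f x) \<bullet> g \<xi>\<bar> \<le> norm (g \<xi>) * norm (f x)" for x \<xi>
      using Cauchy_Schwarz_ineq2[of "cis (- (x \<bullet> \<xi>)) * f x" "g \<xi>"] by (simp add: norm_mult mult.commute)
    then show "AE p in lborel \<Otimes>\<^sub>M lborel. norm (case p of (\<xi>, x) \<Rightarrow> (cis (- (x \<bullet> \<xi>)) * f x) \<bullet> g \<xi>)
        \<le> norm (case p of (\<xi>, x) \<Rightarrow> norm (g \<xi>) * norm (f x))"
      by (auto simp: abs_mult)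
  qed
  have adj: "(cis a * u) \<bullet> v = u \<bullet> (cis (- a) * v)" for a and u v :: complex
    by (simp add: inner_complex_def algebra_simps)
  have "(LINT \<xi>|lborel. FT1 f \<xi> \<bullet> g \<xi>) = (LINT \<xi>|lborel. fconst TYPE('a) * (LINT x|lborel. (cis (- (x \<bullet> \<xi>)) * f x) \<bullet> g \<xi>))"
    using f by (simp add: FT1_def integrable_cis_mult)
  also have "\<dots> = fconst TYPE('a) * (LINT \<xi>|lborel. (LINT x|lborel. (cis (- (x \<bullet> \<xi>)) * f x) \<bullet> g \<xi>))"
    by simp
  also have "(LINT \<xi>|lborel. (LINT x|lborel. (cis (- (x \<bullet> \<xi>)) * f x) \<bullet> g \<xi>))
      = (LINT x|lborel. (LINT \<xi>|lborel. (cis (- (x \<bullet> \<xi>)) * f x) \<bullet> g \<xi>))"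
    using lborel_pair.Fubini_integral[OF int] by simp
  also have "\<dots> = (LINT x|lborel. f x \<bullet> (LINT \<xi>|lborel. cis (x \<bullet> \<xi>) * g \<xi>))"
  proof (intro Bochner_Integration.integral_cong refl)
    fix x
    have "integrable lborel (\<lambda>\<xi>. cis (x \<bullet> \<xi>) * g \<xi>)"
      using integrable_cis_mult[OF g, of "- x"] by (simp add: inner_commute)
    then show "(LINT \<xi>|lborel. (cis (- (x \<bullet> \<xi>)) * f x) \<bullet> g \<xi>) = f x \<bullet> (LINT \<xi>|lborel. cis (x \<bullet> \<xi>) * g \<xi>)"
      by (simp add: adj)
  qed
  also have "fconst TYPE('a) * \<dots> = (LINT x|lborel. f x \<bullet> FT1 g (- x))"
    by (simp add: FT1_def inner_commute)
  finally show ?thesis .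
qed

lemma inner_affL_one: "f \<in> sqint \<Longrightarrow> inner (abs_L2 f) (affL 1 a (abs_L2 f)) = (LINT x|lborel. f x \<bullet> f (a + x))"
  using sqint_affine[of 1 f a] by (simp add: affL_abs_L2 inner_abs_L2)

text \<open>\<open>f\<close> is taken in L^1 so that its transform is a bounded function, and in L^2
  so that its correlation with its translates is defined. The damping factor makes the left side an
  absolutely convergent pairing, to which \<open>FT1_adjoint\<close> applies with the damped
  transform as the second function.\<close>

lemma FT1_gauss_energy:
  fixes f :: "'a::euclidean_space \<Rightarrow> complex"
  assumes f1: "integrable lborel f" and f2: "f \<in> sqint" and e: "e > 0"
  shows "(LINT \<xi>|lborel. gauss (e *\<^sub>R \<xi>) * (norm (FT1 f \<xi>))\<^sup>2)
      = fconst TYPE('a) * (LINT z|lborel. gauss z * inner (abs_L2 f) (affL 1 (- e *\<^sub>R z) (abs_L2 f)))"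
    and "integrable lborel (\<lambda>\<xi>. gauss (e *\<^sub>R \<xi>) * (norm (FT1 f \<xi>))\<^sup>2)"
proof -
  let ?c = "fconst TYPE('a)"
  have [measurable]: "f \<in> borel_measurable borel" using f1 by auto
  define C where "C = ?c * (LINT x|lborel. norm (f x))"
  have C: "norm (FT1 f \<xi>) \<le> C" for \<xi> unfolding C_def by (rule norm_FT1_le)
  have C0: "C \<ge> 0" using order_trans[OF norm_ge_zero C] .
  show "integrable lborel (\<lambda>\<xi>. gauss (e *\<^sub>R \<xi>) * (norm (FT1 f \<xi>))\<^sup>2)"
  proof (rule Bochner_Integration.integrable_bound)
    show "integrable lborel (\<lambda>\<xi>::'a. C\<^sup>2 * gauss (e *\<^sub>R \<xi>))"
      using gauss_scaled_integrable[of e, where 'a = 'a] e by simp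
    show "AE \<xi> in lborel. norm (gauss (e *\<^sub>R \<xi>) * (norm (FT1 f \<xi>))\<^sup>2) \<le> norm (C\<^sup>2 * gauss (e *\<^sub>R \<xi>))"
      using power_mono[OF C norm_ge_zero, of _ 2] gauss_pos
      by (auto simp: abs_mult less_imp_le mult.commute intro!: mult_left_mono AE_I2)
  qed measurable
  define g where "g \<xi> = gauss (e *\<^sub>R \<xi>) *\<^sub>R FT1 f \<xi>" for \<xi>
  have [measurable]: "g \<in> borel_measurable borel" unfolding g_def by measurable
  have g: "integrable lborel g"
  proof (rule Bochner_Integration.integrable_bound)
    show "integrable lborel (\<lambda>\<xi>::'a. C * gauss (e *\<^sub>R \<xi>))"
      using gauss_scaled_integrable[of e, where 'a = 'a] e by simp
    show "AE \<xi> in lborel. norm (g \<xi>) \<le> norm (C * gauss (e *\<^sub>R \<xi>))"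
      using C C0 gauss_pos
      by (auto simp: g_def abs_mult mult.commute intro!: mult_right_mono AE_I2)
  qed measurable
  \<comment> \<open>Transforming the damped spectrum back gives a Gaussian average of f over shifts
    of size e, since the integral over \<xi> is the transform of a Gaussian.\<close>
  have Fg: "FT1 g (- x) = ?c *\<^sub>R (LINT z|lborel. gauss z *\<^sub>R f (x + (- e) *\<^sub>R z))" for x
  proof -
    have "integrable (lborel \<Otimes>\<^sub>M lborel) (\<lambda>(\<xi>::'a, y). norm (gauss (e *\<^sub>R \<xi>)) * norm (f y))"
      using f1 gauss_scaled_integrable[of e, where 'a = 'a] e
      by (intro lborel_pair.Fubini_integrable) (auto simp: norm_mult)
    then have int: "integrable (lborel \<Otimes>\<^sub>M lborel) (\<lambda>(\<xi>, y). cis ((x - y) \<bullet> \<xi>) * gauss (e *\<^sub>R \<xi>) * f y)"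
      by (rule Bochner_Integration.integrable_bound) (auto simp: norm_mult abs_mult split_beta')
    have "FT1 g (- x) = ?c *\<^sub>R (LINT \<xi>|lborel. cis (x \<bullet> \<xi>) * (gauss (e *\<^sub>R \<xi>) *\<^sub>R (?c *\<^sub>R (LINT y|lborel. cis (- (y \<bullet> \<xi>)) * f y))))"
      by (simp add: FT1_def g_def inner_commute)
    also have "\<dots> = ?c *\<^sub>R (LINT \<xi>|lborel. ?c *\<^sub>R (LINT y|lborel. cis ((x - y) \<bullet> \<xi>) * gauss (e *\<^sub>R \<xi>) * f y))"
    proof (intro arg_cong[of _ _ "\<lambda>u. ?c *\<^sub>R u"] Bochner_Integration.integral_cong refl)
      fix \<xi> :: 'a
      have "(LINT y|lborel. cis ((x - y) \<bullet> \<xi>) * gauss (e *\<^sub>R \<xi>) * f y)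
        = (LINT y|lborel. (cis (x \<bullet> \<xi>) * gauss (e *\<^sub>R \<xi>)) * (cis (- (y \<bullet> \<xi>)) * f y))"
        by (intro Bochner_Integration.integral_cong) (auto simp: inner_diff_left cis_mult algebra_simps diff_conv_add_uminus simp del: add_uminus_conv_diff)
      also have "\<dots> = (cis (x \<bullet> \<xi>) * gauss (e *\<^sub>R \<xi>)) * (LINT y|lborel. (cis (- (y \<bullet> \<xi>)) * f y))"
        by simp
      finally show "cis (x \<bullet> \<xi>) * (gauss (e *\<^sub>R \<xi>) *\<^sub>R (?c *\<^sub>R (LINT y|lborel. cis (- (y \<bullet> \<xi>)) * f y)))
        = ?c *\<^sub>R (LINT y|lborel. cis ((x - y) \<bullet> \<xi>) * gauss (e *\<^sub>R \<xi>) * f y)"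
        by (simp add: scaleR_conv_of_real)
    qed
    also have "\<dots> = (?c * ?c) *\<^sub>R (LINT \<xi>|lborel. (LINT y|lborel. cis ((x - y) \<bullet> \<xi>) * gauss (e *\<^sub>R \<xi>) * f y))"
      by simp
    also have "(LINT \<xi>|lborel. (LINT y|lborel. cis ((x - y) \<bullet> \<xi>) * gauss (e *\<^sub>R \<xi>) * f y))
      = (LINT y|lborel. (LINT \<xi>|lborel. cis ((x - y) \<bullet> \<xi>) * gauss (e *\<^sub>R \<xi>) * f y))"
      using lborel_pair.Fubini_integral[OF int] by simp
    also have "\<dots> = (LINT y|lborel. (LINT \<xi>|lborel. cis ((x - y) \<bullet> \<xi>) * gauss (e *\<^sub>R \<xi>)) * f y)"
      by simp
    also have "\<dots> = (LINT y|lborel. (inverse ?c * (1/e) ^ DIM('a)) *\<^sub>R (gauss ((1/e) *\<^sub>R (x - y)) *\<^sub>R f y))"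
      unfolding gaussian_Fourier_scaled[OF e]
      by (intro Bochner_Integration.integral_cong)
         (auto simp: scaleR_conv_of_real fconst_def simp flip: powr_minus)
    also have "\<dots> = (inverse ?c * (1/e) ^ DIM('a)) *\<^sub>R (LINT y|lborel. gauss ((1/e) *\<^sub>R (x - y)) *\<^sub>R f y)"
      by (rule integral_scaleR_right)
    \<comment> \<open>The substitution y = x - e z produces the factor e^n that cancels (1/e)^n and
      leaves a Gaussian of fixed width.\<close>
    also have "(LINT y|lborel. gauss ((1/e) *\<^sub>R (x - y)) *\<^sub>R f y)
      = (\<bar>-e\<bar> ^ DIM('a)) *\<^sub>R (LINT z|lborel. gauss ((1/e) *\<^sub>R (x - (x + (-e) *\<^sub>R z))) *\<^sub>R f (x + (- e) *\<^sub>R z))"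
    proof (rule integral_lborel_affine)
      show "integrable lborel (\<lambda>y. gauss ((1/e) *\<^sub>R (x - y)) *\<^sub>R f y)"
        by (rule Bochner_Integration.integrable_bound[OF f1])
           (auto simp: gauss_le_1 less_imp_le[OF gauss_pos] intro!: mult_left_le_one_le)
    qed (use e in simp)
    finally show ?thesis
      using e fconst_pos[where 'a = 'a] by (simp add: power_one_over power_mult_distrib field_simps)
  qed
  \<comment> \<open>Integrability on the product rests on f being in L^2: for each z the product of
    f with its translate is at most half the sum of their squares, whose integral does not depend on
    z.\<close>
  have J: "integrable (lborel \<Otimes>\<^sub>M lborel) (\<lambda>(z, x). gauss z * (f x \<bullet> f (x + (- e) *\<^sub>R z)))"
  proof (rule lborel_pair.Fubini_integrable)
    show "(\<lambda>(z, x). gauss z * (f x \<bullet> f (x + (- e) *\<^sub>R z))) \<in> borel_measurable (lborel \<Otimes>\<^sub>M lborel)"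
      by measurable
    have shift: "(\<lambda>x. f (x + (- e) *\<^sub>R z)) \<in> sqint" for z
      using sqint_affine[OF _ f2, of 1 "(-e) *\<^sub>R z"] by (simp add: add.commute)
    have int: "integrable lborel (\<lambda>x. gauss z * (f x \<bullet> f (x + (- e) *\<^sub>R z)))" for z
      using sqint_inner_integrable[OF f2 shift] by simp
    then show "AE z in lborel. integrable lborel (\<lambda>x. case (z, x) of (z, x) \<Rightarrow> gauss z * (f x \<bullet> f (x + (- e) *\<^sub>R z)))"
      by simp
    define D where "D = (LINT x|lborel. (norm (f x))\<^sup>2)"
    have bd: "(LINT x|lborel. norm (gauss z * (f x \<bullet> f (x + (- e) *\<^sub>R z)))) \<le> gauss z * D" for z
    proof -
      have "(LINT x|lborel. norm (gauss z * (f x \<bullet> f (x + (- e) *\<^sub>R z))))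
        \<le> (LINT x|lborel. gauss z * (((norm (f x))\<^sup>2 + (norm (f (x + (- e) *\<^sub>R z)))\<^sup>2) / 2))"
      proof (rule integral_mono)
        show "integrable lborel (\<lambda>x. norm (gauss z * (f x \<bullet> f (x + (- e) *\<^sub>R z))))"
          using int by (rule integrable_norm)
        show "integrable lborel (\<lambda>x. gauss z * (((norm (f x))\<^sup>2 + (norm (f (x + (- e) *\<^sub>R z)))\<^sup>2) / 2))"
          using sqint_integrable[OF f2] sqint_integrable[OF shift[of z]] by simp
        fix x
        have "\<bar>f x \<bullet> f (x + (- e) *\<^sub>R z)\<bar> \<le> norm (f x) * norm (f (x + (- e) *\<^sub>R z))"
          by (rule Cauchy_Schwarz_ineq2)
        also have "\<dots> \<le> ((norm (f x))\<^sup>2 + (norm (f (x + (- e) *\<^sub>R z)))\<^sup>2) / 2"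
          using sum_squares_bound[of "norm (f x)" "norm (f (x + (- e) *\<^sub>R z))"] by simp
        finally show "norm (gauss z * (f x \<bullet> f (x + (- e) *\<^sub>R z)))
            \<le> gauss z * (((norm (f x))\<^sup>2 + (norm (f (x + (- e) *\<^sub>R z)))\<^sup>2) / 2)"
          using gauss_pos[of z] by (auto simp: abs_mult intro!: mult_mono)
      qed
      also have "\<dots> = gauss z * (((LINT x|lborel. (norm (f x))\<^sup>2) + (LINT x|lborel. (norm (f (x + (- e) *\<^sub>R z)))\<^sup>2)) / 2)"
        using sqint_integrable[OF f2] sqint_integrable[OF shift[of z]] by simp
      also have "(LINT x|lborel. (norm (f (x + (- e) *\<^sub>R z)))\<^sup>2) = D"
        using integral_lborel_affine[OF _ sqint_integrable[OF f2], of 1 "(-e) *\<^sub>R z"] by (simp add: D_def add.commute)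
      finally show ?thesis by (simp add: D_def)
    qed
    show "integrable lborel (\<lambda>z. LINT x|lborel. norm (case (z, x) of (z, x) \<Rightarrow> gauss z * (f x \<bullet> f (x + (- e) *\<^sub>R z))))"
    proof (rule Bochner_Integration.integrable_bound)
      show "integrable lborel (\<lambda>z::'a. gauss z * D)" using gauss_integrable[where 'a = 'a] by simp
      have "0 \<le> (LINT x|lborel. norm (gauss z * (f x \<bullet> f (x + (- e) *\<^sub>R z))))" for z
        by (rule integral_nonneg_AE) simp
      then show "AE z in lborel. norm (LINT x|lborel. norm (case (z, x) of (z, x) \<Rightarrow> gauss z * (f x \<bullet> f (x + (- e) *\<^sub>R z))))
        \<le> norm (gauss z * D)"
        using order_trans[OF bd abs_ge_self] by (auto intro!: AE_I2)
    qed measurable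
  qed
  have "(LINT \<xi>|lborel. gauss (e *\<^sub>R \<xi>) * (norm (FT1 f \<xi>))\<^sup>2) = (LINT \<xi>|lborel. FT1 f \<xi> \<bullet> g \<xi>)"
    by (simp add: g_def power2_norm_eq_inner)
  also have "\<dots> = (LINT x|lborel. f x \<bullet> FT1 g (- x))" by (rule FT1_adjoint[OF f1 g])
  also have "\<dots> = (LINT x|lborel. ?c * (LINT z|lborel. gauss z * (f x \<bullet> f (x + (- e) *\<^sub>R z))))"
  proof (intro Bochner_Integration.integral_cong refl)
    fix x
    have "integrable lborel (\<lambda>z. gauss z *\<^sub>R f (x + (- e) *\<^sub>R z))"
      by (rule Bochner_Integration.integrable_bound[OF integrable_lborel_affine[OF _ f1, of "-e" x]])
         (use e in \<open>auto simp: gauss_le_1 less_imp_le[OF gauss_pos] intro!: mult_left_le_one_le\<close>)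
    then show "f x \<bullet> FT1 g (- x) = ?c * (LINT z|lborel. gauss z * (f x \<bullet> f (x + (- e) *\<^sub>R z)))"
      unfolding Fg by (simp flip: integral_inner_right)
  qed
  also have "\<dots> = ?c * (LINT x|lborel. (LINT z|lborel. gauss z * (f x \<bullet> f (x + (- e) *\<^sub>R z))))"
    by simp
  also have "(LINT x|lborel. (LINT z|lborel. gauss z * (f x \<bullet> f (x + (- e) *\<^sub>R z))))
     = (LINT z|lborel. (LINT x|lborel. gauss z * (f x \<bullet> f (x + (- e) *\<^sub>R z))))"
    using lborel_pair.Fubini_integral[OF J] by simp
  also have "\<dots> = (LINT z|lborel. gauss z * inner (abs_L2 f) (affL 1 (- e *\<^sub>R z) (abs_L2 f)))"
    by (simp add: inner_affL_one[OF f2] add.commute)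
  finally show "(LINT \<xi>|lborel. gauss (e *\<^sub>R \<xi>) * (norm (FT1 f \<xi>))\<^sup>2)
      = ?c * (LINT z|lborel. gauss z * inner (abs_L2 f) (affL 1 (- e *\<^sub>R z) (abs_L2 f)))" .
qed

text \<open>In \<open>FT1_gauss_energy\<close> let e tend to 0. On the right dominated convergence
  applies, by continuity of translations. On the left the Gaussians increase to 1, and monotone
  convergence proves square integrability together with the equality of norms.\<close>

lemma FT1_isometry:
  fixes f :: "'a::euclidean_space \<Rightarrow> complex"
  assumes f1: "integrable lborel f" and f2: "f \<in> sqint"
  shows "FT1 f \<in> sqint" "norm (abs_L2 (FT1 f)) = norm (abs_L2 f)"
proof -
  let ?c = "fconst TYPE('a)"
  have [measurable]: "f \<in> borel_measurable borel" using f1 by auto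
  define U where "U = abs_L2 f"
  define e where "e k = 1 / real (Suc k)" for k
  have e0: "e k > 0" for k by (simp add: e_def)
  have elim: "e \<longlonglongrightarrow> 0" unfolding e_def by (rule LIMSEQ_Suc[OF lim_1_over_n])
  have cont: "isCont (\<lambda>a. affL 1 a U) 0"
    using affL_tendsto[of U] by (simp add: isCont_def affL_def)
  have "(\<lambda>k. LINT z|lborel. gauss z * inner U (affL 1 (- e k *\<^sub>R z) U)) \<longlonglongrightarrow> (LINT z|lborel. gauss (z::'a) * inner U U)"
  proof (rule integral_dominated_convergence[where w = "\<lambda>z. gauss z * (norm U * norm U)"])
    show "integrable lborel (\<lambda>z::'a. gauss z * (norm U * norm U))" using gauss_integrable[where 'a = 'a] by simp
    show "AE z in lborel. (\<lambda>k. gauss z * inner U (affL 1 (- e k *\<^sub>R z) U)) \<longlonglongrightarrow> gauss z * inner U U"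
    proof (rule AE_I2)
      fix z :: 'a
      have "(\<lambda>k. - e k *\<^sub>R z) \<longlonglongrightarrow> 0" using elim by (auto intro!: tendsto_eq_intros)
      from isCont_tendsto_compose[OF cont this]
      have "(\<lambda>k. affL 1 (- e k *\<^sub>R z) U) \<longlonglongrightarrow> U" by (simp add: affL_def)
      then show "(\<lambda>k. gauss z * inner U (affL 1 (- e k *\<^sub>R z) U)) \<longlonglongrightarrow> gauss z * inner U U"
        by (intro tendsto_intros)
    qed
    show "AE z in lborel. norm (gauss z * inner U (affL 1 (- e k *\<^sub>R z) U)) \<le> gauss z * (norm U * norm U)" for k
    proof (rule AE_I2)
      fix z :: 'a
      have "\<bar>inner U (affL 1 (- e k *\<^sub>R z) U)\<bar> \<le> norm U * norm U"
        using Cauchy_Schwarz_ineq2[of U "affL 1 (- e k *\<^sub>R z) U"] by (simp add: norm_affL)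
      then show "norm (gauss z * inner U (affL 1 (- e k *\<^sub>R z) U)) \<le> gauss z * (norm U * norm U)"
        using gauss_pos[of z] by (simp add: abs_mult)
    qed
    show "(\<lambda>z. gauss z * inner U (affL 1 (- e k *\<^sub>R z) U)) \<in> borel_measurable lborel" for k
      unfolding U_def inner_affL_one[OF f2] by measurable
  qed measurable
  note main = this
  have c: "?c * (LINT z|lborel. gauss (z::'a) * inner U U) = (norm U)\<^sup>2"
    using fconst_pos[where 'a = 'a] by (simp add: gauss_integral_fconst power2_norm_eq_inner)
  from tendsto_mult[OF tendsto_const[of ?c] main]
  have lim: "(\<lambda>k. LINT \<xi>|lborel. gauss (e k *\<^sub>R \<xi>) * (norm (FT1 f \<xi>))\<^sup>2) \<longlonglongrightarrow> (norm U)\<^sup>2"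
    unfolding FT1_gauss_energy(1)[OF f1 f2 e0] U_def[symmetric]
    unfolding c .
  have "(\<lambda>k. \<integral>\<^sup>+\<xi>. ennreal (gauss (e k *\<^sub>R \<xi>) * (norm (FT1 f \<xi>))\<^sup>2) \<partial>lborel)
      \<longlonglongrightarrow> (\<integral>\<^sup>+\<xi>. ennreal ((norm (FT1 f \<xi>))\<^sup>2) \<partial>lborel)"
  proof (rule nn_integral_LIMSEQ)
    show "incseq (\<lambda>k \<xi>. ennreal (gauss (e k *\<^sub>R \<xi>) * (norm (FT1 f \<xi>))\<^sup>2))"
    proof (intro incseq_SucI le_funI ennreal_leI mult_right_mono)
      fix k and \<xi> :: 'a
      have "(e (Suc k) * norm \<xi>)\<^sup>2 \<le> (e k * norm \<xi>)\<^sup>2"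
        by (intro power_mono mult_right_mono) (auto simp: e_def frac_le)
      then show "gauss (e k *\<^sub>R \<xi>) \<le> gauss (e (Suc k) *\<^sub>R \<xi>)"
        by (simp add: gauss_def abs_mult power_mult_distrib)
    qed simp
    fix \<xi> :: 'a
    have "(\<lambda>k. gauss (e k *\<^sub>R \<xi>) * (norm (FT1 f \<xi>))\<^sup>2) \<longlonglongrightarrow> (norm (FT1 f \<xi>))\<^sup>2"
      unfolding gauss_def using elim by (auto intro!: tendsto_eq_intros)
    then show "(\<lambda>k. ennreal (gauss (e k *\<^sub>R \<xi>) * (norm (FT1 f \<xi>))\<^sup>2)) \<longlonglongrightarrow> ennreal ((norm (FT1 f \<xi>))\<^sup>2)"
      by (intro tendsto_intros)
  qed measurable
  moreover have "(\<integral>\<^sup>+\<xi>. ennreal (gauss (e k *\<^sub>R \<xi>) * (norm (FT1 f \<xi>))\<^sup>2) \<partial>lborel)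
      = ennreal (LINT \<xi>|lborel. gauss (e k *\<^sub>R \<xi>) * (norm (FT1 f \<xi>))\<^sup>2)" for k
    by (rule nn_integral_eq_integral[OF FT1_gauss_energy(2)[OF f1 f2 e0]]) (simp add: less_imp_le[OF gauss_pos])
  ultimately have eq: "(\<integral>\<^sup>+\<xi>. ennreal ((norm (FT1 f \<xi>))\<^sup>2) \<partial>lborel) = ennreal ((norm U)\<^sup>2)"
    using tendsto_ennrealI[OF lim] by (auto dest: LIMSEQ_unique)
  then show s: "FT1 f \<in> sqint" by (intro sqintI_nn) auto
  show "norm (abs_L2 (FT1 f)) = norm (abs_L2 f)"
    using norm_abs_L2_sq_nn[OF s] eq by (simp add: U_def ennreal_inj)
qed

section \<open>Extension of the transform to L^2\<close>

definition trunc :: "real \<Rightarrow> ('a::euclidean_space \<Rightarrow> complex) \<Rightarrow> 'a \<Rightarrow> complex" where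
  "trunc R f x = indicator (cball 0 R) x *\<^sub>R f x"

lemma trunc_measurable [measurable]:
  fixes f :: "'a::euclidean_space \<Rightarrow> complex"
  assumes [measurable]: "f \<in> borel_measurable borel"
  shows "trunc R f \<in> borel_measurable borel"
proof -
  have [measurable]: "cball (0::'a) R \<in> sets borel" by simp
  show ?thesis unfolding trunc_def by measurable
qed

lemma norm_trunc_le: "norm (trunc R f x) \<le> norm (f x)"
  by (auto simp: trunc_def split: split_indicator)

lemma trunc_sqint: "f \<in> sqint \<Longrightarrow> trunc R f \<in> sqint"
  by (rule sqint_dominated[where B = 1]) (auto simp: norm_trunc_le dest: sqint_measurable)

lemma trunc_integrable:
  fixes f :: "'a::euclidean_space \<Rightarrow> complex"
  assumes f: "f \<in> sqint"
  shows "integrable lborel (trunc R f)"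
proof (rule Bochner_Integration.integrable_bound)
  have [measurable]: "f \<in> borel_measurable borel" using f by (rule sqint_measurable)
  have "emeasure lborel (cball (0::'a) R) < top"
    by (rule emeasure_bounded_less_top) simp
  then have "integrable lborel (indicator (cball 0 R) :: 'a \<Rightarrow> real)" by simp
  then show "integrable lborel (\<lambda>x. indicator (cball 0 R) x + (norm (f x))\<^sup>2)"
    using sqint_integrable[OF f] by simp
  show "trunc R f \<in> borel_measurable lborel" by measurable
  have "norm (f x) \<le> 1 + (norm (f x))\<^sup>2" for x
    using sum_squares_bound[of "norm (f x)" 1] norm_ge_zero[of "f x"] by (simp del: norm_ge_zero)
  then show "AE x in lborel. norm (trunc R f x) \<le> norm (indicator (cball 0 R) x + (norm (f x))\<^sup>2)"
    by (auto simp: trunc_def split: split_indicator)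
qed

lemma trunc_tendsto:
  fixes f :: "'a::euclidean_space \<Rightarrow> complex"
  assumes f: "f \<in> sqint"
  shows "((\<lambda>R. abs_L2 (trunc R f)) \<longlongrightarrow> abs_L2 f) at_top"
proof (rule tendsto_at_topI_sequentially)
  fix X :: "nat \<Rightarrow> real" assume X: "filterlim X at_top sequentially"
  have [measurable]: "f \<in> borel_measurable borel" using f by (rule sqint_measurable)
  show "(\<lambda>n. abs_L2 (trunc (X n) f)) \<longlonglongrightarrow> abs_L2 f"
  proof (rule tendsto_abs_L2_dominated(2)[OF f])
    show "AE x in lborel. (\<lambda>n. trunc (X n) f x) \<longlonglongrightarrow> f x"
    proof (intro AE_I2 tendsto_eventually)
      fix x :: 'a
      show "\<forall>\<^sub>F n in sequentially. trunc (X n) f x = f x"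
        using filterlim_at_top[THEN iffD1, OF X, rule_format, of "norm x"]
        by eventually_elim (simp add: trunc_def)
    qed
  qed (auto simp: norm_trunc_le)
qed

definition FTL :: "'a::euclidean_space L2 \<Rightarrow> 'a L2" where
  "FTL U = lim (\<lambda>k. abs_L2 (FT1 (trunc (real k) (rep_L2 U))))"

lemma abs_L2_FT1_diff:
  assumes "integrable lborel f" "f \<in> sqint" "integrable lborel g" "g \<in> sqint"
  shows "norm (abs_L2 (FT1 f) - abs_L2 (FT1 g)) = norm (abs_L2 f - abs_L2 g)"
proof -
  have "FT1 (\<lambda>x. f x - g x) = (\<lambda>\<xi>. FT1 f \<xi> - FT1 g \<xi>)"
    using assms by (auto simp: FT1_diff)
  then have "abs_L2 (FT1 f) - abs_L2 (FT1 g) = abs_L2 (FT1 (\<lambda>x. f x - g x))"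
    using assms by (simp add: abs_L2_diff FT1_isometry)
  then show ?thesis using assms by (simp add: FT1_isometry sqint_diff abs_L2_diff)
qed

lemma FT1_trunc_diff:
  "f \<in> sqint \<Longrightarrow> norm (abs_L2 (FT1 (trunc R f)) - abs_L2 (FT1 (trunc S f))) = norm (abs_L2 (trunc R f) - abs_L2 (trunc S f))"
  by (rule abs_L2_FT1_diff) (auto intro: trunc_sqint trunc_integrable)

text \<open>\<open>has_fourier\<close> takes the limit over all radii, whereas \<open>FTL\<close> is
  defined along integer ones. By isometry the transforms of the truncations at \<open>X n\<close>
  and at n are as close as the truncations themselves.\<close>

lemma FT1_trunc_tendsto_rep: "((\<lambda>R. abs_L2 (FT1 (trunc R (rep_L2 U)))) \<longlongrightarrow> FTL U) at_top"
proof -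
  define f where "f = rep_L2 U"
  have f: "f \<in> sqint" by (simp add: f_def)
  have "Cauchy (\<lambda>k. abs_L2 (trunc (real k) f))"
    using filterlim_compose[OF trunc_tendsto[OF f] filterlim_real_sequentially]
    by (rule LIMSEQ_imp_Cauchy)
  then have "Cauchy (\<lambda>k. abs_L2 (FT1 (trunc (real k) f)))"
    by (simp add: Cauchy_def dist_norm FT1_trunc_diff[OF f])
  then have lim: "(\<lambda>k. abs_L2 (FT1 (trunc (real k) f))) \<longlonglongrightarrow> FTL U"
    by (simp add: FTL_def f_def Cauchy_convergent_iff convergent_LIMSEQ_iff)
  show ?thesis
    unfolding f_def[symmetric]
  proof (rule tendsto_at_topI_sequentially)
    fix X :: "nat \<Rightarrow> real" assume X: "filterlim X at_top sequentially"
    have "(\<lambda>n. abs_L2 (trunc (X n) f) - abs_L2 (trunc (real n) f)) \<longlonglongrightarrow> abs_L2 f - abs_L2 f"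
      by (intro tendsto_diff filterlim_compose[OF trunc_tendsto[OF f]] X filterlim_real_sequentially)
    then have "(\<lambda>n. norm (abs_L2 (trunc (X n) f) - abs_L2 (trunc (real n) f))) \<longlonglongrightarrow> 0"
      by (intro tendsto_norm_zero) simp
    then have "(\<lambda>n. abs_L2 (FT1 (trunc (X n) f)) - abs_L2 (FT1 (trunc (real n) f))) \<longlonglongrightarrow> 0"
      unfolding FT1_trunc_diff[OF f, symmetric] by (rule tendsto_norm_zero_cancel)
    from tendsto_add[OF this lim] show "(\<lambda>n. abs_L2 (FT1 (trunc (X n) f))) \<longlonglongrightarrow> FTL U" by simp
  qed
qed

lemma FT1_cong_AE:
  assumes [measurable]: "f \<in> borel_measurable borel" "g \<in> borel_measurable borel"
    and "AE x in lborel. f x = g x"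
  shows "FT1 f = FT1 g"
  unfolding FT1_def
  by (intro ext arg_cong[where f = "\<lambda>u. _ *\<^sub>R u"] integral_cong_AE) (use assms(3) in auto)

lemma FT1_trunc_rep:
  assumes f: "f \<in> sqint"
  shows "FT1 (trunc R (rep_L2 (abs_L2 f))) = FT1 (trunc R f)"
proof -
  have [measurable]: "f \<in> borel_measurable borel" using f by (rule sqint_measurable)
  show ?thesis
    by (rule FT1_cong_AE) (use rep_abs_L2[OF f] in \<open>auto simp: trunc_def elim!: eventually_mono\<close>)
qed

lemma FTL_tendsto:
  "f \<in> sqint \<Longrightarrow> ((\<lambda>R. abs_L2 (FT1 (trunc R f))) \<longlongrightarrow> FTL (abs_L2 f)) at_top"
  using FT1_trunc_tendsto_rep[of "abs_L2 f"] by (simp add: FT1_trunc_rep)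

lemma FTL_eq_FT1:
  assumes "integrable lborel f" "f \<in> sqint"
  shows "FTL (abs_L2 f) = abs_L2 (FT1 f)"
proof -
  have "((\<lambda>R. norm (abs_L2 (trunc R f) - abs_L2 f)) \<longlongrightarrow> 0) at_top"
    using trunc_tendsto[OF assms(2)] by (subst (asm) LIM_zero_iff[symmetric]) (rule tendsto_norm_zero)
  then have "((\<lambda>R. norm (abs_L2 (FT1 (trunc R f)) - abs_L2 (FT1 f))) \<longlongrightarrow> 0) at_top"
    using assms by (simp add: abs_L2_FT1_diff trunc_sqint trunc_integrable)
  then have "((\<lambda>R. abs_L2 (FT1 (trunc R f))) \<longlongrightarrow> abs_L2 (FT1 f)) at_top"
    by (subst LIM_zero_iff[symmetric]) (simp add: tendsto_norm_zero_iff)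
  from tendsto_unique[OF _ FTL_tendsto[OF assms(2)] this] show ?thesis by simp
qed

lemma norm_FTL [simp]: "norm (FTL U) = norm U"
proof -
  have "((\<lambda>R. norm (abs_L2 (FT1 (trunc R (rep_L2 U))))) \<longlongrightarrow> norm (FTL U)) at_top"
    by (intro tendsto_norm FT1_trunc_tendsto_rep)
  moreover have "((\<lambda>R. norm (abs_L2 (trunc R (rep_L2 U)))) \<longlongrightarrow> norm (abs_L2 (rep_L2 U))) at_top"
    by (intro tendsto_norm trunc_tendsto) simp
  ultimately show ?thesis
    by (auto simp: FT1_isometry(2) trunc_integrable trunc_sqint dest: tendsto_unique[rotated])
qed

lemma affL_isometry_bounded_linear: "\<bar>c\<bar> = 1 \<Longrightarrow> bounded_linear (affL c t)"
  by (rule bounded_linear_intro[where K = 1]) (auto simp: affL_add affL_scaleR norm_affL)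

text \<open>With the unitary normalisation the inverse transform is the transform followed by a
  reflection. At first it enters as the adjoint; that it inverts is a consequence.\<close>

definition iFTL :: "'a::euclidean_space L2 \<Rightarrow> 'a L2" where
  "iFTL U = affL (-1) 0 (FTL U)"

lemma norm_iFTL [simp]: "norm (iFTL U) = norm U"
  by (simp add: iFTL_def norm_affL)

lemma FTL_adjoint: "inner (FTL U) V = inner U (iFTL V)"
proof -
  define f g where "f = rep_L2 U" and "g = rep_L2 V"
  have s: "f \<in> sqint" "g \<in> sqint" by (auto simp: f_def g_def)
  have "((\<lambda>R. inner (abs_L2 (FT1 (trunc R f))) (abs_L2 (trunc R g))) \<longlongrightarrow> inner (FTL (abs_L2 f)) (abs_L2 g)) at_top"
    by (intro tendsto_inner FTL_tendsto trunc_tendsto s)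
  moreover have "((\<lambda>R. inner (abs_L2 (trunc R f)) (affL (-1) 0 (abs_L2 (FT1 (trunc R g)))))
      \<longlongrightarrow> inner (abs_L2 f) (affL (-1) 0 (FTL (abs_L2 g)))) at_top"
    by (intro tendsto_inner trunc_tendsto s bounded_linear.tendsto[OF affL_isometry_bounded_linear] FTL_tendsto) simp
  moreover have "inner (abs_L2 (FT1 (trunc R f))) (abs_L2 (trunc R g))
      = inner (abs_L2 (trunc R f)) (affL (-1) 0 (abs_L2 (FT1 (trunc R g))))" for R
    using FT1_adjoint[OF trunc_integrable[OF s(1), of R] trunc_integrable[OF s(2), of R]]
      sqint_affine[of "-1" "FT1 (trunc R g)" 0]
    by (simp add: inner_abs_L2 affL_abs_L2 FT1_isometry trunc_sqint trunc_integrable s)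
  ultimately show ?thesis
    by (auto simp: f_def g_def iFTL_def dest: tendsto_unique[rotated])
qed

text \<open>Linearity comes for free from the adjoint relation, and then isometry makes the adjoint a
  two-sided inverse.\<close>

lemma L2_eqI: "(\<And>W. inner W U = inner W V) \<Longrightarrow> U = (V :: 'a::euclidean_space L2)"
  by (metis inner_diff_right inner_eq_zero_iff right_minus_eq)

lemma FTL_linear: "linear FTL"
proof
  fix U V :: "'a L2" and c
  have adj: "inner W (FTL U) = inner (iFTL W) U" for U W :: "'a L2"
    by (metis FTL_adjoint inner_commute)
  show "FTL (U + V) = FTL U + FTL V"
    by (rule L2_eqI) (simp add: adj inner_add_right)
  show "FTL (c *\<^sub>R U) = c *\<^sub>R FTL U"
    by (rule L2_eqI) (simp add: adj)
qed

lemma iFTL_linear: "linear iFTL"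
proof
  fix U V :: "'a L2" and c
  show "iFTL (U + V) = iFTL U + iFTL V"
    by (rule L2_eqI) (simp add: inner_add_right flip: FTL_adjoint)
  show "iFTL (c *\<^sub>R U) = c *\<^sub>R iFTL U"
    by (rule L2_eqI) (simp flip: FTL_adjoint)
qed

lemma bounded_linear_iFTL: "bounded_linear iFTL"
  using iFTL_linear by (auto intro!: bounded_linear.intro bounded_linear_axioms.intro exI[of _ 1])

lemma linear_isometry_inner:
  fixes T :: "'a::real_inner \<Rightarrow> 'b::real_inner"
  assumes "linear T" "\<And>x. norm (T x) = norm x"
  shows "inner (T x) (T y) = inner x y"
  by (simp add: dot_norm assms(2) flip: linear_add[OF assms(1)])

lemma iFTL_FTL [simp]: "iFTL (FTL U) = U"
  by (rule L2_eqI) (simp add: linear_isometry_inner[OF FTL_linear norm_FTL] flip: FTL_adjoint)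

lemma FTL_iFTL [simp]: "FTL (iFTL U) = U"
  by (rule L2_eqI)
     (metis FTL_adjoint inner_commute iFTL_linear linear_isometry_inner norm_iFTL)

lemma FTL_bound_sup:
  fixes f :: "'a::euclidean_space \<Rightarrow> complex"
  assumes f: "integrable lborel f" "f \<in> sqint"
  shows "AE \<xi> in lborel. norm (rep_L2 (FTL (abs_L2 f)) \<xi>) \<le> fconst TYPE('a) * (LINT x|lborel. norm (f x))"
proof -
  have "AE \<xi> in lborel. rep_L2 (FTL (abs_L2 f)) \<xi> = FT1 f \<xi>"
    unfolding FTL_eq_FT1[OF f] by (rule rep_abs_L2[OF FT1_isometry(1)[OF f]])
  then show ?thesis by eventually_elim (simp add: norm_FT1_le)
qed

text \<open>The bound from L^1 to L^\<infinity> for the inverse transform. In the Sobolev embedding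
  it controls the part of a function with frequencies in a ball.\<close>

lemma iFTL_bound_sup:
  fixes f :: "'a::euclidean_space \<Rightarrow> complex"
  assumes f: "integrable lborel f" "f \<in> sqint"
  shows "AE \<xi> in lborel. norm (rep_L2 (iFTL (abs_L2 f)) \<xi>) \<le> fconst TYPE('a) * (LINT x|lborel. norm (f x))"
proof -
  have "iFTL (abs_L2 f) = abs_L2 (\<lambda>\<xi>. FT1 f (0 + (-1) *\<^sub>R \<xi>))"
    by (simp only: iFTL_def FTL_eq_FT1[OF f] affL_abs_L2[OF _ FT1_isometry(1)[OF f], of "-1"])
  then have "AE \<xi> in lborel. rep_L2 (iFTL (abs_L2 f)) \<xi> = FT1 f (0 + (-1) *\<^sub>R \<xi>)"
    using rep_abs_L2[OF sqint_affine[OF _ FT1_isometry(1)[OF f], of "-1" 0]] by simp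
  then show ?thesis by eventually_elim (simp add: norm_FT1_le)
qed

section \<open>Multiplication operators\<close>

definition mulL :: "('a::euclidean_space \<Rightarrow> real) \<Rightarrow> 'a L2 \<Rightarrow> 'a L2" where
  "mulL M U = abs_L2 (\<lambda>x. M x *\<^sub>R rep_L2 U x)"

text \<open>The bound is explicit because it must later be uniform in time. It holds at every point,
  not merely almost everywhere, so that symbols can be handled as functions.\<close>

definition bmult :: "real \<Rightarrow> ('a::euclidean_space \<Rightarrow> real) \<Rightarrow> bool" where
  "bmult B M \<longleftrightarrow> M \<in> borel_measurable borel \<and> (\<forall>x. \<bar>M x\<bar> \<le> B)"

lemma bmultD:
  assumes "bmult B M"
  shows "M \<in> borel_measurable borel" "\<bar>M x\<bar> \<le> B" "0 \<le> B"
proof -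
  show "M \<in> borel_measurable borel" "\<bar>M x\<bar> \<le> B" using assms by (auto simp: bmult_def)
  then show "0 \<le> B" by (meson abs_ge_zero order_trans)
qed

lemma bmult_sqint:
  assumes M: "bmult B M" and f: "f \<in> sqint"
  shows "(\<lambda>x. M x *\<^sub>R f x) \<in> sqint"
proof (rule sqint_dominated[OF f])
  show "(\<lambda>x. M x *\<^sub>R f x) \<in> borel_measurable borel"
    using bmultD(1)[OF M] sqint_measurable[OF f] by measurable
  show "norm (M x *\<^sub>R f x) \<le> B * norm (f x)" for x
    using bmultD(2)[OF M] by (auto intro: mult_right_mono)
qed

lemma mulL_abs_L2:
  assumes M: "M \<in> borel_measurable borel" and f: "f \<in> sqint" and Mf: "(\<lambda>x. M x *\<^sub>R f x) \<in> sqint"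
  shows "mulL M (abs_L2 f) = abs_L2 (\<lambda>x. M x *\<^sub>R f x)"
proof -
  have ae: "AE x in lborel. M x *\<^sub>R rep_L2 (abs_L2 f) x = M x *\<^sub>R f x"
    using rep_abs_L2[OF f] by eventually_elim simp
  have "(\<lambda>x. M x *\<^sub>R rep_L2 (abs_L2 f) x) \<in> sqint"
    unfolding sqint_def
  proof safe
    show m: "(\<lambda>x. M x *\<^sub>R rep_L2 (abs_L2 f) x) \<in> borel_measurable borel" using M by measurable
    have "integrable lborel (\<lambda>x. (norm (M x *\<^sub>R f x))\<^sup>2) \<longleftrightarrow> integrable lborel (\<lambda>x. (norm (M x *\<^sub>R rep_L2 (abs_L2 f) x))\<^sup>2)"
    proof (rule integrable_cong_AE)
      show "(\<lambda>x. (norm (M x *\<^sub>R f x))\<^sup>2) \<in> borel_measurable lborel"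
        using sqint_measurable[OF Mf] by measurable
      show "(\<lambda>x. (norm (M x *\<^sub>R rep_L2 (abs_L2 f) x))\<^sup>2) \<in> borel_measurable lborel"
        using m by measurable
      show "AE x in lborel. (norm (M x *\<^sub>R f x))\<^sup>2 = (norm (M x *\<^sub>R rep_L2 (abs_L2 f) x))\<^sup>2"
        using ae by eventually_elim auto
    qed
    then show "integrable lborel (\<lambda>x. (norm (M x *\<^sub>R rep_L2 (abs_L2 f) x))\<^sup>2)"
      using sqint_integrable[OF Mf] by simp
  qed
  then show ?thesis unfolding mulL_def using ae Mf by (simp add: abs_L2_eq_iff)
qed

lemma mulL_abs_L2_bmult: "bmult B M \<Longrightarrow> f \<in> sqint \<Longrightarrow> mulL M (abs_L2 f) = abs_L2 (\<lambda>x. M x *\<^sub>R f x)"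
  by (rule mulL_abs_L2) (auto dest: bmultD bmult_sqint)

lemma norm_mulL_le: "bmult B M \<Longrightarrow> norm (mulL M U) \<le> B * norm U"
  using norm_abs_L2_le[of "\<lambda>x. M x *\<^sub>R rep_L2 U x" "rep_L2 U" B] bmult_sqint[of B M "rep_L2 U"]
    bmultD[of B M]
  by (simp add: mulL_def mult_right_mono)

lemma mulL_add:
  assumes M: "bmult B M"
  shows "mulL M (U + V) = mulL M U + mulL M V"
  using mulL_abs_L2_bmult[OF M, of "\<lambda>x. rep_L2 U x + rep_L2 V x"] abs_L2_add[of "rep_L2 U" "rep_L2 V"]
    bmult_sqint[OF M]
  by (simp add: mulL_def abs_L2_add sqint_add scaleR_add_right)

lemma mulL_scaleR:
  assumes M: "bmult B M"
  shows "mulL M (c *\<^sub>R U) = c *\<^sub>R mulL M U"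
  using mulL_abs_L2_bmult[OF M, of "\<lambda>x. c *\<^sub>R rep_L2 U x"] abs_L2_scaleR[of "rep_L2 U" c]
    bmult_sqint[OF M]
  by (simp add: mulL_def abs_L2_scaleR sqint_scaleR scaleR_left_commute mult.commute)

lemma bounded_linear_mulL: "bmult B M \<Longrightarrow> bounded_linear (mulL M)"
  by (rule bounded_linear_intro[where K = B])
     (auto simp: mulL_add mulL_scaleR mult.commute dest: norm_mulL_le)

lemma mulL_diff: "bmult B M \<Longrightarrow> mulL M (U - V) = mulL M U - mulL M V"
  by (rule linear_diff[OF bounded_linear.linear[OF bounded_linear_mulL]])

lemma mulL_mulL:
  assumes M: "bmult B M" and N: "bmult C N"
  shows "mulL M (mulL N U) = mulL (\<lambda>x. M x * N x) U"
  by (subst (2) mulL_def, subst mulL_abs_L2_bmult[OF M bmult_sqint[OF N]]) (simp_all add: mulL_def)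

lemma mulL_plus: "bmult B M \<Longrightarrow> bmult C N \<Longrightarrow> mulL (\<lambda>x. M x + N x) U = mulL M U + mulL N U"
  by (simp add: mulL_def abs_L2_add bmult_sqint scaleR_add_left)

lemma mulL_minus: "bmult B M \<Longrightarrow> bmult C N \<Longrightarrow> mulL (\<lambda>x. M x - N x) U = mulL M U - mulL N U"
  by (simp add: mulL_def abs_L2_diff bmult_sqint scaleR_diff_left)

lemma mulL_const: "mulL (\<lambda>_. c) U = c *\<^sub>R U"
  using abs_L2_scaleR[of "rep_L2 U" c] by (simp add: mulL_def)

lemma mulL_one [simp]: "mulL (\<lambda>_. 1) U = U"
  by (simp add: mulL_const)

lemma mulL_zero [simp]: "mulL M 0 = 0" if "bmult B M"
  by (rule linear_0[OF bounded_linear.linear[OF bounded_linear_mulL[OF that]]])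

lemma norm_mulL_mono:
  assumes M: "bmult B M" and N: "bmult C N" and c: "0 \<le> c" and le: "\<And>x. \<bar>M x\<bar> \<le> c * \<bar>N x\<bar>"
  shows "norm (mulL M U) \<le> c * norm (mulL N U)"
  unfolding mulL_def
  by (rule norm_abs_L2_le[OF bmult_sqint[OF M] bmult_sqint[OF N] c])
     (use le in \<open>auto simp: mult.assoc[symmetric] intro: mult_right_mono\<close>)

lemma mulL_inject:
  assumes M: "bmult B M" and nz: "\<And>x. M x \<noteq> 0" and eq: "mulL M U = mulL M V"
  shows "U = V"
proof -
  have "AE x in lborel. M x *\<^sub>R rep_L2 U x = M x *\<^sub>R rep_L2 V x"
    using eq by (simp add: mulL_def abs_L2_eq_iff bmult_sqint[OF M])
  then have "AE x in lborel. rep_L2 U x = rep_L2 V x"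
    by eventually_elim (use nz in simp)
  then show ?thesis using abs_L2_eq_iff[of "rep_L2 U" "rep_L2 V"] by simp
qed

lemma bmult_cmult: "bmult B M \<Longrightarrow> bmult (\<bar>c\<bar> * B) (\<lambda>x. c * M x)"
  unfolding bmult_def by (auto simp: abs_mult intro!: mult_left_mono)

lemma bmult_add: "bmult B M \<Longrightarrow> bmult C N \<Longrightarrow> bmult (B + C) (\<lambda>x. M x + N x)"
  unfolding bmult_def by (auto intro!: order_trans[OF abs_triangle_ineq] add_mono)

lemma bmult_uminus: "bmult B M \<Longrightarrow> bmult B (\<lambda>x. - M x)"
  unfolding bmult_def by auto

lemma bmult_const: "\<bar>c\<bar> \<le> B \<Longrightarrow> bmult B (\<lambda>_. c)"
  by (auto simp: bmult_def)

text \<open>Pointwise convergence of the symbols gives strong, not uniform, convergence of the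
  operators: for a fixed class dominated convergence applies, and the common bound B takes care of
  the moving argument.\<close>

lemma mulL_tendsto:
  fixes M :: "nat \<Rightarrow> 'a::euclidean_space \<Rightarrow> real"
  assumes M: "\<And>i. bmult B (M i)" and N: "N \<in> borel_measurable borel" and lim: "\<And>x. (\<lambda>i. M i x) \<longlonglongrightarrow> N x"
    and X: "X \<longlonglongrightarrow> U"
  shows "(\<lambda>i. mulL (M i) (X i)) \<longlonglongrightarrow> mulL N U"
proof -
  have "(\<lambda>i. mulL (M i) U) \<longlonglongrightarrow> mulL N U"
    unfolding mulL_def
  proof (rule tendsto_abs_L2_dominated(2)[OF sqint_scaleR[OF rep_L2_sqint, of B]])
    show "(\<lambda>x. N x *\<^sub>R rep_L2 U x) \<in> borel_measurable borel" using N by measurable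
    show "(\<lambda>x. M i x *\<^sub>R rep_L2 U x) \<in> borel_measurable borel" for i using bmultD(1)[OF M] by measurable
    show "norm (M i x *\<^sub>R rep_L2 U x) \<le> norm (B *\<^sub>R rep_L2 U x)" for i x
      using bmultD(2,3)[OF M] by (auto intro: mult_right_mono)
    show "AE x in lborel. (\<lambda>i. M i x *\<^sub>R rep_L2 U x) \<longlonglongrightarrow> N x *\<^sub>R rep_L2 U x"
      by (intro AE_I2 tendsto_intros lim)
  qed
  moreover have "(\<lambda>i. mulL (M i) (X i - U)) \<longlonglongrightarrow> 0"
  proof (rule Lim_null_comparison)
    show "\<forall>\<^sub>F i in sequentially. norm (mulL (M i) (X i - U)) \<le> B * norm (X i - U)"
      by (simp add: norm_mulL_le[OF M])
    have "(\<lambda>i. B * norm (X i - U)) \<longlonglongrightarrow> B * norm (U - U)" by (intro tendsto_intros X)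
    then show "(\<lambda>i. B * norm (X i - U)) \<longlonglongrightarrow> 0" by simp
  qed
  ultimately have "(\<lambda>i. mulL (M i) U + mulL (M i) (X i - U)) \<longlonglongrightarrow> mulL N U + 0"
    by (rule tendsto_add)
  then show ?thesis by (simp flip: mulL_add[OF M])
qed

lemma continuous_on_mulL:
  fixes S :: "'t::metric_space \<Rightarrow> 'a::euclidean_space \<Rightarrow> real"
  assumes S: "\<And>t. t \<in> T \<Longrightarrow> bmult B (S t)" and c: "\<And>x. continuous_on T (\<lambda>t. S t x)"
    and g: "continuous_on T g"
  shows "continuous_on T (\<lambda>t. mulL (S t) (g t))"
  unfolding continuous_on_sequentially o_def
proof safe
  fix X t assume t: "t \<in> T" and X: "\<forall>n. X n \<in> T" "X \<longlonglongrightarrow> t"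
  show "(\<lambda>n. mulL (S (X n)) (g (X n))) \<longlonglongrightarrow> mulL (S t) (g t)"
  proof (rule mulL_tendsto[where B = B])
    show "bmult B (S (X i))" for i using S X by auto
    show "S t \<in> borel_measurable borel" using bmultD(1)[OF S[OF t]] .
    show "(\<lambda>i. S (X i) x) \<longlonglongrightarrow> S t x" for x
      using c[of x] t X by (auto simp: continuous_on_sequentially o_def)
    show "(\<lambda>i. g (X i)) \<longlonglongrightarrow> g t"
      using g t X by (auto simp: continuous_on_sequentially o_def)
  qed
qed

lemma has_vector_derivative_iff_quotient:
  fixes f :: "real \<Rightarrow> 'b::real_normed_vector"
  shows "(f has_vector_derivative D) (at t within T) \<longleftrightarrow>
    ((\<lambda>s. (f s - f t) /\<^sub>R (s - t)) \<longlongrightarrow> D) (at t within T)"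
proof -
  have eq: "norm (f s - f t - (s - t) *\<^sub>R D) / norm (s - t) = norm ((f s - f t) /\<^sub>R (s - t) - D)" if "s \<noteq> t" for s
  proof -
    have "(f s - f t) /\<^sub>R (s - t) - D = (f s - f t - (s - t) *\<^sub>R D) /\<^sub>R (s - t)"
      using that by (simp add: scaleR_diff_right)
    then show ?thesis by (simp add: divide_inverse mult.commute)
  qed
  have "(f has_vector_derivative D) (at t within T) \<longleftrightarrow>
    ((\<lambda>s. norm (f s - f t - (s - t) *\<^sub>R D) / norm (s - t)) \<longlongrightarrow> 0) (at t within T)"
    by (simp add: has_vector_derivative_def has_derivative_iff_norm bounded_linear_scaleR_left)
  also have "\<dots> \<longleftrightarrow> ((\<lambda>s. norm ((f s - f t) /\<^sub>R (s - t) - D)) \<longlongrightarrow> 0) (at t within T)"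
    by (rule filterlim_cong[OF refl refl]) (use eq in \<open>auto simp: eventually_at_filter intro!: always_eventually\<close>)
  also have "\<dots> \<longleftrightarrow> ((\<lambda>s. (f s - f t) /\<^sub>R (s - t)) \<longlongrightarrow> D) (at t within T)"
    by (simp add: tendsto_norm_zero_iff LIM_zero_iff)
  finally show ?thesis .
qed

text \<open>As the derivative symbols are bounded by C, the mean value theorem bounds every
  difference quotient by C, and \<open>mulL_tendsto\<close> applies. The bound of the symbols
  themselves may vary with time.\<close>

lemma mulL_has_vector_derivative:
  fixes S :: "real \<Rightarrow> 'a::euclidean_space \<Rightarrow> real"
  assumes T: "convex T" and t: "t \<in> T"
    and S: "\<And>s. s \<in> T \<Longrightarrow> bmult (B s) (S s)" and S': "\<And>s. s \<in> T \<Longrightarrow> bmult C (S' s)"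
    and d: "\<And>s x. s \<in> T \<Longrightarrow> ((\<lambda>s. S s x) has_real_derivative S' s x) (at s within T)"
  shows "((\<lambda>s. mulL (S s) U) has_vector_derivative mulL (S' t) U) (at t within T)"
  unfolding has_vector_derivative_iff_quotient tendsto_at_iff_sequentially o_def
proof (intro allI impI)
  fix X :: "nat \<Rightarrow> real" assume X: "\<forall>i. X i \<in> T - {t}" "X \<longlonglongrightarrow> t"
  define Q where "Q i x = (S (X i) x - S t x) / (X i - t)" for i x
  have Q: "bmult C (Q i)" for i
    unfolding bmult_def
  proof safe
    have [measurable]: "S (X i) \<in> borel_measurable borel" "S t \<in> borel_measurable borel"
      using X t by (auto intro: bmultD(1)[OF S])
    show "Q i \<in> borel_measurable borel" unfolding Q_def by measurable
    fix x
    have "\<bar>S (X i) x - S t x\<bar> \<le> C * \<bar>X i - t\<bar>"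
      using field_differentiable_bound[OF T d, of x C "X i" t] X t bmultD(2)[OF S'] by auto
    then show "\<bar>Q i x\<bar> \<le> C"
      using X by (auto simp: Q_def field_simps)
  qed
  have "(\<lambda>i. mulL (Q i) U) \<longlonglongrightarrow> mulL (S' t) U"
  proof (rule mulL_tendsto[OF Q _ _ tendsto_const])
    show "S' t \<in> borel_measurable borel" by (rule bmultD(1)[OF S'[OF t]])
    fix x
    have "((\<lambda>s. (S s x - S t x) / (s - t)) \<longlongrightarrow> S' t x) (at t within T)"
      using d[OF t, of x] by (simp add: has_field_derivative_iff)
    then show "(\<lambda>i. Q i x) \<longlonglongrightarrow> S' t x"
      using X by (auto simp: tendsto_at_iff_sequentially o_def Q_def)
  qed
  moreover have "mulL (Q i) U = (mulL (S (X i)) U - mulL (S t) U) /\<^sub>R (X i - t)" for i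
  proof -
    have b: "bmult (B (X i)) (S (X i))" "bmult (B t) (S t)" using X t S by auto
    have "(X i - t) *\<^sub>R mulL (Q i) U = mulL (\<lambda>x. (X i - t) * Q i x) U"
      using mulL_mulL[OF bmult_const[OF order_refl] Q, of "X i - t"] by (simp add: mulL_const)
    also have "(\<lambda>x. (X i - t) * Q i x) = (\<lambda>x. S (X i) x - S t x)"
      using X by (auto simp: Q_def)
    finally show ?thesis using X by (auto simp: mulL_minus[OF b] eq_vector_fraction_iff field_simps)
  qed
  ultimately show "(\<lambda>i. (mulL (S (X i)) U - mulL (S t) U) /\<^sub>R (X i - t)) \<longlonglongrightarrow> mulL (S' t) U"
    by simp
qed

section \<open>Lebesgue space inequalities\<close>

lemma Lp_borel_iff:
  assumes [measurable]: "f \<in> borel_measurable borel"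
  shows "f \<in> Lp q \<longleftrightarrow> integrable lborel (\<lambda>x. norm (f x) powr q)"
proof -
  have "f \<in> borel_measurable lebesgue" by (intro measurable_completion) simp
  then show ?thesis by (simp add: Lp_def integrable_completion)
qed

lemma Lp_norm_borel:
  assumes [measurable]: "f \<in> borel_measurable borel"
  shows "Lp_norm q f = (LINT x|lborel. norm (f x) powr q) powr (1 / q)"
  by (simp add: Lp_norm_def integral_completion)

lemma Lp_norm_nonneg [simp]: "0 \<le> Lp_norm q f"
  by (simp add: Lp_norm_def)

lemma Lp_borelI_nn:
  fixes f :: "'a::euclidean_space \<Rightarrow> complex"
  assumes f[measurable]: "f \<in> borel_measurable borel" and q: "q > 0" and C: "0 \<le> C"
    and le: "(\<integral>\<^sup>+x. ennreal (norm (f x) powr q) \<partial>lborel) \<le> ennreal (C powr q)"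
  shows "f \<in> Lp q" "Lp_norm q f \<le> C"
proof -
  have i: "integrable lborel (\<lambda>x. norm (f x) powr q)"
    using le by (intro integrableI_bounded) (auto intro: le_less_trans)
  then show "f \<in> Lp q" by (simp add: Lp_borel_iff)
  have "ennreal (LINT x|lborel. norm (f x) powr q) \<le> ennreal (C powr q)"
    using le nn_integral_eq_integral[OF i] by simp
  then have "(LINT x|lborel. norm (f x) powr q) \<le> C powr q" by simp
  then have "Lp_norm q f \<le> (C powr q) powr (1 / q)"
    unfolding Lp_norm_borel[OF f] using q by (intro powr_mono2) auto
  then show "Lp_norm q f \<le> C" using q C by (simp add: powr_powr)
qed

lemma Lp_norm_powr_nn:
  fixes f :: "'a::euclidean_space \<Rightarrow> complex"
  assumes [measurable]: "f \<in> borel_measurable borel" and f: "f \<in> Lp q" and q: "q > 0"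
  shows "(\<integral>\<^sup>+x. ennreal (norm (f x) powr q) \<partial>lborel) = ennreal (Lp_norm q f powr q)"
proof -
  have i: "integrable lborel (\<lambda>x. norm (f x) powr q)" using f by (simp add: Lp_borel_iff)
  show ?thesis
    unfolding nn_integral_eq_integral[OF i, simplified] using q
    by (simp add: Lp_norm_borel powr_powr)
qed

lemma sqint_iff_Lp2: "f \<in> borel_measurable borel \<Longrightarrow> f \<in> sqint \<longleftrightarrow> f \<in> Lp 2"
  by (simp add: Lp_borel_iff sqint_def)

lemma norm_abs_L2_eq: "f \<in> sqint \<Longrightarrow> norm (abs_L2 f) = Lp_norm 2 f"
  using norm_abs_L2_sq[of f]
  by (simp add: Lp_norm_borel sqint_measurable powr_half_sqrt real_sqrt_unique)

text \<open>A and B are any upper bounds for the two norms, so finiteness of the integral on the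
  left is a conclusion. Young's inequality is applied to f / A and g / B; if A or B is 0, the
  product vanishes almost everywhere.\<close>

lemma Holder_nn_integral:
  fixes f g :: "'a \<Rightarrow> real"
  assumes [measurable]: "f \<in> borel_measurable M" "g \<in> borel_measurable M"
    and f0: "\<And>x. 0 \<le> f x" and g0: "\<And>x. 0 \<le> g x"
    and pq: "p > 1" "q > 1" "1 / p + 1 / q = 1"
    and A: "0 \<le> A" "(\<integral>\<^sup>+x. ennreal (f x powr p) \<partial>M) \<le> ennreal (A powr p)"
    and B: "0 \<le> B" "(\<integral>\<^sup>+x. ennreal (g x powr q) \<partial>M) \<le> ennreal (B powr q)"
  shows "(\<integral>\<^sup>+x. ennreal (f x * g x) \<partial>M) \<le> ennreal (A * B)"
proof (cases "A = 0 \<or> B = 0")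
  case True
  have "AE x in M. f x * g x = 0"
  proof (cases "A = 0")
    case True
    then have "(\<integral>\<^sup>+x. ennreal (f x powr p) \<partial>M) = 0" using A pq by simp
    then have "AE x in M. ennreal (f x powr p) = 0" by (subst (asm) nn_integral_0_iff_AE) auto
    then show ?thesis by eventually_elim (use pq in simp)
  next
    case False
    then have "(\<integral>\<^sup>+x. ennreal (g x powr q) \<partial>M) = 0" using B pq True by simp
    then have "AE x in M. ennreal (g x powr q) = 0" by (subst (asm) nn_integral_0_iff_AE) auto
    then show ?thesis by eventually_elim (use pq in simp)
  qed
  then have "(\<integral>\<^sup>+x. ennreal (f x * g x) \<partial>M) = (\<integral>\<^sup>+x. 0 \<partial>M)"
    by (intro nn_integral_cong_AE) (auto elim!: eventually_mono)
  then show ?thesis by simp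
next
  case False
  with A B have A0: "A > 0" and B0: "B > 0" by auto
  have Y: "f x * g x \<le> (A * B / (p * A powr p)) * f x powr p + (A * B / (q * B powr q)) * g x powr q" for x
  proof -
    have "(f x / A) * (g x / B) \<le> (f x / A) powr p / p + (g x / B) powr q / q"
      using A0 B0 f0 g0 pq by (intro Youngs_inequality) auto
    then have "A * B * ((f x / A) * (g x / B)) \<le> A * B * ((f x / A) powr p / p + (g x / B) powr q / q)"
      using A0 B0 by (intro mult_left_mono) auto
    then show ?thesis
      using A0 B0 f0 g0 by (simp add: powr_divide field_simps)
  qed
  have "(\<integral>\<^sup>+x. ennreal (f x * g x) \<partial>M)
      \<le> (\<integral>\<^sup>+x. ennreal (A * B / (p * A powr p)) * ennreal (f x powr p) + ennreal (A * B / (q * B powr q)) * ennreal (g x powr q) \<partial>M)"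
    using Y A0 B0 pq
    by (intro nn_integral_mono) (auto simp: ennreal_leI simp flip: ennreal_mult' ennreal_plus)
  also have "\<dots> = ennreal (A * B / (p * A powr p)) * (\<integral>\<^sup>+x. ennreal (f x powr p) \<partial>M)
      + ennreal (A * B / (q * B powr q)) * (\<integral>\<^sup>+x. ennreal (g x powr q) \<partial>M)"
    by (simp add: nn_integral_add nn_integral_cmult)
  also have "\<dots> \<le> ennreal (A * B / (p * A powr p)) * ennreal (A powr p)
      + ennreal (A * B / (q * B powr q)) * ennreal (B powr q)"
    by (intro add_mono mult_left_mono A B) auto
  also have "\<dots> = ennreal (A * B / p + A * B / q)"
    using A0 B0 pq by (simp flip: ennreal_mult' ennreal_plus)
  also have "A * B / p + A * B / q = A * B * (1 / p + 1 / q)" by (simp add: field_simps)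
  also have "\<dots> = A * B" by (simp add: pq)
  finally show ?thesis .
qed

lemma powr_diff_le:
  fixes a b p :: real
  assumes "p > 1" "a \<ge> 0" "b \<ge> 0"
  shows "\<bar>a powr p - b powr p\<bar> \<le> p * \<bar>a - b\<bar> * (a + b) powr (p - 1)"
proof -
  have main: "a powr p - b powr p \<le> p * (a - b) * (a + b) powr (p - 1)" if ab: "b < a" "0 \<le> b" for a b :: real
  proof -
    have "continuous_on {b..a} (\<lambda>x. x powr p)"
      using ab assms by (intro continuous_on_powr' continuous_intros) auto
    moreover have "((\<lambda>x. x powr p) has_derivative (\<lambda>h. p * x powr (p - 1) * h)) (at x)" if "b < x" "x < a" for x
      using that ab unfolding has_field_derivative_def[symmetric]
      by (auto intro!: derivative_eq_intros)
    ultimately obtain z where z: "b < z" "z < a" "a powr p - b powr p = (a - b) * (p * z powr (p - 1))"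
      using mvt[OF ab(1), of "\<lambda>x. x powr p" "\<lambda>x h. p * x powr (p - 1) * h"] by (auto simp: mult_ac)
    have "z powr (p - 1) \<le> (a + b) powr (p - 1)" using z ab assms by (intro powr_mono2) auto
    then have "(a - b) * (p * z powr (p - 1)) \<le> (a - b) * (p * (a + b) powr (p - 1))"
      using ab assms by (intro mult_left_mono) auto
    then show ?thesis using z by (simp add: mult_ac)
  qed
  consider "a = b" | "a < b" | "b < a" by linarith
  then show ?thesis
  proof cases
    case 2
    have "a powr p \<le> b powr p" using 2 assms by (intro powr_mono2) auto
    with main[OF 2] assms 2 show ?thesis by (simp add: add.commute)
  next
    case 3
    have "b powr p \<le> a powr p" using 3 assms by (intro powr_mono2) auto
    with main[OF 3] assms 3 show ?thesis by simp
  qed simp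
qed

lemma add_powr_le:
  fixes a b q :: real
  assumes "q > 0" "a \<ge> 0" "b \<ge> 0"
  shows "(a + b) powr q \<le> 2 powr q * (a powr q + b powr q)"
proof -
  have "(a + b) powr q \<le> (2 * max a b) powr q" using assms by (intro powr_mono2) auto
  also have "\<dots> = 2 powr q * max a b powr q" using assms by (simp add: powr_mult)
  also have "max a b powr q \<le> a powr q + b powr q" by (auto simp: max_def)
  finally show ?thesis by simp
qed

lemma powr_add_le_add_powr:
  fixes a b q :: real
  assumes "q \<ge> 1" "a \<ge> 0" "b \<ge> 0"
  shows "a powr q + b powr q \<le> (a + b) powr q"
proof (cases "a + b = 0")
  case False
  then have s: "a + b > 0" using assms by auto
  have "(a / (a + b)) powr q \<le> a / (a + b)" "(b / (a + b)) powr q \<le> b / (a + b)"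
    using s assms powr_mono'[of 1 q "a / (a + b)"] powr_mono'[of 1 q "b / (a + b)"] by auto
  then have "(a / (a + b)) powr q + (b / (a + b)) powr q \<le> a / (a + b) + b / (a + b)" by linarith
  also have "\<dots> = 1" using s by (simp flip: add_divide_distrib)
  finally show ?thesis using s assms by (simp add: powr_divide flip: add_divide_distrib)
next
  case True
  then have "a = 0" "b = 0" using assms by auto
  then show ?thesis by simp
qed

text \<open>By the mean value theorem the difference of the powers is at most p |u - v| (|u| +
  |v|)^(p-1). Hoelder's inequality with exponents p and p/(p-1), applied to the k-th powers,
  measures every factor in L^(pk).\<close>

lemma Lp_diff_abs_powr:
  fixes u v :: "'a::euclidean_space \<Rightarrow> complex"
  assumes [measurable]: "u \<in> borel_measurable borel" "v \<in> borel_measurable borel"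
    and p: "p > 1" and k: "k \<ge> 1"
    and D: "D \<ge> 0" "(\<lambda>x. u x - v x) \<in> Lp (p * k)" "Lp_norm (p * k) (\<lambda>x. u x - v x) \<le> D"
    and E: "E \<ge> 0" "u \<in> Lp (p * k)" "Lp_norm (p * k) u \<le> E"
    and F: "F \<ge> 0" "v \<in> Lp (p * k)" "Lp_norm (p * k) v \<le> F"
  shows "(\<lambda>x. abs_powr p u x - abs_powr p v x) \<in> Lp k"
    "Lp_norm k (\<lambda>x. abs_powr p u x - abs_powr p v x) \<le> p * D * (2 * (E + F)) powr (p - 1)"
proof -
  let ?h = "\<lambda>x. abs_powr p u x - abs_powr p v x"
  have pk: "p * k > 0" "p * k \<ge> 1" using p k by (auto intro!: mult_ge1_I)
  have [measurable]: "?h \<in> borel_measurable borel" unfolding abs_powr_def by measurable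
  define S where "S x = norm (u x) + norm (v x)" for x
  have [measurable]: "S \<in> borel_measurable borel" unfolding S_def by measurable
  have le: "norm (?h x) powr k \<le> p powr k * (norm (u x - v x) powr k * (S x powr ((p - 1) * k)))" for x
  proof -
    have "norm (?h x) = \<bar>norm (u x) powr p - norm (v x) powr p\<bar>"
      by (simp add: abs_powr_def flip: of_real_diff)
    also have "\<dots> \<le> p * \<bar>norm (u x) - norm (v x)\<bar> * S x powr (p - 1)"
      unfolding S_def using p by (intro powr_diff_le) auto
    also have "\<dots> \<le> p * norm (u x - v x) * S x powr (p - 1)"
      using p norm_triangle_ineq3[of "u x" "v x"] by (intro mult_right_mono mult_left_mono) auto
    finally have "norm (?h x) powr k \<le> (p * norm (u x - v x) * S x powr (p - 1)) powr k"
      using k by (intro powr_mono2) auto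
    also have "\<dots> = p powr k * (norm (u x - v x) powr k * (S x powr ((p - 1) * k)))"
      using p by (simp add: powr_mult powr_powr mult.assoc)
    finally show ?thesis .
  qed
  define q where "q = p / (p - 1)"
  have q: "q > 1" "1 / p + 1 / q = 1" using p by (auto simp: q_def field_simps)
  \<comment> \<open>The inequalities (a + b)^q <= 2^q (a^q + b^q) for the functions and a^q + b^q <=
    (a + b)^q for the bounds, with q = p k >= 1, stand in for Minkowski's. The price is the factor
    2.\<close>
  have SF: "(\<integral>\<^sup>+x. ennreal (S x powr (p * k)) \<partial>lborel) \<le> ennreal ((2 * (E + F)) powr (p * k))"
  proof -
    have "(\<integral>\<^sup>+x. ennreal (S x powr (p * k)) \<partial>lborel)
      \<le> (\<integral>\<^sup>+x. ennreal (2 powr (p * k)) * (ennreal (norm (u x) powr (p * k)) + ennreal (norm (v x) powr (p * k))) \<partial>lborel)"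
      using add_powr_le[OF pk(1), of "norm (u _)" "norm (v _)"]
      by (intro nn_integral_mono) (auto simp: S_def ennreal_leI simp flip: ennreal_mult' ennreal_plus)
    also have "\<dots> = ennreal (2 powr (p * k)) * (ennreal (Lp_norm (p * k) u powr (p * k)) + ennreal (Lp_norm (p * k) v powr (p * k)))"
      using pk E F by (simp add: nn_integral_cmult nn_integral_add Lp_norm_powr_nn)
    also have "\<dots> \<le> ennreal (2 powr (p * k)) * (ennreal (E powr (p * k)) + ennreal (F powr (p * k)))"
      using pk E F by (intro mult_left_mono add_mono ennreal_leI powr_mono2) auto
    also have "\<dots> = ennreal (2 powr (p * k) * (E powr (p * k) + F powr (p * k)))"
      by (simp flip: ennreal_mult' ennreal_plus)
    also have "\<dots> \<le> ennreal (2 powr (p * k) * (E + F) powr (p * k))"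
      using pk E F by (intro ennreal_leI mult_left_mono powr_add_le_add_powr) auto
    finally show ?thesis using E F by (simp add: powr_mult[of 2 "E + F", symmetric] del: distrib_left_numeral)
  qed
  have "(\<integral>\<^sup>+x. ennreal (norm (?h x) powr k) \<partial>lborel)
      \<le> (\<integral>\<^sup>+x. ennreal (p powr k) * ennreal (norm (u x - v x) powr k * (S x powr ((p - 1) * k))) \<partial>lborel)"
    using le by (intro nn_integral_mono) (auto simp: ennreal_leI simp flip: ennreal_mult')
  also have "\<dots> = ennreal (p powr k) * (\<integral>\<^sup>+x. ennreal (norm (u x - v x) powr k * (S x powr ((p - 1) * k))) \<partial>lborel)"
    by (rule nn_integral_cmult) measurable
  also have "(\<integral>\<^sup>+x. ennreal (norm (u x - v x) powr k * (S x powr ((p - 1) * k))) \<partial>lborel)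
      \<le> ennreal (D powr k * (2 * (E + F)) powr ((p - 1) * k))"
  proof (rule Holder_nn_integral[OF _ _ _ _ p q])
    have "(\<integral>\<^sup>+x. ennreal ((norm (u x - v x) powr k) powr p) \<partial>lborel) = ennreal (Lp_norm (p * k) (\<lambda>x. u x - v x) powr (p * k))"
      using Lp_norm_powr_nn[OF _ D(2) pk(1)] by (simp add: powr_powr mult.commute)
    also have "\<dots> \<le> ennreal ((D powr k) powr p)"
      using D pk by (auto intro!: ennreal_leI powr_mono2 simp: powr_powr mult.commute[of k])
    finally show "(\<integral>\<^sup>+x. ennreal ((norm (u x - v x) powr k) powr p) \<partial>lborel) \<le> ennreal ((D powr k) powr p)" .
    have eq: "(p - 1) * k * q = p * k" using p by (simp add: q_def)
    show "(\<integral>\<^sup>+x. ennreal ((S x powr ((p - 1) * k)) powr q) \<partial>lborel) \<le> ennreal (((2 * (E + F)) powr ((p - 1) * k)) powr q)"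
      using SF by (simp add: powr_powr eq)
  qed auto
  also have "ennreal (p powr k) * ennreal (D powr k * (2 * (E + F)) powr ((p - 1) * k))
      = ennreal ((p * D * (2 * (E + F)) powr (p - 1)) powr k)"
    using p D E F by (simp add: powr_mult powr_powr mult.assoc flip: ennreal_mult')
  finally have "(\<integral>\<^sup>+x. ennreal (norm (?h x) powr k) \<partial>lborel) \<le> ennreal ((p * D * (2 * (E + F)) powr (p - 1)) powr k)"
    by (simp add: mult_left_mono)
  moreover have "0 \<le> p * D * (2 * (E + F)) powr (p - 1)" using p D by simp
  ultimately show "?h \<in> Lp k" "Lp_norm k ?h \<le> p * D * (2 * (E + F)) powr (p - 1)"
    using Lp_borelI_nn[of ?h k "p * D * (2 * (E + F)) powr (p - 1)"] k by auto
qed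

section \<open>Sobolev embedding\<close>

lemma nn_integral_powr_from_0:
  assumes a: "a > 0" and y: "y \<ge> 0"
  shows "(\<integral>\<^sup>+l. indicator {0..y} l * ennreal (a * l powr (a - 1)) \<partial>lborel) = ennreal (y powr a)"
proof -
  have "((\<lambda>l. a * l powr (a - 1)) has_integral a * (y powr (a - 1 + 1) / (a - 1 + 1))) {0..y}"
    by (rule has_integral_mult_right[OF has_integral_powr_from_0]) (use a y in auto)
  then have "((\<lambda>l. a * l powr (a - 1)) has_integral y powr a) {0..y}" using a by simp
  from nn_integral_has_integral_lebesgue'[OF _ this] show ?thesis using a by (simp add: mult.commute)
qed

lemma nn_integral_layer_cake:
  fixes f :: "'a::euclidean_space \<Rightarrow> real"
  assumes [measurable]: "f \<in> borel_measurable borel" and f: "\<And>x. 0 \<le> f x" and q: "q > 0"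
  shows "(\<integral>\<^sup>+x. ennreal (f x powr q) \<partial>lborel)
    = (\<integral>\<^sup>+l. indicator {0..} l * ennreal (q * l powr (q - 1)) * emeasure lborel {x. l \<le> f x} \<partial>lborel)"
proof -
  have "(\<integral>\<^sup>+x. ennreal (f x powr q) \<partial>lborel)
      = (\<integral>\<^sup>+x. (\<integral>\<^sup>+l. indicator {0..} l * ennreal (q * l powr (q - 1)) * indicator {x. l \<le> f x} x \<partial>lborel) \<partial>lborel)"
    unfolding nn_integral_powr_from_0[OF q f, symmetric]
    by (intro nn_integral_cong) (auto split: split_indicator)
  also have "\<dots> = (\<integral>\<^sup>+l. (\<integral>\<^sup>+x. indicator {0..} l * ennreal (q * l powr (q - 1)) * indicator {x. l \<le> f x} x \<partial>lborel) \<partial>lborel)"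
    by (rule lborel_pair.Fubini') measurable
  also have "\<dots> = (\<integral>\<^sup>+l. indicator {0..} l * ennreal (q * l powr (q - 1)) * emeasure lborel {x. l \<le> f x} \<partial>lborel)"
    by (intro nn_integral_cong nn_integral_cmult_indicator) measurable
  finally show ?thesis .
qed

text \<open>In place of polar coordinates, |\<xi>|^(-2s) is written as A^(-2s) plus the integral of
  2 s l^(-2s-1) over l from |\<xi>| to A. Fubini turns the second part into an integral over volumes
  of balls, which converges at 0 because 2 s < n.\<close>

lemma nn_integral_cball_powr:
  assumes s: "s > 0" "2 * s < real DIM('a::euclidean_space)"
  obtains K where "K > 0" "\<And>A. A > 0 \<Longrightarrow>
    (\<integral>\<^sup>+\<xi>. indicator (cball 0 A) (\<xi>::'a) * ennreal (norm \<xi> powr (- 2 * s)) \<partial>lborel) \<le> ennreal (K * A powr (real DIM('a) - 2 * s))"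
proof
  let ?n = "real DIM('a)"
  define V where "V = unit_ball_vol ?n"
  have V: "V > 0" by (simp add: V_def)
  \<comment> \<open>The first summand comes from A^(-2s) times the volume of the ball, the second
    from the integral over radii.\<close>
  define K where "K = V + 2 * s * V / (?n - 2 * s)"
  show "K > 0" unfolding K_def using V s by (intro add_pos_nonneg) auto
  fix A :: real assume A: "A > 0"
  have [measurable]: "cball (0::'a) A \<in> sets borel" by simp
  have ball: "emeasure lborel (cball (0::'a) r) = ennreal (V * r powr ?n)" if "r \<ge> 0" for r
    using that by (cases "r = 0") (simp_all add: emeasure_cball V_def powr_realpow)
  have pt: "ennreal (x powr (- 2 * s)) \<le> ennreal (A powr (- 2 * s))
      + (\<integral>\<^sup>+l. indicator {x..A} l * ennreal (2 * s * l powr (- 2 * s - 1)) \<partial>lborel)" if x: "0 \<le> x" "x \<le> A" for x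
  proof (cases "x = 0")
    case False
    have "((\<lambda>l. 2 * s * l powr (- 2 * s - 1)) has_integral (- (A powr (- 2 * s)) - (- (x powr (- 2 * s))))) {x..A}"
    proof (rule fundamental_theorem_of_calculus)
      fix l assume "l \<in> {x..A}"
      then show "((\<lambda>l. - (l powr (- 2 * s))) has_vector_derivative 2 * s * l powr (- 2 * s - 1)) (at l within {x..A})"
        using False x unfolding has_real_derivative_iff_has_vector_derivative[symmetric]
        by (auto intro!: derivative_eq_intros)
    qed (use x in auto)
    from nn_integral_has_integral_lebesgue'[OF _ this]
    have eq: "(\<integral>\<^sup>+l. indicator {x..A} l * ennreal (2 * s * l powr (- 2 * s - 1)) \<partial>lborel)
        = ennreal (x powr (- 2 * s) - A powr (- 2 * s))"
      using s by (simp add: mult.commute)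
    have "A powr (- 2 * s) \<le> x powr (- 2 * s)" using False x s by (intro powr_mono2') auto
    then show ?thesis unfolding eq by (simp flip: ennreal_plus)
  qed simp
  have "(\<integral>\<^sup>+\<xi>. indicator (cball 0 A) (\<xi>::'a) * ennreal (norm \<xi> powr (- 2 * s)) \<partial>lborel)
    \<le> (\<integral>\<^sup>+\<xi>. ennreal (A powr (- 2 * s)) * indicator (cball 0 A) (\<xi>::'a)
        + (\<integral>\<^sup>+l. indicator {norm \<xi>..A} l * ennreal (2 * s * l powr (- 2 * s - 1)) \<partial>lborel) \<partial>lborel)"
    using pt[of "norm _"] by (intro nn_integral_mono) (auto split: split_indicator)
  also have "\<dots> = ennreal (A powr (- 2 * s)) * emeasure lborel (cball (0::'a) A)
        + (\<integral>\<^sup>+\<xi>. (\<integral>\<^sup>+l. indicator {norm (\<xi>::'a)..A} l * ennreal (2 * s * l powr (- 2 * s - 1)) \<partial>lborel) \<partial>lborel)"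
  proof (subst nn_integral_add)
    show "(\<lambda>\<xi>::'a. \<integral>\<^sup>+l. indicator {norm \<xi>..A} l * ennreal (2 * s * l powr (- 2 * s - 1)) \<partial>lborel) \<in> borel_measurable lborel"
      unfolding atLeastAtMost_def atLeast_def atMost_def Int_def by measurable
  qed (auto simp: nn_integral_cmult_indicator)
  also have "(\<integral>\<^sup>+\<xi>. (\<integral>\<^sup>+l. indicator {norm (\<xi>::'a)..A} l * ennreal (2 * s * l powr (- 2 * s - 1)) \<partial>lborel) \<partial>lborel)
     = (\<integral>\<^sup>+\<xi>. (\<integral>\<^sup>+l. indicator {0..A} l * ennreal (2 * s * l powr (- 2 * s - 1)) * indicator {\<xi>. norm \<xi> \<le> l} (\<xi>::'a) \<partial>lborel) \<partial>lborel)"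
    by (intro nn_integral_cong) (auto split: split_indicator intro: order_trans[OF norm_ge_zero])
  also have "\<dots> = (\<integral>\<^sup>+l. (\<integral>\<^sup>+\<xi>. indicator {0..A} l * ennreal (2 * s * l powr (- 2 * s - 1)) * indicator {\<xi>. norm \<xi> \<le> l} (\<xi>::'a) \<partial>lborel) \<partial>lborel)"
    by (rule lborel_pair.Fubini') measurable
  also have "\<dots> = (\<integral>\<^sup>+l. indicator {0..A} l * ennreal (2 * s * l powr (- 2 * s - 1)) * emeasure lborel (cball (0::'a) l) \<partial>lborel)"
  proof (intro nn_integral_cong)
    fix l :: real
    have "{\<xi>::'a. norm \<xi> \<le> l} = cball 0 l" by auto
    then show "(\<integral>\<^sup>+\<xi>. indicator {0..A} l * ennreal (2 * s * l powr (- 2 * s - 1)) * indicator {\<xi>. norm \<xi> \<le> l} (\<xi>::'a) \<partial>lborel)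
      = indicator {0..A} l * ennreal (2 * s * l powr (- 2 * s - 1)) * emeasure lborel (cball (0::'a) l)"
      by (simp add: nn_integral_cmult_indicator)
  qed
  also have "\<dots> = (\<integral>\<^sup>+l. ennreal (2 * s * V / (?n - 2 * s)) * (indicator {0..A} l * ennreal ((?n - 2 * s) * l powr (?n - 2 * s - 1))) \<partial>lborel)"
  proof (intro nn_integral_cong)
    fix l :: real
    have "l powr (- 2 * s - 1) * l powr ?n = l powr (?n - 2 * s - 1)"
      by (simp flip: powr_add) (simp add: algebra_simps)
    then show "indicator {0..A} l * ennreal (2 * s * l powr (- 2 * s - 1)) * emeasure lborel (cball (0::'a) l)
      = ennreal (2 * s * V / (?n - 2 * s)) * (indicator {0..A} l * ennreal ((?n - 2 * s) * l powr (?n - 2 * s - 1)))"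
      using s V by (auto simp: ball mult_ac simp flip: ennreal_mult'' ennreal_mult' split: split_indicator)
  qed
  also have "\<dots> = ennreal (2 * s * V / (?n - 2 * s)) * ennreal (A powr (?n - 2 * s))"
    using s A nn_integral_powr_from_0[of "?n - 2 * s" A] by (subst nn_integral_cmult) auto
  also have "ennreal (A powr (- 2 * s)) * emeasure lborel (cball (0::'a) A) = ennreal (V * A powr (?n - 2 * s))"
    using A V by (simp add: ball powr_diff powr_minus field_simps flip: ennreal_mult')
  also have "ennreal (V * A powr (?n - 2 * s)) + ennreal (2 * s * V / (?n - 2 * s)) * ennreal (A powr (?n - 2 * s))
      = ennreal (K * A powr (?n - 2 * s))"
    using s V by (simp add: K_def distrib_right flip: ennreal_mult' ennreal_plus)
  finally show "(\<integral>\<^sup>+\<xi>. indicator (cball 0 A) (\<xi>::'a) * ennreal (norm \<xi> powr (- 2 * s)) \<partial>lborel)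
      \<le> ennreal (K * A powr (?n - 2 * s))" .
qed

lemma rep_L2_add: "AE x in lborel. rep_L2 (U + V) x = rep_L2 U x + rep_L2 V x"
  using rep_abs_L2[OF sqint_add[OF rep_L2_sqint rep_L2_sqint], of U V] abs_L2_add[of "rep_L2 U" "rep_L2 V"]
  by simp

lemma rep_L2_diff: "AE x in lborel. rep_L2 (U - V) x = rep_L2 U x - rep_L2 V x"
  using rep_abs_L2[OF sqint_diff[OF rep_L2_sqint rep_L2_sqint], of U V] abs_L2_diff[of "rep_L2 U" "rep_L2 V"]
  by simp

lemma rep_L2_zero: "AE x in lborel. rep_L2 0 x = 0"
  using rep_abs_L2[OF sqint_zero] by (simp add: abs_L2_zero)

text \<open>Level set argument of Chemin and Xu: at height \<open>l\<close> the frequencies are cut at the radius \<open>A\<close>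
  for which the low frequency part is bounded by \<open>l / 2\<close>.\<close>

lemma Sobolev_critical:
  assumes s: "s > 0" "2 * s < real DIM('a::euclidean_space)"
    and q: "q = 2 * real DIM('a) / (real DIM('a) - 2 * s)"
  obtains C where "C > 0" "\<And>G::'a L2. (\<lambda>\<xi>. norm \<xi> powr s *\<^sub>R rep_L2 G \<xi>) \<in> sqint \<Longrightarrow>
    rep_L2 (iFTL G) \<in> Lp q \<and> Lp_norm q (rep_L2 (iFTL G)) \<le> C * norm (abs_L2 (\<lambda>\<xi>. norm \<xi> powr s *\<^sub>R rep_L2 G \<xi>))"
proof -
  let ?n = "real DIM('a)"
  obtain K where K: "K > 0" "\<And>A. A > 0 \<Longrightarrow>
    (\<integral>\<^sup>+\<xi>. indicator (cball 0 A) (\<xi>::'a) * ennreal (norm \<xi> powr (- 2 * s)) \<partial>lborel) \<le> ennreal (K * A powr (?n - 2 * s))"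
    using nn_integral_cball_powr[OF s] by metis
  define c where "c = fconst TYPE('a) * sqrt K"
  have c: "c > 0" using K fconst_pos[where 'a = 'a] by (simp add: c_def)
  define d where "d = ?n / 2 - s"
  have d: "d > 0" using s by (simp add: d_def)
  \<comment> \<open>This identity makes the exponents close up: integrating l^(q-3) up to a multiple
    of |\<xi>|^d gives |\<xi>|^(d(q-2)) = |\<xi>|^(2s), the square of the weight in the norm on the
    right.\<close>
  have q2: "q > 2" and dq: "d * (q - 2) = 2 * s"
    using s by (simp_all add: q d_def field_simps)
  \<comment> \<open>The factor 4 q / (q - 2) arises from q l^(q-1) times Chebyshev's 4 / l^2,
    integrated in l; the power of 2 c comes from the choice of the cut-off radius.\<close>
  define C where "C = ((4 * q / (q - 2)) * (2 * c) powr (q - 2)) powr (1 / q)"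
  have C: "C > 0" using q2 c by (simp add: C_def)
  have Cq: "C powr q = (4 * q / (q - 2)) * (2 * c) powr (q - 2)"
    using q2 c by (simp add: C_def powr_powr)
  show thesis
  proof (rule that[OF C])
    fix G :: "'a L2" assume w: "(\<lambda>\<xi>. norm \<xi> powr s *\<^sub>R rep_L2 G \<xi>) \<in> sqint"
    define g where "g = rep_L2 G"
    have g[simp]: "g \<in> sqint" and [measurable]: "g \<in> borel_measurable borel" by (auto simp: g_def)
    define N where "N = norm (abs_L2 (\<lambda>\<xi>. norm \<xi> powr s *\<^sub>R rep_L2 G \<xi>))"
    have N2: "(\<integral>\<^sup>+\<xi>. ennreal ((norm \<xi> powr s * norm (g \<xi>))\<^sup>2) \<partial>lborel) = ennreal (N\<^sup>2)"
      using norm_abs_L2_sq_nn[OF w] by (simp add: N_def g_def)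
    define f where "f = rep_L2 (iFTL G)"
    have [measurable]: "f \<in> borel_measurable borel" by (simp add: f_def)
    have N0: "N \<ge> 0" by (simp add: N_def)
    have "(\<integral>\<^sup>+x. ennreal (norm (f x) powr q) \<partial>lborel) \<le> ennreal ((C * N) powr q)"
    proof (cases "N = 0")
      case True
      then have "(\<integral>\<^sup>+\<xi>. ennreal ((norm \<xi> powr s * norm (g \<xi>))\<^sup>2) \<partial>lborel) = 0"
        using N2 by simp
      then have "AE \<xi> in lborel. ennreal ((norm \<xi> powr s * norm (g \<xi>))\<^sup>2) = 0"
        by (subst (asm) nn_integral_0_iff_AE) auto
      moreover have "AE \<xi> in lborel. \<xi> \<noteq> (0::'a)" by (rule AE_lborel_singleton)
      ultimately have "AE \<xi> in lborel. g \<xi> = 0" by eventually_elim auto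
      then have "G = 0" using abs_L2_eq_iff[of g "\<lambda>_. 0"] by (simp add: g_def abs_L2_zero)
      then have "iFTL G = 0" by (simp add: linear_0[OF iFTL_linear])
      then have "AE x in lborel. f x = 0" using rep_L2_zero by (simp add: f_def)
      then have "(\<integral>\<^sup>+x. ennreal (norm (f x) powr q) \<partial>lborel) = nn_integral lborel (\<lambda>x::'a. 0)"
        by (intro nn_integral_cong_AE) (auto elim!: eventually_mono)
      then show ?thesis by simp
    next
      case False
      with N0 have N: "N > 0" by simp
      \<comment> \<open>By the Cauchy-Schwarz inequality the part with frequencies below A is at
        most c N A^d. With this \<kappa> the radius given by A^d = l / \<kappa> turns the bound into
        exactly l / 2.\<close>
      define \<kappa> where "\<kappa> = 2 * c * N"
      have \<kappa>: "\<kappa> > 0" using c N by (simp add: \<kappa>_def)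
      have level: "emeasure lborel {x. l \<le> norm (f x)}
          \<le> ennreal (4 / l\<^sup>2) * (\<integral>\<^sup>+\<xi>. indicator {\<xi>. l \<le> \<kappa> * norm \<xi> powr d} \<xi> * ennreal ((norm (g \<xi>))\<^sup>2) \<partial>lborel)"
        if l: "l > 0" for l
      proof -
        define A where "A = (l / \<kappa>) powr (1 / d)"
        have A: "A > 0" using l \<kappa> by (simp add: A_def)
        have Ad: "A powr d = l / \<kappa>" using l \<kappa> d by (simp add: A_def powr_powr)
        have [measurable]: "cball (0::'a) A \<in> sets borel" by simp
        define GA where "GA = abs_L2 (trunc A g)"
        have ti: "integrable lborel (trunc A g)" by (rule trunc_integrable[OF g])
        have ts: "trunc A g \<in> sqint" by (rule trunc_sqint[OF g])
        have "(\<integral>\<^sup>+\<xi>. ennreal (norm (trunc A g \<xi>)) \<partial>lborel)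
          = (\<integral>\<^sup>+\<xi>. (indicator (cball 0 A) \<xi> * ennreal (norm \<xi> powr (- s))) * ennreal (norm \<xi> powr s * norm (g \<xi>)) \<partial>lborel)"
        proof (rule nn_integral_cong_AE, use AE_lborel_singleton[of 0] in eventually_elim)
          fix \<xi> :: 'a assume "\<xi> \<noteq> 0"
          then have "norm \<xi> powr (- s) * (norm \<xi> powr s * norm (g \<xi>)) = norm (g \<xi>)"
            by (simp add: powr_minus)
          then show "ennreal (norm (trunc A g \<xi>)) = (indicator (cball 0 A) \<xi> * ennreal (norm \<xi> powr (- s))) * ennreal (norm \<xi> powr s * norm (g \<xi>))"
            by (auto simp: trunc_def split: split_indicator simp flip: ennreal_mult')
        qed
        then have "(\<integral>\<^sup>+\<xi>. ennreal (norm (trunc A g \<xi>)) \<partial>lborel)\<^sup>2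
          \<le> (\<integral>\<^sup>+\<xi>. (indicator (cball 0 A) \<xi> * ennreal (norm (\<xi>::'a) powr (- s)))^2 \<partial>lborel) * (\<integral>\<^sup>+\<xi>. (ennreal (norm \<xi> powr s * norm (g \<xi>)))^2 \<partial>lborel)"
          by (simp only:) (rule Cauchy_Schwarz_nn_integral; measurable)
        also have "(\<integral>\<^sup>+\<xi>. (indicator (cball 0 A) \<xi> * ennreal (norm (\<xi>::'a) powr (- s)))^2 \<partial>lborel)
          = (\<integral>\<^sup>+\<xi>. indicator (cball 0 A) \<xi> * ennreal (norm (\<xi>::'a) powr (- 2 * s)) \<partial>lborel)"
        proof (intro nn_integral_cong)
          fix \<xi> :: 'a
          have "norm \<xi> powr (- 2 * s) = (norm \<xi> powr (- s))\<^sup>2"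
            by (simp add: power2_eq_square flip: powr_add)
          then show "(indicator (cball 0 A) \<xi> * ennreal (norm \<xi> powr (- s)))^2
              = indicator (cball 0 A) \<xi> * ennreal (norm \<xi> powr (- 2 * s))"
            by (auto split: split_indicator simp: ennreal_power)
        qed
        also have "(\<integral>\<^sup>+\<xi>. (ennreal (norm \<xi> powr s * norm (g \<xi>)))^2 \<partial>lborel) = ennreal (N\<^sup>2)"
          unfolding N2[symmetric] by (intro nn_integral_cong) (simp add: ennreal_power)
        also have "(\<integral>\<^sup>+\<xi>. indicator (cball 0 A) \<xi> * ennreal (norm (\<xi>::'a) powr (- 2 * s)) \<partial>lborel) * ennreal (N\<^sup>2)
          \<le> ennreal (K * A powr (?n - 2 * s)) * ennreal (N\<^sup>2)"
          by (intro mult_right_mono K A) auto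
        also have "\<dots> = ennreal ((sqrt K * A powr d * N)\<^sup>2)"
        proof -
          have "A powr (?n - 2 * s) = (A powr d)\<^sup>2"
            using A by (simp add: power2_eq_square d_def flip: powr_add)
          then show ?thesis using K by (simp add: power_mult_distrib flip: ennreal_mult')
        qed
        finally have "(ennreal (LINT \<xi>|lborel. norm (trunc A g \<xi>)))\<^sup>2 \<le> ennreal ((sqrt K * A powr d * N)\<^sup>2)"
          using nn_integral_eq_integral[OF integrable_norm[OF ti]] by simp
        then have "(LINT \<xi>|lborel. norm (trunc A g \<xi>))\<^sup>2 \<le> (sqrt K * A powr d * N)\<^sup>2"
          by (subst (asm) ennreal_power) auto
        then have "(LINT \<xi>|lborel. norm (trunc A g \<xi>)) \<le> sqrt K * A powr d * N"
          by (rule power2_le_imp_le) (use K N in simp)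
        then have "fconst TYPE('a) * (LINT \<xi>|lborel. norm (trunc A g \<xi>)) \<le> fconst TYPE('a) * (sqrt K * A powr d * N)"
          using fconst_pos[where 'a = 'a] by (intro mult_left_mono) auto
        also have "\<dots> = c * N * (l / \<kappa>)" by (simp add: Ad c_def)
        also have "\<dots> = l / 2" using N c by (simp add: \<kappa>_def)
        finally have "fconst TYPE('a) * (LINT \<xi>|lborel. norm (trunc A g \<xi>)) \<le> l / 2" .
        note lw = this
        have low: "AE x in lborel. norm (rep_L2 (iFTL GA) x) \<le> l / 2"
          using iFTL_bound_sup[OF ti ts] unfolding GA_def by eventually_elim (use lw in simp)
        define h where "h = rep_L2 (iFTL (G - GA))"
        have [measurable]: "h \<in> borel_measurable borel" by (simp add: h_def)
        have "iFTL G = iFTL GA + iFTL (G - GA)"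
          by (simp flip: linear_add[OF iFTL_linear])
        then have sum: "AE x in lborel. f x = rep_L2 (iFTL GA) x + h x"
          using rep_L2_add[of "iFTL GA" "iFTL (G - GA)"] by (simp add: f_def h_def)
        have "(\<integral>\<^sup>+x. ennreal ((norm (h x))\<^sup>2) \<partial>lborel) = ennreal ((norm (G - GA))\<^sup>2)"
          using norm_L2_sq_nn[of "iFTL (G - GA)"] by (simp add: h_def)
        also have "G - GA = abs_L2 (\<lambda>\<xi>. g \<xi> - trunc A g \<xi>)"
          using abs_L2_diff[OF g ts] by (simp add: GA_def g_def)
        also have "ennreal ((norm \<dots>)\<^sup>2) = (\<integral>\<^sup>+\<xi>. ennreal ((norm (g \<xi> - trunc A g \<xi>))\<^sup>2) \<partial>lborel)"
          by (rule norm_abs_L2_sq_nn[OF sqint_diff[OF g ts]])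
        also have "\<dots> \<le> (\<integral>\<^sup>+\<xi>. indicator {\<xi>. l \<le> \<kappa> * norm \<xi> powr d} \<xi> * ennreal ((norm (g \<xi>))\<^sup>2) \<partial>lborel)"
        proof (rule nn_integral_mono)
          fix \<xi> :: 'a
          show "ennreal ((norm (g \<xi> - trunc A g \<xi>))\<^sup>2) \<le> indicator {\<xi>. l \<le> \<kappa> * norm \<xi> powr d} \<xi> * ennreal ((norm (g \<xi>))\<^sup>2)"
          proof (cases "norm \<xi> \<le> A")
            case False
            then have "A powr d \<le> norm \<xi> powr d" using A d by (intro powr_mono2) auto
            then have "l \<le> \<kappa> * norm \<xi> powr d" using \<kappa> by (simp add: Ad field_simps)
            then show ?thesis using False by (simp add: trunc_def)
          qed (simp add: trunc_def)
        qed
        finally have hi: "(\<integral>\<^sup>+x. ennreal ((norm (h x))\<^sup>2) \<partial>lborel)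
          \<le> (\<integral>\<^sup>+\<xi>. indicator {\<xi>. l \<le> \<kappa> * norm \<xi> powr d} \<xi> * ennreal ((norm (g \<xi>))\<^sup>2) \<partial>lborel)" .
        \<comment> \<open>Where |f| >= l the low frequencies account for at most l / 2, so |h| >= l
          / 2 there, and Chebyshev's inequality applies to h.\<close>
        have "emeasure lborel {x. l \<le> norm (f x)} = (\<integral>\<^sup>+x. indicator {x. l \<le> norm (f x)} x \<partial>lborel)"
          by (subst nn_integral_indicator) auto
        also have "\<dots> \<le> (\<integral>\<^sup>+x. ennreal (4 / l\<^sup>2) * ennreal ((norm (h x))\<^sup>2) \<partial>lborel)"
        proof (rule nn_integral_mono_AE, use low sum in eventually_elim)
          fix x assume 1: "norm (rep_L2 (iFTL GA) x) \<le> l / 2" "f x = rep_L2 (iFTL GA) x + h x"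
          show "indicator {x. l \<le> norm (f x)} x \<le> ennreal (4 / l\<^sup>2) * ennreal ((norm (h x))\<^sup>2)"
          proof (cases "l \<le> norm (f x)")
            case True
            then have "l / 2 \<le> norm (h x)" using 1 norm_triangle_ineq[of "rep_L2 (iFTL GA) x" "h x"] by simp
            then have "(l / 2)\<^sup>2 \<le> (norm (h x))\<^sup>2" using l by (intro power_mono) auto
            then have "1 \<le> 4 / l\<^sup>2 * (norm (h x))\<^sup>2" using l by (simp add: field_simps power_divide)
            then show ?thesis using True by (simp flip: ennreal_mult')
          qed simp
        qed
        also have "\<dots> = ennreal (4 / l\<^sup>2) * (\<integral>\<^sup>+x. ennreal ((norm (h x))\<^sup>2) \<partial>lborel)"
          by (rule nn_integral_cmult) measurable
        also have "\<dots> \<le> ennreal (4 / l\<^sup>2) * (\<integral>\<^sup>+\<xi>. indicator {\<xi>. l \<le> \<kappa> * norm \<xi> powr d} \<xi> * ennreal ((norm (g \<xi>))\<^sup>2) \<partial>lborel)"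
          by (intro mult_left_mono hi) simp
        finally show ?thesis .
      qed
      have "(\<integral>\<^sup>+x. ennreal (norm (f x) powr q) \<partial>lborel)
        = (\<integral>\<^sup>+l. indicator {0..} l * ennreal (q * l powr (q - 1)) * emeasure lborel {x. l \<le> norm (f x)} \<partial>lborel)"
        using q2 by (intro nn_integral_layer_cake) auto
      also have "\<dots> \<le> (\<integral>\<^sup>+l. (\<integral>\<^sup>+\<xi>. indicator {0..} l * ennreal (4 * q * l powr (q - 3)) *
          (indicator {\<xi>. l \<le> \<kappa> * norm \<xi> powr d} \<xi> * ennreal ((norm (g \<xi>))\<^sup>2)) \<partial>lborel) \<partial>lborel)"
      proof (rule nn_integral_mono)
        fix l :: real
        show "indicator {0..} l * ennreal (q * l powr (q - 1)) * emeasure lborel {x. l \<le> norm (f x)}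
          \<le> (\<integral>\<^sup>+\<xi>. indicator {0..} l * ennreal (4 * q * l powr (q - 3)) *
          (indicator {\<xi>. l \<le> \<kappa> * norm \<xi> powr d} \<xi> * ennreal ((norm (g \<xi>))\<^sup>2)) \<partial>lborel)"
        proof (cases "l > 0")
          case True
          have pw: "l powr (q - 3) = l powr (q - 1) / l\<^sup>2"
            using True powr_diff[of l "q - 1" 2] by simp
          have "q * l powr (q - 1) * (4 / l\<^sup>2) = 4 * q * l powr (q - 3)" by (simp add: pw)
          then have eq: "ennreal (q * l powr (q - 1)) * ennreal (4 / l\<^sup>2) = ennreal (4 * q * l powr (q - 3))"
            by (subst ennreal_mult''[symmetric]) auto
          have "indicator {0..} l * ennreal (q * l powr (q - 1)) * emeasure lborel {x. l \<le> norm (f x)}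
             \<le> ennreal (q * l powr (q - 1)) * (ennreal (4 / l\<^sup>2) * (\<integral>\<^sup>+\<xi>. indicator {\<xi>. l \<le> \<kappa> * norm \<xi> powr d} \<xi> * ennreal ((norm (g \<xi>))\<^sup>2) \<partial>lborel))"
            using True by (auto intro!: mult_left_mono level)
          also have "\<dots> = ennreal (4 * q * l powr (q - 3)) * (\<integral>\<^sup>+\<xi>. indicator {\<xi>. l \<le> \<kappa> * norm \<xi> powr d} \<xi> * ennreal ((norm (g \<xi>))\<^sup>2) \<partial>lborel)"
            by (simp only: mult.assoc[symmetric] eq)
          also have "\<dots> = (\<integral>\<^sup>+\<xi>. indicator {0..} l * ennreal (4 * q * l powr (q - 3)) *
          (indicator {\<xi>. l \<le> \<kappa> * norm \<xi> powr d} \<xi> * ennreal ((norm (g \<xi>))\<^sup>2)) \<partial>lborel)"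
            using True by (simp add: nn_integral_cmult)
          finally show ?thesis .
        next
          case False
          then show ?thesis using q2 by (cases "l = 0") auto
        qed
      qed
      also have "\<dots> = (\<integral>\<^sup>+\<xi>. (\<integral>\<^sup>+l. indicator {0..} l * ennreal (4 * q * l powr (q - 3)) *
          (indicator {\<xi>. l \<le> \<kappa> * norm \<xi> powr d} \<xi> * ennreal ((norm (g \<xi>))\<^sup>2)) \<partial>lborel) \<partial>lborel)"
        by (rule lborel_pair.Fubini') measurable
      also have "\<dots> = (\<integral>\<^sup>+\<xi>. ennreal (4 * q / (q - 2) * \<kappa> powr (q - 2)) * ennreal ((norm \<xi> powr s * norm (g \<xi>))\<^sup>2) \<partial>lborel)"
      proof (intro nn_integral_cong)
        fix \<xi> :: 'a
        have y: "\<kappa> * norm \<xi> powr d \<ge> 0" using \<kappa> by simp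
        have "(\<integral>\<^sup>+l. indicator {0..} l * ennreal (4 * q * l powr (q - 3)) *
          (indicator {\<xi>. l \<le> \<kappa> * norm \<xi> powr d} \<xi> * ennreal ((norm (g \<xi>))\<^sup>2)) \<partial>lborel)
          = (\<integral>\<^sup>+l. ennreal (4 * q / (q - 2) * (norm (g \<xi>))\<^sup>2) * (indicator {0..\<kappa> * norm \<xi> powr d} l * ennreal ((q - 2) * l powr (q - 2 - 1))) \<partial>lborel)"
          using q2 by (intro nn_integral_cong) (auto split: split_indicator simp: mult_ac simp flip: ennreal_mult'')
        also have "\<dots> = ennreal (4 * q / (q - 2) * (norm (g \<xi>))\<^sup>2) * ennreal ((\<kappa> * norm \<xi> powr d) powr (q - 2))"
          using q2 y nn_integral_powr_from_0[of "q - 2"] by (subst nn_integral_cmult) auto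
        also have "\<dots> = ennreal (4 * q / (q - 2) * \<kappa> powr (q - 2)) * ennreal ((norm \<xi> powr s * norm (g \<xi>))\<^sup>2)"
        proof -
          have "(\<kappa> * norm \<xi> powr d) powr (q - 2) = \<kappa> powr (q - 2) * (norm \<xi> powr s)\<^sup>2"
            using \<kappa> by (simp add: powr_mult powr_powr dq power2_eq_square flip: powr_add)
          then show ?thesis
            using q2 by (simp add: power_mult_distrib mult_ac flip: ennreal_mult'')
        qed
        finally show "(\<integral>\<^sup>+l. indicator {0..} l * ennreal (4 * q * l powr (q - 3)) *
          (indicator {\<xi>. l \<le> \<kappa> * norm \<xi> powr d} \<xi> * ennreal ((norm (g \<xi>))\<^sup>2)) \<partial>lborel)
          = ennreal (4 * q / (q - 2) * \<kappa> powr (q - 2)) * ennreal ((norm \<xi> powr s * norm (g \<xi>))\<^sup>2)" .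
      qed
      also have "\<dots> = ennreal (4 * q / (q - 2) * \<kappa> powr (q - 2)) * ennreal (N\<^sup>2)"
        by (simp add: nn_integral_cmult N2)
      also have "\<dots> = ennreal ((C * N) powr q)"
      proof -
        have "N powr (q - 2) * N\<^sup>2 = N powr q" using N powr_add[of N "q - 2" 2] by simp
        then have "4 * q / (q - 2) * \<kappa> powr (q - 2) * N\<^sup>2 = (C * N) powr q"
          using C N c by (simp add: powr_mult Cq \<kappa>_def)
        then show ?thesis by (simp flip: ennreal_mult'')
      qed
      finally show ?thesis .
    qed
    from Lp_borelI_nn[OF _ _ _ this]
    show "rep_L2 (iFTL G) \<in> Lp q \<and> Lp_norm q (rep_L2 (iFTL G)) \<le> C * norm (abs_L2 (\<lambda>\<xi>. norm \<xi> powr s *\<^sub>R rep_L2 G \<xi>))"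
      using C N0 q2 by (simp add: f_def N_def)
  qed
qed

section \<open>Ultracontractivity of the fractional heat semigroup\<close>

text \<open>Rescaling \<xi> by c = s^(-1/(2\<sigma>)) removes s from the integrand and produces the
  power of s. What remains lies below e times a Gaussian because \<sigma> >= 1: |\<xi>|^2 / 2 is at
  most 1 in the unit ball and at most |\<xi>|^(2\<sigma>) outside.\<close>

lemma exp_powr_integral:
  assumes \<sigma>: "\<sigma> \<ge> 1"
  obtains K where "K > 0" "\<And>s. s > 0 \<Longrightarrow>
    (\<integral>\<^sup>+\<xi>. ennreal (exp (- 2 * s * norm (\<xi>::'a::euclidean_space) powr (2 * \<sigma>))) \<partial>lborel)
      \<le> ennreal (K * s powr (- real DIM('a) / (2 * \<sigma>)))"
proof
  define K where "K = exp 1 * inverse (fconst TYPE('a))"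
  show "K > 0" using fconst_pos[where 'a = 'a] by (simp add: K_def)
  fix s :: real assume s: "s > 0"
  define c where "c = s powr (- 1 / (2 * \<sigma>))"
  have c: "c > 0" using s by (simp add: c_def)
  have cs: "s * c powr (2 * \<sigma>) = 1"
  proof -
    have "c powr (2 * \<sigma>) = s powr (- 1 / (2 * \<sigma>) * (2 * \<sigma>))" unfolding c_def powr_powr ..
    also have "- 1 / (2 * \<sigma>) * (2 * \<sigma>) = - 1" using \<sigma> by simp
    finally show ?thesis using s by (simp add: powr_minus)
  qed
  have cn: "c ^ DIM('a) = s powr (- real DIM('a) / (2 * \<sigma>))"
    using s c by (simp add: c_def powr_powr flip: powr_realpow)
  have g: "exp (- 2 * norm \<xi> powr (2 * \<sigma>)) \<le> exp 1 * gauss \<xi>" for \<xi> :: 'a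
  proof -
    have "(norm \<xi>)\<^sup>2 / 2 \<le> 1 + 2 * norm \<xi> powr (2 * \<sigma>)"
    proof (cases "norm \<xi> \<le> 1")
      case True
      then have "(norm \<xi>)\<^sup>2 \<le> 1" by (simp add: power_le_one)
      moreover have "0 \<le> norm \<xi> powr (2 * \<sigma>)" by simp
      ultimately show ?thesis by linarith
    next
      case False
      then have "norm \<xi> powr 2 \<le> norm \<xi> powr (2 * \<sigma>)" using \<sigma> by (intro powr_mono) auto
      moreover have "norm \<xi> powr 2 = (norm \<xi>)\<^sup>2" using False by (subst powr_numeral) auto
      moreover have "0 \<le> (norm \<xi>)\<^sup>2" by simp
      ultimately show ?thesis by linarith
    qed
    then show ?thesis by (simp add: gauss_def flip: exp_add)
  qed
  have "(\<integral>\<^sup>+\<xi>. ennreal (exp (- 2 * s * norm (\<xi>::'a) powr (2 * \<sigma>))) \<partial>lborel)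
    = ennreal (\<bar>c\<bar> ^ DIM('a)) * (\<integral>\<^sup>+\<xi>. ennreal (exp (- 2 * s * norm (0 + c *\<^sub>R (\<xi>::'a)) powr (2 * \<sigma>))) \<partial>lborel)"
    using c by (intro nn_integral_lborel_affine) auto
  also have "\<dots> = ennreal (c ^ DIM('a)) * (\<integral>\<^sup>+\<xi>. ennreal (exp (- 2 * norm (\<xi>::'a) powr (2 * \<sigma>))) \<partial>lborel)"
  proof -
    have "s * norm (0 + c *\<^sub>R \<xi>) powr (2 * \<sigma>) = norm \<xi> powr (2 * \<sigma>)" for \<xi> :: 'a
      using c cs by (simp add: powr_mult flip: mult.assoc)
    then have "- 2 * s * norm (0 + c *\<^sub>R \<xi>) powr (2 * \<sigma>) = - 2 * norm \<xi> powr (2 * \<sigma>)" for \<xi> :: 'a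
      by (simp add: mult.assoc)
    then show ?thesis by (simp only: abs_of_pos[OF c])
  qed
  also have "\<dots> \<le> ennreal (c ^ DIM('a)) * (\<integral>\<^sup>+\<xi>. ennreal (exp 1 * gauss (\<xi>::'a)) \<partial>lborel)"
    by (intro mult_left_mono nn_integral_mono ennreal_leI g) auto
  also have "(\<integral>\<^sup>+\<xi>. ennreal (exp 1 * gauss (\<xi>::'a)) \<partial>lborel) = ennreal K"
    using gauss_integrable[where 'a = 'a] gauss_integral_fconst[where 'a = 'a] less_imp_le[OF gauss_pos]
    by (subst nn_integral_eq_integral) (auto simp: K_def intro!: AE_I2 mult_nonneg_nonneg)
  also have "ennreal (c ^ DIM('a)) * ennreal K = ennreal (K * s powr (- real DIM('a) / (2 * \<sigma>)))"
    by (simp only: cn mult.commute[of K] ennreal_mult'[OF powr_ge_zero])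
  finally show "(\<integral>\<^sup>+\<xi>. ennreal (exp (- 2 * s * norm (\<xi>::'a) powr (2 * \<sigma>))) \<partial>lborel)
      \<le> ennreal (K * s powr (- real DIM('a) / (2 * \<sigma>)))" .
qed

definition heat :: "real \<Rightarrow> real \<Rightarrow> 'a::euclidean_space \<Rightarrow> real" where
  "heat \<sigma> s \<xi> = exp (- s * norm \<xi> powr (2 * \<sigma>))"

lemma heat_bmult: "s \<ge> 0 \<Longrightarrow> bmult 1 (heat \<sigma> s)"
  unfolding bmult_def heat_def by auto

text \<open>The transform of an integrable function is bounded, so the norm is controlled by the L^2
  norm of the heat symbol alone. The square of the latter is the integral in
  \<open>exp_powr_integral\<close>, hence the halved exponent.\<close>

lemma heat_L1_L2:
  assumes \<sigma>: "\<sigma> \<ge> 1"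
  obtains C where "C > 0" "\<And>s (f::'a::euclidean_space \<Rightarrow> complex). s > 0 \<Longrightarrow> integrable lborel f \<Longrightarrow> f \<in> sqint \<Longrightarrow>
    norm (mulL (heat \<sigma> s) (FTL (abs_L2 f))) \<le> C * s powr (- real DIM('a) / (4 * \<sigma>)) * (LINT x|lborel. norm (f x))"
proof -
  obtain K where K: "K > 0" "\<And>s. s > 0 \<Longrightarrow>
    (\<integral>\<^sup>+\<xi>. ennreal (exp (- 2 * s * norm (\<xi>::'a) powr (2 * \<sigma>))) \<partial>lborel)
      \<le> ennreal (K * s powr (- real DIM('a) / (2 * \<sigma>)))"
    using exp_powr_integral[OF \<sigma>] by metis
  define C where "C = fconst TYPE('a) * sqrt K"
  have C: "C > 0" using K fconst_pos[where 'a = 'a] by (simp add: C_def)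
  show thesis
  proof (rule that[OF C])
    fix s :: real and f :: "'a \<Rightarrow> complex"
    assume s: "s > 0" and f: "integrable lborel f" "f \<in> sqint"
    define I where "I = (LINT x|lborel. norm (f x))"
    have I: "I \<ge> 0" by (simp add: I_def)
    let ?F = "FTL (abs_L2 f)"
    have ae: "AE \<xi> in lborel. norm (rep_L2 ?F \<xi>) \<le> fconst TYPE('a) * I"
      unfolding I_def by (rule FTL_bound_sup[OF f])
    have "ennreal ((norm (mulL (heat \<sigma> s) ?F))\<^sup>2) = (\<integral>\<^sup>+\<xi>. ennreal ((norm (heat \<sigma> s \<xi> *\<^sub>R rep_L2 ?F \<xi>))\<^sup>2) \<partial>lborel)"
      unfolding mulL_def using s by (intro norm_abs_L2_sq_nn bmult_sqint[OF heat_bmult]) auto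
    also have "\<dots> \<le> (\<integral>\<^sup>+\<xi>. ennreal ((fconst TYPE('a) * I)\<^sup>2) * ennreal (exp (- 2 * s * norm (\<xi>::'a) powr (2 * \<sigma>))) \<partial>lborel)"
    proof (rule nn_integral_mono_AE, use ae in eventually_elim)
      fix \<xi> :: 'a assume le: "norm (rep_L2 ?F \<xi>) \<le> fconst TYPE('a) * I"
      have h2: "(heat \<sigma> s \<xi>)\<^sup>2 = exp (- 2 * s * norm \<xi> powr (2 * \<sigma>))"
        by (simp add: heat_def flip: exp_double)
      have "(norm (heat \<sigma> s \<xi> *\<^sub>R rep_L2 ?F \<xi>))\<^sup>2 = (heat \<sigma> s \<xi>)\<^sup>2 * (norm (rep_L2 ?F \<xi>))\<^sup>2"
        by (simp add: power_mult_distrib)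
      also have "\<dots> \<le> (heat \<sigma> s \<xi>)\<^sup>2 * (fconst TYPE('a) * I)\<^sup>2"
        using le by (intro mult_left_mono power_mono) auto
      finally show "ennreal ((norm (heat \<sigma> s \<xi> *\<^sub>R rep_L2 ?F \<xi>))\<^sup>2)
          \<le> ennreal ((fconst TYPE('a) * I)\<^sup>2) * ennreal (exp (- 2 * s * norm \<xi> powr (2 * \<sigma>)))"
        unfolding h2 by (subst ennreal_mult'[symmetric]) (auto intro!: ennreal_leI simp: mult.commute)
    qed
    also have "\<dots> = ennreal ((fconst TYPE('a) * I)\<^sup>2) * (\<integral>\<^sup>+\<xi>. ennreal (exp (- 2 * s * norm (\<xi>::'a) powr (2 * \<sigma>))) \<partial>lborel)"
      by (rule nn_integral_cmult) measurable
    also have "\<dots> \<le> ennreal ((fconst TYPE('a) * I)\<^sup>2) * ennreal (K * s powr (- real DIM('a) / (2 * \<sigma>)))"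
      by (intro mult_left_mono K s) simp
    also have "\<dots> = ennreal ((C * s powr (- real DIM('a) / (4 * \<sigma>)) * I)\<^sup>2)"
    proof -
      have "s powr (- real DIM('a) / (2 * \<sigma>)) = (s powr (- real DIM('a) / (4 * \<sigma>)))\<^sup>2"
        using \<sigma> by (simp add: power2_eq_square flip: powr_add)
      then show ?thesis
        using K by (simp add: C_def power_mult_distrib mult_ac flip: ennreal_mult')
    qed
    finally have "(norm (mulL (heat \<sigma> s) ?F))\<^sup>2 \<le> (C * s powr (- real DIM('a) / (4 * \<sigma>)) * I)\<^sup>2"
      by simp
    then show "norm (mulL (heat \<sigma> s) ?F) \<le> C * s powr (- real DIM('a) / (4 * \<sigma>)) * (LINT x|lborel. norm (f x))"
      unfolding I_def[symmetric] by (rule power2_le_imp_le) (use C I in simp)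
  qed
qed

text \<open>Splitting \<open>g\<close> at a height \<open>l\<close> into an integrable and a square integrable part and optimising
  over \<open>l\<close> interpolates between the endpoint bounds on \<open>L\<^sup>1\<close> and \<open>L\<^sup>2\<close>.\<close>

lemma heat_Lm_L2:
  fixes m \<sigma> :: real
  assumes \<sigma>: "\<sigma> \<ge> 1" and m: "1 \<le> m" "m < 2"
  obtains C where "C > 0" "\<And>s (g::'a::euclidean_space \<Rightarrow> complex). s > 0 \<Longrightarrow> g \<in> sqint \<Longrightarrow> g \<in> Lp m \<Longrightarrow>
    norm (mulL (heat \<sigma> s) (FTL (abs_L2 g))) \<le> C * s powr (- real DIM('a) / (2 * \<sigma>) * (1 / m - 1 / 2)) * Lp_norm m g"
proof -
  let ?n = "real DIM('a)"
  obtain C1 where C1: "C1 > 0" "\<And>s (f::'a::euclidean_space \<Rightarrow> complex). s > 0 \<Longrightarrow> integrable lborel f \<Longrightarrow> f \<in> sqint \<Longrightarrow>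
    norm (mulL (heat \<sigma> s) (FTL (abs_L2 f))) \<le> C1 * s powr (- real DIM('a) / (4 * \<sigma>)) * (LINT x|lborel. norm (f x))"
    using heat_L1_L2[OF \<sigma>, where 'a = 'a] by metis
  show thesis
  proof (rule that[of "C1 + 1"])
    show "C1 + 1 > 0" using C1 by simp
    fix s :: real and g :: "'a \<Rightarrow> complex"
    assume s: "s > 0" and g: "g \<in> sqint" "g \<in> Lp m"
    have [measurable]: "g \<in> borel_measurable borel" using g by (auto dest: sqint_measurable)
    have bm: "bmult 1 (heat \<sigma> s :: 'a \<Rightarrow> real)" using s by (intro heat_bmult) auto
    define N where "N = Lp_norm m g"
    have N0: "N \<ge> 0" by (simp add: N_def)
    have int: "integrable lborel (\<lambda>x. norm (g x) powr m)" using g by (simp add: Lp_borel_iff)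
    have Nm: "(LINT x|lborel. norm (g x) powr m) = N powr m"
      using m by (simp add: N_def Lp_norm_borel powr_powr)
    show "norm (mulL (heat \<sigma> s) (FTL (abs_L2 g))) \<le> (C1 + 1) * s powr (- ?n / (2 * \<sigma>) * (1 / m - 1 / 2)) * Lp_norm m g"
    proof (cases "N = 0")
      case True
      then have "AE x in lborel. norm (g x) powr m = 0"
        using Nm int by (subst integral_nonneg_eq_0_iff_AE[symmetric]) auto
      then have "AE x in lborel. g x = 0" by eventually_elim simp
      then have "abs_L2 g = 0" using abs_L2_eq_iff[OF g(1) sqint_zero] by (simp add: abs_L2_zero)
      then show ?thesis using C1 by (simp add: linear_0[OF FTL_linear] mulL_zero[OF bm])
    next
      case False
      with N0 have N: "N > 0" by simp
      \<comment> \<open>At this height both pieces contribute the same power of s: the large values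
        of g through L^1, the small ones through L^2.\<close>
      define l where "l = N * s powr (- ?n / (2 * \<sigma> * m))"
      have l: "l > 0" using N s by (simp add: l_def)
      define g1 where "g1 x = (if norm (g x) > l then g x else 0)" for x
      define g2 where "g2 x = (if norm (g x) > l then 0 else g x)" for x
      have [measurable]: "g1 \<in> borel_measurable borel" "g2 \<in> borel_measurable borel"
        unfolding g1_def g2_def by measurable
      have g1s: "g1 \<in> sqint" and g2s: "g2 \<in> sqint"
        by (rule sqint_dominated[OF g(1), where B = 1]; simp add: g1_def g2_def)+
      have g12: "abs_L2 g = abs_L2 g1 + abs_L2 g2"
        unfolding abs_L2_add[OF g1s g2s] by (rule arg_cong[where f = abs_L2]) (auto simp: g1_def g2_def)
      have le1: "norm (g1 x) \<le> l powr (1 - m) * norm (g x) powr m" for x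
      proof (cases "norm (g x) > l")
        case True
        have "norm (g x) powr (1 - m) \<le> l powr (1 - m)" using True l m by (intro powr_mono2') auto
        then have "norm (g x) powr (1 - m) * norm (g x) powr m \<le> l powr (1 - m) * norm (g x) powr m"
          by (intro mult_right_mono) auto
        then show ?thesis using True l by (simp add: g1_def flip: powr_add)
      qed (use l in \<open>simp add: g1_def\<close>)
      have i1: "integrable lborel g1"
        by (rule Bochner_Integration.integrable_bound[OF integrable_mult_right[OF int, of "l powr (1 - m)"]])
           (use le1 in auto)
      have I1: "(LINT x|lborel. norm (g1 x)) \<le> l powr (1 - m) * N powr m"
      proof -
        have "(LINT x|lborel. norm (g1 x)) \<le> (LINT x|lborel. l powr (1 - m) * norm (g x) powr m)"
          using i1 int le1 by (intro integral_mono) auto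
        then show ?thesis by (simp add: Nm)
      qed
      have le2: "(norm (g2 x))\<^sup>2 \<le> l powr (2 - m) * norm (g x) powr m" for x
      proof (cases "norm (g x) > l \<or> g x = 0")
        case False
        have "norm (g x) powr (2 - m) \<le> l powr (2 - m)" using False l m by (intro powr_mono2) auto
        then have "norm (g x) powr (2 - m) * norm (g x) powr m \<le> l powr (2 - m) * norm (g x) powr m"
          by (intro mult_right_mono) auto
        then show ?thesis using False l by (simp add: g2_def flip: powr_add)
      qed (use l in \<open>auto simp: g2_def\<close>)
      have "(norm (abs_L2 g2))\<^sup>2 \<le> (LINT x|lborel. l powr (2 - m) * norm (g x) powr m)"
        unfolding norm_abs_L2_sq[OF g2s] using le2 int sqint_integrable[OF g2s] by (intro integral_mono) auto
      also have "\<dots> = (l powr (1 - m / 2) * N powr (m / 2))\<^sup>2"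
      proof -
        have "(l powr (1 - m / 2))\<^sup>2 = l powr (2 - m)" "(N powr (m / 2))\<^sup>2 = N powr m"
          using N l by (simp_all add: power2_eq_square flip: powr_add)
        then show ?thesis by (simp add: Nm power_mult_distrib)
      qed
      finally have I2: "norm (abs_L2 g2) \<le> l powr (1 - m / 2) * N powr (m / 2)"
        by (rule power2_le_imp_le) simp
      let ?e = "s powr (- ?n / (2 * \<sigma>) * (1 / m - 1 / 2))"
      have e1: "s powr (- ?n / (4 * \<sigma>)) * (l powr (1 - m) * N powr m) = ?e * N"
      proof -
        have 1: "l powr (1 - m) = N powr (1 - m) * s powr (- ?n / (2 * \<sigma> * m) * (1 - m))"
          using N s by (simp add: l_def powr_mult powr_powr)
        have 2: "N powr (1 - m) * N powr m = N" using N by (simp flip: powr_add)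
        have "- ?n / (4 * \<sigma>) + - ?n / (2 * \<sigma> * m) * (1 - m) = - ?n / (2 * \<sigma>) * (1 / m - 1 / 2)"
          using \<sigma> m by (simp add: field_simps)
        then have 3: "s powr (- ?n / (4 * \<sigma>)) * s powr (- ?n / (2 * \<sigma> * m) * (1 - m)) = ?e"
          by (simp only: powr_add[symmetric])
        have "s powr (- ?n / (4 * \<sigma>)) * (l powr (1 - m) * N powr m)
          = (s powr (- ?n / (4 * \<sigma>)) * s powr (- ?n / (2 * \<sigma> * m) * (1 - m))) * (N powr (1 - m) * N powr m)"
          unfolding 1 by (simp only: mult_ac)
        then show ?thesis unfolding 2 3 .
      qed
      have e2: "l powr (1 - m / 2) * N powr (m / 2) = ?e * N"
      proof -
        have 1: "l powr (1 - m / 2) = N powr (1 - m / 2) * s powr (- ?n / (2 * \<sigma> * m) * (1 - m / 2))"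
          using N s by (simp add: l_def powr_mult powr_powr)
        have 2: "N powr (1 - m / 2) * N powr (m / 2) = N" using N by (simp flip: powr_add)
        have 3: "- ?n / (2 * \<sigma> * m) * (1 - m / 2) = - ?n / (2 * \<sigma>) * (1 / m - 1 / 2)"
          using \<sigma> m by (simp add: field_simps)
        have "l powr (1 - m / 2) * N powr (m / 2)
          = s powr (- ?n / (2 * \<sigma> * m) * (1 - m / 2)) * (N powr (1 - m / 2) * N powr (m / 2))"
          unfolding 1 by (simp only: mult_ac)
        then show ?thesis unfolding 2 3 .
      qed
      have "norm (mulL (heat \<sigma> s) (FTL (abs_L2 g)))
        \<le> norm (mulL (heat \<sigma> s) (FTL (abs_L2 g1))) + norm (mulL (heat \<sigma> s) (FTL (abs_L2 g2)))"
        unfolding g12 linear_add[OF FTL_linear] mulL_add[OF bm] by (rule norm_triangle_ineq)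
      also have "\<dots> \<le> C1 * s powr (- ?n / (4 * \<sigma>)) * (l powr (1 - m) * N powr m) + l powr (1 - m / 2) * N powr (m / 2)"
      proof (rule add_mono)
        show "norm (mulL (heat \<sigma> s) (FTL (abs_L2 g1))) \<le> C1 * s powr (- ?n / (4 * \<sigma>)) * (l powr (1 - m) * N powr m)"
          using C1 I1 by (intro order_trans[OF C1(2)[OF s i1 g1s]] mult_left_mono) auto
        show "norm (mulL (heat \<sigma> s) (FTL (abs_L2 g2))) \<le> l powr (1 - m / 2) * N powr (m / 2)"
          using norm_mulL_le[OF bm, of "FTL (abs_L2 g2)"] I2 by simp
      qed
      also have "\<dots> = (C1 + 1) * ?e * N"
        by (simp only: mult.assoc e1 e2) (simp add: algebra_simps)
      finally show ?thesis by (simp add: N_def)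
    qed
  qed
qed

section \<open>Bounds for the fundamental solutions\<close>

lemma K0_symb_eq: "K0_symb t r = K1_symb t r + exp (- t)"
  by (auto simp: K0_symb_def K1_symb_def field_simps)

lemma K1_symb_zero [simp]: "K1_symb 0 r = 0"
  by (simp add: K1_symb_def)

lemma one_minus_exp_le: "(1::real) - exp (- x) \<le> x"
  using exp_ge_add_one_self[of "- x"] by simp

text \<open>With \<mu> = min r 1 and M = max r 1 the symbol is (exp(-t \<mu>) - exp(-t M)) / (M -
  \<mu>), symmetric in r and 1. Positivity becomes visible, and low and high frequencies are treated
  at once.\<close>

lemma K1_symb_min_max:
  assumes "r \<noteq> 1"
  shows "K1_symb t r = exp (- t * min r 1) * (1 - exp (- t * (max r 1 - min r 1))) / (max r 1 - min r 1)"
proof -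
  have e: "exp (- t * a) * (1 - exp (- t * (b - a))) = exp (- t * a) - exp (- t * b)" for a b
    by (simp add: right_diff_distrib algebra_simps flip: exp_add)
  show ?thesis
  proof (cases "r < 1")
    case True
    then show ?thesis using assms e[of r 1] by (simp add: K1_symb_def)
  next
    case False
    have "(exp (- t * r) - exp (- t)) / (1 - r) = (exp (- t) - exp (- t * r)) / (r - 1)"
      using assms by (simp add: field_simps)
    then show ?thesis using False assms e[of 1 r] by (simp add: K1_symb_def)
  qed
qed

lemma K1_symb_nonneg:
  assumes "t \<ge> 0" "r \<ge> 0"
  shows "0 \<le> K1_symb t r"
proof (cases "r = 1")
  case False
  have "1 - exp (- t * (max r 1 - min r 1)) \<ge> 0" using assms by (simp add: mult_nonneg_nonpos)
  then show ?thesis unfolding K1_symb_min_max[OF False] by (intro divide_nonneg_nonneg mult_nonneg_nonneg) auto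
qed (use assms in \<open>simp add: K1_symb_def\<close>)

text \<open>The factor max r 1 records the smoothing of order 2\<sigma> at high frequencies. If M >=
  2 \<mu>, the denominator M - \<mu> is at least M / 2. Otherwise M < 2 \<mu>, and the bound t
  exp(-t \<mu>), which survives at r = 1, leaves a factor t \<mu> to be absorbed.\<close>

lemma K1_symb_le:
  assumes t: "t \<ge> 0" and r: "r \<ge> 0"
  shows "K1_symb t r * max r 1 \<le> 4 * exp (- t * min r 1 / 2)"
proof -
  define \<mu> M where "\<mu> = min r 1" and "M = max r 1"
  have \<mu>: "0 \<le> \<mu>" "\<mu> \<le> 1" and M: "1 \<le> M" "\<mu> \<le> M" using r by (auto simp: \<mu>_def M_def)
  have le: "t * \<mu> \<le> 2 * exp (t * \<mu> / 2)"
    using exp_ge_add_one_self[of "t * \<mu> / 2"] by linarith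
  \<comment> \<open>Half of the exponential is spent on the factor t \<mu>; this is why the bounds
    below decay with rate \<mu> / 2.\<close>
  have te: "t * \<mu> * exp (- t * \<mu>) \<le> 2 * exp (- t * \<mu> / 2)"
  proof -
    have "t * \<mu> * exp (- t * \<mu>) \<le> 2 * exp (t * \<mu> / 2) * exp (- t * \<mu>)"
      using le by (rule mult_right_mono) simp
    also have "\<dots> = 2 * exp (- t * \<mu> / 2)" by (simp add: mult.assoc flip: exp_add)
    finally show ?thesis .
  qed
  have tm: "K1_symb t r \<le> t * exp (- t * \<mu>)"
  proof (cases "r = 1")
    case False
    then have d: "M - \<mu> > 0" by (auto simp: M_def \<mu>_def)
    have "1 - exp (- t * (M - \<mu>)) \<le> t * (M - \<mu>)" using one_minus_exp_le[of "t * (M - \<mu>)"] by simp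
    then have "exp (- t * \<mu>) * (1 - exp (- t * (M - \<mu>))) \<le> exp (- t * \<mu>) * (t * (M - \<mu>))"
      by (rule mult_left_mono) simp
    then show ?thesis
      using d unfolding K1_symb_min_max[OF False] M_def[symmetric] \<mu>_def[symmetric]
      by (simp add: divide_le_eq mult_ac)
  qed (simp add: K1_symb_def \<mu>_def)
  show ?thesis
  proof (cases "M \<ge> 2 * \<mu>")
    case True
    then have "r \<noteq> 1" by (auto simp: M_def \<mu>_def)
    have d: "M - \<mu> \<ge> M / 2" "M - \<mu> > 0" using True M by auto
    have "exp (- t * \<mu>) * (1 - exp (- t * (M - \<mu>))) \<le> exp (- t * \<mu>) * 1"
      by (rule mult_left_mono) auto
    then have "K1_symb t r \<le> exp (- t * \<mu>) / (M - \<mu>)"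
      using d unfolding K1_symb_min_max[OF \<open>r \<noteq> 1\<close>] M_def[symmetric] \<mu>_def[symmetric]
      by (simp add: divide_right_mono)
    also have "\<dots> \<le> exp (- t * \<mu>) / (M / 2)"
      using d M by (intro divide_left_mono) auto
    finally have "K1_symb t r * M \<le> 2 * exp (- t * \<mu>)" using M by (simp add: field_simps)
    also have "exp (- t * \<mu>) \<le> exp (- t * \<mu> / 2)" using t \<mu> by simp
    finally show ?thesis using exp_gt_zero[of "- t * \<mu> / 2"] unfolding M_def \<mu>_def by linarith
  next
    case False
    have "K1_symb t r * M \<le> t * exp (- t * \<mu>) * (2 * \<mu>)"
      using False M \<mu> t by (intro mult_mono tm) auto
    also have "\<dots> \<le> 4 * exp (- t * \<mu> / 2)" using te by (simp add: mult_ac)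
    finally show ?thesis unfolding M_def \<mu>_def .
  qed
qed

text \<open>Stated as the differential equation K1' + r K1 = exp(-t), the derivative has no
  denominator, and r = 1 is no exception in what follows.\<close>

lemma K1_symb_has_derivative:
  "((\<lambda>t. K1_symb t r) has_real_derivative exp (- t) - r * K1_symb t r) (at t within T)"
proof (cases "r = 1")
  case True
  show ?thesis unfolding K1_symb_def using True
    by (auto intro!: derivative_eq_intros simp: algebra_simps)
next
  case False
  have "((\<lambda>t. (exp (- t * r) - exp (- t)) / (1 - r)) has_real_derivative (- r * exp (- t * r) + exp (- t)) / (1 - r)) (at t within T)"
    using False by (auto intro!: derivative_eq_intros)
  moreover have "(- r * exp (- t * r) + exp (- t)) / (1 - r) = exp (- t) - r * K1_symb t r"
    using False by (simp add: K1_symb_def field_simps)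
  ultimately show ?thesis using False by (simp add: K1_symb_def)
qed

definition k1 :: "real \<Rightarrow> real \<Rightarrow> 'a::euclidean_space \<Rightarrow> real" where
  "k1 \<sigma> t \<xi> = K1_symb t (norm \<xi> powr (2 * \<sigma>))"

definition hs :: "real \<Rightarrow> 'a::euclidean_space \<Rightarrow> real" where
  "hs \<sigma> \<xi> = norm \<xi> powr \<sigma>"

lemma hs_nonneg [simp]: "0 \<le> hs \<sigma> \<xi>" by (simp add: hs_def)

lemma hs_sq: "(hs \<sigma> \<xi>)\<^sup>2 = norm \<xi> powr (2 * \<sigma>)"
  by (simp add: hs_def power2_eq_square flip: powr_add)

lemma hs_measurable [measurable]: "hs \<sigma> \<in> borel_measurable borel"
  unfolding hs_def by measurable

lemma K1_symb_measurable [measurable]: "K1_symb t \<in> borel_measurable borel"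
  by (intro borel_measurable_continuous_onI continuous_at_imp_continuous_on ballI isCont_K1_symb)

lemma k1_measurable [measurable]: "k1 \<sigma> t \<in> borel_measurable borel"
  unfolding k1_def by measurable

text \<open>The low frequency variable \<open>min r 1\<close> governs the decay of every symbol.\<close>

definition low :: "real \<Rightarrow> 'a::euclidean_space \<Rightarrow> real" where
  "low \<sigma> \<xi> = min (norm \<xi> powr (2 * \<sigma>)) 1"

lemma low_bounds [simp]: "0 \<le> low \<sigma> \<xi>" "low \<sigma> \<xi> \<le> 1" by (auto simp: low_def)

text \<open>Write r = min r 1 * max r 1. The second factor is paid for by \<open>K1_symb_le\<close>,
  so each power of r leaves a power of \<open>low\<close>, which is small where the exponential
  decays slowly. The powers 0, 1/2 and 1 of r belong to u, |D|^\<sigma> u and u_t.\<close>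

lemma k1_bounds:
  assumes t: "t \<ge> 0"
  shows "0 \<le> k1 \<sigma> t \<xi>"
    and "k1 \<sigma> t \<xi> \<le> 4 * exp (- t * low \<sigma> \<xi> / 2)"
    and "hs \<sigma> \<xi> * k1 \<sigma> t \<xi> \<le> 4 * (low \<sigma> \<xi> powr (1/2) * exp (- t * low \<sigma> \<xi> / 2))"
    and "(hs \<sigma> \<xi>)\<^sup>2 * k1 \<sigma> t \<xi> \<le> 4 * (low \<sigma> \<xi> * exp (- t * low \<sigma> \<xi> / 2))"
proof -
  define r where "r = norm \<xi> powr (2 * \<sigma>)"
  have r: "r \<ge> 0" by (simp add: r_def)
  have l: "low \<sigma> \<xi> = min r 1" by (simp add: low_def r_def)
  have k: "k1 \<sigma> t \<xi> = K1_symb t r" by (simp add: k1_def r_def)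
  have h: "hs \<sigma> \<xi> = sqrt r" unfolding r_def by (simp flip: hs_sq)
  let ?e = "exp (- t * min r 1 / 2)"
  have b: "K1_symb t r * max r 1 \<le> 4 * ?e" by (rule K1_symb_le[OF t r])
  have n: "0 \<le> K1_symb t r" by (rule K1_symb_nonneg[OF t r])
  show "0 \<le> k1 \<sigma> t \<xi>" using n by (simp add: k)
  have "K1_symb t r * 1 \<le> K1_symb t r * max r 1" using n by (intro mult_left_mono) auto
  then show "k1 \<sigma> t \<xi> \<le> 4 * exp (- t * low \<sigma> \<xi> / 2)" using b by (simp add: k l)
  have rr: "r = min r 1 * max r 1" by (auto simp: min_def max_def)
  have "min r 1 * (K1_symb t r * max r 1) \<le> min r 1 * (4 * ?e)" using r by (intro mult_left_mono b) auto
  then show "(hs \<sigma> \<xi>)\<^sup>2 * k1 \<sigma> t \<xi> \<le> 4 * (low \<sigma> \<xi> * exp (- t * low \<sigma> \<xi> / 2))"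
    using rr r by (simp add: k l h mult_ac)
  have "sqrt r = sqrt (min r 1) * sqrt (max r 1)" using rr real_sqrt_mult by metis
  also have "\<dots> \<le> sqrt (min r 1) * max r 1"
    using r real_sqrt_le_mono[of "max r 1" "(max r 1)\<^sup>2"] by (intro mult_left_mono) (auto simp: power2_eq_square mult_le_cancel_left1)
  finally have "sqrt r * K1_symb t r \<le> sqrt (min r 1) * max r 1 * K1_symb t r" using n by (intro mult_right_mono)
  also have "\<dots> \<le> sqrt (min r 1) * (4 * ?e)"
    using mult_left_mono[OF b, of "sqrt (min r 1)"] r by (simp add: mult_ac)
  finally show "hs \<sigma> \<xi> * k1 \<sigma> t \<xi> \<le> 4 * (low \<sigma> \<xi> powr (1/2) * exp (- t * low \<sigma> \<xi> / 2))"
    using r by (simp add: k l h powr_half_sqrt mult_ac)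
qed

section \<open>Decay of operators from pointwise bounds on their symbols\<close>

lemma exp_decay_powr:
  fixes b :: real
  assumes b: "b \<ge> 0"
  obtains C :: real where "C > 0" "\<And>t::real. t \<ge> 0 \<Longrightarrow> exp (- t / 4) \<le> C * (1 + t) powr (- b)"
proof (cases "b = 0")
  case True
  show ?thesis by (rule that[of 1]) (auto simp: True)
next
  case False
  with b have b: "b > 0" by simp
  define c where "c = max 1 (4 * b)"
  show ?thesis
  proof (rule that[of "c powr b"])
    show "c powr b > 0" by (simp add: c_def)
    fix t :: real assume t: "t \<ge> 0"
    have "1 + t \<le> c * (1 + t / (4 * b))"
    proof -
      have "t = 4 * b * (t / (4 * b))" using b by simp
      also have "\<dots> \<le> c * (t / (4 * b))" using t b by (intro mult_right_mono) (auto simp: c_def)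
      finally have "t \<le> c * (t / (4 * b))" .
      moreover have "1 \<le> c" by (simp add: c_def)
      ultimately show ?thesis by (simp add: distrib_left)
    qed
    also have "\<dots> \<le> c * exp (t / (4 * b))"
      using exp_ge_add_one_self[of "t / (4 * b)"] by (intro mult_left_mono) (auto simp: c_def)
    finally have "(1 + t) powr b \<le> (c * exp (t / (4 * b))) powr b"
      using t b by (intro powr_mono2) auto
    also have "\<dots> = c powr b * exp (t / 4)"
      using b by (simp add: powr_mult c_def exp_powr_real)
    finally show "exp (- t / 4) \<le> c powr b * (1 + t) powr (- b)"
      using t by (simp add: powr_minus exp_minus field_simps)
  qed
qed

text \<open>\<open>0 powr 0\<close> evaluates to 0, so the value 1 for j = 0 is prescribed
  separately.\<close>

definition lowp :: "real \<Rightarrow> real \<Rightarrow> real" where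
  "lowp j \<mu> = (if j = 0 then 1 else \<mu> powr j)"

text \<open>Because \<mu> <= 1 and j <= 1, (\<mu> (1 + t))^j is at most 1 + t \<mu>, and 1 + x <= 4
  exp(x / 4) gives the constant.\<close>

lemma lowp_decay:
  assumes "0 \<le> j" "j \<le> 1" "0 \<le> \<mu>" "\<mu> \<le> 1" "t \<ge> 0"
  shows "lowp j \<mu> * exp (- t * \<mu> / 4) \<le> 4 * (1 + t) powr (- j)"
proof -
  have "lowp j \<mu> * (1 + t) powr j \<le> 1 + t * \<mu>"
  proof (cases "j = 0 \<or> \<mu> = 0")
    case True
    then show ?thesis using assms by (auto simp: lowp_def)
  next
    case False
    have "lowp j \<mu> * (1 + t) powr j = (\<mu> * (1 + t)) powr j"
      using False assms by (simp add: lowp_def powr_mult)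
    also have "\<dots> \<le> (1 + t * \<mu>) powr j"
      using assms by (intro powr_mono2) (auto simp: algebra_simps)
    also have "\<dots> \<le> (1 + t * \<mu>) powr 1" using assms by (intro powr_mono) auto
    finally show ?thesis using assms by simp
  qed
  also have "\<dots> \<le> 4 * exp (t * \<mu> / 4)" using exp_ge_add_one_self[of "t * \<mu> / 4"] by linarith
  finally have "lowp j \<mu> * (1 + t) powr j * exp (- t * \<mu> / 4) \<le> 4 * exp (t * \<mu> / 4) * exp (- t * \<mu> / 4)"
    by (rule mult_right_mono) simp
  also have "\<dots> = 4" by (simp add: mult.assoc flip: exp_add)
  finally show ?thesis using assms by (simp add: powr_minus field_simps)
qed

text \<open>A symbol of order \<open>j\<close> at time \<open>t\<close> gains the factor \<open>(1 + t) powr - j\<close> on \<open>L\<^sup>2\<close>, and the heat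
  rate in addition on \<open>L\<^sup>m \<inter> L\<^sup>2\<close>.\<close>

definition symb_order :: "real \<Rightarrow> real \<Rightarrow> real \<Rightarrow> real \<Rightarrow> ('a::euclidean_space \<Rightarrow> real) \<Rightarrow> bool" where
  "symb_order \<sigma> j A t S \<longleftrightarrow> S \<in> borel_measurable borel \<and> 0 \<le> A \<and>
     (\<forall>\<xi>. \<bar>S \<xi>\<bar> \<le> A * (exp (- t) + lowp j (low \<sigma> \<xi>) * exp (- t * low \<sigma> \<xi> / 2)))"

lemma lowp_le_1: "0 \<le> j \<Longrightarrow> 0 \<le> \<mu> \<Longrightarrow> \<mu> \<le> 1 \<Longrightarrow> lowp j \<mu> \<le> 1"
  using powr_mono2[of j \<mu> 1] by (auto simp: lowp_def)

lemma lowp_nonneg: "0 \<le> lowp j \<mu>" by (simp add: lowp_def)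

lemma symb_order_bmult:
  assumes S: "symb_order \<sigma> j A t S" and j: "0 \<le> j" and t: "t \<ge> 0"
  shows "bmult (2 * A) S"
proof -
  have "\<bar>S \<xi>\<bar> \<le> 2 * A" for \<xi>
  proof -
    have "\<bar>S \<xi>\<bar> \<le> A * (exp (- t) + lowp j (low \<sigma> \<xi>) * exp (- t * low \<sigma> \<xi> / 2))"
      using S by (auto simp: symb_order_def)
    also have "\<dots> \<le> A * (1 + 1 * 1)"
      using S t j by (intro mult_left_mono add_mono mult_mono lowp_le_1)
        (auto simp: symb_order_def lowp_nonneg)
    finally show ?thesis by simp
  qed
  then show ?thesis using S by (simp add: bmult_def symb_order_def)
qed

lemma symb_order_L2:
  obtains C where "C > 0" "\<And>j A t S (U::'a::euclidean_space L2). symb_order \<sigma> j A t S \<Longrightarrow> 0 \<le> j \<Longrightarrow> j \<le> 1 \<Longrightarrow> t \<ge> 0 \<Longrightarrow>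
     norm (mulL S U) \<le> A * C * (1 + t) powr (- j) * norm U"
proof -
  obtain C1 where C1: "C1 > 0" "\<And>t::real. t \<ge> 0 \<Longrightarrow> exp (- t / 4) \<le> C1 * (1 + t) powr (- 1)"
    using exp_decay_powr[of 1] by auto
  show thesis
  proof (rule that[of "C1 + 4"])
    show "C1 + 4 > 0" using C1 by simp
    fix j A t :: real and S :: "'a \<Rightarrow> real" and U :: "'a L2"
    assume S: "symb_order \<sigma> j A t S" and j: "0 \<le> j" "j \<le> 1" and t: "t \<ge> 0"
    have A: "A \<ge> 0" using S by (simp add: symb_order_def)
    have "\<bar>S \<xi>\<bar> \<le> A * (C1 + 4) * (1 + t) powr (- j)" for \<xi>
    proof -
      have "exp (- t) \<le> exp (- t / 4)" using t by simp
      also have "\<dots> \<le> C1 * (1 + t) powr (- 1)" by (rule C1(2)[OF t])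
      also have "\<dots> \<le> C1 * (1 + t) powr (- j)"
        using C1 t j by (intro mult_left_mono powr_mono) auto
      finally have 1: "exp (- t) \<le> C1 * (1 + t) powr (- j)" .
      have "exp (- t * low \<sigma> \<xi> / 2) \<le> exp (- t * low \<sigma> \<xi> / 4)" using t by simp
      then have "lowp j (low \<sigma> \<xi>) * exp (- t * low \<sigma> \<xi> / 2) \<le> lowp j (low \<sigma> \<xi>) * exp (- t * low \<sigma> \<xi> / 4)"
        by (intro mult_left_mono lowp_nonneg)
      also have "\<dots> \<le> 4 * (1 + t) powr (- j)"
        using j t by (intro lowp_decay) auto
      finally have "exp (- t) + lowp j (low \<sigma> \<xi>) * exp (- t * low \<sigma> \<xi> / 2) \<le> (C1 + 4) * (1 + t) powr (- j)"
        using 1 by (simp add: distrib_right)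
      from mult_left_mono[OF this A]
      show ?thesis using S by (auto simp: symb_order_def mult.assoc intro: order_trans)
    qed
    then have "bmult (A * (C1 + 4) * (1 + t) powr (- j)) S"
      using S by (simp add: bmult_def symb_order_def)
    then show "norm (mulL S U) \<le> A * (C1 + 4) * (1 + t) powr (- j) * norm U"
      by (rule norm_mulL_le)
  qed
qed

text \<open>For |\<xi>| <= 1 one half of exp(-t low / 2) is traded, together with
  \<open>lowp\<close>, for (1 + t)^(-j); the other half is compared with the heat symbol at time (1
  + t) / 4, which gives the rate of the heat semigroup. Shifting time by 1 costs exp(1/4) and
  removes the singularity at t = 0. For |\<xi>| > 1 the decay in t is exponential and the L^2 norm
  suffices.\<close>

lemma symb_order_Lm:
  assumes \<sigma>: "\<sigma> \<ge> 1" and m: "1 \<le> m" "m < 2"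
  obtains C where "C > 0" "\<And>j A t S (g::'a::euclidean_space \<Rightarrow> complex). symb_order \<sigma> j A t S \<Longrightarrow> 0 \<le> j \<Longrightarrow> j \<le> 1 \<Longrightarrow> t \<ge> 0 \<Longrightarrow>
     g \<in> sqint \<Longrightarrow> g \<in> Lp m \<Longrightarrow>
     norm (mulL S (FTL (abs_L2 g))) \<le> A * C * (1 + t) powr (- (real DIM('a) / (2 * \<sigma>) * (1 / m - 1 / 2)) - j) * (Lp_norm m g + norm (abs_L2 g))"
proof -
  define \<alpha> where "\<alpha> = real DIM('a) / (2 * \<sigma>) * (1 / m - 1 / 2)"
  have \<alpha>: "\<alpha> \<ge> 0" using \<sigma> m by (simp add: \<alpha>_def field_simps)
  \<comment> \<open>The exponent \<alpha> + 1 serves all orders j <= 1 at once.\<close>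
  obtain C1 where C1: "C1 > 0" "\<And>t::real. t \<ge> 0 \<Longrightarrow> exp (- t / 4) \<le> C1 * (1 + t) powr (- (\<alpha> + 1))"
    using exp_decay_powr[of "\<alpha> + 1"] \<alpha> by auto
  obtain C2 where C2: "C2 > 0" "\<And>s (g::'a::euclidean_space \<Rightarrow> complex). s > 0 \<Longrightarrow> g \<in> sqint \<Longrightarrow> g \<in> Lp m \<Longrightarrow>
    norm (mulL (heat \<sigma> s) (FTL (abs_L2 g))) \<le> C2 * s powr (- \<alpha>) * Lp_norm m g"
    using heat_Lm_L2[OF \<sigma> m, where 'a = 'a] unfolding \<alpha>_def minus_divide_left minus_mult_left by metis
  define C where "C = 5 * C1 + 4 * exp (1/4) * C2 * (1 / 4) powr (- \<alpha>)"
  have C: "C > 0" unfolding C_def using C1 C2 by (intro add_pos_nonneg) auto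
  show thesis
  proof (rule that[OF C])
    fix j A t :: real and S :: "'a \<Rightarrow> real" and g :: "'a \<Rightarrow> complex"
    assume S: "symb_order \<sigma> j A t S" and j: "0 \<le> j" "j \<le> 1" and t: "t \<ge> 0" and g: "g \<in> sqint" "g \<in> Lp m"
    have A: "A \<ge> 0" using S by (simp add: symb_order_def)
    have tj: "(1 + t) powr (- j) * (1 + t) powr (- \<alpha>) = (1 + t) powr (- \<alpha> - j)"
    proof -
      have "- j + - \<alpha> = - \<alpha> - j" by simp
      then show ?thesis by (simp only: powr_add[symmetric])
    qed
    let ?h = "heat \<sigma> ((1 + t) / 4) :: 'a \<Rightarrow> real"
    have hb: "bmult 1 ?h" using t by (intro heat_bmult) auto
    \<comment> \<open>The two frequency regimes are added instead of distinguished, so that the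
      operator splits into a multiple of the identity and a heat operator. The 5 collects C1 from
      exp(-t) and 4 C1 from the other term.\<close>
    define N where "N \<xi> = 5 * C1 * (1 + t) powr (- \<alpha> - j) + 4 * exp (1/4) * (1 + t) powr (- j) * ?h \<xi>" for \<xi> :: 'a
    have SN: "\<bar>S \<xi>\<bar> \<le> A * N \<xi>" for \<xi>
    proof -
      have b: "exp (- t / 4) \<le> C1 * (1 + t) powr (- \<alpha> - j)"
        using C1(1) t j by (intro order_trans[OF C1(2)[OF t]] mult_left_mono powr_mono) auto
      have 1: "exp (- t) \<le> C1 * (1 + t) powr (- \<alpha> - j)"
        using t by (intro order_trans[OF _ b]) simp
      have cut: "lowp j (low \<sigma> \<xi>) * exp (- t * low \<sigma> \<xi> / 2)
          \<le> 4 * C1 * (1 + t) powr (- \<alpha> - j) + 4 * exp (1/4) * (1 + t) powr (- j) * ?h \<xi>"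
      proof (cases "norm \<xi> powr (2 * \<sigma>) \<le> 1")
        case True
        then have l: "low \<sigma> \<xi> = norm \<xi> powr (2 * \<sigma>)" by (simp add: low_def)
        have e: "exp (- t * low \<sigma> \<xi> / 4) \<le> exp (1/4) * ?h \<xi>"
          using True by (simp add: l heat_def algebra_simps flip: exp_add)
        have "lowp j (low \<sigma> \<xi>) * exp (- t * low \<sigma> \<xi> / 2) = (lowp j (low \<sigma> \<xi>) * exp (- t * low \<sigma> \<xi> / 4)) * exp (- t * low \<sigma> \<xi> / 4)"
          by (simp add: mult.assoc flip: exp_add)
        also have "\<dots> \<le> (4 * (1 + t) powr (- j)) * (exp (1/4) * ?h \<xi>)"
          using j t by (intro mult_mono e lowp_decay) auto
        also have "\<dots> \<le> 4 * C1 * (1 + t) powr (- \<alpha> - j) + 4 * exp (1/4) * (1 + t) powr (- j) * ?h \<xi>"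
          using C1 by (simp add: mult_ac)
        finally show ?thesis .
      next
        case False
        then have l: "low \<sigma> \<xi> = 1" by (simp add: low_def)
        have "lowp j (low \<sigma> \<xi>) * exp (- t * low \<sigma> \<xi> / 2) = exp (- t / 2)"
          by (simp add: l lowp_def)
        also have "\<dots> \<le> exp (- t / 4)" using t by simp
        also note b
        also have "C1 * (1 + t) powr (- \<alpha> - j) \<le> 4 * C1 * (1 + t) powr (- \<alpha> - j) + 4 * exp (1/4) * (1 + t) powr (- j) * ?h \<xi>"
          using C1 by (intro add_increasing2) (auto simp: heat_def)
        finally show ?thesis .
      qed
      have "exp (- t) + lowp j (low \<sigma> \<xi>) * exp (- t * low \<sigma> \<xi> / 2) \<le> N \<xi>"
        using add_mono[OF 1 cut] by (simp add: N_def)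
      from mult_left_mono[OF this A] show ?thesis using S by (auto simp: symb_order_def intro: order_trans)
    qed
    have h1: "bmult (5 * C1 * (1 + t) powr (- \<alpha> - j)) (\<lambda>_::'a. 5 * C1 * (1 + t) powr (- \<alpha> - j))"
      using C1 by (intro bmult_const) auto
    have h2: "bmult (\<bar>4 * exp (1/4) * (1 + t) powr (- j)\<bar> * 1) (\<lambda>\<xi>. 4 * exp (1/4) * (1 + t) powr (- j) * ?h \<xi>)"
      by (rule bmult_cmult[OF hb])
    have N: "bmult (5 * C1 * (1 + t) powr (- \<alpha> - j) + \<bar>4 * exp (1/4) * (1 + t) powr (- j)\<bar> * 1) N"
      unfolding N_def by (rule bmult_add[OF h1 h2])
    have N0: "N \<xi> \<ge> 0" for \<xi> using C1 by (simp add: N_def heat_def)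
    let ?G = "FTL (abs_L2 g)"
    have c: "mulL (\<lambda>\<xi>. 4 * exp (1/4) * (1 + t) powr (- j) * ?h \<xi>) ?G = (4 * exp (1/4) * (1 + t) powr (- j)) *\<^sub>R mulL ?h ?G"
      using mulL_mulL[OF bmult_const[OF order_refl] hb, of "4 * exp (1/4) * (1 + t) powr (- j)" ?G] by (simp add: mulL_const)
    have "norm (mulL S ?G) \<le> A * norm (mulL N ?G)"
      by (rule norm_mulL_mono[OF symb_order_bmult[OF S j(1) t] N A]) (use SN N0 in simp)
    also have "mulL N ?G = (5 * C1 * (1 + t) powr (- \<alpha> - j)) *\<^sub>R ?G + (4 * exp (1/4) * (1 + t) powr (- j)) *\<^sub>R mulL ?h ?G"
      unfolding N_def mulL_plus[OF h1 h2] c by (simp only: mulL_const)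
    also have "norm \<dots> \<le> 5 * C1 * (1 + t) powr (- \<alpha> - j) * norm ?G + 4 * exp (1/4) * (1 + t) powr (- j) * norm (mulL ?h ?G)"
      by (rule order_trans[OF norm_triangle_ineq]) (use C1 in simp)
    also have "\<dots> \<le> 5 * C1 * (1 + t) powr (- \<alpha> - j) * norm (abs_L2 g)
        + 4 * exp (1/4) * (1 + t) powr (- j) * (C2 * ((1 + t) / 4) powr (- \<alpha>) * Lp_norm m g)"
      using t C1 by (intro add_mono mult_left_mono C2 g) auto
    also have "((1 + t) / 4) powr (- \<alpha>) = (1 + t) powr (- \<alpha>) * (1 / 4) powr (- \<alpha>)"
      using t by (simp flip: powr_mult)
    also have "5 * C1 * (1 + t) powr (- \<alpha> - j) * norm (abs_L2 g)
        + 4 * exp (1/4) * (1 + t) powr (- j) * (C2 * ((1 + t) powr (- \<alpha>) * (1 / 4) powr (- \<alpha>)) * Lp_norm m g)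
      = (1 + t) powr (- \<alpha> - j) * (5 * C1 * norm (abs_L2 g) + 4 * exp (1/4) * C2 * (1 / 4) powr (- \<alpha>) * Lp_norm m g)"
      by (simp only: tj[symmetric] distrib_left mult_ac)
    also have "\<dots> \<le> (1 + t) powr (- \<alpha> - j) * (C * norm (abs_L2 g) + C * Lp_norm m g)"
      using C1 C2 unfolding C_def by (intro mult_left_mono add_mono mult_right_mono) auto
    finally have "norm (mulL S ?G) \<le> A * ((1 + t) powr (- \<alpha> - j) * (C * norm (abs_L2 g) + C * Lp_norm m g))"
      using A by (simp add: mult_left_mono)
    also have "\<dots> = A * C * (1 + t) powr (- \<alpha> - j) * (Lp_norm m g + norm (abs_L2 g))"
      by (simp add: algebra_simps)
    finally show "norm (mulL S ?G) \<le> A * C * (1 + t) powr (- (real DIM('a) / (2 * \<sigma>) * (1 / m - 1 / 2)) - j) * (Lp_norm m g + norm (abs_L2 g))"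
      by (simp add: \<alpha>_def)
  qed
qed

section \<open>The nonlinearity in time weighted spaces\<close>

lemma sqint_cong_AE:
  assumes f: "f \<in> borel_measurable borel" and g: "g \<in> sqint" and eq: "AE x in lborel. f x = g x"
  shows "f \<in> sqint"
proof -
  have [measurable]: "f \<in> borel_measurable borel" "g \<in> borel_measurable borel"
    using f g by (auto dest: sqint_measurable)
  have "integrable lborel (\<lambda>x. (norm (f x))\<^sup>2) \<longleftrightarrow> integrable lborel (\<lambda>x. (norm (g x))\<^sup>2)"
    by (rule integrable_cong_AE) (use eq in \<open>auto elim!: eventually_mono\<close>)
  then show ?thesis using sqint_integrable[OF g] f by (simp add: sqint_def)
qed

lemma Lp_cong_AE:
  fixes f g :: "'a::euclidean_space \<Rightarrow> complex"
  assumes f: "f \<in> borel_measurable lebesgue" and g: "g \<in> borel_measurable lebesgue"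
    and eq: "AE x in lebesgue. f x = g x"
  shows "f \<in> Lp q \<longleftrightarrow> g \<in> Lp q" "Lp_norm q f = Lp_norm q g"
proof -
  note [measurable] = f g
  have "integrable lebesgue (\<lambda>x. norm (f x) powr q) \<longleftrightarrow> integrable lebesgue (\<lambda>x. norm (g x) powr q)"
    by (rule integrable_cong_AE) (use eq in \<open>auto elim!: eventually_mono\<close>)
  then show "f \<in> Lp q \<longleftrightarrow> g \<in> Lp q" by (simp add: Lp_def f g)
  have "(LINT x|lebesgue. norm (f x) powr q) = (LINT x|lebesgue. norm (g x) powr q)"
    by (rule integral_cong_AE) (use eq in \<open>auto elim!: eventually_mono\<close>)
  then show "Lp_norm q f = Lp_norm q g" by (simp add: Lp_norm_def)
qed

lemma Lp_cong_AE_borel: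
  fixes f g :: "'a::euclidean_space \<Rightarrow> complex"
  assumes f: "f \<in> borel_measurable borel" and g: "g \<in> borel_measurable borel"
    and eq: "AE x in lborel. f x = g x"
  shows "f \<in> Lp q \<longleftrightarrow> g \<in> Lp q" "Lp_norm q f = Lp_norm q g"
proof -
  have "f \<in> borel_measurable lebesgue" "g \<in> borel_measurable lebesgue"
    using f g by (auto intro!: measurable_completion)
  from Lp_cong_AE[OF this AE_completion[OF eq]]
  show "f \<in> Lp q \<longleftrightarrow> g \<in> Lp q" "Lp_norm q f = Lp_norm q g" .
qed

locale damped_wave =
  fixes dim :: "'a::euclidean_space itself" and \<sigma> p m n :: real
  assumes n: "n = real DIM('a)"
    and \<sigma>: "\<sigma> \<ge> 1" and p: "p > 1" and m: "1 \<le> m" "m < 2"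
    and crit: "(n \<le> 2 * \<sigma> \<and> 2 / m \<le> p) \<or>
         (2 * \<sigma> < n \<and> n \<le> 4 * \<sigma> / (2 - m) \<and> 2 / m \<le> p \<and> p \<le> n / (n - 2 * \<sigma>))"
    and fujita: "p > 1 + 2 * m * \<sigma> / n"
begin

definition "\<alpha> = n / (2 * \<sigma>) * (1 / m - 1 / 2)"
definition "\<beta> = n * (p - 1) / (2 * m * \<sigma>)"

lemma n_pos: "n > 0" by (simp add: n)

lemma \<alpha>_nonneg: "\<alpha> \<ge> 0"
  using n_pos \<sigma> m by (simp add: \<alpha>_def field_simps)

lemma \<beta>_gt_1: "\<beta> > 1"
  using n_pos \<sigma> m fujita by (simp add: \<beta>_def field_simps)

text \<open>The weight of the solution space: \<open>X\<close> bounded in \<open>L\<^sup>2\<close> stands for the function with Fourier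
  transform \<open>X / Wt t\<close>.\<close>

definition Wt :: "real \<Rightarrow> 'a \<Rightarrow> real" where
  "Wt t \<xi> = (1 + t) powr \<alpha> * (1 + (1 + t) powr (1/2) * hs \<sigma> \<xi>)"

definition iW :: "real \<Rightarrow> 'a \<Rightarrow> real" where "iW t \<xi> = 1 / Wt t \<xi>"

lemma Wt_measurable [measurable]: "Wt t \<in> borel_measurable borel"
  unfolding Wt_def by measurable

lemma iW_measurable [measurable]: "iW t \<in> borel_measurable borel"
  unfolding iW_def by measurable

lemma one_plus_pos: "1 + c * hs \<sigma> (\<xi>::'a) > 0" if "c \<ge> 0"
  using that by (intro add_pos_nonneg) auto

lemma Wt_pos: "t \<ge> 0 \<Longrightarrow> Wt t \<xi> > 0"
  unfolding Wt_def by (intro mult_pos_pos one_plus_pos) auto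

lemma powr_le_one_plus:
  fixes x \<theta> :: real
  assumes "0 \<le> \<theta>" "\<theta> \<le> 1" "0 \<le> x"
  shows "x powr \<theta> \<le> 1 + x"
proof -
  have "x powr \<theta> \<le> (1 + x) powr \<theta>" using assms by (intro powr_mono2) auto
  also have "\<dots> \<le> (1 + x) powr 1" using assms by (intro powr_mono) auto
  finally show ?thesis using assms by simp
qed

text \<open>With x = (1 + t)^(1/2) |\<xi>|^\<sigma> the inequality x^\<theta> <= 1 + x shows that
  the weight controls the fraction \<theta> of \<sigma> derivatives, with the gain (1 +
  t)^(-\<theta>/2).\<close>

lemma iW_bmult_powr:
  assumes t: "t \<ge> 0" and \<theta>: "0 < \<theta>" "\<theta> \<le> 1"
  shows "bmult ((1 + t) powr (- \<alpha> - \<theta> / 2)) (\<lambda>\<xi>. hs \<sigma> \<xi> powr \<theta> * iW t \<xi>)"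
  unfolding bmult_def
proof safe
  fix \<xi> :: 'a
  define T where "T = (1 + t) powr (1/2)"
  have T: "T > 0" using t by (simp add: T_def)
  have "T powr \<theta> * hs \<sigma> \<xi> powr \<theta> = (T * hs \<sigma> \<xi>) powr \<theta>" using T by (simp add: powr_mult)
  also have "\<dots> \<le> 1 + T * hs \<sigma> \<xi>" using T \<theta> by (intro powr_le_one_plus) auto
  finally have h: "hs \<sigma> \<xi> powr \<theta> \<le> T powr (- \<theta>) * (1 + T * hs \<sigma> \<xi>)"
    using T by (simp add: powr_minus field_simps)
  have W: "Wt t \<xi> = (1 + t) powr \<alpha> * (1 + T * hs \<sigma> \<xi>)" by (simp add: Wt_def T_def)
  have "hs \<sigma> \<xi> powr \<theta> * iW t \<xi> \<le> (T powr (- \<theta>) * (1 + T * hs \<sigma> \<xi>)) * iW t \<xi>"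
    using Wt_pos[OF t, of \<xi>] by (intro mult_right_mono h) (simp add: iW_def)
  also have "\<dots> = T powr (- \<theta>) * (1 + t) powr (- \<alpha>)"
  proof -
    define P where "P = 1 + T * hs \<sigma> \<xi>"
    have "P > 0" unfolding P_def using T by (intro one_plus_pos) simp
    then show ?thesis
      unfolding iW_def W P_def[symmetric] by (simp add: powr_minus divide_inverse)
  qed
  also have "\<dots> = (1 + t) powr (- \<alpha> - \<theta> / 2)"
  proof -
    have "1 / 2 * (- \<theta>) + - \<alpha> = - \<alpha> - \<theta> / 2" by simp
    then show ?thesis by (simp only: T_def powr_powr powr_add[symmetric])
  qed
  finally show "\<bar>hs \<sigma> \<xi> powr \<theta> * iW t \<xi>\<bar> \<le> (1 + t) powr (- \<alpha> - \<theta> / 2)"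
    using Wt_pos[OF t, of \<xi>] by (simp add: iW_def)
qed measurable

lemma iW_bmult: "t \<ge> 0 \<Longrightarrow> bmult ((1 + t) powr (- \<alpha>)) (iW t)"
  unfolding bmult_def
proof safe
  fix \<xi> :: 'a assume t: "t \<ge> 0"
  have "(1 + t) powr \<alpha> * 1 \<le> Wt t \<xi>"
    unfolding Wt_def by (intro mult_left_mono) auto
  then have "1 / Wt t \<xi> \<le> 1 / (1 + t) powr \<alpha>"
    using t by (intro divide_left_mono mult_pos_pos Wt_pos) auto
  then show "\<bar>iW t \<xi>\<bar> \<le> (1 + t) powr (- \<alpha>)"
    using Wt_pos[OF t, of \<xi>] by (simp add: iW_def powr_minus field_simps)
qed measurable

section \<open>The function behind a weighted spectrum, and its L^q norms\<close>

definition uval :: "real \<Rightarrow> 'a L2 \<Rightarrow> 'a \<Rightarrow> complex" where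
  "uval t X = rep_L2 (iFTL (mulL (iW t) X))"

lemma uval_measurable [measurable]: "uval t X \<in> borel_measurable borel"
  by (simp add: uval_def)

lemma uval_diff:
  assumes t: "t \<ge> 0"
  shows "AE x in lborel. uval t (X - Y) x = uval t X x - uval t Y x"
  unfolding uval_def mulL_diff[OF iW_bmult[OF t]] linear_diff[OF iFTL_linear] by (rule rep_L2_diff)

text \<open>This plays the role of the Gagliardo-Nirenberg inequality. The embedding into L^q takes
  s = n (1/2 - 1/q) derivatives, the fraction \<theta> = s / \<sigma> of those under control, and
  the hypothesis \<open>qs\<close> says \<theta> <= 1. The case q = 2 stands apart because the
  critical embedding asks for s > 0.\<close>

lemma Sobolev_weighted:
  assumes q: "q \<ge> 2" and qs: "n * (1 / 2 - 1 / q) \<le> \<sigma>"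
  obtains C where "C > 0" "\<And>t X. t \<ge> 0 \<Longrightarrow> uval t X \<in> Lp q \<and>
    Lp_norm q (uval t X) \<le> C * (1 + t) powr (- \<alpha> - n / (2 * \<sigma>) * (1 / 2 - 1 / q)) * norm X"
proof (cases "q = 2")
  case True
  have "uval t X \<in> Lp q \<and> Lp_norm q (uval t X) \<le> 1 * (1 + t) powr (- \<alpha> - n / (2 * \<sigma>) * (1 / 2 - 1 / q)) * norm X"
    if t: "t \<ge> 0" for t X
  proof
    have s: "uval t X \<in> sqint" by (simp add: uval_def)
    then show "uval t X \<in> Lp q" using sqint_iff_Lp2[of "uval t X"] True by simp
    have "Lp_norm 2 (uval t X) = norm (mulL (iW t) X)"
      using norm_abs_L2_eq[OF s] by (simp add: uval_def)
    then show "Lp_norm q (uval t X) \<le> 1 * (1 + t) powr (- \<alpha> - n / (2 * \<sigma>) * (1 / 2 - 1 / q)) * norm X"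
      using norm_mulL_le[OF iW_bmult[OF t], of X] True by simp
  qed
  then show ?thesis using that[of 1] by auto
next
  case False
  with q have q: "q > 2" by simp
  define s where "s = n * (1 / 2 - 1 / q)"
  have s: "s > 0" "2 * s < n" using q n_pos by (auto simp: s_def field_simps)
  have qn: "q = 2 * real DIM('a) / (real DIM('a) - 2 * s)"
  proof -
    have "n - 2 * s = 2 * n / q" by (simp add: s_def right_diff_distrib)
    then show ?thesis using n_pos q by (simp flip: n)
  qed
  obtain C where C: "C > 0" "\<And>G::'a L2. (\<lambda>\<xi>. norm \<xi> powr s *\<^sub>R rep_L2 G \<xi>) \<in> sqint \<Longrightarrow>
    rep_L2 (iFTL G) \<in> Lp q \<and> Lp_norm q (rep_L2 (iFTL G)) \<le> C * norm (abs_L2 (\<lambda>\<xi>. norm \<xi> powr s *\<^sub>R rep_L2 G \<xi>))"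
    using Sobolev_critical[OF s(1) _ qn] s(2) n by metis
  define \<theta> where "\<theta> = s / \<sigma>"
  have \<theta>: "0 < \<theta>" "\<theta> \<le> 1" using s \<sigma> qs by (auto simp: \<theta>_def s_def)
  have hp: "hs \<sigma> \<xi> powr \<theta> = norm \<xi> powr s" for \<xi> :: 'a
    using \<sigma> by (simp add: hs_def powr_powr \<theta>_def)
  have ex: "\<theta> / 2 = n / (2 * \<sigma>) * (1 / 2 - 1 / q)" by (simp add: \<theta>_def s_def)
  show ?thesis
  proof (rule that[OF C(1)])
    fix t :: real and X :: "'a L2" assume t: "(t::real) \<ge> 0"
    note b = iW_bmult_powr[OF t \<theta>, unfolded hp]
    define G where "G = mulL (iW t) X"
    have ae: "AE \<xi> in lborel. norm \<xi> powr s *\<^sub>R rep_L2 G \<xi> = (norm \<xi> powr s * iW t \<xi>) *\<^sub>R rep_L2 X \<xi>"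
      using rep_abs_L2[OF bmult_sqint[OF iW_bmult[OF t] rep_L2_sqint, of X]]
      unfolding G_def mulL_def by eventually_elim simp
    have sq: "(\<lambda>\<xi>. norm \<xi> powr s *\<^sub>R rep_L2 G \<xi>) \<in> sqint"
      by (rule sqint_cong_AE[OF _ bmult_sqint[OF b rep_L2_sqint] ae]) measurable
    have "abs_L2 (\<lambda>\<xi>. norm \<xi> powr s *\<^sub>R rep_L2 G \<xi>) = mulL (\<lambda>\<xi>. norm \<xi> powr s * iW t \<xi>) X"
      unfolding mulL_def by (subst abs_L2_eq_iff[OF sq bmult_sqint[OF b rep_L2_sqint]]) (rule ae)
    then have "C * norm (abs_L2 (\<lambda>\<xi>. norm \<xi> powr s *\<^sub>R rep_L2 G \<xi>)) \<le> C * ((1 + t) powr (- \<alpha> - \<theta> / 2) * norm X)"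
      using norm_mulL_le[OF b, of X] C(1) by (intro mult_left_mono) auto
    with C(2)[OF sq] show "uval t X \<in> Lp q \<and>
      Lp_norm q (uval t X) \<le> C * (1 + t) powr (- \<alpha> - n / (2 * \<sigma>) * (1 / 2 - 1 / q)) * norm X"
      unfolding uval_def G_def[symmetric] ex[symmetric] by (auto simp: mult.assoc)
  qed
qed

lemma abs_powr_measurable [measurable]:
  "f \<in> borel_measurable borel \<Longrightarrow> abs_powr q f \<in> borel_measurable borel"
  unfolding abs_powr_def by measurable

text \<open>A difference of p-th powers is homogeneous of degree p, so in L^k it decays with p times
  the rate of the function in L^(pk).\<close>

lemma nonlinear_k:
  assumes k: "k \<ge> 1" "p * k \<ge> 2" "n * (1 / 2 - 1 / (p * k)) \<le> \<sigma>"
  obtains C where "C > 0" "\<And>t X Y. t \<ge> 0 \<Longrightarrow>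
    (\<lambda>x. abs_powr p (uval t X) x - abs_powr p (uval t Y) x) \<in> Lp k \<and>
    Lp_norm k (\<lambda>x. abs_powr p (uval t X) x - abs_powr p (uval t Y) x)
      \<le> C * (1 + t) powr (- (n / (2 * \<sigma>) * (p / m - 1 / k))) * (norm (X - Y) * (norm X + norm Y) powr (p - 1))"
proof -
  obtain C where C: "C > 0" "\<And>t X. t \<ge> 0 \<Longrightarrow> uval t X \<in> Lp (p * k) \<and>
    Lp_norm (p * k) (uval t X) \<le> C * (1 + t) powr (- \<alpha> - n / (2 * \<sigma>) * (1 / 2 - 1 / (p * k))) * norm X"
    using Sobolev_weighted[OF k(2,3)] by metis
  define a where "a = - \<alpha> - n / (2 * \<sigma>) * (1 / 2 - 1 / (p * k))"
  \<comment> \<open>The rate of the function in L^(pk) is n / (2\<sigma>) (1/m - 1/(pk)), because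
    the 1/2 in \<alpha> cancels against that of the embedding.\<close>
  have pa: "a * p = - (n / (2 * \<sigma>) * (p / m - 1 / k))"
    using p k \<sigma> m by (simp add: a_def \<alpha>_def field_simps)
  show ?thesis
  proof (rule that[of "p * C * (2 * C) powr (p - 1)"])
    show "p * C * (2 * C) powr (p - 1) > 0" using C p by simp
    fix t :: real and X Y :: "'a L2" assume t: "(t::real) \<ge> 0"
    define e where "e = (1 + t) powr a"
    have e: "e > 0" using t by (simp add: e_def)
    have ep: "e * e powr (p - 1) = (1 + t) powr (- (n / (2 * \<sigma>) * (p / m - 1 / k)))"
      unfolding pa[symmetric] e_def powr_powr using t by (simp add: algebra_simps flip: powr_add)
    let ?D = "C * e * norm (X - Y)" and ?E = "C * e * norm X" and ?F = "C * e * norm Y"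
    have b: "uval t X \<in> Lp (p * k)" "Lp_norm (p * k) (uval t X) \<le> C * e * norm X" for X
      using C(2)[OF t, of X] by (auto simp: e_def a_def)
    have d: "(\<lambda>x. uval t X x - uval t Y x) \<in> Lp (p * k)" "Lp_norm (p * k) (\<lambda>x. uval t X x - uval t Y x) \<le> ?D"
      using b[of "X - Y"] Lp_cong_AE_borel[OF _ _ uval_diff[OF t, of X Y], of "p * k"] by auto
    have "p * ?D * (2 * (?E + ?F)) powr (p - 1) = p * ?D * ((2 * C) * e * (norm X + norm Y)) powr (p - 1)"
      by (simp add: algebra_simps)
    also have "\<dots> = p * ?D * ((2 * C) powr (p - 1) * e powr (p - 1) * (norm X + norm Y) powr (p - 1))"
      using C e by (simp add: powr_mult)
    also have "\<dots> = p * C * (2 * C) powr (p - 1) * (e * e powr (p - 1)) * (norm (X - Y) * (norm X + norm Y) powr (p - 1))"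
      by (simp only: mult_ac)
    finally have eq: "p * ?D * (2 * (?E + ?F)) powr (p - 1) = \<dots>" .
    show "(\<lambda>x. abs_powr p (uval t X) x - abs_powr p (uval t Y) x) \<in> Lp k \<and>
      Lp_norm k (\<lambda>x. abs_powr p (uval t X) x - abs_powr p (uval t Y) x)
      \<le> p * C * (2 * C) powr (p - 1) * (1 + t) powr (- (n / (2 * \<sigma>) * (p / m - 1 / k))) * (norm (X - Y) * (norm X + norm Y) powr (p - 1))"
      unfolding ep[symmetric] eq[symmetric]
      using C e by (intro conjI Lp_diff_abs_powr[OF _ _ p k(1) _ d _ b[of X] _ b[of Y]]) auto
  qed
qed

lemma uval_0: "t \<ge> 0 \<Longrightarrow> AE x in lborel. uval t 0 x = 0"
  using rep_L2_zero by (simp add: uval_def mulL_zero[OF iW_bmult] linear_0[OF iFTL_linear])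

text \<open>The shape anticipates the hypotheses of \<open>duhamel_kernel\<close>: one common factor
  \<open>Z\<close>, and all dependence on time in the two powers of 1 + t.\<close>

definition nl_bound :: "real \<Rightarrow> bool" where
  "nl_bound C \<longleftrightarrow> C > 0 \<and> (\<forall>t X Y. t \<ge> 0 \<longrightarrow>
    (let g = (\<lambda>x. abs_powr p (uval t X) x - abs_powr p (uval t Y) x);
         Z = C * (norm (X - Y) * (norm X + norm Y) powr (p - 1)) in
     g \<in> Lp m \<and> g \<in> sqint \<and> Lp_norm m g \<le> (1 + t) powr (- \<beta>) * Z \<and>
     norm (abs_L2 g) \<le> (1 + t) powr (- \<beta> - \<alpha>) * Z))"

text \<open>These are the exponents k = m and k = 2 of \<open>nonlinear_k\<close>. For k = m the
  condition p k >= 2 is p >= 2/m. For k = 2 the Sobolev condition is p <= n / (n - 2\<sigma>), or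
  automatic when n <= 2\<sigma>; for k = m it then follows from m < 2.\<close>

lemma nonlinear_bound: obtains C where "nl_bound C"
proof -
  have pm: "p * m \<ge> 2" using crit m by (auto simp: field_simps)
  have p2: "p * 2 \<ge> 2" using p by simp
  have mono: "n * (1 / 2 - 1 / (p * m)) \<le> n * (1 / 2 - 1 / (p * 2))"
    using n_pos p m by (intro mult_left_mono diff_left_mono divide_left_mono) auto
  have k2: "n * (1 / 2 - 1 / (p * 2)) \<le> \<sigma>"
  proof (cases "n \<le> 2 * \<sigma>")
    case True
    have "n * (1 / 2 - 1 / (p * 2)) \<le> n * (1 / 2)" using n_pos p by (intro mult_left_mono) auto
    then show ?thesis using True by simp
  next
    case False
    then have "p * (n - 2 * \<sigma>) \<le> n" using crit by (auto simp: field_simps)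
    then show ?thesis using p by (simp add: field_simps)
  qed
  obtain C1 where C1: "C1 > 0" "\<And>t X Y. t \<ge> 0 \<Longrightarrow>
    (\<lambda>x. abs_powr p (uval t X) x - abs_powr p (uval t Y) x) \<in> Lp m \<and>
    Lp_norm m (\<lambda>x. abs_powr p (uval t X) x - abs_powr p (uval t Y) x)
      \<le> C1 * (1 + t) powr (- (n / (2 * \<sigma>) * (p / m - 1 / m))) * (norm (X - Y) * (norm X + norm Y) powr (p - 1))"
    by (rule nonlinear_k[OF m(1) pm order_trans[OF mono k2]]) (rule that)
  obtain C2 where C2: "C2 > 0" "\<And>t X Y. t \<ge> 0 \<Longrightarrow>
    (\<lambda>x. abs_powr p (uval t X) x - abs_powr p (uval t Y) x) \<in> Lp 2 \<and>
    Lp_norm 2 (\<lambda>x. abs_powr p (uval t X) x - abs_powr p (uval t Y) x)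
      \<le> C2 * (1 + t) powr (- (n / (2 * \<sigma>) * (p / m - 1 / 2))) * (norm (X - Y) * (norm X + norm Y) powr (p - 1))"
    by (rule nonlinear_k[OF one_le_numeral p2 k2]) (rule that)
  have e1: "- (n / (2 * \<sigma>) * (p / m - 1 / m)) = - \<beta>"
    using \<sigma> m by (simp add: \<beta>_def field_simps)
  have e2: "- (n / (2 * \<sigma>) * (p / m - 1 / 2)) = - \<beta> - \<alpha>"
    using \<sigma> m by (simp add: \<beta>_def \<alpha>_def field_simps)
  have "nl_bound (C1 + C2)"
    unfolding nl_bound_def Let_def
  proof (intro conjI allI impI)
    show "C1 + C2 > 0" using C1 C2 by simp
    fix t :: real and X Y :: "'a L2" assume t: "(t::real) \<ge> 0"
    let ?g = "\<lambda>x. abs_powr p (uval t X) x - abs_powr p (uval t Y) x"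
    let ?Z = "norm (X - Y) * (norm X + norm Y) powr (p - 1)"
    show "?g \<in> Lp m" using C1(2)[OF t] by auto
    have gm: "?g \<in> borel_measurable borel" by measurable
    then show gs: "?g \<in> sqint" using C2(2)[OF t, of X Y] by (simp add: sqint_iff_Lp2[OF gm])
    have "C1 * (1 + t) powr (- \<beta>) * ?Z \<le> (C1 + C2) * (1 + t) powr (- \<beta>) * ?Z"
      using C2(1) by (intro mult_right_mono) auto
    then show "Lp_norm m ?g \<le> (1 + t) powr (- \<beta>) * ((C1 + C2) * ?Z)"
      using C1(2)[OF t, of X Y] unfolding e1 by (auto simp: mult_ac)
    have "C2 * (1 + t) powr (- \<beta> - \<alpha>) * ?Z \<le> (C1 + C2) * (1 + t) powr (- \<beta> - \<alpha>) * ?Z"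
      using C1(1) by (intro mult_right_mono) auto
    then show "norm (abs_L2 ?g) \<le> (1 + t) powr (- \<beta> - \<alpha>) * ((C1 + C2) * ?Z)"
      using C2(2)[OF t, of X Y] unfolding norm_abs_L2_eq[OF gs] e2 by (auto simp: mult_ac)
  qed
  then show ?thesis by (rule that)
qed

lemma abs_powr_uval:
  assumes "nl_bound C" and t: "t \<ge> 0"
  shows "abs_powr p (uval t X) \<in> sqint"
proof (rule sqint_cong_AE)
  show "(\<lambda>x. abs_powr p (uval t X) x - abs_powr p (uval t 0) x) \<in> sqint"
    using assms by (auto simp: nl_bound_def Let_def)
  show "AE x in lborel. abs_powr p (uval t X) x = abs_powr p (uval t X) x - abs_powr p (uval t 0) x"
    using uval_0[OF t] by eventually_elim (simp add: abs_powr_def)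
qed measurable

lemma abs_powr_uval_sqint: "t \<ge> 0 \<Longrightarrow> abs_powr p (uval t X) \<in> sqint"
  using nonlinear_bound abs_powr_uval by metis

section \<open>The nonlinearity as a map between spectra, and its Duhamel kernel\<close>

definition NL :: "real \<Rightarrow> 'a L2 \<Rightarrow> 'a L2" where
  "NL t X = FTL (abs_L2 (abs_powr p (uval t X)))"

lemma NL_diff:
  "t \<ge> 0 \<Longrightarrow> NL t X - NL t Y = FTL (abs_L2 (\<lambda>x. abs_powr p (uval t X) x - abs_powr p (uval t Y) x))"
  by (simp add: NL_def abs_L2_diff abs_powr_uval_sqint flip: linear_diff[OF FTL_linear])

lemma NL_0: "t \<ge> 0 \<Longrightarrow> NL t 0 = 0"
proof -
  assume t: "t \<ge> 0"
  have "AE x in lborel. abs_powr p (uval t 0) x = 0"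
    using uval_0[OF t] by eventually_elim (simp add: abs_powr_def)
  then have "abs_L2 (abs_powr p (uval t 0)) = 0"
    using abs_L2_eq_iff[OF abs_powr_uval_sqint[OF t] sqint_zero] by (simp add: abs_L2_zero)
  then show ?thesis by (simp add: NL_def linear_0[OF FTL_linear])
qed

text \<open>For \<open>\<tau> \<le> t / 2\<close> the kernel carries the decay, for \<open>\<tau> \<ge> t / 2\<close> the source does.\<close>

lemma duhamel_kernel:
  obtains C where "C > 0" "\<And>j A S t \<tau> (g::'a \<Rightarrow> complex) Z. 0 \<le> j \<Longrightarrow> j \<le> 1 \<Longrightarrow> 0 \<le> \<tau> \<Longrightarrow> \<tau> \<le> t \<Longrightarrow>
    symb_order \<sigma> j A (t - \<tau>) S \<Longrightarrow> g \<in> sqint \<Longrightarrow> g \<in> Lp m \<Longrightarrow> 0 \<le> Z \<Longrightarrow>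
    Lp_norm m g \<le> (1 + \<tau>) powr (- \<beta>) * Z \<Longrightarrow> norm (abs_L2 g) \<le> (1 + \<tau>) powr (- \<beta> - \<alpha>) * Z \<Longrightarrow>
    norm (mulL S (FTL (abs_L2 g))) \<le> A * C * (1 + t) powr (- \<alpha> - j) * ((1 + \<tau>) powr (- \<beta>) + (1 + (t - \<tau>)) powr (- \<beta>)) * Z"
proof -
  obtain C2 where C2: "C2 > 0" "\<And>j A t S (U::'a L2). symb_order \<sigma> j A t S \<Longrightarrow> 0 \<le> j \<Longrightarrow> j \<le> 1 \<Longrightarrow> t \<ge> 0 \<Longrightarrow>
     norm (mulL S U) \<le> A * C2 * (1 + t) powr (- j) * norm U"
    using symb_order_L2 by metis
  obtain Cm where Cm: "Cm > 0" "\<And>j A t S (g::'a \<Rightarrow> complex). symb_order \<sigma> j A t S \<Longrightarrow> 0 \<le> j \<Longrightarrow> j \<le> 1 \<Longrightarrow> t \<ge> 0 \<Longrightarrow>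
     g \<in> sqint \<Longrightarrow> g \<in> Lp m \<Longrightarrow>
     norm (mulL S (FTL (abs_L2 g))) \<le> A * Cm * (1 + t) powr (- \<alpha> - j) * (Lp_norm m g + norm (abs_L2 g))"
    by (rule symb_order_Lm[OF \<sigma> m, where 'a = 'a, folded n, folded \<alpha>_def]) (rule that)
  \<comment> \<open>The first summand serves \<tau> <= t / 2, the second \<tau> > t / 2. The powers
    of 2 come from replacing t - \<tau>, respectively \<tau>, by t.\<close>
  define C where "C = 2 * Cm * 2 powr (\<alpha> + 1) + C2 * 2 powr (\<beta> + \<alpha>)"
  have C: "C > 0" unfolding C_def using C2(1) Cm(1) by (intro add_pos_pos) auto
  have half: "(1 + s) powr (- c) \<le> 2 powr c * (1 + t) powr (- c)" if "0 \<le> t" "t / 2 \<le> s" "c \<ge> 0" for s t c :: real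
  proof -
    have "(1 + s) powr (- c) \<le> ((1 + t) / 2) powr (- c)"
      using that by (intro powr_mono2') auto
    also have "\<dots> = 2 powr c * (1 + t) powr (- c)"
      using that by (simp add: powr_divide powr_minus field_simps)
    finally show ?thesis .
  qed
  show ?thesis
  proof (rule that[OF C])
    fix j A t \<tau> Z :: real and S :: "'a \<Rightarrow> real" and g :: "'a \<Rightarrow> complex"
    assume j: "0 \<le> j" "j \<le> 1" and \<tau>: "0 \<le> \<tau>" "\<tau> \<le> t" and S: "symb_order \<sigma> j A (t - \<tau>) S"
      and g: "g \<in> sqint" "g \<in> Lp m" and Z: "0 \<le> Z"
      and gm: "Lp_norm m g \<le> (1 + \<tau>) powr (- \<beta>) * Z" and g2: "norm (abs_L2 g) \<le> (1 + \<tau>) powr (- \<beta> - \<alpha>) * Z"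
    have A: "A \<ge> 0" using S by (simp add: symb_order_def)
    let ?B = "(1 + \<tau>) powr (- \<beta>) + (1 + (t - \<tau>)) powr (- \<beta>)"
    show "norm (mulL S (FTL (abs_L2 g))) \<le> A * C * (1 + t) powr (- \<alpha> - j) * ?B * Z"
    proof (cases "\<tau> \<le> t / 2")
      case True
      have "(1 + \<tau>) powr (- \<beta> - \<alpha>) \<le> (1 + \<tau>) powr (- \<beta>)" using \<tau> \<alpha>_nonneg by (intro powr_mono) auto
      then have "(1 + \<tau>) powr (- \<beta> - \<alpha>) * Z \<le> (1 + \<tau>) powr (- \<beta>) * Z" using Z by (rule mult_right_mono)
      with gm g2 have gg: "Lp_norm m g + norm (abs_L2 g) \<le> 2 * ((1 + \<tau>) powr (- \<beta>) * Z)" by linarith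
      have aj: "- \<alpha> - j = - (\<alpha> + j)" by simp
      have "(1 + (t - \<tau>)) powr (- \<alpha> - j) \<le> 2 powr (\<alpha> + j) * (1 + t) powr (- \<alpha> - j)"
        unfolding aj using \<tau> True \<alpha>_nonneg j by (intro half) auto
      also have "\<dots> \<le> 2 powr (\<alpha> + 1) * (1 + t) powr (- \<alpha> - j)"
        using j by (intro mult_right_mono powr_mono) auto
      finally have k: "(1 + (t - \<tau>)) powr (- \<alpha> - j) \<le> 2 powr (\<alpha> + 1) * (1 + t) powr (- \<alpha> - j)" .
      have "norm (mulL S (FTL (abs_L2 g))) \<le> A * Cm * (1 + (t - \<tau>)) powr (- \<alpha> - j) * (Lp_norm m g + norm (abs_L2 g))"
        by (rule Cm(2)[OF S j _ g]) (use \<tau> in simp)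
      also have "\<dots> \<le> A * Cm * (2 powr (\<alpha> + 1) * (1 + t) powr (- \<alpha> - j)) * (2 * ((1 + \<tau>) powr (- \<beta>) * Z))"
        using A Cm(1) by (intro mult_mono k gg mult_left_mono) auto
      also have "\<dots> = (2 * Cm * 2 powr (\<alpha> + 1)) * (A * (1 + t) powr (- \<alpha> - j) * Z * (1 + \<tau>) powr (- \<beta>))"
        by (simp only: mult_ac)
      also have "\<dots> \<le> C * (A * (1 + t) powr (- \<alpha> - j) * Z * ?B)"
        using A Z C2(1) Cm(1) unfolding C_def by (intro mult_mono mult_left_mono) auto
      finally show ?thesis by (simp only: mult_ac)
    next
      case False
      have ba: "- \<beta> - \<alpha> = - (\<beta> + \<alpha>)" by simp
      have k: "(1 + \<tau>) powr (- \<beta> - \<alpha>) \<le> 2 powr (\<beta> + \<alpha>) * (1 + t) powr (- \<beta> - \<alpha>)"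
        unfolding ba using \<tau> False \<alpha>_nonneg \<beta>_gt_1 by (intro half) auto
      \<comment> \<open>Since j <= 1 < \<beta>, the excess power \<beta> - j of 1 + t - \<tau> may
        be enlarged to one of 1 + t, where it uses up part of the decay (1 + t)^(-\<beta>-\<alpha>)
        of the source.\<close>
      have "(1 + (t - \<tau>)) powr (- j) = (1 + (t - \<tau>)) powr (- \<beta>) * (1 + (t - \<tau>)) powr (\<beta> - j)"
        by (simp flip: powr_add)
      also have "\<dots> \<le> (1 + (t - \<tau>)) powr (- \<beta>) * (1 + t) powr (\<beta> - j)"
        using \<tau> j \<beta>_gt_1 by (intro mult_left_mono powr_mono2) auto
      finally have k2: "(1 + (t - \<tau>)) powr (- j) \<le> (1 + (t - \<tau>)) powr (- \<beta>) * (1 + t) powr (\<beta> - j)" .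
      have tt: "(1 + t) powr (\<beta> - j) * (1 + t) powr (- \<beta> - \<alpha>) = (1 + t) powr (- \<alpha> - j)"
      proof -
        have "\<beta> - j + (- \<beta> - \<alpha>) = - \<alpha> - j" by simp
        then show ?thesis by (simp only: powr_add[symmetric])
      qed
      have g3: "norm (FTL (abs_L2 g)) \<le> 2 powr (\<beta> + \<alpha>) * (1 + t) powr (- \<beta> - \<alpha>) * Z"
        using g2 mult_right_mono[OF k Z] by simp
      have "norm (mulL S (FTL (abs_L2 g))) \<le> A * C2 * (1 + (t - \<tau>)) powr (- j) * norm (FTL (abs_L2 g))"
        by (rule C2(2)[OF S j]) (use \<tau> in simp)
      also have "\<dots> \<le> A * C2 * ((1 + (t - \<tau>)) powr (- \<beta>) * (1 + t) powr (\<beta> - j)) * ((2 powr (\<beta> + \<alpha>) * (1 + t) powr (- \<beta> - \<alpha>)) * Z)"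
        using A C2(1) by (intro mult_mono k2 mult_left_mono g3) auto
      also have "\<dots> = (C2 * 2 powr (\<beta> + \<alpha>)) * (A * ((1 + t) powr (\<beta> - j) * (1 + t) powr (- \<beta> - \<alpha>)) * Z * (1 + (t - \<tau>)) powr (- \<beta>))"
        by (simp only: mult_ac)
      also have "\<dots> \<le> C * (A * ((1 + t) powr (\<beta> - j) * (1 + t) powr (- \<beta> - \<alpha>)) * Z * ?B)"
        using A Z C2(1) Cm(1) unfolding C_def by (intro mult_mono mult_left_mono) auto
      finally show ?thesis unfolding tt by (simp only: mult_ac)
    qed
  qed
qed

end

section \<open>The Duhamel integral\<close>

lemma at_within_atLeast0: "0 \<le> t \<Longrightarrow> t < T \<Longrightarrow> at t within {0..} = at t within {0..T::real}"
  by (rule at_within_nhd[of _ "{..<T}"]) auto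

lemma continuous_on_atLeast0I:
  fixes f :: "real \<Rightarrow> 'b::topological_space"
  assumes "\<And>T. T \<ge> 0 \<Longrightarrow> continuous_on {0..T} f"
  shows "continuous_on {0..} f"
  unfolding continuous_on_def
proof
  fix t :: real assume t: "t \<in> {0..}"
  then have "continuous_on {0..t + 1} f" by (intro assms) simp
  then show "(f \<longlongrightarrow> f t) (at t within {0..})"
    using t by (simp add: continuous_on_def at_within_atLeast0[of t "t + 1"])
qed

text \<open>Negative times receive the value at 0. This preserves bounds and continuity of any
  kernel, and it is the extension by 0 when the kernel vanishes at time 0.\<close>

definition pos_ext :: "(real \<Rightarrow> 'a \<Rightarrow> real) \<Rightarrow> real \<Rightarrow> 'a \<Rightarrow> real" where
  "pos_ext S s = S (max s 0)"

lemma continuous_on_pos_ext: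
  assumes "\<And>x. continuous_on {0..} (\<lambda>s. S s x)"
  shows "continuous_on UNIV (\<lambda>s. pos_ext S s x)"
  unfolding pos_ext_def
  by (rule continuous_on_compose2[OF assms, of UNIV "\<lambda>s. max s 0"]) (auto intro!: continuous_intros)

lemma continuous_on_duhamel_integrand2:
  fixes N :: "real \<Rightarrow> 'a::euclidean_space L2"
  assumes S: "\<And>s. s \<ge> 0 \<Longrightarrow> bmult C (S s)" and c: "\<And>x. continuous_on {0..} (\<lambda>s. S s x)"
    and N: "continuous_on {0..} N"
  shows "continuous_on ({0..a} \<times> {0..b}) (\<lambda>(t, \<tau>). mulL (pos_ext S (t - \<tau>)) (N \<tau>))"
  unfolding split_beta'
proof (rule continuous_on_mulL[where B = C])
  show "bmult C (pos_ext S (fst z - snd z))" for z :: "real \<times> real"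
    unfolding pos_ext_def by (rule S) simp
  show "continuous_on ({0..a} \<times> {0..b}) (\<lambda>z. pos_ext S (fst z - snd z) x)" for x
    by (rule continuous_on_compose2[OF continuous_on_pos_ext[where S = S, OF c]]) (auto intro!: continuous_intros)
  show "continuous_on ({0..a} \<times> {0..b}) (\<lambda>z. N (snd z))"
    by (rule continuous_on_compose2[OF N]) (auto intro!: continuous_intros)
qed

lemma continuous_on_duhamel_slice:
  fixes N :: "real \<Rightarrow> 'a::euclidean_space L2"
  assumes S: "\<And>s. s \<ge> 0 \<Longrightarrow> bmult C (S s)" and c: "\<And>x. continuous_on {0..} (\<lambda>s. S s x)"
    and N: "continuous_on {0..} N"
  shows "continuous_on {0..T} (\<lambda>\<tau>. mulL (pos_ext S (t - \<tau>)) (N \<tau>))"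
proof (rule continuous_on_mulL[where B = C])
  show "bmult C (pos_ext S (t - \<tau>))" for \<tau> unfolding pos_ext_def by (rule S) simp
  show "continuous_on {0..T} (\<lambda>\<tau>. pos_ext S (t - \<tau>) x)" for x
    by (rule continuous_on_compose2[OF continuous_on_pos_ext[where S = S, OF c]]) (auto intro!: continuous_intros)
  show "continuous_on {0..T} N" by (rule continuous_on_subset[OF N]) auto
qed

lemma continuous_on_duhamel_integrand:
  fixes N :: "real \<Rightarrow> 'a::euclidean_space L2"
  assumes S: "\<And>s. s \<ge> 0 \<Longrightarrow> bmult C (S s)" and c: "\<And>x. continuous_on {0..} (\<lambda>s. S s x)"
    and N: "continuous_on {0..} N"
  shows "continuous_on {0..t} (\<lambda>\<tau>. mulL (S (t - \<tau>)) (N \<tau>))"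
proof (rule continuous_on_mulL[where B = C])
  show "bmult C (S (t - \<tau>))" if "\<tau> \<in> {0..t}" for \<tau> using that by (intro S) auto
  show "continuous_on {0..t} (\<lambda>\<tau>. S (t - \<tau>) x)" for x
    by (rule continuous_on_compose2[OF c]) (auto intro!: continuous_intros)
  show "continuous_on {0..t} N" by (rule continuous_on_subset[OF N]) auto
qed

lemmas duhamel_integrable = integrable_continuous_interval[OF continuous_on_duhamel_integrand]

text \<open>If the kernel vanishes at time \<open>0\<close>, extending it by \<open>0\<close> turns the Duhamel integral into one
  over a fixed interval.\<close>

lemma duhamel_fixed_interval:
  fixes N :: "real \<Rightarrow> 'a::euclidean_space L2"
  assumes S: "\<And>s. s \<ge> 0 \<Longrightarrow> bmult C (S s)" and c: "\<And>x. continuous_on {0..} (\<lambda>s. S s x)"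
    and S0: "\<And>x. S 0 x = 0" and N: "continuous_on {0..} N" and t: "0 \<le> t" "t \<le> T"
  shows "integral {0..t} (\<lambda>\<tau>. mulL (S (t - \<tau>)) (N \<tau>)) = integral {0..T} (\<lambda>\<tau>. mulL (pos_ext S (t - \<tau>)) (N \<tau>))"
proof -
  have z: "mulL (pos_ext S (t - \<tau>)) (N \<tau>) = 0" if "\<tau> \<ge> t" for \<tau>
  proof -
    have "pos_ext S (t - \<tau>) = (\<lambda>_. 0)" using that S0 by (auto simp: pos_ext_def max_def)
    then show ?thesis by (simp add: mulL_const)
  qed
  have "continuous_on {0..T} (\<lambda>\<tau>. mulL (pos_ext S (t - \<tau>)) (N \<tau>))"
    by (rule continuous_on_duhamel_slice[OF S c N])
  then have "integral {0..t} (\<lambda>\<tau>. mulL (pos_ext S (t - \<tau>)) (N \<tau>)) + integral {t..T} (\<lambda>\<tau>. mulL (pos_ext S (t - \<tau>)) (N \<tau>))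
      = integral {0..T} (\<lambda>\<tau>. mulL (pos_ext S (t - \<tau>)) (N \<tau>))"
    by (intro Henstock_Kurzweil_Integration.integral_combine t integrable_continuous_interval)
  moreover have "integral {t..T} (\<lambda>\<tau>. mulL (pos_ext S (t - \<tau>)) (N \<tau>)) = integral {t..T} (\<lambda>_. 0)"
    by (rule integral_cong) (simp add: z)
  moreover have "integral {0..t} (\<lambda>\<tau>. mulL (S (t - \<tau>)) (N \<tau>)) = integral {0..t} (\<lambda>\<tau>. mulL (pos_ext S (t - \<tau>)) (N \<tau>))"
    by (rule integral_cong) (simp add: pos_ext_def)
  ultimately show ?thesis by simp
qed

lemma duhamel_continuous:
  fixes N :: "real \<Rightarrow> 'a::euclidean_space L2"
  assumes S: "\<And>s. s \<ge> 0 \<Longrightarrow> bmult C (S s)" and c: "\<And>x. continuous_on {0..} (\<lambda>s. S s x)"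
    and S0: "\<And>x. S 0 x = 0" and N: "continuous_on {0..} N"
  shows "continuous_on {0..} (\<lambda>t. integral {0..t} (\<lambda>\<tau>. mulL (S (t - \<tau>)) (N \<tau>)))"
proof (rule continuous_on_atLeast0I)
  fix T :: real assume T: "T \<ge> 0"
  have "continuous_on {0..T} (\<lambda>t. integral (cbox 0 T) (\<lambda>\<tau>. mulL (pos_ext S (t - \<tau>)) (N \<tau>)))"
    by (rule integral_continuous_on_param) (use continuous_on_duhamel_integrand2[OF S c N, of T T] in simp)
  then show "continuous_on {0..T} (\<lambda>t. integral {0..t} (\<lambda>\<tau>. mulL (S (t - \<tau>)) (N \<tau>)))"
    using duhamel_fixed_interval[OF S c S0 N]
    by (subst continuous_on_cong[OF refl]) auto
qed

section \<open>Differentiation of the Duhamel integral\<close>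

definition dk :: "real \<Rightarrow> real \<Rightarrow> 'a::euclidean_space \<Rightarrow> real" where
  "dk \<sigma> t \<xi> = exp (- t) - (hs \<sigma> \<xi>)\<^sup>2 * k1 \<sigma> t \<xi>"

lemma dk_measurable [measurable]: "dk \<sigma> t \<in> borel_measurable borel"
  unfolding dk_def by measurable

lemma k1_zero [simp]: "k1 \<sigma> 0 \<xi> = 0" by (simp add: k1_def)

lemma k1_has_derivative: "((\<lambda>t. k1 \<sigma> t \<xi>) has_real_derivative dk \<sigma> t \<xi>) (at t within T)"
  unfolding k1_def dk_def hs_sq by (rule K1_symb_has_derivative)

lemma continuous_on_k1 [continuous_intros]: "continuous_on T (\<lambda>t. k1 \<sigma> t \<xi>)"
  by (rule DERIV_continuous_on[OF k1_has_derivative])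

lemma continuous_on_dk [continuous_intros]: "continuous_on T (\<lambda>t. dk \<sigma> t \<xi>)"
  unfolding dk_def by (intro continuous_intros)

text \<open>The time derivative \<open>dk\<close> has the same order as |\<xi>|^(2\<sigma>) k1 up to
  the term exp(-t), which is not small at low frequencies; \<open>symb_order\<close> allows for this
  term.\<close>

lemma symb_order_k1:
  assumes t: "t \<ge> 0"
  shows "symb_order \<sigma> 0 4 t (k1 \<sigma> t :: 'a::euclidean_space \<Rightarrow> real)"
    and "symb_order \<sigma> (1/2) 4 t (\<lambda>\<xi>::'a::euclidean_space. hs \<sigma> \<xi> * k1 \<sigma> t \<xi>)"
    and "symb_order \<sigma> 1 4 t (\<lambda>\<xi>::'a::euclidean_space. (hs \<sigma> \<xi>)\<^sup>2 * k1 \<sigma> t \<xi>)"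
    and "symb_order \<sigma> 1 4 t (dk \<sigma> t :: 'a::euclidean_space \<Rightarrow> real)"
proof -
  note b = k1_bounds[OF t, of \<sigma>, where 'a = 'a]
  have "k1 \<sigma> t \<xi> \<le> 4 * (exp (- t) + exp (- t * low \<sigma> \<xi> / 2))" for \<xi> :: 'a
    by (rule order_trans[OF b(2)]) simp
  then show "symb_order \<sigma> 0 4 t (k1 \<sigma> t :: 'a \<Rightarrow> real)"
    unfolding symb_order_def lowp_def by (auto simp: abs_of_nonneg[OF b(1)])
  have "hs \<sigma> \<xi> * k1 \<sigma> t \<xi> \<le> 4 * (exp (- t) + low \<sigma> \<xi> powr (1/2) * exp (- t * low \<sigma> \<xi> / 2))" for \<xi> :: 'a
    by (rule order_trans[OF b(3)]) simp
  then show "symb_order \<sigma> (1/2) 4 t (\<lambda>\<xi>::'a. hs \<sigma> \<xi> * k1 \<sigma> t \<xi>)"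
    unfolding symb_order_def lowp_def using b(1) by (auto simp: abs_mult)
  have "(hs \<sigma> \<xi>)\<^sup>2 * k1 \<sigma> t \<xi> \<le> 4 * (exp (- t) + low \<sigma> \<xi> * exp (- t * low \<sigma> \<xi> / 2))" for \<xi> :: 'a
    by (rule order_trans[OF b(4)]) simp
  then show "symb_order \<sigma> 1 4 t (\<lambda>\<xi>::'a. (hs \<sigma> \<xi>)\<^sup>2 * k1 \<sigma> t \<xi>)"
    unfolding symb_order_def lowp_def using b(1) by (auto simp: abs_mult)
  have "\<bar>dk \<sigma> t \<xi>\<bar> \<le> 4 * (exp (- t) + low \<sigma> \<xi> * exp (- t * low \<sigma> \<xi> / 2))" for \<xi> :: 'a
  proof -
    have "0 \<le> (hs \<sigma> \<xi>)\<^sup>2 * k1 \<sigma> t \<xi>" using b(1) by simp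
    moreover have "0 \<le> x \<Longrightarrow> x \<le> 4 * y \<Longrightarrow> 0 < a \<Longrightarrow> \<bar>a - x\<bar> \<le> 4 * (a + y)" for a x y :: real
      by (auto simp: abs_le_iff)
    ultimately show ?thesis using b(4)[of \<xi>] exp_gt_zero[of "- t"] unfolding dk_def by blast
  qed
  then show "symb_order \<sigma> 1 4 t (dk \<sigma> t :: 'a \<Rightarrow> real)"
    unfolding symb_order_def lowp_def by auto
qed

lemma bmult_kernels:
  assumes t: "t \<ge> 0"
  shows bmult_k1: "bmult 8 (k1 \<sigma> t :: 'a::euclidean_space \<Rightarrow> real)"
    and bmult_hs_k1: "bmult 8 (\<lambda>\<xi>::'a. hs \<sigma> \<xi> * k1 \<sigma> t \<xi>)"
    and bmult_hs2_k1: "bmult 8 (\<lambda>\<xi>::'a. (hs \<sigma> \<xi>)\<^sup>2 * k1 \<sigma> t \<xi>)"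
    and bmult_dk: "bmult 8 (dk \<sigma> t :: 'a \<Rightarrow> real)"
  using symb_order_bmult[OF symb_order_k1(1)[OF t] _ t] symb_order_bmult[OF symb_order_k1(2)[OF t] _ t]
    symb_order_bmult[OF symb_order_k1(3)[OF t] _ t] symb_order_bmult[OF symb_order_k1(4)[OF t] _ t]
  by simp_all

text \<open>Splitting \<open>k1 = (1 - exp (- s)) + wk\<close> isolates the jump at \<open>s = 0\<close> of the derivative of the
  kernel extended by \<open>0\<close>: the extension of \<open>wk\<close> is continuously differentiable.\<close>

definition wk :: "real \<Rightarrow> real \<Rightarrow> 'a::euclidean_space \<Rightarrow> real" where
  "wk \<sigma> s \<xi> = k1 \<sigma> s \<xi> - 1 + exp (- s)"

definition wk' :: "real \<Rightarrow> real \<Rightarrow> 'a::euclidean_space \<Rightarrow> real" where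
  "wk' \<sigma> s \<xi> = - ((hs \<sigma> \<xi>)\<^sup>2 * k1 \<sigma> s \<xi>)"

lemma wk_has_derivative: "((\<lambda>s. wk \<sigma> s \<xi>) has_real_derivative wk' \<sigma> s \<xi>) (at s within T)"
  unfolding wk_def wk'_def
  by (rule derivative_eq_intros k1_has_derivative refl)+ (simp add: dk_def)

lemma pos_ext_has_derivative:
  assumes d: "\<And>s. s \<ge> 0 \<Longrightarrow> ((\<lambda>s. S s x) has_real_derivative S' s x) (at s)"
    and S0: "S 0 x = (0::real)" and S'0: "S' 0 x = 0"
  shows "((\<lambda>s. pos_ext S s x) has_real_derivative pos_ext S' s x) (at s)"
proof -
  consider "s > 0" | "s < 0" | "s = 0" by linarith
  then show ?thesis
  proof cases
    case 1
    have "((\<lambda>s. pos_ext S s x) has_real_derivative S' s x) (at s)"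
      by (rule DERIV_cong_ev[THEN iffD1, OF refl _ refl d])
         (use 1 in \<open>auto simp: pos_ext_def eventually_nhds intro!: exI[of _ "{0<..}"]\<close>)
    then show ?thesis using 1 by (simp add: pos_ext_def)
  next
    case 2
    have "((\<lambda>s. pos_ext S s x) has_real_derivative 0) (at s)"
      by (rule DERIV_cong_ev[THEN iffD1, OF refl _ refl DERIV_const[of 0]])
         (use 2 S0 in \<open>auto simp: pos_ext_def eventually_nhds max_def intro!: exI[of _ "{..<0}"]\<close>)
    then show ?thesis using 2 S'0 by (simp add: pos_ext_def max_def)
  next
    case 3
    \<comment> \<open>At 0 the one-sided quotients are compared: on the left the extension is
      constant, and on the right S' 0 x = 0 makes the limit agree.\<close>
    have "((\<lambda>y. (pos_ext S y x - pos_ext S 0 x) / (y - 0)) \<longlongrightarrow> 0) (at (0::real))"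
    proof (rule filterlim_split_at)
      show "((\<lambda>y. (pos_ext S y x - pos_ext S 0 x) / (y - 0)) \<longlongrightarrow> 0) (at_left (0::real))"
        using S0 by (intro tendsto_eventually) (auto simp: eventually_at_filter pos_ext_def max_def)
      have "((\<lambda>y. (S y x - S 0 x) / (y - 0)) \<longlongrightarrow> 0) (at_right (0::real))"
        using d[of 0] S'0 unfolding has_field_derivative_iff by (auto intro: tendsto_mono[OF at_le])
      then show "((\<lambda>y. (pos_ext S y x - pos_ext S 0 x) / (y - 0)) \<longlongrightarrow> 0) (at_right (0::real))"
        by (rule Lim_transform_eventually) (auto simp: eventually_at_filter pos_ext_def max_def)
    qed
    then show ?thesis using 3 S'0 by (simp add: has_field_derivative_iff pos_ext_def)
  qed
qed

lemma has_vector_derivative_atLeast0: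
  "0 \<le> t \<Longrightarrow> (f has_vector_derivative D) (at t within {0..t + 1}) \<Longrightarrow> (f has_vector_derivative D) (at t within {0..})"
  by (simp add: at_within_atLeast0[of t "t + 1"])

lemma wk_bmult: "s \<ge> 0 \<Longrightarrow> bmult 10 (wk \<sigma> s :: 'a::euclidean_space \<Rightarrow> real)"
proof -
  assume s: "s \<ge> 0"
  have "bmult 10 (\<lambda>\<xi>::'a. k1 \<sigma> s \<xi> + (exp (- s) - 1))"
  proof -
    have "0 < exp (- s)" "exp (- s) \<le> 1" using s by auto
    then have "\<bar>exp (- s) - 1\<bar> \<le> 2" by linarith
    then have "bmult (8 + 2) (\<lambda>\<xi>::'a. k1 \<sigma> s \<xi> + (exp (- s) - 1))"
      by (intro bmult_add bmult_k1 bmult_const s)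
    then show ?thesis by simp
  qed
  moreover have "(\<lambda>\<xi>::'a. k1 \<sigma> s \<xi> + (exp (- s) - 1)) = wk \<sigma> s" by (auto simp: wk_def)
  ultimately show ?thesis by simp
qed

text \<open>The extended \<open>wk\<close> permits differentiation under an integral with fixed
  limits. The other part, with kernel 1 - exp(-(t - \<tau>)), falls to the fundamental theorem of
  calculus once exp(-t) is taken out of the integral.\<close>

lemma duhamel_derivative:
  fixes N :: "real \<Rightarrow> 'a::euclidean_space L2"
  assumes N: "continuous_on {0..} N" and t: "0 \<le> t"
  shows "((\<lambda>t. integral {0..t} (\<lambda>\<tau>. mulL (k1 \<sigma> (t - \<tau>)) (N \<tau>))) has_vector_derivative
      integral {0..t} (\<lambda>\<tau>. mulL (dk \<sigma> (t - \<tau>)) (N \<tau>))) (at t within {0..})" (is ?A)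
    and "continuous_on {0..} (\<lambda>t. integral {0..t} (\<lambda>\<tau>. mulL (dk \<sigma> (t - \<tau>)) (N \<tau>)))" (is ?B)
proof -
  have w: "s \<ge> 0 \<Longrightarrow> bmult 10 (wk \<sigma> s :: 'a \<Rightarrow> real)" for s by (rule wk_bmult)
  have w': "s \<ge> 0 \<Longrightarrow> bmult 8 (wk' \<sigma> s :: 'a \<Rightarrow> real)" for s
    unfolding wk'_def by (intro bmult_uminus bmult_hs2_k1)
  have cw: "continuous_on {0..} (\<lambda>s. wk \<sigma> s \<xi>)" and cw': "continuous_on {0..} (\<lambda>s. wk' \<sigma> s \<xi>)" for \<xi> :: 'a
    unfolding wk_def wk'_def by (intro continuous_intros)+
  have w0: "wk \<sigma> 0 \<xi> = 0" "wk' \<sigma> 0 \<xi> = 0" for \<xi> :: 'a by (auto simp: wk_def wk'_def)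
  have cN: "continuous_on {0..u} N" for u by (rule continuous_on_subset[OF N]) auto
  have ceN: "continuous_on {0..u} (\<lambda>\<tau>. exp \<tau> *\<^sub>R N \<tau>)" for u by (intro continuous_intros cN)
  \<comment> \<open>D1 and V1 are the Duhamel integrals with kernels 1 - exp(-s) and exp(-s),
    written so that u does not occur under the integral sign.\<close>
  define D1 where "D1 u = integral {0..u} N - exp (- u) *\<^sub>R integral {0..u} (\<lambda>\<tau>. exp \<tau> *\<^sub>R N \<tau>)" for u
  define V1 where "V1 u = exp (- u) *\<^sub>R integral {0..u} (\<lambda>\<tau>. exp \<tau> *\<^sub>R N \<tau>)" for u
  define D2 where "D2 u = integral {0..u} (\<lambda>\<tau>. mulL (wk \<sigma> (u - \<tau>)) (N \<tau>))" for u
  define V2 where "V2 u = integral {0..u} (\<lambda>\<tau>. mulL (wk' \<sigma> (u - \<tau>)) (N \<tau>))" for u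
  have "(D2 has_vector_derivative V2 t) (at t within {0..})"
  proof (rule has_vector_derivative_atLeast0[OF t])
    have "((\<lambda>u. integral (cbox 0 (t + 1)) (\<lambda>\<tau>. mulL (pos_ext (wk \<sigma>) (u - \<tau>)) (N \<tau>))) has_vector_derivative
      integral (cbox 0 (t + 1)) (\<lambda>\<tau>. mulL (pos_ext (wk' \<sigma>) (t - \<tau>)) (N \<tau>))) (at t within {0..t + 1})"
    proof (rule leibniz_rule_vector_derivative)
      fix u \<tau> :: real
      have "((\<lambda>s. mulL (pos_ext (wk \<sigma>) s) (N \<tau>)) has_vector_derivative mulL (pos_ext (wk' \<sigma>) (u - \<tau>)) (N \<tau>)) (at (u - \<tau>))"
      proof (rule mulL_has_vector_derivative[where T = UNIV])
        show "bmult 10 (pos_ext (wk \<sigma>) s :: 'a \<Rightarrow> real)" for s unfolding pos_ext_def by (rule w) simp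
        show "bmult 8 (pos_ext (wk' \<sigma>) s :: 'a \<Rightarrow> real)" for s unfolding pos_ext_def by (rule w') simp
        show "((\<lambda>s. pos_ext (wk \<sigma>) s \<xi>) has_real_derivative pos_ext (wk' \<sigma>) s \<xi>) (at s)" for s and \<xi> :: 'a
          by (rule pos_ext_has_derivative[where S = "wk \<sigma>" and S' = "wk' \<sigma>"]) (auto simp: w0 wk_has_derivative)
      qed auto
      note d2 = this
      have d1: "((\<lambda>u. u - \<tau>) has_vector_derivative 1) (at u within {0..t + 1})"
        by (auto intro!: derivative_eq_intros)
      from vector_diff_chain_within[OF d1 has_vector_derivative_at_within[OF d2]]
      show "((\<lambda>u. mulL (pos_ext (wk \<sigma>) (u - \<tau>)) (N \<tau>)) has_vector_derivative mulL (pos_ext (wk' \<sigma>) (u - \<tau>)) (N \<tau>)) (at u within {0..t + 1})"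
        by (simp add: o_def)
    next
      fix u :: real assume u: "u \<in> {0..t + 1}"
      have "continuous_on {0..t + 1} (\<lambda>\<tau>. mulL (pos_ext (wk \<sigma>) (u - \<tau>)) (N \<tau>))"
        by (rule continuous_on_duhamel_slice[OF w cw N])
      then show "(\<lambda>\<tau>. mulL (pos_ext (wk \<sigma>) (u - \<tau>)) (N \<tau>)) integrable_on cbox 0 (t + 1)"
        by (simp add: integrable_continuous_interval)
    next
      show "continuous_on ({0..t + 1} \<times> cbox 0 (t + 1)) (\<lambda>(u, \<tau>). mulL (pos_ext (wk' \<sigma>) (u - \<tau>)) (N \<tau>))"
        using continuous_on_duhamel_integrand2[OF w' cw' N, of "t + 1" "t + 1"] t by simp
    qed (use t in auto)
    moreover have "integral (cbox 0 (t + 1)) (\<lambda>\<tau>. mulL (pos_ext (wk \<sigma>) (u - \<tau>)) (N \<tau>)) = D2 u" if "u \<in> {0..t + 1}" for u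
      using duhamel_fixed_interval[OF w cw w0(1) N, of u "t + 1"] that by (simp add: D2_def)
    moreover have "integral (cbox 0 (t + 1)) (\<lambda>\<tau>. mulL (pos_ext (wk' \<sigma>) (t - \<tau>)) (N \<tau>)) = V2 t"
      using duhamel_fixed_interval[OF w' cw' w0(2) N, of t "t + 1"] t by (simp add: V2_def)
    ultimately show "(D2 has_vector_derivative V2 t) (at t within {0..t + 1})"
      using t by (auto intro: has_vector_derivative_transform[of t "{0..t + 1}" D2, rotated 2])
  qed
  moreover have "(D1 has_vector_derivative V1 t) (at t within {0..})"
  proof (rule has_vector_derivative_atLeast0[OF t])
    have 1: "((\<lambda>u. integral {0..u} N) has_vector_derivative N t) (at t within {0..t + 1})"
      by (rule integral_has_vector_derivative[OF cN]) (use t in auto)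
    have 2: "((\<lambda>u. integral {0..u} (\<lambda>\<tau>. exp \<tau> *\<^sub>R N \<tau>)) has_vector_derivative exp t *\<^sub>R N t) (at t within {0..t + 1})"
      by (rule integral_has_vector_derivative[OF ceN]) (use t in auto)
    have 3: "((\<lambda>u. exp (- u)) has_real_derivative - exp (- t)) (at t within {0..t + 1})"
      by (auto intro!: derivative_eq_intros)
    \<comment> \<open>The boundary terms N t cancel, because 1 - exp(-s) vanishes at s = 0.\<close>
    have "(D1 has_vector_derivative N t - (exp (- t) *\<^sub>R (exp t *\<^sub>R N t) + (- exp (- t)) *\<^sub>R integral {0..t} (\<lambda>\<tau>. exp \<tau> *\<^sub>R N \<tau>))) (at t within {0..t + 1})"
      unfolding D1_def by (intro has_vector_derivative_diff 1 has_vector_derivative_scaleR 2 3)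
    then show "(D1 has_vector_derivative V1 t) (at t within {0..t + 1})"
      by (simp add: V1_def flip: exp_add)
  qed
  ultimately have D: "((\<lambda>u. D1 u + D2 u) has_vector_derivative V1 t + V2 t) (at t within {0..})"
    by (intro has_vector_derivative_add)
  have i1: "N integrable_on {0..u}" "(\<lambda>\<tau>. exp \<tau> *\<^sub>R N \<tau>) integrable_on {0..u}" for u
    by (intro integrable_continuous_interval cN ceN)+
  have k: "integral {0..u} (\<lambda>\<tau>. mulL (k1 \<sigma> (u - \<tau>)) (N \<tau>)) = D1 u + D2 u"
    and v: "integral {0..u} (\<lambda>\<tau>. mulL (dk \<sigma> (u - \<tau>)) (N \<tau>)) = V1 u + V2 u" if u: "u \<ge> 0" for u
  proof -
    have iw: "(\<lambda>\<tau>. mulL (wk \<sigma> (u - \<tau>)) (N \<tau>)) integrable_on {0..u}"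
      by (rule duhamel_integrable[OF w cw N])
    have iw': "(\<lambda>\<tau>. mulL (wk' \<sigma> (u - \<tau>)) (N \<tau>)) integrable_on {0..u}"
      by (rule duhamel_integrable[OF w' cw' N])
    have ee: "exp (- u) *\<^sub>R (exp \<tau> *\<^sub>R x) = exp (- (u - \<tau>)) *\<^sub>R x" for \<tau> and x :: "'a L2"
      by (simp flip: exp_add)
    have e1: "exp (- u) *\<^sub>R integral {0..u} (\<lambda>\<tau>. exp \<tau> *\<^sub>R N \<tau>) = integral {0..u} (\<lambda>\<tau>. exp (- (u - \<tau>)) *\<^sub>R N \<tau>)"
      unfolding ee[symmetric] by (rule integral_cmul[symmetric])
    have e2: "(\<lambda>\<tau>. exp (- (u - \<tau>)) *\<^sub>R N \<tau>) integrable_on {0..u}"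
      unfolding ee[symmetric] by (intro integrable_cmul i1)
    have "integral {0..u} (\<lambda>\<tau>. mulL (k1 \<sigma> (u - \<tau>)) (N \<tau>))
        = integral {0..u} (\<lambda>\<tau>. (N \<tau> - exp (- (u - \<tau>)) *\<^sub>R N \<tau>) + mulL (wk \<sigma> (u - \<tau>)) (N \<tau>))"
    proof (rule integral_cong)
      fix \<tau> assume "\<tau> \<in> {0..u}"
      then have s: "u - \<tau> \<ge> 0" by simp
      have "k1 \<sigma> (u - \<tau>) = (\<lambda>\<xi>::'a. (1 - exp (- (u - \<tau>))) + wk \<sigma> (u - \<tau>) \<xi>)" by (auto simp: wk_def)
      then have "mulL (k1 \<sigma> (u - \<tau>)) (N \<tau>) = (1 - exp (- (u - \<tau>))) *\<^sub>R N \<tau> + mulL (wk \<sigma> (u - \<tau>)) (N \<tau>)"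
        using mulL_plus[OF bmult_const[OF order_refl] w[OF s]] by (simp add: mulL_const)
      then show "mulL (k1 \<sigma> (u - \<tau>)) (N \<tau>) = (N \<tau> - exp (- (u - \<tau>)) *\<^sub>R N \<tau>) + mulL (wk \<sigma> (u - \<tau>)) (N \<tau>)"
        by (simp add: scaleR_diff_left)
    qed
    also have "\<dots> = D1 u + D2 u"
      unfolding D1_def D2_def e1
      by (simp only: integral_add[OF integrable_diff[OF i1(1) e2] iw] integral_diff[OF i1(1) e2])
    finally show "integral {0..u} (\<lambda>\<tau>. mulL (k1 \<sigma> (u - \<tau>)) (N \<tau>)) = D1 u + D2 u" .
    have "integral {0..u} (\<lambda>\<tau>. mulL (dk \<sigma> (u - \<tau>)) (N \<tau>))
        = integral {0..u} (\<lambda>\<tau>. exp (- (u - \<tau>)) *\<^sub>R N \<tau> + mulL (wk' \<sigma> (u - \<tau>)) (N \<tau>))"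
    proof (rule integral_cong)
      fix \<tau> assume "\<tau> \<in> {0..u}"
      then have s: "u - \<tau> \<ge> 0" by simp
      have "dk \<sigma> (u - \<tau>) = (\<lambda>\<xi>::'a. exp (- (u - \<tau>)) + wk' \<sigma> (u - \<tau>) \<xi>)" by (auto simp: wk'_def dk_def)
      then show "mulL (dk \<sigma> (u - \<tau>)) (N \<tau>) = exp (- (u - \<tau>)) *\<^sub>R N \<tau> + mulL (wk' \<sigma> (u - \<tau>)) (N \<tau>)"
        using mulL_plus[OF bmult_const[OF order_refl] w'[OF s]] by (simp add: mulL_const)
    qed
    also have "\<dots> = V1 u + V2 u"
      unfolding V1_def V2_def e1 by (rule integral_add[OF e2 iw'])
    finally show "integral {0..u} (\<lambda>\<tau>. mulL (dk \<sigma> (u - \<tau>)) (N \<tau>)) = V1 u + V2 u" .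
  qed
  show ?A
    unfolding v[OF t] by (rule has_vector_derivative_transform[OF _ _ D]) (use t k in auto)
  have "continuous_on {0..} V1"
    unfolding V1_def by (intro continuous_intros continuous_on_atLeast0I indefinite_integral_continuous_1 i1)
  moreover have "continuous_on {0..} V2"
    unfolding V2_def by (rule duhamel_continuous[OF w' cw' w0(2) N])
  ultimately show ?B
    by (subst continuous_on_cong[OF refl, of _ _ "\<lambda>u. V1 u + V2 u"]) (auto simp: v intro!: continuous_intros)
qed

text \<open>Either summand integrates to at most 1 / (b - 1), whatever t is; this uniformity makes
  the contraction constant independent of time.\<close>

lemma integral_kernel_le:
  fixes b t :: real
  assumes b: "b > 1" and t: "t \<ge> 0"
  shows "(\<lambda>\<tau>. (1 + \<tau>) powr (- b) + (1 + (t - \<tau>)) powr (- b)) integrable_on {0..t}"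
    and "integral {0..t} (\<lambda>\<tau>. (1 + \<tau>) powr (- b) + (1 + (t - \<tau>)) powr (- b)) \<le> 2 / (b - 1)"
proof -
  have 1: "((\<lambda>\<tau>. (1 + \<tau>) powr (- b)) has_integral
      (- ((1 + t) powr (1 - b)) / (b - 1)) - (- ((1 + 0) powr (1 - b)) / (b - 1))) {0..t}"
  proof (rule fundamental_theorem_of_calculus[OF t])
    fix x assume x: "x \<in> {0..t}"
    show "((\<lambda>x. - ((1 + x) powr (1 - b)) / (b - 1)) has_vector_derivative (1 + x) powr (- b)) (at x within {0..t})"
      unfolding has_real_derivative_iff_has_vector_derivative[symmetric]
    proof -
      have "((\<lambda>x. (1 + x) powr (1 - b)) has_real_derivative (1 - b) * (1 + x) powr (- b)) (at x within {0..t})"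
        using x by (auto intro!: derivative_eq_intros)
      from DERIV_cdivide[OF DERIV_minus[OF this], of "b - 1"]
      show "((\<lambda>x. - ((1 + x) powr (1 - b)) / (b - 1)) has_real_derivative (1 + x) powr (- b)) (at x within {0..t})"
        by (rule DERIV_cong) (use b in \<open>simp add: field_simps\<close>)
    qed
  qed
  have 2: "((\<lambda>\<tau>. (1 + (t - \<tau>)) powr (- b)) has_integral
      ((1 + (t - t)) powr (1 - b) / (b - 1)) - ((1 + (t - 0)) powr (1 - b) / (b - 1))) {0..t}"
  proof (rule fundamental_theorem_of_calculus[OF t])
    fix x assume x: "x \<in> {0..t}"
    show "((\<lambda>x. (1 + (t - x)) powr (1 - b) / (b - 1)) has_vector_derivative (1 + (t - x)) powr (- b)) (at x within {0..t})"
      unfolding has_real_derivative_iff_has_vector_derivative[symmetric]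
    proof -
      have "((\<lambda>x. (1 + (t - x)) powr (1 - b)) has_real_derivative (b - 1) * (1 + (t - x)) powr (- b)) (at x within {0..t})"
        using x by (auto intro!: derivative_eq_intros simp: algebra_simps)
      from DERIV_cdivide[OF this, of "b - 1"]
      show "((\<lambda>x. (1 + (t - x)) powr (1 - b) / (b - 1)) has_real_derivative (1 + (t - x)) powr (- b)) (at x within {0..t})"
        by (rule DERIV_cong) (use b in \<open>simp add: field_simps\<close>)
    qed
  qed
  note i = has_integral_add[OF 1 2]
  show "(\<lambda>\<tau>. (1 + \<tau>) powr (- b) + (1 + (t - \<tau>)) powr (- b)) integrable_on {0..t}"
    using i by (rule has_integral_integrable)
  have "(1 + t) powr (1 - b) / (b - 1) \<ge> 0" using b by simp
  then show "integral {0..t} (\<lambda>\<tau>. (1 + \<tau>) powr (- b) + (1 + (t - \<tau>)) powr (- b)) \<le> 2 / (b - 1)"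
    unfolding integral_unique[OF i] by simp
qed

section \<open>The fixed point equation\<close>

context damped_wave
begin

lemma Wt_0: "Wt 0 \<xi> = 1 + hs \<sigma> \<xi>"
  by (simp add: Wt_def)

text \<open>\<open>Kx\<close> is the kernel acting on the unknown in the weight of time \<open>0\<close>; \<open>Q t\<close> and \<open>R t\<close> pass to the
  weight of time \<open>t\<close> and back.\<close>

definition Kx :: "real \<Rightarrow> 'a \<Rightarrow> real" where "Kx s \<xi> = Wt 0 \<xi> * k1 \<sigma> s \<xi>"
definition Q :: "real \<Rightarrow> 'a \<Rightarrow> real" where "Q t \<xi> = Wt t \<xi> * iW 0 \<xi>"
definition R :: "real \<Rightarrow> 'a \<Rightarrow> real" where "R t \<xi> = Wt 0 \<xi> * iW t \<xi>"

lemma Wt_nz: "t \<ge> 0 \<Longrightarrow> Wt t \<xi> \<noteq> 0" using Wt_pos[of t \<xi>] by simp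

lemma Kx_bmult: "s \<ge> 0 \<Longrightarrow> bmult 16 (Kx s)"
proof -
  assume s: "s \<ge> 0"
  have "bmult (8 + 8) (\<lambda>\<xi>::'a. k1 \<sigma> s \<xi> + hs \<sigma> \<xi> * k1 \<sigma> s \<xi>)"
    by (intro bmult_add bmult_k1 bmult_hs_k1 s)
  moreover have "(\<lambda>\<xi>::'a. k1 \<sigma> s \<xi> + hs \<sigma> \<xi> * k1 \<sigma> s \<xi>) = Kx s"
    by (auto simp: Kx_def Wt_0 algebra_simps)
  ultimately show ?thesis by simp
qed

lemma Kx_continuous: "continuous_on T (\<lambda>s. Kx s \<xi>)"
  unfolding Kx_def by (intro continuous_intros)

lemma Kx_zero: "Kx 0 \<xi> = 0" by (simp add: Kx_def)

lemma Q_bmult: assumes t: "t \<ge> 0" shows "bmult ((1 + t) powr (\<alpha> + 1/2)) (Q t)"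
  unfolding bmult_def
proof safe
  show "Q t \<in> borel_measurable borel" unfolding Q_def by measurable
  fix \<xi> :: 'a
  have T: "1 \<le> (1 + t) powr (1/2)" using t by (intro ge_one_powr_ge_zero) auto
  have "1 + (1 + t) powr (1/2) * hs \<sigma> \<xi> \<le> (1 + t) powr (1/2) * (1 + hs \<sigma> \<xi>)"
    using T by (simp add: distrib_left)
  then have "(1 + t) powr \<alpha> * (1 + (1 + t) powr (1/2) * hs \<sigma> \<xi>) \<le> (1 + t) powr \<alpha> * ((1 + t) powr (1/2) * (1 + hs \<sigma> \<xi>))"
    by (rule mult_left_mono) simp
  then have "Wt t \<xi> \<le> (1 + t) powr (\<alpha> + 1/2) * Wt 0 \<xi>"
    unfolding Wt_def[of t] Wt_0 by (simp add: powr_add mult.assoc)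
  then show "\<bar>Q t \<xi>\<bar> \<le> (1 + t) powr (\<alpha> + 1/2)"
    using Wt_pos[OF t, of \<xi>] Wt_pos[of 0 \<xi>] by (simp add: Q_def iW_def divide_le_eq)
qed

lemma R_bmult: assumes t: "t \<ge> 0" shows "bmult 1 (R t)"
  unfolding bmult_def
proof safe
  show "R t \<in> borel_measurable borel" unfolding R_def by measurable
  fix \<xi> :: 'a
  have T: "1 \<le> (1 + t) powr (1/2)" "1 \<le> (1 + t) powr \<alpha>" using t \<alpha>_nonneg by (auto intro!: ge_one_powr_ge_zero)
  have "1 * (1 + 1 * hs \<sigma> \<xi>) \<le> (1 + t) powr \<alpha> * (1 + (1 + t) powr (1/2) * hs \<sigma> \<xi>)"
    using T by (intro mult_mono add_mono mult_right_mono) auto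
  then have "Wt 0 \<xi> \<le> Wt t \<xi>" unfolding Wt_0 Wt_def[of t] by simp
  then show "\<bar>R t \<xi>\<bar> \<le> 1"
    using Wt_pos[OF t, of \<xi>] Wt_pos[of 0 \<xi>] by (simp add: R_def iW_def divide_le_eq)
qed

lemma Wt_continuous: "continuous_on {0..} (\<lambda>t. Wt t \<xi>)"
  unfolding Wt_def by (intro continuous_intros) auto

lemma iW_continuous: "continuous_on {0..} (\<lambda>t. iW t \<xi>)"
  unfolding iW_def by (intro continuous_intros Wt_continuous) (auto simp: Wt_nz)

lemma Q_continuous: "continuous_on {0..} (\<lambda>t. Q t \<xi>)"
  and R_continuous: "continuous_on {0..} (\<lambda>t. R t \<xi>)"
  unfolding Q_def R_def by (intro continuous_intros Wt_continuous iW_continuous)+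

lemma Q_R: "t \<ge> 0 \<Longrightarrow> mulL (Q t) (mulL (R t) X) = X"
proof -
  assume t: "t \<ge> 0"
  have "(\<lambda>\<xi>. Q t \<xi> * R t \<xi>) = (\<lambda>_. 1)" using Wt_nz[OF t] Wt_nz[of 0] by (auto simp: Q_def R_def iW_def)
  then show ?thesis by (simp add: mulL_mulL[OF Q_bmult[OF t] R_bmult[OF t]])
qed

lemma R_Q: "t \<ge> 0 \<Longrightarrow> mulL (R t) (mulL (Q t) X) = X"
proof -
  assume t: "t \<ge> 0"
  have "(\<lambda>\<xi>. R t \<xi> * Q t \<xi>) = (\<lambda>_. 1)" using Wt_nz[OF t] Wt_nz[of 0] by (auto simp: Q_def R_def iW_def)
  then show ?thesis by (simp add: mulL_mulL[OF R_bmult[OF t] Q_bmult[OF t]])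
qed

lemma iW_R: assumes t: "t \<ge> 0" shows "mulL (iW 0) (mulL (R t) X) = mulL (iW t) X"
proof -
  have "(\<lambda>\<xi>. iW 0 \<xi> * R t \<xi>) = iW t" using Wt_nz[of 0] by (auto simp: R_def iW_def)
  then show ?thesis by (simp add: mulL_mulL[OF iW_bmult[of 0] R_bmult[OF t]])
qed

lemma NL_R: "t \<ge> 0 \<Longrightarrow> NL 0 (mulL (R t) X) = NL t X"
  by (simp add: NL_def uval_def iW_R)

text \<open>All decay is given up here: continuity in time and uniqueness ask only for a Lipschitz
  constant on bounded sets.\<close>

lemma NL_Lipschitz:
  obtains C where "C > 0" "\<And>t X Y. t \<ge> 0 \<Longrightarrow> norm (NL t X - NL t Y) \<le> C * (norm (X - Y) * (norm X + norm Y) powr (p - 1))"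
proof -
  obtain C where C: "nl_bound C" by (rule nonlinear_bound)
  have C0: "C > 0" using C by (simp add: nl_bound_def)
  show ?thesis
  proof (rule that[OF C0])
    fix t :: real and X Y :: "'a L2" assume t: "t \<ge> 0"
    let ?Z = "C * (norm (X - Y) * (norm X + norm Y) powr (p - 1))"
    have "norm (NL t X - NL t Y) \<le> (1 + t) powr (- \<beta> - \<alpha>) * ?Z"
      using C t by (simp add: NL_diff nl_bound_def Let_def)
    also have "\<dots> \<le> 1 * ?Z"
      using t \<alpha>_nonneg \<beta>_gt_1 C0 powr_mono[of "- \<beta> - \<alpha>" 0 "1 + t"] by (intro mult_right_mono) auto
    finally show "norm (NL t X - NL t Y) \<le> ?Z" by simp
  qed
qed

lemma NL_continuous: "continuous_on UNIV (NL 0)"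
proof -
  obtain C where C: "C > 0" "\<And>t X Y. t \<ge> 0 \<Longrightarrow> norm (NL t X - NL t Y) \<le> C * (norm (X - Y) * (norm X + norm Y) powr (p - 1))"
    by (rule NL_Lipschitz) (rule that)
  have "(NL 0 \<longlongrightarrow> NL 0 X) (at X)" for X
  proof -
    have "((\<lambda>Y. C * (norm (Y - X) * (norm Y + norm X) powr (p - 1))) \<longlongrightarrow> C * (norm (X - X) * (norm X + norm X) powr (p - 1))) (at X)"
      using p by (intro tendsto_intros tendsto_powr') (auto intro!: always_eventually)
    then have "((\<lambda>Y. C * (norm (Y - X) * (norm Y + norm X) powr (p - 1))) \<longlongrightarrow> 0) (at X)" by simp
    from Lim_null_comparison[OF _ this, of "\<lambda>Y. NL 0 Y - NL 0 X"]
    have "((\<lambda>Y. NL 0 Y - NL 0 X) \<longlongrightarrow> 0) (at X)" using C(2)[of 0] by (auto intro!: always_eventually)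
    then show ?thesis by (simp add: LIM_zero_iff)
  qed
  then show ?thesis by (simp add: continuous_on_def)
qed

lemma NL_compose_continuous: "continuous_on T X \<Longrightarrow> continuous_on T (\<lambda>\<tau>. NL 0 (X \<tau>))"
  by (rule continuous_on_compose2[OF NL_continuous]) auto

text \<open>The weight of time t times k1 is a sum of symbols of orders 0 and 1/2, each with the
  power of 1 + t that its decay has to compensate.\<close>

lemma mulL_Q_Kx:
  assumes t: "t \<ge> 0" and s: "s \<ge> 0"
  shows "norm (mulL (Q t) (mulL (Kx s) G)) \<le> (1 + t) powr \<alpha> * norm (mulL (k1 \<sigma> s) G)
      + (1 + t) powr (\<alpha> + 1/2) * norm (mulL (\<lambda>\<xi>. hs \<sigma> \<xi> * k1 \<sigma> s \<xi>) G)"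
proof -
  let ?a = "(1 + t) powr \<alpha>" and ?b = "(1 + t) powr (\<alpha> + 1/2)"
  note k = bmult_k1[OF s, of \<sigma>, where 'a = 'a] and h = bmult_hs_k1[OF s, of \<sigma>, where 'a = 'a]
  have "mulL (Q t) (mulL (Kx s) G) = mulL (\<lambda>\<xi>. Q t \<xi> * Kx s \<xi>) G"
    by (rule mulL_mulL[OF Q_bmult[OF t] Kx_bmult[OF s]])
  also have "(\<lambda>\<xi>. Q t \<xi> * Kx s \<xi>) = (\<lambda>\<xi>. ?a * k1 \<sigma> s \<xi> + ?b * (hs \<sigma> \<xi> * k1 \<sigma> s \<xi>))"
  proof
    fix \<xi> :: 'a
    have "Q t \<xi> * Kx s \<xi> = Wt t \<xi> * k1 \<sigma> s \<xi>" using Wt_nz[of 0 \<xi>] by (simp add: Q_def Kx_def iW_def)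
    then show "Q t \<xi> * Kx s \<xi> = ?a * k1 \<sigma> s \<xi> + ?b * (hs \<sigma> \<xi> * k1 \<sigma> s \<xi>)"
      by (simp add: Wt_def powr_add algebra_simps)
  qed
  also have "mulL \<dots> G = mulL (\<lambda>\<xi>. ?a * k1 \<sigma> s \<xi>) G + mulL (\<lambda>\<xi>. ?b * (hs \<sigma> \<xi> * k1 \<sigma> s \<xi>)) G"
    by (rule mulL_plus[OF bmult_cmult[OF k] bmult_cmult[OF h]])
  also have "mulL (\<lambda>\<xi>. ?a * k1 \<sigma> s \<xi>) G = ?a *\<^sub>R mulL (k1 \<sigma> s) G"
    using mulL_mulL[OF bmult_const[OF order_refl] k, of ?a G] by (simp add: mulL_const)
  also have "mulL (\<lambda>\<xi>. ?b * (hs \<sigma> \<xi> * k1 \<sigma> s \<xi>)) G = ?b *\<^sub>R mulL (\<lambda>\<xi>. hs \<sigma> \<xi> * k1 \<sigma> s \<xi>) G"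
    using mulL_mulL[OF bmult_const[OF order_refl] h, of ?b G] by (simp add: mulL_const)
  finally show ?thesis
    by (simp only:) (rule order_trans[OF norm_triangle_ineq], simp)
qed

definition bker :: "real \<Rightarrow> real \<Rightarrow> real" where
  "bker t \<tau> = (1 + \<tau>) powr (- \<beta>) + (1 + (t - \<tau>)) powr (- \<beta>)"

text \<open>The powers (1 + t)^\<alpha> and (1 + t)^(\<alpha> + 1/2) cancel exactly against the
  rates of \<open>duhamel_kernel\<close> for the orders 0 and 1/2, so that only \<open>bker\<close>
  is left. The velocity bound is the case of order 1 with Y = 0.\<close>

lemma weighted_kernel:
  obtains C where "C > 0"
    "\<And>t \<tau> X Y. 0 \<le> \<tau> \<Longrightarrow> \<tau> \<le> t \<Longrightarrow> norm (mulL (Q t) (mulL (Kx (t - \<tau>)) (NL \<tau> X - NL \<tau> Y)))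
      \<le> C * (norm (X - Y) * (norm X + norm Y) powr (p - 1)) * bker t \<tau>"
    "\<And>t \<tau> X. 0 \<le> \<tau> \<Longrightarrow> \<tau> \<le> t \<Longrightarrow> norm (mulL (dk \<sigma> (t - \<tau>)) (NL \<tau> X))
      \<le> C * (1 + t) powr (- \<alpha> - 1) * (norm X * norm X powr (p - 1)) * bker t \<tau>"
proof -
  obtain C1 where C1: "nl_bound C1" by (rule nonlinear_bound)
  have C10: "C1 > 0" using C1 by (simp add: nl_bound_def)
  obtain C2 where C2: "C2 > 0" "\<And>j A S t \<tau> (g::'a \<Rightarrow> complex) Z. 0 \<le> j \<Longrightarrow> j \<le> 1 \<Longrightarrow> 0 \<le> \<tau> \<Longrightarrow> \<tau> \<le> t \<Longrightarrow>
    symb_order \<sigma> j A (t - \<tau>) S \<Longrightarrow> g \<in> sqint \<Longrightarrow> g \<in> Lp m \<Longrightarrow> 0 \<le> Z \<Longrightarrow>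
    Lp_norm m g \<le> (1 + \<tau>) powr (- \<beta>) * Z \<Longrightarrow> norm (abs_L2 g) \<le> (1 + \<tau>) powr (- \<beta> - \<alpha>) * Z \<Longrightarrow>
    norm (mulL S (FTL (abs_L2 g))) \<le> A * C2 * (1 + t) powr (- \<alpha> - j) * ((1 + \<tau>) powr (- \<beta>) + (1 + (t - \<tau>)) powr (- \<beta>)) * Z"
    by (rule duhamel_kernel) (rule that)
  have est: "norm (mulL S (NL \<tau> X - NL \<tau> Y)) \<le> 4 * C2 * (1 + t) powr (- \<alpha> - j) * bker t \<tau> * (C1 * (norm (X - Y) * (norm X + norm Y) powr (p - 1)))"
    if j: "0 \<le> j" "j \<le> 1" and \<tau>: "0 \<le> \<tau>" "\<tau> \<le> t" and S: "symb_order \<sigma> j 4 (t - \<tau>) S" for j t \<tau> S X Y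
  proof -
    let ?g = "\<lambda>x. abs_powr p (uval \<tau> X) x - abs_powr p (uval \<tau> Y) x"
    let ?Z = "C1 * (norm (X - Y) * (norm X + norm Y) powr (p - 1))"
    have g: "?g \<in> Lp m" "?g \<in> sqint" "Lp_norm m ?g \<le> (1 + \<tau>) powr (- \<beta>) * ?Z" "norm (abs_L2 ?g) \<le> (1 + \<tau>) powr (- \<beta> - \<alpha>) * ?Z"
      using C1 \<tau>(1) by (auto simp: nl_bound_def Let_def)
    have Z: "0 \<le> ?Z" using C10 by simp
    show ?thesis
      using C2(2)[OF j \<tau> S g(2) g(1) Z g(3,4)] \<tau> by (simp add: NL_diff bker_def)
  qed
  show ?thesis
  proof (rule that[of "8 * C2 * C1"])
    show "8 * C2 * C1 > 0" using C10 C2(1) by simp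
    fix t \<tau> :: real and X Y :: "'a L2" assume \<tau>: "0 \<le> \<tau>" "\<tau> \<le> t"
    let ?Z = "norm (X - Y) * (norm X + norm Y) powr (p - 1)"
    let ?G = "NL \<tau> X - NL \<tau> Y"
    have s: "t - \<tau> \<ge> 0" and t: "t \<ge> 0" using \<tau> by auto
    have e0: "(1 + t) powr \<alpha> * (1 + t) powr (- \<alpha> - 0) = 1"
      and e1: "(1 + t) powr (\<alpha> + 1/2) * (1 + t) powr (- \<alpha> - 1/2) = 1"
      using t by (simp_all flip: powr_add)
    have "norm (mulL (Q t) (mulL (Kx (t - \<tau>)) ?G)) \<le> (1 + t) powr \<alpha> * norm (mulL (k1 \<sigma> (t - \<tau>)) ?G)
      + (1 + t) powr (\<alpha> + 1/2) * norm (mulL (\<lambda>\<xi>. hs \<sigma> \<xi> * k1 \<sigma> (t - \<tau>) \<xi>) ?G)"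
      by (rule mulL_Q_Kx[OF t s])
    also have "\<dots> \<le> (1 + t) powr \<alpha> * (4 * C2 * (1 + t) powr (- \<alpha> - 0) * bker t \<tau> * (C1 * ?Z))
      + (1 + t) powr (\<alpha> + 1/2) * (4 * C2 * (1 + t) powr (- \<alpha> - 1/2) * bker t \<tau> * (C1 * ?Z))"
      by (intro add_mono mult_left_mono est \<tau> symb_order_k1 s) auto
    also have "\<dots> = ((1 + t) powr \<alpha> * (1 + t) powr (- \<alpha> - 0)) * (4 * C2 * bker t \<tau> * (C1 * ?Z))
      + ((1 + t) powr (\<alpha> + 1/2) * (1 + t) powr (- \<alpha> - 1/2)) * (4 * C2 * bker t \<tau> * (C1 * ?Z))"
      by (simp only: mult_ac)
    also have "\<dots> = 8 * C2 * C1 * ?Z * bker t \<tau>" unfolding e0 e1 by simp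
    finally show "norm (mulL (Q t) (mulL (Kx (t - \<tau>)) ?G)) \<le> 8 * C2 * C1 * ?Z * bker t \<tau>" .
    have "norm (mulL (dk \<sigma> (t - \<tau>)) (NL \<tau> X - NL \<tau> 0)) \<le> 4 * C2 * (1 + t) powr (- \<alpha> - 1) * bker t \<tau> * (C1 * (norm (X - 0) * (norm X + norm (0::'a L2)) powr (p - 1)))"
      by (intro est \<tau> symb_order_k1 s) auto
    also have "\<dots> = 4 * C2 * C1 * ((1 + t) powr (- \<alpha> - 1) * (norm X * norm X powr (p - 1)) * bker t \<tau>)"
      by simp
    also have "\<dots> \<le> 8 * C2 * C1 * ((1 + t) powr (- \<alpha> - 1) * (norm X * norm X powr (p - 1)) * bker t \<tau>)"
      using C10 C2(1) by (intro mult_right_mono) (auto simp: bker_def)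
    finally show "norm (mulL (dk \<sigma> (t - \<tau>)) (NL \<tau> X)) \<le> 8 * C2 * C1 * (1 + t) powr (- \<alpha> - 1) * (norm X * norm X powr (p - 1)) * bker t \<tau>"
      using \<tau> by (simp add: NL_0 mult.assoc)
  qed
qed

text \<open>The first argument carries the weight and the second does not: K0 contains exp(-t),
  which smooths nothing, so the regularity of \<open>u\<^sub>0\<close> must be put in, whereas for
  \<open>u\<^sub>1\<close> the smoothing of K1 pays for the weight contained in
  \<open>Kx\<close>.\<close>

definition lin :: "'a L2 \<Rightarrow> 'a L2 \<Rightarrow> real \<Rightarrow> 'a L2" where
  "lin x0 v1 t = mulL (\<lambda>\<xi>. k1 \<sigma> t \<xi> + exp (- t)) x0 + mulL (Kx t) v1"

definition Psi :: "'a L2 \<Rightarrow> 'a L2 \<Rightarrow> (real \<Rightarrow> 'a L2) \<Rightarrow> real \<Rightarrow> 'a L2" where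
  "Psi x0 v1 X t = lin x0 v1 t + integral {0..t} (\<lambda>\<tau>. mulL (Kx (t - \<tau>)) (NL 0 (X \<tau>)))"

text \<open>As k1 has the derivative \<open>dk\<close>, that of k1 + exp(-t) is -|\<xi>|^(2\<sigma>)
  k1. This symbol is bounded, so the velocity takes \<open>v0\<close> without the weight.\<close>

definition vlin :: "'a L2 \<Rightarrow> 'a L2 \<Rightarrow> real \<Rightarrow> 'a L2" where
  "vlin v0 v1 t = mulL (\<lambda>\<xi>. - ((hs \<sigma> \<xi>)\<^sup>2 * k1 \<sigma> t \<xi>)) v0 + mulL (dk \<sigma> t) v1"

definition vel :: "'a L2 \<Rightarrow> 'a L2 \<Rightarrow> (real \<Rightarrow> 'a L2) \<Rightarrow> real \<Rightarrow> 'a L2" where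
  "vel v0 v1 X t = vlin v0 v1 t + integral {0..t} (\<lambda>\<tau>. mulL (dk \<sigma> (t - \<tau>)) (NL 0 (X \<tau>)))"

text \<open>\<open>x0\<close> stands for the Fourier transform of \<open>u\<^sub>0\<close> multiplied by \<open>Wt 0\<close>.\<close>

definition data :: "('a \<Rightarrow> complex) \<Rightarrow> ('a \<Rightarrow> complex) \<Rightarrow> 'a L2 \<Rightarrow> real \<Rightarrow> bool" where
  "data g0 g1 x0 E \<longleftrightarrow> g0 \<in> sqint \<and> g0 \<in> Lp m \<and> g1 \<in> sqint \<and> g1 \<in> Lp m \<and>
     mulL (iW 0) x0 = FTL (abs_L2 g0) \<and> norm x0 \<le> E \<and>
     Lp_norm m g0 + norm (abs_L2 g0) \<le> E \<and> Lp_norm m g1 + norm (abs_L2 g1) \<le> E"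

lemma k0_bmult: "t \<ge> 0 \<Longrightarrow> bmult 9 (\<lambda>\<xi>::'a. k1 \<sigma> t \<xi> + exp (- t))"
proof -
  assume t: "t \<ge> 0"
  have "bmult (8 + 1) (\<lambda>\<xi>::'a. k1 \<sigma> t \<xi> + exp (- t))"
    by (intro bmult_add bmult_k1 bmult_const t) (use t in simp)
  then show ?thesis by simp
qed

lemma linear_estimate:
  obtains C where "C > 0"
    "\<And>g0 g1 x0 E t. data g0 g1 x0 E \<Longrightarrow> t \<ge> 0 \<Longrightarrow> norm (mulL (Q t) (lin x0 (FTL (abs_L2 g1)) t)) \<le> C * E"
    "\<And>g0 g1 x0 E t. data g0 g1 x0 E \<Longrightarrow> t \<ge> 0 \<Longrightarrow> norm (vlin (FTL (abs_L2 g0)) (FTL (abs_L2 g1)) t) \<le> C * (1 + t) powr (- \<alpha> - 1) * E"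
proof -
  obtain Cm where Cm: "Cm > 0" "\<And>j A t S (g::'a \<Rightarrow> complex). symb_order \<sigma> j A t S \<Longrightarrow> 0 \<le> j \<Longrightarrow> j \<le> 1 \<Longrightarrow> t \<ge> 0 \<Longrightarrow>
     g \<in> sqint \<Longrightarrow> g \<in> Lp m \<Longrightarrow>
     norm (mulL S (FTL (abs_L2 g))) \<le> A * Cm * (1 + t) powr (- \<alpha> - j) * (Lp_norm m g + norm (abs_L2 g))"
    by (rule symb_order_Lm[OF \<sigma> m, where 'a = 'a, folded n, folded \<alpha>_def]) (rule that)
  obtain Ce where Ce: "Ce > 0" "\<And>t::real. t \<ge> 0 \<Longrightarrow> exp (- t / 4) \<le> Ce * (1 + t) powr (- (\<alpha> + 1/2))"
    by (rule exp_decay_powr[of "\<alpha> + 1/2"]) (use \<alpha>_nonneg that in auto)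
  have est: "norm (mulL S (FTL (abs_L2 g))) \<le> 4 * Cm * (1 + t) powr (- \<alpha> - j) * E"
    if "symb_order \<sigma> j 4 t S" "0 \<le> j" "j \<le> 1" "t \<ge> 0" "g \<in> sqint" "g \<in> Lp m" "Lp_norm m g + norm (abs_L2 g) \<le> E" for j t and S :: "'a \<Rightarrow> real" and g E
    using Cm(1) that(7) by (intro order_trans[OF Cm(2)[OF that(1-6)]] mult_left_mono) auto
  have kx: "norm (mulL (Q t) (mulL (Kx t) (FTL (abs_L2 g)))) \<le> 8 * Cm * E"
    if t: "t \<ge> 0" and g: "g \<in> sqint" "g \<in> Lp m" "Lp_norm m g + norm (abs_L2 g) \<le> E" for t g E
  proof -
    have e0: "(1 + t) powr \<alpha> * (1 + t) powr (- \<alpha> - 0) = 1"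
      and e1: "(1 + t) powr (\<alpha> + 1/2) * (1 + t) powr (- \<alpha> - 1/2) = 1"
      using t by (simp_all flip: powr_add)
    have "norm (mulL (Q t) (mulL (Kx t) (FTL (abs_L2 g)))) \<le> (1 + t) powr \<alpha> * norm (mulL (k1 \<sigma> t) (FTL (abs_L2 g)))
      + (1 + t) powr (\<alpha> + 1/2) * norm (mulL (\<lambda>\<xi>. hs \<sigma> \<xi> * k1 \<sigma> t \<xi>) (FTL (abs_L2 g)))"
      by (rule mulL_Q_Kx[OF t t])
    also have "\<dots> \<le> (1 + t) powr \<alpha> * (4 * Cm * (1 + t) powr (- \<alpha> - 0) * E)
      + (1 + t) powr (\<alpha> + 1/2) * (4 * Cm * (1 + t) powr (- \<alpha> - 1/2) * E)"
      by (intro add_mono mult_left_mono est symb_order_k1 t g) auto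
    also have "\<dots> = ((1 + t) powr \<alpha> * (1 + t) powr (- \<alpha> - 0)) * (4 * Cm * E)
      + ((1 + t) powr (\<alpha> + 1/2) * (1 + t) powr (- \<alpha> - 1/2)) * (4 * Cm * E)"
      by (simp only: mult_ac)
    finally show ?thesis unfolding e0 e1 by simp
  qed
  show ?thesis
  proof (rule that[of "16 * Cm + Ce"])
    show "16 * Cm + Ce > 0" using Cm(1) Ce(1) by simp
    fix g0 g1 :: "'a \<Rightarrow> complex" and x0 :: "'a L2" and E t :: real
    assume d: "data g0 g1 x0 E" and t: "t \<ge> 0"
    have g0: "g0 \<in> sqint" "g0 \<in> Lp m" "Lp_norm m g0 + norm (abs_L2 g0) \<le> E"
      and g1: "g1 \<in> sqint" "g1 \<in> Lp m" "Lp_norm m g1 + norm (abs_L2 g1) \<le> E"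
      and x0: "mulL (iW 0) x0 = FTL (abs_L2 g0)" "norm x0 \<le> E"
      using d by (auto simp: data_def)
    have E: "E \<ge> 0" using order_trans[OF norm_ge_zero x0(2)] .
    \<comment> \<open>The weight of \<open>x0\<close> is moved into the kernel, because the rate for
      data in L^m concerns the transform of \<open>g0\<close> itself.\<close>
    have k: "mulL (k1 \<sigma> t) x0 = mulL (Kx t) (FTL (abs_L2 g0))"
    proof -
      have "(\<lambda>\<xi>. Kx t \<xi> * iW 0 \<xi>) = k1 \<sigma> t" using Wt_nz[of 0] by (auto simp: Kx_def iW_def)
      then show ?thesis unfolding x0(1)[symmetric] by (simp add: mulL_mulL[OF Kx_bmult[OF t] iW_bmult[of 0]])
    qed
    \<comment> \<open>The part exp(-t) \<open>x0\<close> gains nothing from L^m, but exp(-t)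
      outweighs the growth (1 + t)^(\<alpha> + 1/2) of \<open>Q t\<close>.\<close>
    have "exp (- t) * (1 + t) powr (\<alpha> + 1/2) \<le> exp (- t / 4) * (1 + t) powr (\<alpha> + 1/2)"
      using t by (intro mult_right_mono) auto
    also have "\<dots> \<le> (Ce * (1 + t) powr (- (\<alpha> + 1/2))) * (1 + t) powr (\<alpha> + 1/2)"
      by (intro mult_right_mono Ce t) simp
    also have "\<dots> = Ce * ((1 + t) powr (- (\<alpha> + 1/2)) * (1 + t) powr (\<alpha> + 1/2))" by (simp only: mult.assoc)
    also have "(1 + t) powr (- (\<alpha> + 1/2)) * (1 + t) powr (\<alpha> + 1/2) = 1"
      using t unfolding powr_add[symmetric] by simp
    also have "Ce * 1 = Ce" by simp
    finally have ex: "exp (- t) * (1 + t) powr (\<alpha> + 1/2) \<le> Ce" .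
    have "norm (exp (- t) *\<^sub>R mulL (Q t) x0) \<le> exp (- t) * ((1 + t) powr (\<alpha> + 1/2) * norm x0)"
      using norm_mulL_le[OF Q_bmult[OF t], of x0] by simp
    also have "\<dots> = (exp (- t) * (1 + t) powr (\<alpha> + 1/2)) * norm x0" by simp
    also have "\<dots> \<le> Ce * E" using Ce(1) by (intro mult_mono ex x0(2)) auto
    finally have b: "norm (exp (- t) *\<^sub>R mulL (Q t) x0) \<le> Ce * E" .
    have "lin x0 (FTL (abs_L2 g1)) t = mulL (Kx t) (FTL (abs_L2 g0)) + exp (- t) *\<^sub>R x0 + mulL (Kx t) (FTL (abs_L2 g1))"
      unfolding lin_def mulL_plus[OF bmult_k1[OF t] bmult_const[OF order_refl]] k by (simp add: mulL_const)
    then have eq: "mulL (Q t) (lin x0 (FTL (abs_L2 g1)) t) = mulL (Q t) (mulL (Kx t) (FTL (abs_L2 g0))) + exp (- t) *\<^sub>R mulL (Q t) x0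
        + mulL (Q t) (mulL (Kx t) (FTL (abs_L2 g1)))"
      by (simp add: mulL_add[OF Q_bmult[OF t]] mulL_scaleR[OF Q_bmult[OF t]])
    have "norm (mulL (Q t) (lin x0 (FTL (abs_L2 g1)) t)) \<le> norm (mulL (Q t) (mulL (Kx t) (FTL (abs_L2 g0)))) + norm (exp (- t) *\<^sub>R mulL (Q t) x0)
        + norm (mulL (Q t) (mulL (Kx t) (FTL (abs_L2 g1))))"
      unfolding eq by (rule order_trans[OF norm_triangle_ineq add_right_mono[OF norm_triangle_ineq]])
    also have "\<dots> \<le> 8 * Cm * E + Ce * E + 8 * Cm * E"
      by (rule add_mono[OF add_mono[OF kx[OF t g0] b] kx[OF t g1]])
    finally show "norm (mulL (Q t) (lin x0 (FTL (abs_L2 g1)) t)) \<le> (16 * Cm + Ce) * E"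
      by (simp add: algebra_simps)
    have so: "symb_order \<sigma> 1 4 t (\<lambda>\<xi>::'a. - ((hs \<sigma> \<xi>)\<^sup>2 * k1 \<sigma> t \<xi>))"
      using symb_order_k1(3)[OF t, of \<sigma>, where 'a = 'a] unfolding symb_order_def by (auto simp: abs_mult)
    have "norm (vlin (FTL (abs_L2 g0)) (FTL (abs_L2 g1)) t) \<le> 4 * Cm * (1 + t) powr (- \<alpha> - 1) * E + 4 * Cm * (1 + t) powr (- \<alpha> - 1) * E"
      unfolding vlin_def using t g0 g1 so symb_order_k1(4)[OF t]
      by (intro order_trans[OF norm_triangle_ineq add_mono] est) auto
    also have "\<dots> = (8 * Cm) * ((1 + t) powr (- \<alpha> - 1) * E)" by simp
    also have "\<dots> \<le> (16 * Cm + Ce) * ((1 + t) powr (- \<alpha> - 1) * E)"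
      using Cm(1) Ce(1) E by (intro mult_right_mono) auto
    finally show "norm (vlin (FTL (abs_L2 g0)) (FTL (abs_L2 g1)) t) \<le> (16 * Cm + Ce) * (1 + t) powr (- \<alpha> - 1) * E"
      by (simp add: mult.assoc)
  qed
qed

section \<open>The Duhamel map, its fixed point and uniqueness\<close>

lemma Psi_integrand_integrable:
  "continuous_on {0..} X \<Longrightarrow> (\<lambda>\<tau>. mulL (Kx (t - \<tau>)) (NL 0 (X \<tau>))) integrable_on {0..t}"
  by (rule duhamel_integrable[where C = 16]) (auto intro: Kx_bmult Kx_continuous NL_compose_continuous)

lemma lin_continuous: "continuous_on {0..} (lin x0 v1)"
  unfolding lin_def
proof (intro continuous_intros)
  show "continuous_on {0..} (\<lambda>t. mulL (\<lambda>\<xi>. k1 \<sigma> t \<xi> + exp (- t)) x0)"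
    by (rule continuous_on_mulL[where B = 9]) (auto intro!: k0_bmult continuous_intros)
  show "continuous_on {0..} (\<lambda>t. mulL (Kx t) v1)"
    by (rule continuous_on_mulL[where B = 16]) (auto intro!: Kx_bmult Kx_continuous continuous_intros)
qed

lemma Psi_continuous: "continuous_on {0..} X \<Longrightarrow> continuous_on {0..} (Psi x0 v1 X)"
  unfolding Psi_def
  by (intro continuous_intros lin_continuous duhamel_continuous[where C = 16] Kx_bmult Kx_continuous Kx_zero NL_compose_continuous)
     auto

lemma Psi_diff:
  assumes X: "continuous_on {0..} X" and Y: "continuous_on {0..} Y"
  shows "Psi x0 v1 X t - Psi x0 v1 Y t = integral {0..t} (\<lambda>\<tau>. mulL (Kx (t - \<tau>)) (NL 0 (X \<tau>) - NL 0 (Y \<tau>)))"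
proof -
  have "Psi x0 v1 X t - Psi x0 v1 Y t
      = integral {0..t} (\<lambda>\<tau>. mulL (Kx (t - \<tau>)) (NL 0 (X \<tau>)) - mulL (Kx (t - \<tau>)) (NL 0 (Y \<tau>)))"
    unfolding Psi_def by (simp add: integral_diff Psi_integrand_integrable X Y)
  also have "\<dots> = integral {0..t} (\<lambda>\<tau>. mulL (Kx (t - \<tau>)) (NL 0 (X \<tau>) - NL 0 (Y \<tau>)))"
    by (rule integral_cong) (simp add: mulL_diff[OF Kx_bmult])
  finally show ?thesis .
qed

lemma bker_integral:
  assumes "t \<ge> 0"
  shows "(\<lambda>\<tau>. c * bker t \<tau>) integrable_on {0..t}"
    "c \<ge> 0 \<Longrightarrow> integral {0..t} (\<lambda>\<tau>. c * bker t \<tau>) \<le> c * (2 / (\<beta> - 1))"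
proof -
  note i = integral_kernel_le[OF \<beta>_gt_1 assms, folded bker_def]
  show "(\<lambda>\<tau>. c * bker t \<tau>) integrable_on {0..t}"
    using integrable_cmul[OF i(1), of c] by simp
  have "integral {0..t} (\<lambda>\<tau>. c * bker t \<tau>) = c * integral {0..t} (bker t)"
    using integral_cmul[of "{0..t}" c "bker t"] by simp
  then show "c \<ge> 0 \<Longrightarrow> integral {0..t} (\<lambda>\<tau>. c * bker t \<tau>) \<le> c * (2 / (\<beta> - 1))"
    by (simp only:) (rule mult_left_mono[OF i(2)])
qed

lemma vel_integrable:
  "continuous_on {0..} X \<Longrightarrow> (\<lambda>\<tau>. mulL (dk \<sigma> (t - \<tau>)) (NL 0 (X \<tau>))) integrable_on {0..t}"
  by (rule duhamel_integrable[where C = 8]) (auto intro!: bmult_dk continuous_on_dk NL_compose_continuous)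

lemma global_existence:
  obtains \<epsilon> C where "\<epsilon> > 0" "C > 0"
    "\<And>g0 g1 x0 E. data g0 g1 x0 E \<Longrightarrow> E \<le> \<epsilon> \<Longrightarrow> \<exists>X. continuous_on {0..} X \<and>
      (\<forall>t\<ge>0. X t = Psi x0 (FTL (abs_L2 g1)) X t) \<and>
      (\<forall>t\<ge>0. norm (mulL (Q t) (X t)) \<le> C * E) \<and>
      (\<forall>t\<ge>0. norm (vel (FTL (abs_L2 g0)) (FTL (abs_L2 g1)) X t) \<le> C * (1 + t) powr (- \<alpha> - 1) * E)"
proof -
  obtain C1 where C1: "C1 > 0"
    "\<And>g0 g1 x0 E t. data g0 g1 x0 E \<Longrightarrow> t \<ge> 0 \<Longrightarrow> norm (mulL (Q t) (lin x0 (FTL (abs_L2 g1)) t)) \<le> C1 * E"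
    "\<And>g0 g1 x0 E t. data g0 g1 x0 E \<Longrightarrow> t \<ge> 0 \<Longrightarrow> norm (vlin (FTL (abs_L2 g0)) (FTL (abs_L2 g1)) t) \<le> C1 * (1 + t) powr (- \<alpha> - 1) * E"
    by (rule linear_estimate) (rule that)
  obtain C2 where C2: "C2 > 0"
    "\<And>t \<tau> X Y. 0 \<le> \<tau> \<Longrightarrow> \<tau> \<le> t \<Longrightarrow> norm (mulL (Q t) (mulL (Kx (t - \<tau>)) (NL \<tau> X - NL \<tau> Y)))
      \<le> C2 * (norm (X - Y) * (norm X + norm Y) powr (p - 1)) * bker t \<tau>"
    "\<And>t \<tau> X. 0 \<le> \<tau> \<Longrightarrow> \<tau> \<le> t \<Longrightarrow> norm (mulL (dk \<sigma> (t - \<tau>)) (NL \<tau> X))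
      \<le> C2 * (1 + t) powr (- \<alpha> - 1) * (norm X * norm X powr (p - 1)) * bker t \<tau>"
    by (rule weighted_kernel) (rule that)
  define \<kappa> where "\<kappa> = C2 * (2 / (\<beta> - 1))"
  have \<kappa>: "\<kappa> > 0" using C2(1) \<beta>_gt_1 by (simp add: \<kappa>_def)
  \<comment> \<open>\<epsilon> solves \<kappa> (4 C1 \<epsilon>)^(p-1) = 1/2: in a ball of radius 2
    C1 E the norms of two points add up to at most 4 C1 \<epsilon>, so the map has Lipschitz
    constant 1/2 there.\<close>
  define \<epsilon> where "\<epsilon> = (1 / (2 * \<kappa>)) powr (1 / (p - 1)) / (4 * C1)"
  have \<epsilon>: "\<epsilon> > 0" using \<kappa> C1(1) by (simp add: \<epsilon>_def)
  have \<epsilon>p: "\<kappa> * (4 * C1 * \<epsilon>) powr (p - 1) = 1 / 2"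
    using \<kappa> C1(1) p by (simp add: \<epsilon>_def powr_powr)
  show ?thesis
  proof (rule that[OF \<epsilon>, of "3 * C1"])
    show "3 * C1 > 0" using C1(1) by simp
    fix g0 g1 :: "'a \<Rightarrow> complex" and x0 :: "'a L2" and E :: real
    assume d: "data g0 g1 x0 E" and E\<epsilon>: "E \<le> \<epsilon>"
    have E: "E \<ge> 0" using d by (auto simp: data_def intro: order_trans[OF norm_ge_zero])
    define v1 where "v1 = FTL (abs_L2 g1)"
    \<comment> \<open>Twice the bound C1 E of the free evolution: the Lipschitz constant 1/2 leaves
      the other half for the nonlinear part. The radius is proportional to the data, which makes the
      final estimates linear in E.\<close>
    define r where "r = 2 * C1 * E"
    have r: "r \<ge> 0" using C1(1) E by (simp add: r_def)
    have small: "\<kappa> * (2 * r) powr (p - 1) \<le> 1 / 2"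
      unfolding \<epsilon>p[symmetric] r_def using C1(1) E E\<epsilon> \<kappa> p
      by (intro mult_left_mono powr_mono2) auto
    \<comment> \<open>h is measured in the moving weight, where boundedness means decay;
      \<open>Xh h\<close> is the same function in the weight of time 0.\<close>
    define Xh where "Xh h \<tau> = mulL (R \<tau>) (apply_bcontfun h \<tau>)" for h :: "real \<Rightarrow>\<^sub>C 'a L2" and \<tau>
    have Xh: "continuous_on {0..} (Xh h)" for h
      unfolding Xh_def by (rule continuous_on_mulL[where B = 1]) (auto intro: R_bmult R_continuous)
    \<comment> \<open>Bounded continuous functions live on the whole line, so \<Phi> is frozen at
      negative times.\<close>
    define \<Phi> where "\<Phi> h t = mulL (Q (max t 0)) (Psi x0 v1 (Xh h) (max t 0))" for h t
    have \<Phi>c: "continuous_on UNIV (\<Phi> h)" for h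
    proof -
      \<comment> \<open>The bound of \<open>Q t\<close> grows with t, so continuity is obtained on
        compact intervals and then glued.\<close>
      have "continuous_on {0..} (\<lambda>t. mulL (Q t) (Psi x0 v1 (Xh h) t))"
      proof (rule continuous_on_atLeast0I)
        fix T :: real assume T: "T \<ge> 0"
        show "continuous_on {0..T} (\<lambda>t. mulL (Q t) (Psi x0 v1 (Xh h) t))"
        proof (rule continuous_on_mulL[where B = "(1 + T) powr (\<alpha> + 1/2)"])
          fix t assume t: "t \<in> {0..T}"
          have "(1 + t) powr (\<alpha> + 1/2) \<le> (1 + T) powr (\<alpha> + 1/2)"
            using t \<alpha>_nonneg by (intro powr_mono2) auto
          then show "bmult ((1 + T) powr (\<alpha> + 1/2)) (Q t)"
            using Q_bmult[of t] t by (auto simp: bmult_def intro: order_trans)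
        qed (auto intro: continuous_on_subset[OF Q_continuous] continuous_on_subset[OF Psi_continuous[OF Xh]])
      qed
      then show ?thesis
        unfolding \<Phi>_def by (rule continuous_on_compose2) (auto intro!: continuous_intros)
    qed
    have \<Phi>diff: "norm (\<Phi> h t - \<Phi> k t) \<le> \<kappa> * (norm (h - k) * (norm h + norm k) powr (p - 1))" for h k t
    proof -
      define s where "s = max t 0"
      have s: "s \<ge> 0" by (simp add: s_def)
      let ?F = "\<lambda>\<tau>. mulL (Kx (s - \<tau>)) (NL 0 (Xh h \<tau>) - NL 0 (Xh k \<tau>))"
      let ?c = "C2 * (norm (h - k) * (norm h + norm k) powr (p - 1))"
      have iF: "?F integrable_on {0..s}"
      proof (rule duhamel_integrable[where C = 16 and N = "\<lambda>\<tau>. NL 0 (Xh h \<tau>) - NL 0 (Xh k \<tau>)"])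
        show "continuous_on {0..} (\<lambda>\<tau>. NL 0 (Xh h \<tau>) - NL 0 (Xh k \<tau>))"
          by (intro continuous_intros NL_compose_continuous Xh)
      qed (auto intro: Kx_bmult Kx_continuous)
      have iQF: "(\<lambda>\<tau>. mulL (Q s) (?F \<tau>)) integrable_on {0..s}"
        using integrable_linear[OF iF bounded_linear_mulL[OF Q_bmult[OF s]]] by (simp add: o_def)
      have "\<Phi> h t - \<Phi> k t = mulL (Q s) (integral {0..s} ?F)"
        unfolding \<Phi>_def s_def[symmetric] by (simp add: Psi_diff[OF Xh Xh] flip: mulL_diff[OF Q_bmult[OF s]])
      also have "\<dots> = integral {0..s} (\<lambda>\<tau>. mulL (Q s) (?F \<tau>))"
        using integral_linear[OF iF bounded_linear_mulL[OF Q_bmult[OF s]]] by (simp add: o_def)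
      finally have "norm (\<Phi> h t - \<Phi> k t) = norm (integral {0..s} (\<lambda>\<tau>. mulL (Q s) (?F \<tau>)))"
        by (rule arg_cong)
      also have "\<dots> \<le> integral {0..s} (\<lambda>\<tau>. ?c * bker s \<tau>)"
      proof (rule integral_norm_bound_integral[OF iQF bker_integral(1)[OF s]])
        fix \<tau> assume \<tau>: "\<tau> \<in> {0..s}"
        have "norm (mulL (Q s) (?F \<tau>)) = norm (mulL (Q s) (mulL (Kx (s - \<tau>)) (NL \<tau> (apply_bcontfun h \<tau>) - NL \<tau> (apply_bcontfun k \<tau>))))"
          using \<tau> by (simp add: Xh_def NL_R)
        also have "\<dots> \<le> C2 * (norm (apply_bcontfun h \<tau> - apply_bcontfun k \<tau>) * (norm (apply_bcontfun h \<tau>) + norm (apply_bcontfun k \<tau>)) powr (p - 1)) * bker s \<tau>"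
          using \<tau> by (intro C2(2)) auto
        also have "\<dots> \<le> ?c * bker s \<tau>"
          using C2(1) p norm_bounded[of "h - k" \<tau>] norm_bounded[of h \<tau>] norm_bounded[of k \<tau>]
          by (intro mult_right_mono mult_left_mono mult_mono powr_mono2 add_mono) (auto simp: bker_def)
        finally show "norm (mulL (Q s) (?F \<tau>)) \<le> ?c * bker s \<tau>" .
      qed
      also have "\<dots> \<le> ?c * (2 / (\<beta> - 1))"
        using C2(1) by (intro bker_integral(2)[OF s]) auto
      finally show ?thesis by (simp add: \<kappa>_def mult_ac)
    qed
    have \<Phi>0: "norm (\<Phi> 0 t) \<le> C1 * E" for t
    proof -
      define s where "s = max t 0"
      have s: "s \<ge> 0" by (simp add: s_def)
      have "integral {0..s} (\<lambda>\<tau>. mulL (Kx (s - \<tau>)) (NL 0 (Xh 0 \<tau>))) = integral {0..s} (\<lambda>_. 0)"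
        by (rule integral_cong) (simp add: Xh_def NL_0 mulL_zero[OF R_bmult] mulL_zero[OF Kx_bmult])
      then have "\<Phi> 0 t = mulL (Q s) (lin x0 v1 s)" by (simp add: \<Phi>_def Psi_def flip: s_def)
      then show ?thesis using C1(2)[OF d s] by (simp add: v1_def)
    qed
    have pw: "(norm h + norm k) powr (p - 1) \<le> (2 * r) powr (p - 1)" if "norm h \<le> r" "norm k \<le> r" for h k :: "real \<Rightarrow>\<^sub>C 'a L2"
      using that p by (intro powr_mono2) auto
    have half: "\<kappa> * (norm (h - k) * (norm h + norm k) powr (p - 1)) \<le> 1 / 2 * norm (h - k)"
      if "norm h \<le> r" "norm k \<le> r" for h k :: "real \<Rightarrow>\<^sub>C 'a L2"
    proof -
      have "\<kappa> * (norm (h - k) * (norm h + norm k) powr (p - 1)) \<le> \<kappa> * (norm (h - k) * (2 * r) powr (p - 1))"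
        using \<kappa> pw[OF that] by (intro mult_left_mono) auto
      also have "\<dots> = (\<kappa> * (2 * r) powr (p - 1)) * norm (h - k)" by simp
      also have "\<dots> \<le> 1 / 2 * norm (h - k)" by (intro mult_right_mono small) simp
      finally show ?thesis .
    qed
    have \<Phi>r: "norm (\<Phi> h t) \<le> r" if "norm h \<le> r" for h t
    proof -
      have "norm (\<Phi> h t) \<le> norm (\<Phi> 0 t) + norm (\<Phi> h t - \<Phi> 0 t)" by (rule norm_triangle_sub)
      also have "\<dots> \<le> C1 * E + 1 / 2 * norm (h - 0)"
        using that r by (intro add_mono \<Phi>0 order_trans[OF \<Phi>diff half]) auto
      also have "\<dots> \<le> r" using that by (simp add: r_def)
      finally show ?thesis .
    qed
    \<comment> \<open>\<open>Bcontfun\<close> is meaningful where \<Phi> h is bounded and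
      continuous. The preceding bound grants this on the ball of radius r, to which the contraction
      argument is confined.\<close>
    define F where "F h = Bcontfun (\<Phi> h)" for h
    have F: "apply_bcontfun (F h) = \<Phi> h" if "norm h \<le> r" for h
      unfolding F_def by (rule Bcontfun_inverse, rule bcontfun_normI[OF \<Phi>c \<Phi>r[OF that]])
    have "\<exists>!h\<in>cball 0 r. F h = h"
    proof (rule Banach_fix[OF complete_eq_closed[THEN iffD2, OF closed_cball], where c = "1/2"])
      show "cball 0 r \<noteq> ({} :: (real \<Rightarrow>\<^sub>C 'a L2) set)" using r by simp
      show "F ` cball 0 r \<subseteq> cball 0 r"
      proof
        fix k assume "k \<in> F ` cball 0 r"
        then obtain h where h: "norm h \<le> r" "k = F h" by auto
        have "norm (F h) \<le> r" by (rule norm_bound) (simp add: F[OF h(1)] \<Phi>r[OF h(1)])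
        then show "k \<in> cball 0 r" by (simp add: h)
      qed
      fix h k :: "real \<Rightarrow>\<^sub>C 'a L2" assume "h \<in> cball 0 r" "k \<in> cball 0 r"
      then have hk: "norm h \<le> r" "norm k \<le> r" by auto
      have "norm (F h - F k) \<le> 1 / 2 * norm (h - k)"
        by (rule norm_bound) (simp add: F hk, use order_trans[OF \<Phi>diff half[OF hk]] in simp)
      then show "dist (F h) (F k) \<le> 1 / 2 * dist h k" by (simp add: dist_norm)
    qed auto
    then obtain h where h: "norm h \<le> r" "F h = h" by auto
    have hX: "apply_bcontfun h t = mulL (Q t) (Psi x0 v1 (Xh h) t)" if t: "t \<ge> 0" for t
      using F[OF h(1)] h(2) t by (simp add: \<Phi>_def max_def)
    have X: "Xh h t = Psi x0 v1 (Xh h) t" if t: "t \<ge> 0" for t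
      unfolding Xh_def[of h t] hX[OF t] by (rule R_Q[OF t])
    have QX: "norm (mulL (Q t) (Xh h t)) \<le> 3 * C1 * E" if t: "t \<ge> 0" for t
    proof -
      have "norm (mulL (Q t) (Xh h t)) = norm (apply_bcontfun h t)" by (simp add: Xh_def Q_R[OF t])
      also have "\<dots> \<le> r" using norm_bounded[of h t] h(1) by simp
      also have "\<dots> \<le> 3 * C1 * E" using C1(1) E by (simp add: r_def mult_right_mono)
      finally show ?thesis .
    qed
    have vel: "norm (vel (FTL (abs_L2 g0)) v1 (Xh h) t) \<le> 3 * C1 * (1 + t) powr (- \<alpha> - 1) * E" if t: "t \<ge> 0" for t
    proof -
      let ?c = "C2 * (1 + t) powr (- \<alpha> - 1) * (norm h * norm h powr (p - 1))"
      have "norm (integral {0..t} (\<lambda>\<tau>. mulL (dk \<sigma> (t - \<tau>)) (NL 0 (Xh h \<tau>)))) \<le> integral {0..t} (\<lambda>\<tau>. ?c * bker t \<tau>)"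
      proof (rule integral_norm_bound_integral[OF vel_integrable[OF Xh] bker_integral(1)[OF t]])
        fix \<tau> assume \<tau>: "\<tau> \<in> {0..t}"
        have "norm (mulL (dk \<sigma> (t - \<tau>)) (NL 0 (Xh h \<tau>))) = norm (mulL (dk \<sigma> (t - \<tau>)) (NL \<tau> (apply_bcontfun h \<tau>)))"
          using \<tau> by (simp add: Xh_def NL_R)
        also have "\<dots> \<le> C2 * (1 + t) powr (- \<alpha> - 1) * (norm (apply_bcontfun h \<tau>) * norm (apply_bcontfun h \<tau>) powr (p - 1)) * bker t \<tau>"
          using \<tau> by (intro C2(3)) auto
        also have "\<dots> \<le> ?c * bker t \<tau>"
          using C2(1) p norm_bounded[of h \<tau>]
          by (intro mult_right_mono mult_left_mono mult_mono powr_mono2) (auto simp: bker_def)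
        finally show "norm (mulL (dk \<sigma> (t - \<tau>)) (NL 0 (Xh h \<tau>))) \<le> ?c * bker t \<tau>" .
      qed
      also have "\<dots> \<le> ?c * (2 / (\<beta> - 1))" using C2(1) by (intro bker_integral(2)[OF t]) auto
      also have "\<dots> = (1 + t) powr (- \<alpha> - 1) * (\<kappa> * (norm (h - 0) * (norm h + norm (0 :: real \<Rightarrow>\<^sub>C 'a L2)) powr (p - 1)))"
        by (simp add: \<kappa>_def mult_ac)
      also have "\<dots> \<le> (1 + t) powr (- \<alpha> - 1) * (1 / 2 * norm (h - 0))"
        using h(1) r by (intro mult_left_mono half) auto
      also have "\<dots> \<le> (1 + t) powr (- \<alpha> - 1) * (C1 * E)"
        using h(1) by (intro mult_left_mono) (auto simp: r_def)
      finally have I: "norm (integral {0..t} (\<lambda>\<tau>. mulL (dk \<sigma> (t - \<tau>)) (NL 0 (Xh h \<tau>)))) \<le> (1 + t) powr (- \<alpha> - 1) * (C1 * E)" .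
      have "norm (vel (FTL (abs_L2 g0)) v1 (Xh h) t) \<le> C1 * (1 + t) powr (- \<alpha> - 1) * E + (1 + t) powr (- \<alpha> - 1) * (C1 * E)"
        unfolding vel_def v1_def by (rule order_trans[OF norm_triangle_ineq add_mono[OF C1(3)[OF d t] I]])
      also have "\<dots> = 2 * C1 * ((1 + t) powr (- \<alpha> - 1) * E)" by simp
      also have "\<dots> \<le> 3 * C1 * ((1 + t) powr (- \<alpha> - 1) * E)" using C1(1) E by (intro mult_right_mono) auto
      finally show ?thesis by (simp add: mult.assoc)
    qed
    show "\<exists>X. continuous_on {0..} X \<and>
      (\<forall>t\<ge>0. X t = Psi x0 (FTL (abs_L2 g1)) X t) \<and>
      (\<forall>t\<ge>0. norm (mulL (Q t) (X t)) \<le> 3 * C1 * E) \<and>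
      (\<forall>t\<ge>0. norm (vel (FTL (abs_L2 g0)) (FTL (abs_L2 g1)) X t) \<le> 3 * C1 * (1 + t) powr (- \<alpha> - 1) * E)"
      using Xh X QX vel unfolding v1_def by blast
  qed
qed

text \<open>Gronwall's argument at the point where \<open>exp (- K * t) * norm (X t - Y t)\<close> is largest.\<close>

lemma Psi_unique:
  assumes X: "continuous_on {0..} X" "\<And>t. t \<ge> 0 \<Longrightarrow> X t = Psi x0 v1 X t"
    and Y: "continuous_on {0..} Y" "\<And>t. t \<ge> 0 \<Longrightarrow> Y t = Psi x0 v1 Y t"
    and T: "T \<ge> 0"
  shows "X T = Y T"
proof -
  obtain C where C: "C > 0" "\<And>t X Y. t \<ge> 0 \<Longrightarrow> norm (NL t X - NL t Y) \<le> C * (norm (X - Y) * (norm X + norm Y) powr (p - 1))"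
    by (rule NL_Lipschitz) (rule that)
  have cX: "continuous_on {0..T} X" and cY: "continuous_on {0..T} Y"
    by (auto intro: continuous_on_subset[OF X(1)] continuous_on_subset[OF Y(1)])
  have "compact ((\<lambda>t. norm (X t) + norm (Y t)) ` {0..T})"
    by (intro compact_continuous_image continuous_intros cX cY) simp
  then have "bounded ((\<lambda>t. norm (X t) + norm (Y t)) ` {0..T})" by (rule compact_imp_bounded)
  then obtain M where M: "\<And>t. t \<in> {0..T} \<Longrightarrow> norm (X t) + norm (Y t) \<le> M"
    unfolding bounded_iff by fastforce
  \<comment> \<open>16 bounds the kernel \<open>Kx\<close>, and M bounds the sum of the two norms on
    the compact interval, so no smallness of the solutions enters.\<close>
  define L where "L = 16 * C * M powr (p - 1)"
  have L: "L \<ge> 0" using C(1) by (simp add: L_def)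
  \<comment> \<open>Any K >= 2 L yields the factor L / K <= 1/2; adding 1 keeps K positive even if L
    = 0.\<close>
  define K where "K = 2 * L + 1"
  have K: "K > 0" using L by (simp add: K_def)
  define m where "m t = exp (- K * t) * norm (X t - Y t)" for t
  have "continuous_on {0..T} m" unfolding m_def by (intro continuous_intros cX cY)
  then obtain s where s: "s \<in> {0..T}" and sup: "\<And>t. t \<in> {0..T} \<Longrightarrow> m t \<le> m s"
    using continuous_attains_sup[of "{0..T}" m] T by auto
  have m0: "m s \<ge> 0" by (simp add: m_def)
  have s0: "s \<ge> 0" using s by simp
  let ?F = "\<lambda>\<tau>. mulL (Kx (s - \<tau>)) (NL 0 (X \<tau>) - NL 0 (Y \<tau>))"
  have iF: "?F integrable_on {0..s}"
  proof (rule duhamel_integrable[where C = 16 and N = "\<lambda>\<tau>. NL 0 (X \<tau>) - NL 0 (Y \<tau>)"])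
    show "continuous_on {0..} (\<lambda>\<tau>. NL 0 (X \<tau>) - NL 0 (Y \<tau>))"
      by (intro continuous_intros NL_compose_continuous X(1) Y(1))
  qed (auto intro: Kx_bmult Kx_continuous)
  have iE: "((\<lambda>\<tau>. L * m s * exp (K * \<tau>)) has_integral (L * m s * exp (K * s) / K - L * m s * exp (K * 0) / K)) {0..s}"
    using K by (intro fundamental_theorem_of_calculus s0)
      (auto intro!: derivative_eq_intros simp: has_real_derivative_iff_has_vector_derivative[symmetric])
  have "norm (X s - Y s) = norm (Psi x0 v1 X s - Psi x0 v1 Y s)"
    by (simp only: X(2)[OF s0, symmetric] Y(2)[OF s0, symmetric])
  also have "\<dots> = norm (integral {0..s} ?F)" by (simp only: Psi_diff[OF X(1) Y(1)])
  also have "\<dots> \<le> integral {0..s} (\<lambda>\<tau>. L * m s * exp (K * \<tau>))"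
  proof (rule integral_norm_bound_integral[OF iF has_integral_integrable[OF iE]])
    fix \<tau> assume \<tau>: "\<tau> \<in> {0..s}"
    then have \<tau>T: "\<tau> \<in> {0..T}" using s by auto
    have "norm (?F \<tau>) \<le> 16 * norm (NL 0 (X \<tau>) - NL 0 (Y \<tau>))"
      using \<tau> by (intro norm_mulL_le Kx_bmult) auto
    also have "\<dots> \<le> 16 * (C * (norm (X \<tau> - Y \<tau>) * (norm (X \<tau>) + norm (Y \<tau>)) powr (p - 1)))"
      by (intro mult_left_mono C) auto
    also have "\<dots> \<le> 16 * (C * (norm (X \<tau> - Y \<tau>) * M powr (p - 1)))"
      using C(1) p M[OF \<tau>T] by (intro mult_left_mono powr_mono2) auto
    also have "\<dots> = L * (exp (K * \<tau>) * m \<tau>)"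
      by (simp add: L_def m_def mult.assoc flip: exp_add)
    also have "\<dots> \<le> L * (exp (K * \<tau>) * m s)"
      using L sup[OF \<tau>T] by (intro mult_left_mono) auto
    finally show "norm (?F \<tau>) \<le> L * m s * exp (K * \<tau>)" by (simp add: mult_ac)
  qed
  also have "\<dots> \<le> L * m s * exp (K * s) / K"
    unfolding integral_unique[OF iE] using L m0 K by simp
  finally have "exp (- K * s) * norm (X s - Y s) \<le> exp (- K * s) * (L * m s * exp (K * s) / K)"
    by (rule mult_left_mono) simp
  also have "\<dots> = L / K * m s"
    by (simp add: exp_minus field_simps)
  finally have "m s \<le> L / K * m s" by (simp add: m_def)
  moreover have "L / K \<le> 1 / 2" using L K by (simp add: K_def field_simps)
  then have "L / K * m s \<le> 1 / 2 * m s" by (intro mult_right_mono m0)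
  ultimately have "m s \<le> 0" by linarith
  then have "m T \<le> 0" using sup[of T] T by simp
  then show ?thesis by (simp add: m_def mult_le_0_iff)
qed

end

section \<open>Functions and their classes\<close>

lemma ex_borel_version:
  fixes f :: "'a::euclidean_space \<Rightarrow> complex"
  assumes f: "f \<in> borel_measurable lebesgue"
  shows "\<exists>g\<in>borel_measurable borel. AE x in lebesgue. f x = g x"
proof -
  have "(\<lambda>x. Re (f x)) \<in> borel_measurable lebesgue" "(\<lambda>x. Im (f x)) \<in> borel_measurable lebesgue"
    using f by measurable
  then obtain a b where ab: "a \<in> borel_measurable lborel" "AE x in lborel. Re (f x) = a x"
    "b \<in> borel_measurable lborel" "AE x in lborel. Im (f x) = b x"
    using completion_ex_borel_measurable_real[of _ lborel] by metis
  have m: "(\<lambda>x. Complex (a x) (b x)) \<in> borel_measurable borel"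
    unfolding Complex_eq using ab(1,3) by measurable
  have "AE x in lborel. f x = Complex (a x) (b x)"
    using ab(2,4) by eventually_elim (simp add: complex_eq_iff)
  then show ?thesis using m by (intro bexI[of _ "\<lambda>x. Complex (a x) (b x)"]) (auto intro: AE_completion)
qed

text \<open>The data and solutions are Lebesgue measurable functions. A Borel version exists up to a
  null set, and \<open>bv\<close> fixes one so that the theory on \<open>lborel\<close>
  applies.\<close>

definition bv :: "('a::euclidean_space \<Rightarrow> complex) \<Rightarrow> 'a \<Rightarrow> complex" where
  "bv f = (SOME g. g \<in> borel_measurable borel \<and> (AE x in lebesgue. f x = g x))"

lemma bv:
  assumes "f \<in> borel_measurable lebesgue"
  shows "bv f \<in> borel_measurable borel" "AE x in lebesgue. f x = bv f x"
proof -
  have "\<exists>g. g \<in> borel_measurable borel \<and> (AE x in lebesgue. f x = g x)"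
    using ex_borel_version[OF assms] by (simp only: Bex_def)
  from someI_ex[OF this] show "bv f \<in> borel_measurable borel" "AE x in lebesgue. f x = bv f x"
    unfolding bv_def by simp_all
qed

lemma Lp_measurable [measurable_dest]: "f \<in> Lp q \<Longrightarrow> f \<in> borel_measurable lebesgue"
  by (simp add: Lp_def)

lemma borel_measurable_lebesgueI: "f \<in> borel_measurable borel \<Longrightarrow> f \<in> borel_measurable (lebesgue :: 'a::euclidean_space measure)"
  by (intro measurable_completion) simp

lemma bv_Lp:
  assumes f: "f \<in> Lp q"
  shows "bv f \<in> Lp q" "Lp_norm q (bv f) = Lp_norm q f"
  using Lp_cong_AE[OF Lp_measurable[OF f] borel_measurable_lebesgueI[OF bv(1)] bv(2)] f
  by (auto dest: Lp_measurable)

lemma bv_sqint: "f \<in> Lp 2 \<Longrightarrow> bv f \<in> sqint"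
  using bv_Lp(1)[of f 2] bv(1)[of f] by (simp add: sqint_iff_Lp2 Lp_measurable)

definition cl :: "('a::euclidean_space \<Rightarrow> complex) \<Rightarrow> 'a L2" where
  "cl f = abs_L2 (bv f)"

lemma AE_lebesgue_lborel: "(AE x in lebesgue. P x) \<longleftrightarrow> (AE x in lborel. P x)"
  by (rule AE_completion_iff)

lemma cl_eq_abs:
  assumes f: "f \<in> borel_measurable lebesgue" and g: "g \<in> sqint" and eq: "AE x in lebesgue. f x = g x"
  shows "f \<in> Lp 2" "cl f = abs_L2 g"
proof -
  have gb: "g \<in> borel_measurable borel" using g by (rule sqint_measurable)
  show fL: "f \<in> Lp 2"
    using Lp_cong_AE(1)[OF f borel_measurable_lebesgueI[OF gb] eq] g gb by (simp add: sqint_iff_Lp2)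
  have "AE x in lebesgue. bv f x = g x" using bv(2)[OF f] eq by eventually_elim simp
  then show "cl f = abs_L2 g"
    unfolding cl_def by (subst abs_L2_eq_iff[OF bv_sqint[OF fL] g]) (simp add: AE_lebesgue_lborel)
qed

lemma sqint_Lp2: "f \<in> sqint \<Longrightarrow> f \<in> Lp 2"
  by (simp add: sqint_iff_Lp2 sqint_measurable flip: sqint_iff_Lp2)

lemma cl_abs_L2: "f \<in> sqint \<Longrightarrow> cl f = abs_L2 f"
  by (rule cl_eq_abs(2)) (auto intro: borel_measurable_lebesgueI sqint_measurable)

lemma cl_rep [simp]: "cl (rep_L2 U) = U"
  by (simp add: cl_abs_L2)

lemma rep_Lp2 [simp]: "rep_L2 U \<in> Lp 2"
  by (rule sqint_Lp2) simp

lemma norm_cl: "f \<in> Lp 2 \<Longrightarrow> norm (cl f) = Lp_norm 2 f"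
  by (simp add: cl_def norm_abs_L2_eq bv_sqint bv_Lp)

lemma cl_eq_iff:
  assumes f: "f \<in> Lp 2" and g: "g \<in> Lp 2"
  shows "cl f = cl g \<longleftrightarrow> (AE x in lebesgue. f x = g x)"
proof -
  have "cl f = cl g \<longleftrightarrow> (AE x in lebesgue. bv f x = bv g x)"
    unfolding cl_def AE_lebesgue_lborel by (rule abs_L2_eq_iff[OF bv_sqint[OF f] bv_sqint[OF g]])
  also have "\<dots> \<longleftrightarrow> (AE x in lebesgue. f x = g x)"
  proof
    assume "AE x in lebesgue. bv f x = bv g x"
    then show "AE x in lebesgue. f x = g x"
      using bv(2)[OF Lp_measurable[OF f]] bv(2)[OF Lp_measurable[OF g]] by eventually_elim simp
  next
    assume "AE x in lebesgue. f x = g x"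
    then show "AE x in lebesgue. bv f x = bv g x"
      using bv(2)[OF Lp_measurable[OF f]] bv(2)[OF Lp_measurable[OF g]] by eventually_elim simp
  qed
  finally show ?thesis .
qed

lemma cl_add:
  assumes f: "f \<in> Lp 2" and g: "g \<in> Lp 2"
  shows "(\<lambda>x. f x + g x) \<in> Lp 2" "cl (\<lambda>x. f x + g x) = cl f + cl g"
proof -
  have m: "(\<lambda>x. f x + g x) \<in> borel_measurable lebesgue" using f g by measurable
  have ae: "AE x in lebesgue. f x + g x = bv f x + bv g x"
    using bv(2)[OF Lp_measurable[OF f]] bv(2)[OF Lp_measurable[OF g]] by eventually_elim simp
  show "(\<lambda>x. f x + g x) \<in> Lp 2" "cl (\<lambda>x. f x + g x) = cl f + cl g"
    using cl_eq_abs[OF m sqint_add[OF bv_sqint[OF f] bv_sqint[OF g]] ae] f g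
    by (simp_all add: cl_def abs_L2_add bv_sqint)
qed

lemma cl_scaleR:
  assumes f: "f \<in> Lp 2"
  shows "(\<lambda>x. c *\<^sub>R f x) \<in> Lp 2" "cl (\<lambda>x. c *\<^sub>R f x) = c *\<^sub>R cl f"
proof -
  have m: "(\<lambda>x. c *\<^sub>R f x) \<in> borel_measurable lebesgue" using f by measurable
  have ae: "AE x in lebesgue. c *\<^sub>R f x = c *\<^sub>R bv f x"
    using bv(2)[OF Lp_measurable[OF f]] by eventually_elim simp
  show "(\<lambda>x. c *\<^sub>R f x) \<in> Lp 2" "cl (\<lambda>x. c *\<^sub>R f x) = c *\<^sub>R cl f"
    using cl_eq_abs[OF m sqint_scaleR[OF bv_sqint[OF f]] ae] f
    by (simp_all add: cl_def abs_L2_scaleR bv_sqint)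
qed

lemma cl_diff:
  assumes f: "f \<in> Lp 2" and g: "g \<in> Lp 2"
  shows "(\<lambda>x. f x - g x) \<in> Lp 2" "cl (\<lambda>x. f x - g x) = cl f - cl g"
  using cl_add[OF f cl_scaleR(1)[OF g, of "-1"]] cl_scaleR(2)[OF g, of "-1"] by simp_all

lemma cl_sum:
  assumes "finite I" "\<And>i. i \<in> I \<Longrightarrow> f i \<in> Lp 2"
  shows "(\<lambda>x. \<Sum>i\<in>I. f i x) \<in> Lp 2 \<and> cl (\<lambda>x. \<Sum>i\<in>I. f i x) = (\<Sum>i\<in>I. cl (f i))"
  using assms
proof (induction I rule: finite_induct)
  case empty
  then show ?case by (simp add: sqint_Lp2 cl_abs_L2 abs_L2_zero)
next
  case (insert i I)
  then show ?case using cl_add[of "f i" "\<lambda>x. \<Sum>i\<in>I. f i x"] by simp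
qed

section \<open>Limits, integrals and transforms of functions in terms of their classes\<close>

lemma L2_tendsto_iff:
  assumes f: "\<forall>\<^sub>F s in F. f s \<in> Lp 2" and l: "l \<in> Lp 2"
  shows "L2_tendsto f l F \<longleftrightarrow> ((\<lambda>s. cl (f s)) \<longlongrightarrow> cl l) F"
proof -
  have ev: "\<forall>\<^sub>F s in F. (\<lambda>x. f s x - l x) \<in> Lp 2"
    using f by eventually_elim (rule cl_diff(1)[OF _ l])
  have "((\<lambda>s. Lp_norm 2 (\<lambda>x. f s x - l x)) \<longlongrightarrow> 0) F \<longleftrightarrow> ((\<lambda>s. norm (cl (f s) - cl l)) \<longlongrightarrow> 0) F"
    by (rule filterlim_cong[OF refl refl], use f in eventually_elim)
       (simp add: cl_diff[OF _ l] flip: norm_cl)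
  also have "\<dots> \<longleftrightarrow> ((\<lambda>s. cl (f s)) \<longlongrightarrow> cl l) F"
    by (simp add: tendsto_norm_zero_iff LIM_zero_iff)
  finally show ?thesis using ev by (simp add: L2_tendsto_def)
qed

text \<open>Riemann sums commute with passing to classes, so the limit along the division filter is
  the one that defines the integral in the Banach space \<open>L2\<close>.\<close>

lemma has_L2_integral_iff:
  assumes g: "\<And>\<tau>. \<tau> \<in> {a..b} \<Longrightarrow> g \<tau> \<in> Lp 2" and w: "w \<in> Lp 2"
  shows "has_L2_integral g w a b \<longleftrightarrow> ((\<lambda>\<tau>. cl (g \<tau>)) has_integral cl w) {a..b}"
proof -
  have ev: "\<forall>\<^sub>F P in division_filter (cbox a b).
      (\<lambda>x. \<Sum>(\<tau>, k)\<in>P. measure lborel k *\<^sub>R g \<tau> x) \<in> Lp 2 \<and>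
      cl (\<lambda>x. \<Sum>(\<tau>, k)\<in>P. measure lborel k *\<^sub>R g \<tau> x) = (\<Sum>(\<tau>, k)\<in>P. measure lborel k *\<^sub>R cl (g \<tau>))"
    using eventually_division_filter_tagged_division[of "cbox a b"]
  proof eventually_elim
    fix P assume P: "P tagged_division_of cbox a b"
    have fin: "finite P" using P by blast
    have "(\<lambda>x. measure lborel (snd i) *\<^sub>R g (fst i) x) \<in> Lp 2"
      "cl (\<lambda>x. measure lborel (snd i) *\<^sub>R g (fst i) x) = measure lborel (snd i) *\<^sub>R cl (g (fst i))" if i: "i \<in> P" for i
    proof -
      have "fst i \<in> cbox a b" using tag_in_interval[OF P, of "fst i" "snd i"] i by simp
      then have "g (fst i) \<in> Lp 2" using g by simp
      from cl_scaleR[OF this] show "(\<lambda>x. measure lborel (snd i) *\<^sub>R g (fst i) x) \<in> Lp 2"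
        "cl (\<lambda>x. measure lborel (snd i) *\<^sub>R g (fst i) x) = measure lborel (snd i) *\<^sub>R cl (g (fst i))" .
    qed
    then show "(\<lambda>x. \<Sum>(\<tau>, k)\<in>P. measure lborel k *\<^sub>R g \<tau> x) \<in> Lp 2 \<and>
      cl (\<lambda>x. \<Sum>(\<tau>, k)\<in>P. measure lborel k *\<^sub>R g \<tau> x) = (\<Sum>(\<tau>, k)\<in>P. measure lborel k *\<^sub>R cl (g \<tau>))"
      using cl_sum[OF fin, of "\<lambda>i x. measure lborel (snd i) *\<^sub>R g (fst i) x"] by (simp add: split_beta')
  qed
  have "has_L2_integral g w a b \<longleftrightarrow>
    ((\<lambda>P. cl (\<lambda>x. \<Sum>(\<tau>, k)\<in>P. measure lborel k *\<^sub>R g \<tau> x)) \<longlongrightarrow> cl w) (division_filter (cbox a b))"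
    unfolding has_L2_integral_def
    by (subst L2_tendsto_iff) (use ev g w in \<open>auto elim: eventually_mono\<close>)
  also have "\<dots> \<longleftrightarrow> ((\<lambda>P. \<Sum>(\<tau>, k)\<in>P. measure lborel k *\<^sub>R cl (g \<tau>)) \<longlongrightarrow> cl w) (division_filter (cbox a b))"
    by (rule filterlim_cong[OF refl refl]) (use ev in \<open>auto elim: eventually_mono\<close>)
  also have "\<dots> \<longleftrightarrow> ((\<lambda>\<tau>. cl (g \<tau>)) has_integral cl w) {a..b}"
    unfolding interval_cbox by (rule has_integral_cbox[symmetric])
  finally show ?thesis .
qed

lemma fourier_trunc_eq:
  assumes f: "f \<in> Lp 2"
  shows "fourier_trunc R f = FT1 (trunc R (bv f))"
proof
  fix \<xi> :: 'a
  have [measurable]: "f \<in> borel_measurable lebesgue" "bv f \<in> borel_measurable borel"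
    using f bv(1)[OF Lp_measurable[OF f]] by (auto dest: Lp_measurable)
  have [measurable]: "trunc R (bv f) \<in> borel_measurable borel" by measurable
  have c: "(\<lambda>x. cis (- (x \<bullet> \<xi>))) \<in> borel_measurable borel" by measurable
  note [measurable] = borel_measurable_lebesgueI[OF c] borel_measurable_lebesgueI[OF bv(1)[OF Lp_measurable[OF f]]]
  have [measurable]: "cball 0 R \<in> sets lebesgue" by simp
  have "(LINT x:cball 0 R|lebesgue. cis (- (x \<bullet> \<xi>)) * f x) = (LINT x|lebesgue. indicator (cball 0 R) x *\<^sub>R (cis (- (x \<bullet> \<xi>)) * bv f x))"
    unfolding set_lebesgue_integral_def
    by (rule integral_cong_AE) (use bv(2)[OF Lp_measurable[OF f]] in \<open>auto elim!: eventually_mono\<close>)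
  also have "\<dots> = (LINT x|lebesgue. cis (- (x \<bullet> \<xi>)) * trunc R (bv f) x)"
    by (intro Bochner_Integration.integral_cong) (auto simp: trunc_def)
  also have "\<dots> = (LINT x|lborel. cis (- (x \<bullet> \<xi>)) * trunc R (bv f) x)"
    by (rule integral_completion) measurable
  finally show "fourier_trunc R f \<xi> = FT1 (trunc R (bv f)) \<xi>"
    by (simp add: fourier_trunc_def FT1_def fconst_def)
qed

text \<open>Limits in L^2 are unique, so the truncated transforms converge to g exactly when the
  class of g is the transform. As \<open>FTL\<close> is bijective, both choices made by
  \<open>SOME\<close> are thereby determined up to null sets.\<close>

lemma has_fourier_iff:
  "has_fourier f g \<longleftrightarrow> f \<in> Lp 2 \<and> g \<in> Lp 2 \<and> cl g = FTL (cl f)"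
proof -
  have "L2_tendsto (\<lambda>R. fourier_trunc R f) g at_top \<longleftrightarrow> cl g = FTL (cl f)" if f: "f \<in> Lp 2" and g: "g \<in> Lp 2"
  proof -
    have s: "FT1 (trunc R (bv f)) \<in> sqint" for R
      using bv_sqint[OF f] by (intro FT1_isometry trunc_integrable trunc_sqint)
    have "L2_tendsto (\<lambda>R. fourier_trunc R f) g at_top \<longleftrightarrow> ((\<lambda>R. abs_L2 (FT1 (trunc R (bv f)))) \<longlongrightarrow> cl g) at_top"
      unfolding fourier_trunc_eq[OF f] by (subst L2_tendsto_iff) (auto simp: g cl_abs_L2 s sqint_Lp2)
    also have "\<dots> \<longleftrightarrow> cl g = FTL (cl f)"
      using FTL_tendsto[OF bv_sqint[OF f]] unfolding cl_def[of f, symmetric]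
      by (auto dest: tendsto_unique[rotated])
    finally show ?thesis .
  qed
  then show ?thesis by (auto simp: has_fourier_def)
qed

lemma fourier_cl:
  assumes f: "f \<in> Lp 2"
  shows "fourier f \<in> Lp 2" "cl (fourier f) = FTL (cl f)"
proof -
  have "has_fourier f (rep_L2 (FTL (cl f)))" by (simp add: has_fourier_iff f)
  then have "has_fourier f (fourier f)" unfolding fourier_def by (rule someI[of "\<lambda>g. has_fourier f g"])
  then show "fourier f \<in> Lp 2" "cl (fourier f) = FTL (cl f)" by (auto simp: has_fourier_iff)
qed

lemma inv_fourier_cl:
  assumes g: "g \<in> Lp 2"
  shows "inv_fourier g \<in> Lp 2" "cl (inv_fourier g) = iFTL (cl g)"
proof -
  have "has_fourier (rep_L2 (iFTL (cl g))) g" by (simp add: has_fourier_iff g)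
  then have "has_fourier (inv_fourier g) g" unfolding inv_fourier_def by (rule someI[of "\<lambda>f. has_fourier f g"])
  then show "inv_fourier g \<in> Lp 2" "cl (inv_fourier g) = iFTL (cl g)" by (auto simp: has_fourier_iff)
qed

text \<open>Here \<open>M\<close> may be unbounded, like the symbols of \<open>abs_D\<close> and \<open>bessel_hat\<close>.\<close>

lemma cl_mult_eq:
  fixes M N :: "'a::euclidean_space \<Rightarrow> real"
  assumes M: "M \<in> borel_measurable borel" and f: "f \<in> Lp 2" and cf: "cl f = mulL N X"
    and N: "bmult B N" and MN: "bmult C (\<lambda>\<xi>. M \<xi> * N \<xi>)"
  shows "(\<lambda>\<xi>. complex_of_real (M \<xi>) * f \<xi>) \<in> Lp 2"
    "cl (\<lambda>\<xi>. complex_of_real (M \<xi>) * f \<xi>) = mulL (\<lambda>\<xi>. M \<xi> * N \<xi>) X"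
proof -
  have [measurable]: "f \<in> borel_measurable lebesgue" "M \<in> borel_measurable lebesgue"
    using f borel_measurable_lebesgueI[OF M] by (auto dest: Lp_measurable)
  have m: "(\<lambda>\<xi>. complex_of_real (M \<xi>) * f \<xi>) \<in> borel_measurable lebesgue" by measurable
  have "cl f = cl (\<lambda>\<xi>. N \<xi> *\<^sub>R rep_L2 X \<xi>)"
    unfolding cf mulL_def by (rule cl_abs_L2[symmetric, OF bmult_sqint[OF N rep_L2_sqint]])
  then have "AE \<xi> in lebesgue. f \<xi> = N \<xi> *\<^sub>R rep_L2 X \<xi>"
    by (subst (asm) cl_eq_iff[OF f sqint_Lp2[OF bmult_sqint[OF N rep_L2_sqint]]])
  then have ae: "AE \<xi> in lebesgue. complex_of_real (M \<xi>) * f \<xi> = (M \<xi> * N \<xi>) *\<^sub>R rep_L2 X \<xi>"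
    by eventually_elim (simp add: scaleR_conv_of_real)
  show "(\<lambda>\<xi>. complex_of_real (M \<xi>) * f \<xi>) \<in> Lp 2"
    "cl (\<lambda>\<xi>. complex_of_real (M \<xi>) * f \<xi>) = mulL (\<lambda>\<xi>. M \<xi> * N \<xi>) X"
    using cl_eq_abs[OF m bmult_sqint[OF MN rep_L2_sqint] ae] by (simp_all add: mulL_def)
qed

lemma cl_mult:
  assumes M: "bmult B M" and f: "f \<in> Lp 2"
  shows "(\<lambda>\<xi>. complex_of_real (M \<xi>) * f \<xi>) \<in> Lp 2"
    "cl (\<lambda>\<xi>. complex_of_real (M \<xi>) * f \<xi>) = mulL M (cl f)"
  using cl_mult_eq[OF bmultD(1)[OF M] f, of "\<lambda>_. 1" "cl f" 1 B] M by (auto simp: bmult_const)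

lemma fourier_mult_cl:
  assumes M: "bmult B M" and f: "f \<in> Lp 2"
  shows "fourier_mult M f \<in> Lp 2" "cl (fourier_mult M f) = iFTL (mulL M (FTL (cl f)))"
  unfolding fourier_mult_def using fourier_cl[OF f] cl_mult[OF M fourier_cl(1)[OF f]]
  by (auto simp: inv_fourier_cl)

section \<open>The Bessel weight and H^\<sigma>\<close>

definition bw :: "real \<Rightarrow> 'a::euclidean_space \<Rightarrow> real" where
  "bw \<sigma> \<xi> = (1 + (norm \<xi>)\<^sup>2) powr (\<sigma> / 2)"

lemma bw_measurable [measurable]: "bw \<sigma> \<in> borel_measurable borel"
  unfolding bw_def by measurable

lemma bw_ge_1: "\<sigma> \<ge> 0 \<Longrightarrow> 1 \<le> bw \<sigma> \<xi>"
  unfolding bw_def by (intro ge_one_powr_ge_zero) auto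

lemma bw_pos: "0 < bw \<sigma> \<xi>"
proof -
  have "0 < 1 + (norm \<xi>)\<^sup>2" by (intro add_pos_nonneg) auto
  then show ?thesis by (simp add: bw_def)
qed

lemma bw_nz [simp]: "bw \<sigma> \<xi> \<noteq> 0"
  using bw_pos[of \<sigma> \<xi>] by simp

lemma ibw_bmult: "\<sigma> \<ge> 0 \<Longrightarrow> bmult 1 (\<lambda>\<xi>::'a::euclidean_space. 1 / bw \<sigma> \<xi>)"
  unfolding bmult_def
proof safe
  fix \<xi> :: 'a assume "\<sigma> \<ge> 0"
  then show "\<bar>1 / bw \<sigma> \<xi>\<bar> \<le> 1"
    using bw_ge_1[of \<sigma> \<xi>] bw_pos[of \<sigma> \<xi>] by (simp add: abs_of_pos divide_le_eq)
qed measurable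

text \<open>For \<sigma> > 0 the Bessel weight is unbounded and thus not among the multipliers of
  \<open>bmult\<close>. Membership in H^\<sigma> is therefore expressed by division: the transform
  is the bounded symbol 1 / bw applied to some b in L^2, and b is then the weighted
  transform.\<close>

lemma Hs_iff:
  assumes \<sigma>: "\<sigma> \<ge> 0" and f: "f \<in> Lp 2" and b: "FTL (cl f) = mulL (\<lambda>\<xi>. 1 / bw \<sigma> \<xi>) b"
  shows "f \<in> Hs \<sigma>" "cl (bessel_hat \<sigma> f) = b"
proof -
  have e: "bessel_hat \<sigma> f = (\<lambda>\<xi>. complex_of_real (bw \<sigma> \<xi>) * fourier f \<xi>)"
    by (auto simp: bessel_hat_def bw_def)
  have one: "(\<lambda>\<xi>::'a. bw \<sigma> \<xi> * (1 / bw \<sigma> \<xi>)) = (\<lambda>_. 1)" by auto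
  have "bmult 1 (\<lambda>\<xi>::'a. bw \<sigma> \<xi> * (1 / bw \<sigma> \<xi>))" unfolding one by (rule bmult_const) simp
  from cl_mult_eq[OF bw_measurable fourier_cl(1)[OF f] trans[OF fourier_cl(2)[OF f] b] ibw_bmult[OF \<sigma>] this]
  show "f \<in> Hs \<sigma>" "cl (bessel_hat \<sigma> f) = b" using f by (auto simp: e Hs_def one)
qed

lemma Hs_cl:
  assumes \<sigma>: "\<sigma> \<ge> 0" and f: "f \<in> Hs \<sigma>"
  shows "f \<in> Lp 2" "FTL (cl f) = mulL (\<lambda>\<xi>. 1 / bw \<sigma> \<xi>) (cl (bessel_hat \<sigma> f))"
    "norm (cl (bessel_hat \<sigma> f)) = Hs_norm \<sigma> f"
proof -
  show fL: "f \<in> Lp 2" using f by (simp add: Hs_def)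
  have b: "bessel_hat \<sigma> f \<in> Lp 2" using f by (simp add: Hs_def)
  show "norm (cl (bessel_hat \<sigma> f)) = Hs_norm \<sigma> f" using norm_cl[OF b] by (simp add: Hs_norm_def)
  have "mulL (\<lambda>\<xi>. 1 / bw \<sigma> \<xi>) (cl (bessel_hat \<sigma> f)) = cl (\<lambda>\<xi>. complex_of_real (1 / bw \<sigma> \<xi>) * bessel_hat \<sigma> f \<xi>)"
    by (rule cl_mult(2)[OF ibw_bmult[OF \<sigma>] b, symmetric])
  also have "(\<lambda>\<xi>. complex_of_real (1 / bw \<sigma> \<xi>) * bessel_hat \<sigma> f \<xi>) = fourier f"
    by (rule ext) (simp add: bessel_hat_def flip: bw_def mult.assoc of_real_mult)
  finally show "FTL (cl f) = mulL (\<lambda>\<xi>. 1 / bw \<sigma> \<xi>) (cl (bessel_hat \<sigma> f))" by (simp add: fourier_cl[OF fL])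
qed

section \<open>From the fixed point to the energy solution\<close>

context damped_wave
begin

text \<open>The Bessel weight and 1 + |\<xi>|^\<sigma> are equivalent, so \<open>toX\<close> and
  \<open>toB\<close> translate between the norm of H^\<sigma> and the weight of time 0.\<close>

lemma bw_Wt: "Wt 0 \<xi> \<le> 2 * bw \<sigma> \<xi>" "bw \<sigma> \<xi> \<le> 2 powr (\<sigma> / 2) * Wt 0 \<xi>"
proof -
  have h: "hs \<sigma> \<xi> = (norm \<xi>)\<^sup>2 powr (\<sigma> / 2)"
    by (simp add: hs_def powr_powr flip: powr_numeral)
  have "hs \<sigma> \<xi> \<le> bw \<sigma> \<xi>"
    unfolding h bw_def using \<sigma> by (intro powr_mono2) auto
  then show "Wt 0 \<xi> \<le> 2 * bw \<sigma> \<xi>"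
    using bw_ge_1[of \<sigma> \<xi>] \<sigma> by (simp add: Wt_0)
  have "bw \<sigma> \<xi> \<le> (2 * max 1 ((norm \<xi>)\<^sup>2)) powr (\<sigma> / 2)"
    unfolding bw_def using \<sigma> by (intro powr_mono2) auto
  also have "\<dots> = 2 powr (\<sigma> / 2) * max 1 ((norm \<xi>)\<^sup>2) powr (\<sigma> / 2)"
    by (simp add: powr_mult)
  also have "\<dots> \<le> 2 powr (\<sigma> / 2) * Wt 0 \<xi>"
    by (intro mult_left_mono) (auto simp: max_def Wt_0 h)
  finally show "bw \<sigma> \<xi> \<le> 2 powr (\<sigma> / 2) * Wt 0 \<xi>" .
qed

definition toX :: "'a \<Rightarrow> real" where "toX \<xi> = Wt 0 \<xi> * (1 / bw \<sigma> \<xi>)"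
definition toB :: "'a \<Rightarrow> real" where "toB \<xi> = bw \<sigma> \<xi> * iW 0 \<xi>"

lemma toX_bmult: "bmult 2 toX"
  unfolding bmult_def
proof safe
  show "toX \<in> borel_measurable borel" unfolding toX_def by measurable
  fix \<xi> show "\<bar>toX \<xi>\<bar> \<le> 2"
    using bw_Wt(1)[of \<xi>] bw_pos[of \<sigma> \<xi>] Wt_pos[of 0 \<xi>] by (simp add: toX_def divide_le_eq)
qed

lemma toB_bmult: "bmult (2 powr (\<sigma> / 2)) toB"
  unfolding bmult_def
proof safe
  show "toB \<in> borel_measurable borel" unfolding toB_def by measurable
  fix \<xi> show "\<bar>toB \<xi>\<bar> \<le> 2 powr (\<sigma> / 2)"
    using bw_Wt(2)[of \<xi>] bw_pos[of \<sigma> \<xi>] Wt_pos[of 0 \<xi>] by (simp add: toB_def iW_def divide_le_eq)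
qed

lemma ibw: "bmult 1 (\<lambda>\<xi>::'a. 1 / bw \<sigma> \<xi>)"
  using \<sigma> by (intro ibw_bmult) simp

lemma iW_toX: "mulL (iW 0) (mulL toX b) = mulL (\<lambda>\<xi>. 1 / bw \<sigma> \<xi>) b"
proof -
  have "(\<lambda>\<xi>. iW 0 \<xi> * toX \<xi>) = (\<lambda>\<xi>. 1 / bw \<sigma> \<xi>)" using Wt_nz[of 0] by (auto simp: toX_def iW_def)
  then show ?thesis by (simp add: mulL_mulL[OF iW_bmult[of 0] toX_bmult])
qed

lemma ibw_toB: "mulL (\<lambda>\<xi>. 1 / bw \<sigma> \<xi>) (mulL toB X) = mulL (iW 0) X"
proof -
  have "(\<lambda>\<xi>. 1 / bw \<sigma> \<xi> * toB \<xi>) = iW 0" by (auto simp: toB_def)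
  then show ?thesis by (simp add: mulL_mulL[OF ibw toB_bmult])
qed

lemma uval_0_cl: "uval 0 X \<in> Lp 2" "cl (uval 0 X) = iFTL (mulL (iW 0) X)"
  by (simp_all add: uval_def)

lemma uval_Hs: "uval 0 X \<in> Hs \<sigma>" "cl (bessel_hat \<sigma> (uval 0 X)) = mulL toB X"
  using Hs_iff[of \<sigma> "uval 0 X" "mulL toB X"] \<sigma> by (auto simp: ibw_toB uval_0_cl)

definition HX :: "('a \<Rightarrow> complex) \<Rightarrow> 'a L2" where
  "HX f = mulL toX (cl (bessel_hat \<sigma> f))"

lemma HX:
  assumes f: "f \<in> Hs \<sigma>"
  shows "mulL (iW 0) (HX f) = FTL (cl f)" "norm (HX f) \<le> 2 * Hs_norm \<sigma> f" "Lp_norm 2 f \<le> Hs_norm \<sigma> f"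
proof -
  have \<sigma>0: "\<sigma> \<ge> 0" using \<sigma> by simp
  note H = Hs_cl[OF \<sigma>0 f]
  show "mulL (iW 0) (HX f) = FTL (cl f)" by (simp add: HX_def iW_toX H)
  show "norm (HX f) \<le> 2 * Hs_norm \<sigma> f" unfolding HX_def H(3)[symmetric] by (rule norm_mulL_le[OF toX_bmult])
  have "Lp_norm 2 f = norm (FTL (cl f))" by (simp add: norm_cl[OF H(1)])
  also have "\<dots> \<le> 1 * norm (cl (bessel_hat \<sigma> f))" unfolding H(2) by (rule norm_mulL_le[OF ibw])
  finally show "Lp_norm 2 f \<le> Hs_norm \<sigma> f" by (simp add: H(3))
qed

lemma Hs_diff:
  fixes f g :: "'a \<Rightarrow> complex"
  assumes f: "f \<in> Hs \<sigma>" and g: "g \<in> Hs \<sigma>"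
  shows "Hs_norm \<sigma> (\<lambda>x. f x - g x) = norm (cl (bessel_hat \<sigma> f) - cl (bessel_hat \<sigma> g))"
proof -
  have \<sigma>0: "\<sigma> \<ge> 0" using \<sigma> by simp
  note F = Hs_cl[OF \<sigma>0 f] and G = Hs_cl[OF \<sigma>0 g]
  have "FTL (cl (\<lambda>x. f x - g x)) = mulL (\<lambda>\<xi>. 1 / bw \<sigma> \<xi>) (cl (bessel_hat \<sigma> f) - cl (bessel_hat \<sigma> g))"
    by (simp add: cl_diff F G linear_diff[OF FTL_linear] mulL_diff[OF ibw])
  from Hs_iff[OF \<sigma>0 cl_diff(1)[OF F(1) G(1)] this] Hs_cl(3)[OF \<sigma>0] show ?thesis by metis
qed

text \<open>The factor 2 is the constant with which \<open>HX\<close> compares the two weights; it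
  accounts for \<epsilon> / 2 and 2 C in the concluding theorem.\<close>

lemma data_HX:
  assumes "(u\<^sub>0, u\<^sub>1) \<in> data_space \<sigma> m"
  shows "data (bv u\<^sub>0) (bv u\<^sub>1) (HX u\<^sub>0) (2 * data_norm \<sigma> m u\<^sub>0 u\<^sub>1)"
proof -
  have u: "u\<^sub>0 \<in> Lp m" "u\<^sub>0 \<in> Hs \<sigma>" "u\<^sub>1 \<in> Lp m" "u\<^sub>1 \<in> Lp 2" using assms by (auto simp: data_space_def)
  have u2: "u\<^sub>0 \<in> Lp 2" using u(2) by (simp add: Hs_def)
  have nn: "Lp_norm m u\<^sub>0 \<ge> 0" "Hs_norm \<sigma> u\<^sub>0 \<ge> 0" "Lp_norm m u\<^sub>1 \<ge> 0" "Lp_norm 2 u\<^sub>1 \<ge> 0"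
    by (simp_all add: Hs_norm_def)
  have "x \<le> 2 * (a + b + c + d) \<and> a + y \<le> 2 * (a + b + c + d) \<and> c + d \<le> 2 * (a + b + c + d)"
    if "0 \<le> a" "0 \<le> b" "0 \<le> c" "0 \<le> d" "x \<le> 2 * b" "y \<le> b" for a b c d x y :: real
    using that by (simp add: distrib_left)
  from this[OF nn HX(2,3)[OF u(2)], folded data_norm_def] show ?thesis
    unfolding data_def
    using u u2 HX(1)[OF u(2)] norm_cl[OF u2] norm_cl[OF u(4)]
    by (simp add: bv_sqint bv_Lp cl_def)
qed

section \<open>Duhamel's formula for functions and for their spectra\<close>

lemma K1_conv_cl:
  fixes f :: "'a \<Rightarrow> complex"
  assumes s: "s \<ge> 0" and f: "f \<in> Lp 2"
  shows "K1_conv \<sigma> s f \<in> Lp 2" "cl (K1_conv \<sigma> s f) = iFTL (mulL (k1 \<sigma> s) (FTL (cl f)))"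
proof -
  have "K1_conv \<sigma> s f = fourier_mult (k1 \<sigma> s) f" by (simp add: K1_conv_def k1_def[abs_def])
  then show "K1_conv \<sigma> s f \<in> Lp 2" "cl (K1_conv \<sigma> s f) = iFTL (mulL (k1 \<sigma> s) (FTL (cl f)))"
    using fourier_mult_cl[OF bmult_k1[OF s, of \<sigma>] f] by simp_all
qed

lemma K0_conv_cl:
  fixes f :: "'a \<Rightarrow> complex"
  assumes s: "s \<ge> 0" and f: "f \<in> Lp 2"
  shows "K0_conv \<sigma> s f \<in> Lp 2" "cl (K0_conv \<sigma> s f) = iFTL (mulL (\<lambda>\<xi>. k1 \<sigma> s \<xi> + exp (- s)) (FTL (cl f)))"
proof -
  have "K0_conv \<sigma> s f = fourier_mult (\<lambda>\<xi>. k1 \<sigma> s \<xi> + exp (- s)) f"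
    by (simp add: K0_conv_def k1_def[abs_def] K0_symb_eq)
  then show "K0_conv \<sigma> s f \<in> Lp 2" "cl (K0_conv \<sigma> s f) = iFTL (mulL (\<lambda>\<xi>. k1 \<sigma> s \<xi> + exp (- s)) (FTL (cl f)))"
    using fourier_mult_cl[OF k0_bmult[OF s] f] by simp_all
qed

lemma k1_integrable:
  "continuous_on {0..} X \<Longrightarrow> (\<lambda>\<tau>. mulL (k1 \<sigma> (t - \<tau>)) (NL 0 (X \<tau>))) integrable_on {0..t}"
  by (rule duhamel_integrable[where C = 8]) (auto intro!: bmult_k1 continuous_on_k1 NL_compose_continuous)

lemma iW_Psi:
  assumes X: "continuous_on {0..} X" and t: "t \<ge> 0"
  shows "mulL (iW 0) (Psi x0 v1 X t) = mulL (\<lambda>\<xi>. k1 \<sigma> t \<xi> + exp (- t)) (mulL (iW 0) x0) + mulL (k1 \<sigma> t) v1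
    + integral {0..t} (\<lambda>\<tau>. mulL (k1 \<sigma> (t - \<tau>)) (NL 0 (X \<tau>)))"
proof -
  have i0: "bmult ((1 + 0) powr (- \<alpha>)) (iW 0)" by (rule iW_bmult) simp
  have K: "mulL (iW 0) (mulL (Kx s) G) = mulL (k1 \<sigma> s) G" if s: "s \<ge> 0" for s G
  proof -
    have "(\<lambda>\<xi>. iW 0 \<xi> * Kx s \<xi>) = k1 \<sigma> s" using Wt_nz[of 0] by (auto simp: Kx_def iW_def)
    then show ?thesis by (simp add: mulL_mulL[OF i0 Kx_bmult[OF s]])
  qed
  have "mulL (iW 0) (integral {0..t} (\<lambda>\<tau>. mulL (Kx (t - \<tau>)) (NL 0 (X \<tau>))))
      = integral {0..t} (\<lambda>\<tau>. mulL (iW 0) (mulL (Kx (t - \<tau>)) (NL 0 (X \<tau>))))"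
    using integral_linear[OF Psi_integrand_integrable[OF X] bounded_linear_mulL[OF i0]] by (simp add: o_def)
  also have "\<dots> = integral {0..t} (\<lambda>\<tau>. mulL (k1 \<sigma> (t - \<tau>)) (NL 0 (X \<tau>)))"
    by (rule integral_cong) (simp add: K)
  finally have I: "mulL (iW 0) (integral {0..t} (\<lambda>\<tau>. mulL (Kx (t - \<tau>)) (NL 0 (X \<tau>))))
    = integral {0..t} (\<lambda>\<tau>. mulL (k1 \<sigma> (t - \<tau>)) (NL 0 (X \<tau>)))" .
  have L: "mulL (iW 0) (mulL (\<lambda>\<xi>. k1 \<sigma> t \<xi> + exp (- t)) x0) = mulL (\<lambda>\<xi>. k1 \<sigma> t \<xi> + exp (- t)) (mulL (iW 0) x0)"
    by (simp add: mulL_mulL[OF i0 k0_bmult[OF t]] mulL_mulL[OF k0_bmult[OF t] i0] mult.commute)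
  show ?thesis
    by (simp add: Psi_def lin_def mulL_add[OF i0] I L K[OF t])
qed

lemma NL_cl:
  assumes f: "f \<in> Lp 2" and X: "FTL (cl f) = mulL (iW 0) X"
  shows "abs_powr p f \<in> Lp 2" "FTL (cl (abs_powr p f)) = NL 0 X"
proof -
  have "cl f = cl (uval 0 X)" using arg_cong[OF X, of iFTL] by (simp add: uval_0_cl)
  then have "AE x in lebesgue. f x = uval 0 X x" by (simp add: cl_eq_iff[OF f uval_0_cl(1)])
  then have ae: "AE x in lebesgue. abs_powr p f x = abs_powr p (uval 0 X) x"
    by eventually_elim (simp add: abs_powr_def)
  have [measurable]: "f \<in> borel_measurable lebesgue" using f by (rule Lp_measurable)
  have m: "abs_powr p f \<in> borel_measurable lebesgue" unfolding abs_powr_def by measurable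
  note c = cl_eq_abs[OF m abs_powr_uval_sqint[OF order_refl] ae]
  show "abs_powr p f \<in> Lp 2" by (rule c(1))
  show "FTL (cl (abs_powr p f)) = NL 0 X" by (simp add: c(2) NL_def)
qed

text \<open>The integrand is continuous with values in L^2, so its integral exists, and every
  admissible w represents the inverse transform of one and the same class. Taking transforms and
  cancelling the nowhere vanishing weight then leads from Duhamel's formula to the fixed point
  equation and back.\<close>

lemma mild_solution_iff:
  assumes X: "continuous_on {0..} X"
    and u: "\<And>t. t \<ge> 0 \<Longrightarrow> u t \<in> Lp 2" "\<And>t. t \<ge> 0 \<Longrightarrow> FTL (cl (u t)) = mulL (iW 0) (X t)"
    and u0: "u\<^sub>0 \<in> Lp 2" "FTL (cl u\<^sub>0) = mulL (iW 0) x0" and u1: "u\<^sub>1 \<in> Lp 2"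
  shows "mild_solution \<sigma> p u\<^sub>0 u\<^sub>1 u \<longleftrightarrow> (\<forall>t\<ge>0. X t = Psi x0 (FTL (cl u\<^sub>1)) X t)"
proof -
  have i0: "bmult ((1 + 0) powr (- \<alpha>)) (iW 0)" by (rule iW_bmult) simp
  have "(abs_powr p (u t) \<in> Lp 2 \<and>
        (\<exists>w. has_L2_integral (\<lambda>\<tau>. K1_conv \<sigma> (t - \<tau>) (abs_powr p (u \<tau>))) w 0 t \<and>
             (AE x in lebesgue. u t x = K0_conv \<sigma> t u\<^sub>0 x + K1_conv \<sigma> t u\<^sub>1 x + w x)))
      \<longleftrightarrow> X t = Psi x0 (FTL (cl u\<^sub>1)) X t" if t: "t \<ge> 0" for t
  proof -
    define I where "I = integral {0..t} (\<lambda>\<tau>. mulL (k1 \<sigma> (t - \<tau>)) (NL 0 (X \<tau>)))"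
    let ?g = "\<lambda>\<tau>. K1_conv \<sigma> (t - \<tau>) (abs_powr p (u \<tau>))"
    have g: "?g \<tau> \<in> Lp 2" "cl (?g \<tau>) = iFTL (mulL (k1 \<sigma> (t - \<tau>)) (NL 0 (X \<tau>)))" if "\<tau> \<in> {0..t}" for \<tau>
      using that K1_conv_cl[of "t - \<tau>" "abs_powr p (u \<tau>)"] NL_cl[OF u(1,2), of \<tau>] by auto
    have "((\<lambda>\<tau>. mulL (k1 \<sigma> (t - \<tau>)) (NL 0 (X \<tau>))) has_integral I) {0..t}"
      unfolding I_def by (rule integrable_integral[OF k1_integrable[OF X]])
    from has_integral_linear[OF this bounded_linear_iFTL]
    have hi: "((\<lambda>\<tau>. cl (?g \<tau>)) has_integral iFTL I) {0..t}"
      by (rule has_integral_cong[THEN iffD1, rotated]) (simp add: g o_def)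
    have hw: "has_L2_integral ?g w 0 t \<longleftrightarrow> w \<in> Lp 2 \<and> cl w = iFTL I" for w
    proof (cases "w \<in> Lp 2")
      case True
      have "has_L2_integral ?g w 0 t \<longleftrightarrow> ((\<lambda>\<tau>. cl (?g \<tau>)) has_integral cl w) {0..t}"
        by (rule has_L2_integral_iff[OF _ True]) (rule g(1))
      then show ?thesis using hi True by (auto dest: has_integral_unique)
    next
      case False
      then show ?thesis by (simp add: has_L2_integral_def)
    qed
    note K0 = K0_conv_cl[OF t u0(1)] and K1 = K1_conv_cl[OF t u1]
    have ae: "(AE x in lebesgue. u t x = K0_conv \<sigma> t u\<^sub>0 x + K1_conv \<sigma> t u\<^sub>1 x + w x) \<longleftrightarrow>
        X t = Psi x0 (FTL (cl u\<^sub>1)) X t" if w: "w \<in> Lp 2" "cl w = iFTL I" for w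
    proof -
      note K01 = cl_add[OF K0(1) K1(1)]
      note S = cl_add[OF K01(1) w(1)]
      have "(AE x in lebesgue. u t x = K0_conv \<sigma> t u\<^sub>0 x + K1_conv \<sigma> t u\<^sub>1 x + w x) \<longleftrightarrow>
          cl (u t) = cl (\<lambda>x. K0_conv \<sigma> t u\<^sub>0 x + K1_conv \<sigma> t u\<^sub>1 x + w x)"
        by (rule cl_eq_iff[OF u(1)[OF t] S(1), symmetric])
      also have "\<dots> \<longleftrightarrow> FTL (cl (u t)) = FTL (cl (\<lambda>x. K0_conv \<sigma> t u\<^sub>0 x + K1_conv \<sigma> t u\<^sub>1 x + w x))"
        by (metis iFTL_FTL)
      also have "\<dots> \<longleftrightarrow> mulL (iW 0) (X t) = mulL (iW 0) (Psi x0 (FTL (cl u\<^sub>1)) X t)"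
        unfolding S(2) K01(2) K0(2) K1(2) w(2) iW_Psi[OF X t] u(2)[OF t] I_def
        by (simp add: linear_add[OF FTL_linear] u0(2))
      also have "\<dots> \<longleftrightarrow> X t = Psi x0 (FTL (cl u\<^sub>1)) X t"
        using Wt_nz[of 0] by (auto intro: mulL_inject[OF i0] simp: iW_def)
      finally show ?thesis .
    qed
    have "rep_L2 (iFTL I) \<in> Lp 2" "cl (rep_L2 (iFTL I)) = iFTL I" by simp_all
    with hw ae show ?thesis using NL_cl(1)[OF u(1,2)[OF t]] t by blast
  qed
  then show ?thesis unfolding mild_solution_def by blast
qed

text \<open>Continuity in H^\<sigma> is continuity of X. For the time derivative the weight is
  removed first: \<open>dk\<close> equals 1 at time 0, so its product with the unbounded weight is
  not a bounded symbol, and the derivative is taken in L^2.\<close>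

lemma energy_class_Psi:
  assumes X: "continuous_on {0..} X" and fp: "\<And>t. t \<ge> 0 \<Longrightarrow> X t = Psi x0 v1 X t"
  shows "energy_class \<sigma> (\<lambda>t. uval 0 (X t)) (\<lambda>t. rep_L2 (iFTL (vel (mulL (iW 0) x0) v1 X t)))"
  unfolding energy_class_def
proof (intro allI impI conjI)
  fix t :: real assume t: "t \<ge> 0"
  let ?v0 = "mulL (iW 0) x0"
  have N: "continuous_on {0..} (\<lambda>\<tau>. NL 0 (X \<tau>))" by (rule NL_compose_continuous[OF X])
  show "uval 0 (X t) \<in> Hs \<sigma>" by (rule uval_Hs)
  show "rep_L2 (iFTL (vel ?v0 v1 X t)) \<in> Lp 2" by simp
  have "((\<lambda>s. norm (mulL toB (X s) - mulL toB (X t))) \<longlongrightarrow> norm (mulL toB (X t) - mulL toB (X t))) (at t within {0..})"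
    using X t by (intro tendsto_intros bounded_linear.tendsto[OF bounded_linear_mulL[OF toB_bmult]]) (auto simp: continuous_on_def)
  then show "((\<lambda>s. Hs_norm \<sigma> (\<lambda>x. uval 0 (X s) x - uval 0 (X t) x)) \<longlongrightarrow> 0) (at t within {0..})"
    by (simp add: Hs_diff[OF uval_Hs(1) uval_Hs(1)] uval_Hs(2))
  \<comment> \<open>This is the fixed point equation without its weight; all symbols in it and their
    time derivatives are bounded, so each of the three terms can be differentiated.\<close>
  define w where "w s = mulL (\<lambda>\<xi>. k1 \<sigma> s \<xi> + exp (- s)) ?v0 + mulL (k1 \<sigma> s) v1
    + integral {0..s} (\<lambda>\<tau>. mulL (k1 \<sigma> (s - \<tau>)) (NL 0 (X \<tau>)))" for s
  have w: "mulL (iW 0) (X s) = w s" if "s \<ge> 0" for s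
    unfolding w_def iW_Psi[OF X that, symmetric] using fp[OF that] by simp
  have d1: "((\<lambda>s. mulL (\<lambda>\<xi>. k1 \<sigma> s \<xi> + exp (- s)) ?v0) has_vector_derivative
      mulL (\<lambda>\<xi>. - ((hs \<sigma> \<xi>)\<^sup>2 * k1 \<sigma> t \<xi>)) ?v0) (at t within {0..})"
  proof (rule mulL_has_vector_derivative[where C = 8])
    fix s :: real and \<xi> :: 'a assume s: "s \<in> {0..}"
    show "bmult 8 (\<lambda>\<xi>::'a. - ((hs \<sigma> \<xi>)\<^sup>2 * k1 \<sigma> s \<xi>))" using s by (intro bmult_uminus bmult_hs2_k1) simp
    show "bmult 9 (\<lambda>\<xi>::'a. k1 \<sigma> s \<xi> + exp (- s))" using s by (intro k0_bmult) simp
    have "((\<lambda>s. k1 \<sigma> s \<xi> + exp (- s)) has_real_derivative dk \<sigma> s \<xi> + - exp (- s)) (at s within {0..})"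
      by (intro DERIV_add k1_has_derivative) (auto intro!: derivative_eq_intros)
    then show "((\<lambda>s. k1 \<sigma> s \<xi> + exp (- s)) has_real_derivative - ((hs \<sigma> \<xi>)\<^sup>2 * k1 \<sigma> s \<xi>)) (at s within {0..})"
      by (simp add: dk_def)
  qed (use t in auto)
  have d2: "((\<lambda>s. mulL (k1 \<sigma> s) v1) has_vector_derivative mulL (dk \<sigma> t) v1) (at t within {0..})"
    by (rule mulL_has_vector_derivative[where C = 8 and B = "\<lambda>_. 8"])
       (use t in \<open>auto intro: bmult_k1 bmult_dk k1_has_derivative\<close>)
  have "(w has_vector_derivative vel ?v0 v1 X t) (at t within {0..})"
    unfolding w_def vel_def vlin_def
    by (intro has_vector_derivative_add d1 d2 duhamel_derivative(1)[OF N t])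
  from bounded_linear.has_vector_derivative[OF bounded_linear_iFTL this]
  have "((\<lambda>s. iFTL (w s)) has_vector_derivative iFTL (vel ?v0 v1 X t)) (at t within {0..})" .
  then have q: "((\<lambda>s. (iFTL (w s) - iFTL (w t)) /\<^sub>R (s - t)) \<longlongrightarrow> iFTL (vel ?v0 v1 X t)) (at t within {0..})"
    by (simp only: has_vector_derivative_iff_quotient)
  have ue: "(\<lambda>x. (uval 0 (X s) x - uval 0 (X t) x) /\<^sub>R (s - t)) \<in> Lp 2"
    "cl (\<lambda>x. (uval 0 (X s) x - uval 0 (X t) x) /\<^sub>R (s - t)) = (cl (uval 0 (X s)) - cl (uval 0 (X t))) /\<^sub>R (s - t)" for s
    using cl_scaleR[OF cl_diff(1)[OF uval_0_cl(1) uval_0_cl(1)], of "inverse (s - t)" "X s" "X t"]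
    by (simp_all add: cl_diff[OF uval_0_cl(1) uval_0_cl(1)])
  show "L2_tendsto (\<lambda>s x. (uval 0 (X s) x - uval 0 (X t) x) /\<^sub>R (s - t)) (rep_L2 (iFTL (vel ?v0 v1 X t))) (at t within {0..})"
  proof (subst L2_tendsto_iff)
    show "((\<lambda>s. cl (\<lambda>x. (uval 0 (X s) x - uval 0 (X t) x) /\<^sub>R (s - t))) \<longlongrightarrow> cl (rep_L2 (iFTL (vel ?v0 v1 X t)))) (at t within {0..})"
      unfolding cl_rep
      by (rule Lim_transform_eventually[OF q]) (use t in \<open>auto simp: eventually_at_filter ue(2) uval_0_cl w\<close>)
  qed (auto simp: ue(1))
  have "continuous_on {0..} (\<lambda>s. mulL (\<lambda>\<xi>. - ((hs \<sigma> \<xi>)\<^sup>2 * k1 \<sigma> s \<xi>)) ?v0)"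
    by (rule continuous_on_mulL[where B = 8]) (auto intro!: bmult_uminus bmult_hs2_k1 continuous_intros)
  moreover have "continuous_on {0..} (\<lambda>s. mulL (dk \<sigma> s) v1)"
    by (rule continuous_on_mulL[where B = 8]) (auto intro!: bmult_dk continuous_intros)
  ultimately have "continuous_on {0..} (vel ?v0 v1 X)"
    unfolding vel_def[abs_def] vlin_def by (intro continuous_on_add duhamel_derivative(2)[OF N order_refl])
  then have "((\<lambda>s. iFTL (vel ?v0 v1 X s)) \<longlongrightarrow> iFTL (vel ?v0 v1 X t)) (at t within {0..})"
    using t by (intro bounded_linear.tendsto[OF bounded_linear_iFTL]) (simp add: continuous_on_def)
  then show "L2_tendsto (\<lambda>t. rep_L2 (iFTL (vel ?v0 v1 X t))) (rep_L2 (iFTL (vel ?v0 v1 X t))) (at t within {0..})"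
    by (subst L2_tendsto_iff) simp_all
qed

text \<open>This is meant for an arbitrary competing solution: continuity in H^\<sigma> places it
  among the curves to which \<open>Psi_unique\<close> applies.\<close>

lemma HX_continuous:
  assumes "energy_class \<sigma> u v"
  shows "continuous_on {0..} (\<lambda>t. HX (u t))"
  unfolding continuous_on_def
proof
  fix t :: real assume t: "t \<in> {0..}"
  have H: "u s \<in> Hs \<sigma>" if "s \<ge> 0" for s using assms that by (simp add: energy_class_def)
  have "((\<lambda>s. 2 * Hs_norm \<sigma> (\<lambda>x. u s x - u t x)) \<longlongrightarrow> 2 * 0) (at t within {0..})"
    using assms t by (intro tendsto_mult tendsto_const) (auto simp: energy_class_def)
  then have z: "((\<lambda>s. 2 * Hs_norm \<sigma> (\<lambda>x. u s x - u t x)) \<longlongrightarrow> 0) (at t within {0..})" by simp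
  have "norm (HX (u s) - HX (u t)) \<le> 2 * Hs_norm \<sigma> (\<lambda>x. u s x - u t x)" if s: "s \<ge> 0" for s
    using norm_mulL_le[OF toX_bmult, of "cl (bessel_hat \<sigma> (u s)) - cl (bessel_hat \<sigma> (u t))"] t
    by (simp add: HX_def Hs_diff[OF H[OF s] H] mulL_diff[OF toX_bmult])
  then have "\<forall>\<^sub>F s in at t within {0..}. norm (HX (u s) - HX (u t)) \<le> 2 * Hs_norm \<sigma> (\<lambda>x. u s x - u t x)"
    by (auto simp: eventually_at_filter)
  from Lim_null_comparison[OF this z] show "((\<lambda>s. HX (u s)) \<longlongrightarrow> HX (u t)) (at t within {0..})"
    by (simp add: LIM_zero_iff)
qed

lemma uval_decay:
  assumes t: "t \<ge> 0"
  shows "Lp_norm 2 (uval 0 X) \<le> (1 + t) powr (- \<alpha>) * norm (mulL (Q t) X)"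
    "Lp_norm 2 (abs_D \<sigma> (uval 0 X)) \<le> (1 + t) powr (- \<alpha> - 1 / 2) * norm (mulL (Q t) X)"
proof -
  define Y where "Y = mulL (Q t) X"
  have e: "mulL (iW 0) X = mulL (iW t) Y"
    using iW_R[OF t, of Y] by (simp add: Y_def R_Q[OF t])
  have c: "FTL (cl (uval 0 X)) = mulL (iW t) Y" by (simp add: uval_0_cl e)
  have "Lp_norm 2 (uval 0 X) = norm (mulL (iW t) Y)"
    by (simp add: uval_0_cl e flip: norm_cl)
  then show "Lp_norm 2 (uval 0 X) \<le> (1 + t) powr (- \<alpha>) * norm (mulL (Q t) X)"
    using norm_mulL_le[OF iW_bmult[OF t], of Y] by (simp add: Y_def)
  \<comment> \<open>The symbol |\<xi>|^\<sigma> is unbounded and becomes a multiplier only in the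
    product with the inverse weight, the case \<theta> = 1 of \<open>iW_bmult_powr\<close>.\<close>
  have b: "bmult ((1 + t) powr (- \<alpha> - 1 / 2)) (\<lambda>\<xi>. hs \<sigma> \<xi> * iW t \<xi>)"
    using iW_bmult_powr[OF t zero_less_one order_refl] by simp
  have m: "cl (fourier (uval 0 X)) = mulL (iW t) Y" by (simp add: fourier_cl(2)[OF uval_0_cl(1)] c)
  note M = cl_mult_eq[OF hs_measurable fourier_cl(1)[OF uval_0_cl(1)] m iW_bmult[OF t] b]
  have "abs_D \<sigma> (uval 0 X) = inv_fourier (\<lambda>\<xi>. complex_of_real (hs \<sigma> \<xi>) * fourier (uval 0 X) \<xi>)"
    by (simp add: abs_D_def fourier_mult_def hs_def)
  then have "Lp_norm 2 (abs_D \<sigma> (uval 0 X)) = norm (mulL (\<lambda>\<xi>. hs \<sigma> \<xi> * iW t \<xi>) Y)"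
    using norm_cl[OF inv_fourier_cl(1)[OF M(1)]] by (simp add: inv_fourier_cl(2)[OF M(1)] M(2))
  then show "Lp_norm 2 (abs_D \<sigma> (uval 0 X)) \<le> (1 + t) powr (- \<alpha> - 1 / 2) * norm (mulL (Q t) X)"
    using norm_mulL_le[OF b, of Y] by (simp add: Y_def)
qed

lemma Psi_vel_initial:
  shows "Psi x0 v1 X 0 = x0" "vel v0 v1 X 0 = v1"
proof -
  have "Kx 0 = (\<lambda>_. 0)" "dk \<sigma> 0 = (\<lambda>_::'a. 1)" by (auto simp: Kx_zero dk_def)
  then show "Psi x0 v1 X 0 = x0" "vel v0 v1 X 0 = v1"
    by (simp_all add: Psi_def lin_def vel_def vlin_def mulL_const)
qed

theorem small_data_solution:
  "\<exists>\<epsilon>>0. \<exists>C>0. \<forall>(u\<^sub>0 :: 'a \<Rightarrow> complex) u\<^sub>1.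
     (u\<^sub>0, u\<^sub>1) \<in> data_space \<sigma> m \<and> data_norm \<sigma> m u\<^sub>0 u\<^sub>1 \<le> \<epsilon> \<longrightarrow>
     (\<exists>u v. energy_solution \<sigma> p u\<^sub>0 u\<^sub>1 u v \<and>
        (AE x in lebesgue. u 0 x = u\<^sub>0 x) \<and> (AE x in lebesgue. v 0 x = u\<^sub>1 x) \<and>
        (\<forall>u' v'. energy_solution \<sigma> p u\<^sub>0 u\<^sub>1 u' v' \<longrightarrow>
           (\<forall>t\<ge>0. AE x in lebesgue. u' t x = u t x)) \<and>
        (\<forall>t\<ge>0. Lp_norm 2 (u t) \<le> C * (1 + t) powr (- \<alpha>) * data_norm \<sigma> m u\<^sub>0 u\<^sub>1 \<and>
           Lp_norm 2 (abs_D \<sigma> (u t)) \<le> C * (1 + t) powr (- \<alpha> - 1 / 2) * data_norm \<sigma> m u\<^sub>0 u\<^sub>1 \<and>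
           Lp_norm 2 (v t) \<le> C * (1 + t) powr (- \<alpha> - 1) * data_norm \<sigma> m u\<^sub>0 u\<^sub>1))"
proof -
  obtain \<epsilon> C where \<epsilon>: "\<epsilon> > 0" and C: "C > 0" and
    ex: "\<And>g0 g1 x0 E. data g0 g1 x0 E \<Longrightarrow> E \<le> \<epsilon> \<Longrightarrow> \<exists>X. continuous_on {0..} X \<and>
      (\<forall>t\<ge>0. X t = Psi x0 (FTL (abs_L2 g1)) X t) \<and>
      (\<forall>t\<ge>0. norm (mulL (Q t) (X t)) \<le> C * E) \<and>
      (\<forall>t\<ge>0. norm (vel (FTL (abs_L2 g0)) (FTL (abs_L2 g1)) X t) \<le> C * (1 + t) powr (- \<alpha> - 1) * E)"
    by (rule global_existence) (rule that)
  show ?thesis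
  proof (rule exI[of _ "\<epsilon> / 2"], intro conjI, goal_cases)
    case 1
    show ?case using \<epsilon> by simp
  next
    case 2
    show ?case
    proof (rule exI[of _ "2 * C"], intro conjI allI impI, goal_cases)
      case 1
      show ?case using C by simp
    next
      case (2 u\<^sub>0 u\<^sub>1)
      define D where "D = data_norm \<sigma> m u\<^sub>0 u\<^sub>1"
      have d: "data (bv u\<^sub>0) (bv u\<^sub>1) (HX u\<^sub>0) (2 * D)" and D: "2 * D \<le> \<epsilon>"
        using 2 data_HX by (auto simp: D_def)
      have u0: "u\<^sub>0 \<in> Hs \<sigma>" "u\<^sub>0 \<in> Lp 2" and u1: "u\<^sub>1 \<in> Lp 2"
        using 2 by (auto simp: data_space_def Hs_def)
      define x0 v1 where "x0 = HX u\<^sub>0" and "v1 = FTL (cl u\<^sub>1)"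
      have v0: "FTL (cl u\<^sub>0) = mulL (iW 0) x0" by (simp add: x0_def HX(1)[OF u0(1)])
      obtain X where X: "continuous_on {0..} X" "\<And>t. t \<ge> 0 \<Longrightarrow> X t = Psi x0 v1 X t"
        "\<And>t. t \<ge> 0 \<Longrightarrow> norm (mulL (Q t) (X t)) \<le> C * (2 * D)"
        "\<And>t. t \<ge> 0 \<Longrightarrow> norm (vel (mulL (iW 0) x0) v1 X t) \<le> C * (1 + t) powr (- \<alpha> - 1) * (2 * D)"
        using ex[OF d D] unfolding cl_def[symmetric] v0 x0_def[symmetric] v1_def[symmetric] by blast
      define u where "u t = uval 0 (X t)" for t
      define v where "v t = rep_L2 (iFTL (vel (mulL (iW 0) x0) v1 X t))" for t
      have uL: "u t \<in> Lp 2" "FTL (cl (u t)) = mulL (iW 0) (X t)" for t by (simp_all add: u_def uval_0_cl)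
      have sol: "energy_solution \<sigma> p u\<^sub>0 u\<^sub>1 u v"
        unfolding energy_solution_def mild_solution_iff[OF X(1) uL u0(2) v0 u1] v1_def[symmetric]
        using X(2) energy_class_Psi[OF X(1,2)] by (simp add: u_def[abs_def] v_def[abs_def])
      have "cl (u 0) = cl u\<^sub>0" using arg_cong[OF v0, of iFTL] X(2)[of 0] Psi_vel_initial(1) by (simp add: u_def uval_0_cl)
      then have i1: "AE x in lebesgue. u 0 x = u\<^sub>0 x" by (simp add: cl_eq_iff[OF uL(1) u0(2)])
      have "cl (v 0) = cl u\<^sub>1" by (simp add: v_def Psi_vel_initial(2) v1_def)
      then have i2: "AE x in lebesgue. v 0 x = u\<^sub>1 x" by (subst (asm) cl_eq_iff[OF _ u1]) (simp add: v_def)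
      have uniq: "AE x in lebesgue. u' t x = u t x" if s: "energy_solution \<sigma> p u\<^sub>0 u\<^sub>1 u' v'" and t: "t \<ge> 0" for u' v' t
      proof -
        \<comment> \<open>The competitor comes with neither decay nor smallness. It is compared with
          X in the weight of time 0, where continuity of both curves suffices.\<close>
        define Y where "Y t = HX (u' t)" for t
        have H: "u' s \<in> Hs \<sigma>" if "s \<ge> 0" for s using s that by (simp add: energy_solution_def energy_class_def)
        have L: "u' s \<in> Lp 2" "FTL (cl (u' s)) = mulL (iW 0) (Y s)" if "s \<ge> 0" for s
          using H[OF that] by (simp_all add: Y_def HX(1) Hs_def)
        have Y: "continuous_on {0..} Y" unfolding Y_def[abs_def] by (rule HX_continuous[of u' v']) (use s in \<open>simp add: energy_solution_def\<close>)
        have "\<forall>t\<ge>0. Y t = Psi x0 v1 Y t"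
          using s mild_solution_iff[OF Y L u0(2) v0 u1] by (simp add: energy_solution_def v1_def)
        then have "Y t = X t" using Psi_unique[OF Y _ X(1,2) t] by blast
        then have "cl (u' t) = cl (u t)" using arg_cong[OF L(2)[OF t], of iFTL] by (simp add: u_def uval_0_cl)
        then show ?thesis by (simp add: cl_eq_iff[OF L(1)[OF t] uL(1)])
      qed
      have est: "Lp_norm 2 (u t) \<le> 2 * C * (1 + t) powr (- \<alpha>) * D"
        "Lp_norm 2 (abs_D \<sigma> (u t)) \<le> 2 * C * (1 + t) powr (- \<alpha> - 1 / 2) * D"
        "Lp_norm 2 (v t) \<le> 2 * C * (1 + t) powr (- \<alpha> - 1) * D" if t: "t \<ge> 0" for t
      proof -
        have q: "(1 + t) powr a * norm (mulL (Q t) (X t)) \<le> 2 * C * (1 + t) powr a * D" for a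
          using mult_left_mono[OF X(3)[OF t], of "(1 + t) powr a"] by (simp add: mult_ac)
        show "Lp_norm 2 (u t) \<le> 2 * C * (1 + t) powr (- \<alpha>) * D"
          "Lp_norm 2 (abs_D \<sigma> (u t)) \<le> 2 * C * (1 + t) powr (- \<alpha> - 1 / 2) * D"
          unfolding u_def by (rule order_trans[OF uval_decay(1)[OF t] q], rule order_trans[OF uval_decay(2)[OF t] q])
        have "Lp_norm 2 (v t) = norm (vel (mulL (iW 0) x0) v1 X t)"
          unfolding v_def by (simp flip: norm_cl)
        then show "Lp_norm 2 (v t) \<le> 2 * C * (1 + t) powr (- \<alpha> - 1) * D" using X(4)[OF t] by (simp add: mult_ac)
      qed
      show ?case using sol i1 i2 uniq est unfolding D_def by blast
    qed
  qed
qed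

end

theorem theorem1p3:
  fixes \<sigma> p m n :: real
  assumes n_def: "n = real CARD('n::finite)"
    and "\<sigma> \<ge> 1" and "p > 1" and "1 \<le> m" and "m < 2"
    and "(n \<le> 2 * \<sigma> \<and> 2 / m \<le> p) \<or>
         (2 * \<sigma> < n \<and> n \<le> 4 * \<sigma> / (2 - m) \<and> 2 / m \<le> p \<and> p \<le> n / (n - 2 * \<sigma>))"
    and "p > 1 + 2 * m * \<sigma> / n"
  shows "\<exists>\<epsilon>>0. \<exists>C>0. \<forall>(u\<^sub>0 :: real ^ 'n \<Rightarrow> complex) u\<^sub>1.
     (u\<^sub>0, u\<^sub>1) \<in> data_space \<sigma> m \<and> data_norm \<sigma> m u\<^sub>0 u\<^sub>1 \<le> \<epsilon> \<longrightarrow>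
     (\<exists>u v. energy_solution \<sigma> p u\<^sub>0 u\<^sub>1 u v \<and>
        (AE x in lebesgue. u 0 x = u\<^sub>0 x) \<and> (AE x in lebesgue. v 0 x = u\<^sub>1 x) \<and>
        (\<forall>u' v'. energy_solution \<sigma> p u\<^sub>0 u\<^sub>1 u' v' \<longrightarrow>
           (\<forall>t\<ge>0. AE x in lebesgue. u' t x = u t x)) \<and>
        (\<forall>t\<ge>0.
           Lp_norm 2 (u t)
             \<le> C * (1 + t) powr (- n / (2 * \<sigma>) * (1 / m - 1 / 2)) * data_norm \<sigma> m u\<^sub>0 u\<^sub>1 \<and>
           Lp_norm 2 (abs_D \<sigma> (u t))
             \<le> C * (1 + t) powr (- n / (2 * \<sigma>) * (1 / m - 1 / 2) - 1 / 2) * data_norm \<sigma> m u\<^sub>0 u\<^sub>1 \<and>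
           Lp_norm 2 (v t)
             \<le> C * (1 + t) powr (- n / (2 * \<sigma>) * (1 / m - 1 / 2) - 1) * data_norm \<sigma> m u\<^sub>0 u\<^sub>1))"
proof -
  interpret damped_wave "TYPE(real ^ 'n)" \<sigma> p m n
    using assms by unfold_locales (simp_all add: DIM_cart)
  have "- n / (2 * \<sigma>) * (1 / m - 1 / 2) = - \<alpha>" by (simp add: \<alpha>_def)
  then show ?thesis using small_data_solution by (simp only:)
qed

end
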